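(* Let $k\ge 2$ be an integer and let $M$ be a formally symmetric differential expression of odd order $m=2k-1$ on $[0,\infty)$, $$M[y]=\sum_{r=0}^{k-1}(-1)^r\bigl(s_r y^{(r)}\bigr)^{(r)}+\frac12\sum_{r=0}^{k-1} i^{2r+1}\Bigl\{\bigl(q_r y^{(r)}\bigr)^{(r+1)}+\bigl(q_r y^{(r+1)}\bigr)^{(r)}\Bigr\},$$ where the coefficients are real-valued on $[0,\infty)$, $s_r\in C^{(r)}([0,\infty))$ and $q_r\in C^{(r+1)}([0,\infty))$ for $0\le r\le k-1$, and $q_{k-1}(x)>0$ for all $x\in[0,\infty)$. Let $\Delta$ be the maximal domain of $M$ in $L^2(0,\infty)$, and for $f,g\in\Delta$ let $[fg](\infty)=\lim_{x\to\infty}[fg](x)$, where $[fg](x)$ is the sesquilinear form of Green's formula for $M$. (Necessity) Let $p,q$ be integers with $0\le p\le k$ and $0\le q\le k-1$, and put $n=p+q$. If $M$ is in the limit $(k-1+p,k+q)$ case at $\infty$, then $$\det_{1\le r,s\le n+1}\bigl[[f_r g_s](\infty)\bigr]=0\quad\text{for all } f_1,\dots,f_{n+1},g_1,\dots,g_{n+1}\in\Delta .$$ (Converse) Let $n$ be an integer with $0\le n\le 2k-1$. If $$\det_{1\le r,s\le n+1}\bigl[[f_r g_s](\infty)\bigr]=0\quad\text{for all } f_1,\dots,f_{n+1},g_1,\dots,g_{n+1}\in\Delta ,$$ then $M$ is in the limit $(k-1+p,k+q)$ case at $\infty$ for some integers $0\le p\le k$, $0\le q\le k-1$ with $p+q\le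 n$. More precisely, $p+q=n$ if $$\det_{1\le r,s\le n+1}\bigl[[f_r g_s](\infty)\bigr]=0\quad\text{for all } f_1,\dots,f_{n+1},g_1,\dots,g_{n+1}\in\Delta$$ but $$\det_{1\le r,s\le n}\bigl[[f_r g_s](\infty)\bigr]\ne 0\quad\text{for some } f_1,\dots,f_n,g_1,\dots,g_n\in\Delta .$$
   Context: Let $m$ denote the order of $M$. The maximal domain is $$\Delta=\{f\in L^2(0,\infty): f^{(m-1)}\in AC_{\rm loc}(0,\infty)\ \text{and}\ M[f]\in L^2(0,\infty)\},$$ where functions are complex-valued and $AC_{\rm loc}$ means absolutely continuous on all compact subintervals. Sesquilinear form: $[fg](x)$ is the integrated term in Green's formula $$\int_0^x\bigl\{\overline{g}\,M[f]-f\,\overline{M[g]}\bigr\}\,dt=[fg](x)-[fg](0),$$ valid for $f,g$ with $f^{(m-1)},g^{(m-1)}$ locally absolutely continuous. It is obtained by integration by parts and has the form $[fg](x)=\sum_{j,l=0}^{m-1}B_{jl}(x)f^{(j)}(x)\overline{g^{(l)}(x)}$ with continuous functions $B_{jl}$ on $[0,\infty)$ determined by the coefficients of $M$; it is the unique form of this type for which Green's formula holds for all such $f,g$. It is linear in $f$, conjugate-linear in $g$, non-singular at each $x$, and satisfies $[gf](x)=-\overline{[fg](x)}$. For $f,g\in\Delta$ the limit $[fg](\infty)=\lim_{x\to\infty}[fg](x)$ exists and is finite. Limit classification: $T_{\max}$ is the operator in $L^2(0,\infty)$ with domain $\Delta$ and $T_{\max}f=M[f]$; $T_{\min}$ is its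 restriction to $\{f\in\Delta:[fg](0)=[fg](\infty)=0\ \text{for all } g\in\Delta\}$. $T_{\min}$ is closed and symmetric with $T_{\min}^*=T_{\max}$. The deficiency indices are $N_\pm=\dim\{f\in\Delta: M[f]=\pm i f\}$; equivalently, $N_+$ (respectively $N_-$) is the number of linearly independent solutions of $M[y]=\lambda y$ on $[0,\infty)$ lying in $L^2(0,\infty)$, for any $\lambda$ with $\operatorname{Im}\lambda>0$ (respectively $\operatorname{Im}\lambda<0$). $M$ is said to be in the limit $(N_+,N_-)$ case at $\infty$ if the deficiency indices of $T_{\min}$ are $(N_+,N_-)$. Convention: a determinant of size $0$ equals $1$. *)

theory Defs
  imports
    "HOL-Analysis.Analysis"
    "HOL-Library.Function_Algebras"
    "Jordan_Normal_Form.Determinant"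
begin

section \<open>Differential expressions on the half-line\<close>

text \<open>Derivatives are taken relative to \<open>[0,\<infinity>)\<close>: one-sided at \<open>0\<close>, ordinary at \<open>x > 0\<close>.\<close>

definition hderiv :: "(real \<Rightarrow> 'a::real_normed_vector) \<Rightarrow> real \<Rightarrow> 'a" where
  "hderiv f x = vector_derivative f (at x within {0..})"

definition hdiff :: "nat \<Rightarrow> real set \<Rightarrow> (real \<Rightarrow> 'a::real_normed_vector) \<Rightarrow> bool" where
  "hdiff n S f \<longleftrightarrow> (\<forall>j<n. \<forall>x\<in>S. (hderiv ^^ j) f differentiable (at x within {0..}))"

definition Ck_halfline :: "nat \<Rightarrow> (real \<Rightarrow> 'a::real_normed_vector) \<Rightarrow> bool" where
  "Ck_halfline n f \<longleftrightarrow> hdiff n {0..} f \<and> continuous_on {0..} ((hderiv ^^ n) f)"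

definition diff_expr ::
  "nat \<Rightarrow> (nat \<Rightarrow> real \<Rightarrow> real) \<Rightarrow> (nat \<Rightarrow> real \<Rightarrow> real) \<Rightarrow> (real \<Rightarrow> complex) \<Rightarrow> real \<Rightarrow> complex"
  where
  "diff_expr k s q y x =
     (\<Sum>r<k. (-1) ^ r * (hderiv ^^ r) (\<lambda>t. of_real (s r t) * (hderiv ^^ r) y t) x)
     + 1/2 * (\<Sum>r<k. \<i> ^ (2*r+1) *
         ((hderiv ^^ (r+1)) (\<lambda>t. of_real (q r t) * (hderiv ^^ r) y t) x
          + (hderiv ^^ r) (\<lambda>t. of_real (q r t) * (hderiv ^^ (r+1)) y t) x))"


section \<open>The maximal domain\<close>

definition abs_cont_on :: "real \<Rightarrow> real \<Rightarrow> (real \<Rightarrow> 'a::real_normed_vector) \<Rightarrow> bool" where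
  "abs_cont_on a b f \<longleftrightarrow>
     (\<forall>e>0. \<exists>d>0. \<forall>I. finite I \<longrightarrow>
        (\<forall>(u,v)\<in>I. a \<le> u \<and> u \<le> v \<and> v \<le> b) \<longrightarrow>
        pairwise (\<lambda>(u,v) (u',v'). {u<..<v} \<inter> {u'<..<v'} = {}) I \<longrightarrow>
        (\<Sum>(u,v)\<in>I. v - u) < d \<longrightarrow> (\<Sum>(u,v)\<in>I. norm (f v - f u)) < e)"

definition ac_loc :: "(real \<Rightarrow> 'a::real_normed_vector) \<Rightarrow> bool" where
  "ac_loc f \<longleftrightarrow> (\<forall>a b. 0 < a \<longrightarrow> a \<le> b \<longrightarrow> abs_cont_on a b f)"

definition L2_halfline :: "(real \<Rightarrow> complex) \<Rightarrow> bool" where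
  "L2_halfline f \<longleftrightarrow> set_borel_measurable lebesgue {0<..} f \<and>
     set_integrable lebesgue {0<..} (\<lambda>x. (norm (f x))\<^sup>2)"

text \<open>Functions on \<open>(0,\<infinity>)\<close> are represented by their extension by zero, so that an element of the
  maximal domain is determined by its values on \<open>(0,\<infinity>)\<close> and dimensions are not affected by values
  elsewhere.  Since \<open>f\<^sup>(\<^sup>m\<^sup>-\<^sup>1\<^sup>)\<close> is locally absolutely continuous, \<open>M[f]\<close> is defined almost everywhere.\<close>

definition max_dom ::
  "nat \<Rightarrow> (nat \<Rightarrow> real \<Rightarrow> real) \<Rightarrow> (nat \<Rightarrow> real \<Rightarrow> real) \<Rightarrow> (real \<Rightarrow> complex) set" where
  "max_dom k s q = {f. (\<forall>x\<le>0. f x = 0) \<and> L2_halfline f \<and>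
     hdiff (2*k-2) {0<..} f \<and> ac_loc ((hderiv ^^ (2*k-2)) f) \<and> L2_halfline (diff_expr k s q f)}"


section \<open>The sesquilinear form of Green's formula\<close>

text \<open>The integrated term produced by integrating \<open>u\<^sup>(\<^sup>n\<^sup>) v\<^sup>*\<close> by parts \<open>n\<close> times
  (a superscript \<open>*\<close> is complex conjugation).\<close>

definition parts_term :: "nat \<Rightarrow> (real \<Rightarrow> complex) \<Rightarrow> (real \<Rightarrow> complex) \<Rightarrow> real \<Rightarrow> complex" where
  "parts_term n u v x = (\<Sum>j<n. (-1) ^ j * (hderiv ^^ (n-1-j)) u x * cnj ((hderiv ^^ j) v x))"

text \<open>The integrated term for \<open>g\<^sup>* M[f]\<close>; the remaining integrand
  \<open>\<Sum>\<^sub>r s\<^sub>r f\<^sup>(\<^sup>r\<^sup>) g\<^sup>*\<^sup>(\<^sup>r\<^sup>) + i/2 \<Sum>\<^sub>r q\<^sub>r (f\<^sup>(\<^sup>r\<^sup>+\<^sup>1\<^sup>) g\<^sup>*\<^sup>(\<^sup>r\<^sup>) - f\<^sup>(\<^sup>r\<^sup>) g\<^sup>*\<^sup>(\<^sup>r\<^sup>+\<^sup>1\<^sup>))\<close> is Hermitian in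
  \<open>f, g\<close> and cancels in \<open>g\<^sup>* M[f] - f M[g]\<^sup>*\<close>.\<close>

definition half_form ::
  "nat \<Rightarrow> (nat \<Rightarrow> real \<Rightarrow> real) \<Rightarrow> (nat \<Rightarrow> real \<Rightarrow> real) \<Rightarrow>
   (real \<Rightarrow> complex) \<Rightarrow> (real \<Rightarrow> complex) \<Rightarrow> real \<Rightarrow> complex" where
  "half_form k s q f g x =
     (\<Sum>r<k. (-1) ^ r * parts_term r (\<lambda>t. of_real (s r t) * (hderiv ^^ r) f t) g x)
     + 1/2 * (\<Sum>r<k. \<i> ^ (2*r+1) *
         (parts_term (r+1) (\<lambda>t. of_real (q r t) * (hderiv ^^ r) f t) g x
          + parts_term r (\<lambda>t. of_real (q r t) * (hderiv ^^ (r+1)) f t) g x))"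

definition green_form ::
  "nat \<Rightarrow> (nat \<Rightarrow> real \<Rightarrow> real) \<Rightarrow> (nat \<Rightarrow> real \<Rightarrow> real) \<Rightarrow>
   (real \<Rightarrow> complex) \<Rightarrow> (real \<Rightarrow> complex) \<Rightarrow> real \<Rightarrow> complex" where
  "green_form k s q f g x = half_form k s q f g x - cnj (half_form k s q g f x)"

definition green_form_inf ::
  "nat \<Rightarrow> (nat \<Rightarrow> real \<Rightarrow> real) \<Rightarrow> (nat \<Rightarrow> real \<Rightarrow> real) \<Rightarrow>
   (real \<Rightarrow> complex) \<Rightarrow> (real \<Rightarrow> complex) \<Rightarrow> complex" where
  "green_form_inf k s q f g = Lim at_top (green_form k s q f g)"


section \<open>Green's formula\<close>

lemma at_within_half_nonbot: "x \<ge> 0 \<Longrightarrow> at (x::real) within {0..} \<noteq> bot"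
proof -
  assume "x \<ge> 0"
  then have "x islimpt {x..x+1}" using islimpt_Icc[of x "x+1" x] by simp
  then have "x islimpt {0..}" by (rule islimpt_subset) (use \<open>x \<ge> 0\<close> in auto)
  then show ?thesis by (simp add: trivial_limit_within)
qed

lemma hderiv_eqI:
  "(f has_vector_derivative f') (at x within {0..}) \<Longrightarrow> x \<ge> 0 \<Longrightarrow> hderiv f x = f'"
  unfolding hderiv_def by (rule vector_derivative_within[OF at_within_half_nonbot])

lemma hderiv_works:
  "f differentiable (at x within {0..}) \<longleftrightarrow> (f has_vector_derivative hderiv f x) (at x within {0..})"
  unfolding hderiv_def by (rule vector_derivative_works)

lemma hdiffD:
  "hdiff n {0..} f \<Longrightarrow> j < n \<Longrightarrow> x \<ge> 0 \<Longrightarrow>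
   ((hderiv ^^ j) f has_vector_derivative (hderiv ^^ Suc j) f x) (at x within {0..})"
  by (simp add: hdiff_def hderiv_works[symmetric])

lemma hdiff_Suc:
  "hdiff (Suc n) S f \<longleftrightarrow> (\<forall>x\<in>S. f differentiable (at x within {0..})) \<and> hdiff n S (hderiv f)"
proof -
  have "(hderiv ^^ j) (hderiv f) = (hderiv ^^ Suc j) f" for j
    by (simp add: funpow_swap1)
  then show ?thesis
    unfolding hdiff_def by (auto simp: less_Suc_eq_0_disj simp del: funpow.simps(2))
qed

lemma hdiff_mono: "hdiff n S f \<Longrightarrow> m \<le> n \<Longrightarrow> hdiff m S f"
  by (auto simp: hdiff_def)

lemma hdiff_hderiv: "hdiff n S f \<Longrightarrow> m + r \<le> n \<Longrightarrow> hdiff m S ((hderiv ^^ r) f)"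
proof (unfold hdiff_def, intro allI impI ballI)
  fix j x assume *: "\<forall>j<n. \<forall>x\<in>S. (hderiv ^^ j) f differentiable (at x within {0..})"
    "m + r \<le> n" "j < m" "x \<in> S"
  then have "(hderiv ^^ (j + r)) f differentiable (at x within {0..})" by simp
  then show "(hderiv ^^ j) ((hderiv ^^ r) f) differentiable (at x within {0..})"
    by (simp add: funpow_add)
qed

lemma vd_cong:
  assumes "\<And>t. t \<ge> 0 \<Longrightarrow> f t = g t" "x \<ge> 0"
  shows "(f has_vector_derivative d) (at x within {0..}) = (g has_vector_derivative d) (at x within {0..})"
  by (rule has_vector_derivative_cong_ev)
     (use assms in \<open>auto simp: eventually_at_filter\<close>)

lemma hderiv_cong:
  assumes "\<And>t. t \<ge> 0 \<Longrightarrow> f t = g t" "x \<ge> 0"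
  shows "hderiv f x = hderiv g x"
  unfolding hderiv_def vector_derivative_def using vd_cong[OF assms] by simp

lemma hdiff_cong:
  assumes "\<And>t. t \<ge> 0 \<Longrightarrow> f t = g t"
  shows "hdiff n {0..} f = hdiff n {0..} g"
  using assms
proof (induction n arbitrary: f g)
  case 0
  then show ?case by (simp add: hdiff_def)
next
  case (Suc n)
  have "hderiv f t = hderiv g t" if "t \<ge> 0" for t
    using hderiv_cong[of f g] Suc.prems that by blast
  then have "hdiff n {0..} (hderiv f) = hdiff n {0..} (hderiv g)"
    by (rule Suc.IH)
  moreover have "f differentiable (at x within {0..}) \<longleftrightarrow> g differentiable (at x within {0..})"
    if "x \<ge> 0" for x
    using vd_cong[of f g x] Suc.prems that by (metis differentiableI_vector hderiv_works)
  ultimately show ?case by (simp add: hdiff_Suc)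
qed

lemma hdiff_add:
  "hdiff n {0..} f \<Longrightarrow> hdiff n {0..} g \<Longrightarrow> hdiff n {0..} (\<lambda>x. f x + g x)"
proof (induction n arbitrary: f g)
  case 0
  then show ?case by (simp add: hdiff_def)
next
  case (Suc n)
  have d: "((\<lambda>x. f x + g x) has_vector_derivative hderiv f x + hderiv g x) (at x within {0..})"
    if "x \<ge> 0" for x
    using Suc.prems that by (auto simp: hdiff_Suc hderiv_works intro!: derivative_intros)
  have "hdiff n {0..} (\<lambda>x. hderiv f x + hderiv g x)"
    using Suc.prems by (intro Suc.IH) (auto simp: hdiff_Suc)
  then have "hdiff n {0..} (hderiv (\<lambda>x. f x + g x))"
    by (subst hdiff_cong[where g = "\<lambda>x. hderiv f x + hderiv g x"]) (use hderiv_eqI[OF d] in auto)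
  then show ?case using d by (auto simp: hdiff_Suc intro: differentiableI_vector)
qed

lemma hdiff_mult:
  fixes f g :: "real \<Rightarrow> 'a::real_normed_algebra"
  shows "hdiff n {0..} f \<Longrightarrow> hdiff n {0..} g \<Longrightarrow> hdiff n {0..} (\<lambda>x. f x * g x)"
proof (induction n arbitrary: f g)
  case 0
  then show ?case by (simp add: hdiff_def)
next
  case (Suc n)
  have d: "((\<lambda>x. f x * g x) has_vector_derivative f x * hderiv g x + hderiv f x * g x) (at x within {0..})"
    if "x \<ge> 0" for x
    using Suc.prems that by (auto simp: hdiff_Suc hderiv_works intro!: has_vector_derivative_mult)
  have "hdiff n {0..} (\<lambda>x. f x * hderiv g x + hderiv f x * g x)"
    using Suc.prems hdiff_mono[OF Suc.prems(1), of n] hdiff_mono[OF Suc.prems(2), of n]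
    by (intro hdiff_add Suc.IH) (auto simp: hdiff_Suc)
  then have "hdiff n {0..} (hderiv (\<lambda>x. f x * g x))"
    by (subst hdiff_cong[where g = "\<lambda>x. f x * hderiv g x + hderiv f x * g x"])
       (use hderiv_eqI[OF d] in auto)
  then show ?case using d by (auto simp: hdiff_Suc intro: differentiableI_vector)
qed

lemma hdiff_of_real:
  "hdiff n {0..} f \<Longrightarrow> hdiff n {0..} (\<lambda>x. complex_of_real (f x))"
proof (induction n arbitrary: f)
  case 0
  then show ?case by (simp add: hdiff_def)
next
  case (Suc n)
  have d: "((\<lambda>x. complex_of_real (f x)) has_vector_derivative of_real (hderiv f x)) (at x within {0..})"
    if "x \<ge> 0" for x
    using Suc.prems that bounded_linear.has_vector_derivative[OF bounded_linear_of_real]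
    by (auto simp: hdiff_Suc hderiv_works)
  have "hdiff n {0..} (\<lambda>x. complex_of_real (hderiv f x))"
    using Suc.prems by (intro Suc.IH) (auto simp: hdiff_Suc)
  then have "hdiff n {0..} (hderiv (\<lambda>x. complex_of_real (f x)))"
    by (subst hdiff_cong[where g = "\<lambda>x. complex_of_real (hderiv f x)"]) (use hderiv_eqI[OF d] in auto)
  then show ?case using d by (auto simp: hdiff_Suc intro: differentiableI_vector)
qed

lemma parts_term_deriv:
  assumes "hdiff n {0..} u" "hdiff n {0..} v" "x \<ge> 0"
  shows "(parts_term n u v has_vector_derivative
     (hderiv ^^ n) u x * cnj (v x) - (-1) ^ n * u x * cnj ((hderiv ^^ n) v x)) (at x within {0..})"
proof -
  define a where "a j = (-1) ^ j * (hderiv ^^ (n-j)) u x * cnj ((hderiv ^^ j) v x)" for j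
  have "((\<lambda>x. (-1) ^ j * (hderiv ^^ (n-1-j)) u x * cnj ((hderiv ^^ j) v x))
      has_vector_derivative (a j - a (Suc j))) (at x within {0..})" if "j < n" for j
  proof -
    have u: "((hderiv ^^ (n-1-j)) u has_vector_derivative (hderiv ^^ (n-j)) u x) (at x within {0..})"
      using hdiffD[OF assms(1), of "n-1-j" x] that assms(3) by (simp add: Suc_diff_Suc)
    have v: "((hderiv ^^ j) v has_vector_derivative (hderiv ^^ Suc j) v x) (at x within {0..})"
      using hdiffD[OF assms(2) that] assms(3) by simp
    show ?thesis unfolding a_def
      by (rule has_vector_derivative_eq_rhs, rule has_vector_derivative_mult,
          rule has_vector_derivative_mult_right, rule u, rule has_vector_derivative_cnj, rule v)
         (simp add: algebra_simps)
  qed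
  then have "((\<lambda>x. \<Sum>j<n. (-1) ^ j * (hderiv ^^ (n-1-j)) u x * cnj ((hderiv ^^ j) v x))
      has_vector_derivative (\<Sum>j<n. a j - a (Suc j))) (at x within {0..})"
    by (intro has_vector_derivative_sum) auto
  moreover have "(\<Sum>j<n. a j - a (Suc j)) = a 0 - a n"
    by (rule sum_lessThan_telescope')
  ultimately show ?thesis
    unfolding parts_term_def[abs_def] by (simp add: a_def)
qed

lemma green_formula:
  assumes s: "\<And>r. r < k \<Longrightarrow> Ck_halfline r (s r)"
    and q: "\<And>r. r < k \<Longrightarrow> Ck_halfline (r+1) (q r)"
    and f: "hdiff (2*k-1) {0..} f" and g: "hdiff (2*k-1) {0..} g" and x: "x \<ge> 0"
  shows "((\<lambda>t. cnj (g t) * diff_expr k s q f t - f t * cnj (diff_expr k s q g t)) has_integral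
     (green_form k s q f g x - green_form k s q f g 0)) {0..x}"
proof -
  define B where "B f g t =
     (\<Sum>r<k. of_real (s r t) * (hderiv ^^ r) f t * cnj ((hderiv ^^ r) g t))
     + \<i>/2 * (\<Sum>r<k. of_real (q r t) * ((hderiv ^^ (r+1)) f t * cnj ((hderiv ^^ r) g t)
         - (hderiv ^^ r) f t * cnj ((hderiv ^^ (r+1)) g t)))" for f g t
  have half: "(half_form k s q f g has_vector_derivative
      (cnj (g t) * diff_expr k s q f t - B f g t)) (at t within {0..})"
    if f: "hdiff (2*k-1) {0..} f" and g: "hdiff (2*k-1) {0..} g" and t: "t \<ge> 0" for f g t
  proof -
    have pw: "(-1) ^ r * ((-1) ^ r * z) = (z::complex)" for r z
      by (simp flip: mult.assoc power_mult_distrib)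
    have ipw: "\<i> ^ (2*r+1) = \<i> * (-1) ^ r" for r
      by (simp add: power_mult)
    have 1: "(parts_term r (\<lambda>t. of_real (s r t) * (hderiv ^^ r) f t) g has_vector_derivative
        (hderiv ^^ r) (\<lambda>t. of_real (s r t) * (hderiv ^^ r) f t) t * cnj (g t)
        - (-1) ^ r * (of_real (s r t) * (hderiv ^^ r) f t) * cnj ((hderiv ^^ r) g t)) (at t within {0..})"
      if "r < k" for r
      using that s[OF that] hdiff_hderiv[OF f, of r r] hdiff_mono[OF g, of r] t
      by (intro parts_term_deriv hdiff_mult hdiff_of_real) (auto simp: Ck_halfline_def)
    have 2: "(parts_term (r+1) (\<lambda>t. of_real (q r t) * (hderiv ^^ r) f t) g has_vector_derivative
        (hderiv ^^ (r+1)) (\<lambda>t. of_real (q r t) * (hderiv ^^ r) f t) t * cnj (g t)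
        - (-1) ^ (r+1) * (of_real (q r t) * (hderiv ^^ r) f t) * cnj ((hderiv ^^ (r+1)) g t)) (at t within {0..})"
      if "r < k" for r
      using that q[OF that] hdiff_hderiv[OF f, of "r+1" r] hdiff_mono[OF g, of "r+1"] t
      by (intro parts_term_deriv hdiff_mult hdiff_of_real) (auto simp: Ck_halfline_def)
    have 3: "(parts_term r (\<lambda>t. of_real (q r t) * (hderiv ^^ (r+1)) f t) g has_vector_derivative
        (hderiv ^^ r) (\<lambda>t. of_real (q r t) * (hderiv ^^ (r+1)) f t) t * cnj (g t)
        - (-1) ^ r * (of_real (q r t) * (hderiv ^^ (r+1)) f t) * cnj ((hderiv ^^ r) g t)) (at t within {0..})"
      if "r < k" for r
    proof -
      have "hdiff r {0..} (q r)"
        using q[OF that] hdiff_mono[of "r+1" "{0..}" "q r" r] by (simp add: Ck_halfline_def)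
      then show ?thesis
        using that hdiff_hderiv[OF f, of r "r+1"] hdiff_mono[OF g, of r] t
        by (intro parts_term_deriv hdiff_mult hdiff_of_real) auto
    qed
    let ?u = "\<lambda>r t. of_real (s r t) * (hderiv ^^ r) f t"
    let ?v = "\<lambda>r t. of_real (q r t) * (hderiv ^^ r) f t"
    let ?w = "\<lambda>r t. of_real (q r t) * (hderiv ^^ (r+1)) f t"
    show ?thesis
      unfolding half_form_def[abs_def]
    proof (rule has_vector_derivative_eq_rhs[OF has_vector_derivative_add[OF
          has_vector_derivative_sum[OF has_vector_derivative_mult_right[OF 1]]
          has_vector_derivative_mult_right[OF has_vector_derivative_sum[OF
            has_vector_derivative_mult_right[OF has_vector_derivative_add[OF 2 3]]]]]])
      have A: "(\<Sum>r<k. (-1) ^ r * ((hderiv ^^ r) (?u r) t * cnj (g t)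
            - (-1) ^ r * ?u r t * cnj ((hderiv ^^ r) g t)))
          = cnj (g t) * (\<Sum>r<k. (-1) ^ r * (hderiv ^^ r) (?u r) t)
            - (\<Sum>r<k. ?u r t * cnj ((hderiv ^^ r) g t))"
        unfolding sum_distrib_left sum_subtractf[symmetric]
        by (rule sum.cong) (simp_all add: algebra_simps pw)
      have C: "(\<Sum>r<k. \<i> ^ (2*r+1) * (((hderiv ^^ (r+1)) (?v r) t * cnj (g t)
              - (-1) ^ (r+1) * ?v r t * cnj ((hderiv ^^ (r+1)) g t))
            + ((hderiv ^^ r) (?w r) t * cnj (g t) - (-1) ^ r * ?w r t * cnj ((hderiv ^^ r) g t))))
          = cnj (g t) * (\<Sum>r<k. \<i> ^ (2*r+1) * ((hderiv ^^ (r+1)) (?v r) t + (hderiv ^^ r) (?w r) t))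
            - \<i> * (\<Sum>r<k. of_real (q r t) * ((hderiv ^^ (r+1)) f t * cnj ((hderiv ^^ r) g t)
               - (hderiv ^^ r) f t * cnj ((hderiv ^^ (r+1)) g t)))"
        unfolding sum_distrib_left sum_subtractf[symmetric] ipw
        by (rule sum.cong) (simp_all add: algebra_simps pw)
      show "(\<Sum>r<k. (-1) ^ r * ((hderiv ^^ r) (?u r) t * cnj (g t)
            - (-1) ^ r * ?u r t * cnj ((hderiv ^^ r) g t)))
          + 1/2 * (\<Sum>r<k. \<i> ^ (2*r+1) * (((hderiv ^^ (r+1)) (?v r) t * cnj (g t)
              - (-1) ^ (r+1) * ?v r t * cnj ((hderiv ^^ (r+1)) g t))
            + ((hderiv ^^ r) (?w r) t * cnj (g t) - (-1) ^ r * ?w r t * cnj ((hderiv ^^ r) g t))))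
          = cnj (g t) * diff_expr k s q f t - B f g t"
        unfolding A C B_def diff_expr_def by (simp only: algebra_simps) simp
    qed simp_all
  qed
  have B: "cnj (B g f t) = B f g t" for t
    by (simp add: B_def algebra_simps sum_subtractf sum_negf sum_distrib_left)
  have "(green_form k s q f g has_vector_derivative
      cnj (g t) * diff_expr k s q f t - f t * cnj (diff_expr k s q g t)) (at t within {0..x})"
    if "t \<in> {0..x}" for t
  proof -
    have t: "t \<ge> 0" using that by simp
    have "(green_form k s q f g has_vector_derivative
      (cnj (g t) * diff_expr k s q f t - B f g t)
      - cnj (cnj (f t) * diff_expr k s q g t - B g f t)) (at t within {0..})"
      unfolding green_form_def[abs_def]
      by (intro has_vector_derivative_diff has_vector_derivative_cnj half f g t)
    then show ?thesis
      by (rule has_vector_derivative_within_subset[OF has_vector_derivative_eq_rhs]) (auto simp: B)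
  qed
  then show ?thesis
    by (rule fundamental_theorem_of_calculus[OF x])
qed


section \<open>Limit classification\<close>

text \<open>The complex vector space of all functions \<open>\<real> \<rightarrow> \<complex>\<close>, supplying the library dimension \<open>cfun.dim\<close>.
  The spaces measured below have dimension at most the order of \<open>M\<close>, so the value of
  \<open>dim\<close> on infinite-dimensional spaces does not matter.\<close>

interpretation cfun: vector_space "\<lambda>(c::complex) (f::real \<Rightarrow> complex) x. c * f x"
  by unfold_locales (auto simp: fun_eq_iff algebra_simps)

definition defect_space ::
  "nat \<Rightarrow> (nat \<Rightarrow> real \<Rightarrow> real) \<Rightarrow> (nat \<Rightarrow> real \<Rightarrow> real) \<Rightarrow> complex \<Rightarrow> (real \<Rightarrow> complex) set" where
  "defect_space k s q z =
     {f \<in> max_dom k s q. AE x in lebesgue. x > 0 \<longrightarrow> diff_expr k s q f x = z * f x}"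

definition limit_case ::
  "nat \<Rightarrow> (nat \<Rightarrow> real \<Rightarrow> real) \<Rightarrow> (nat \<Rightarrow> real \<Rightarrow> real) \<Rightarrow> nat \<Rightarrow> nat \<Rightarrow> bool" where
  "limit_case k s q Np Nm \<longleftrightarrow>
     cfun.dim (defect_space k s q \<i>) = Np \<and> cfun.dim (defect_space k s q (-\<i>)) = Nm"

definition green_det ::
  "nat \<Rightarrow> (nat \<Rightarrow> real \<Rightarrow> real) \<Rightarrow> (nat \<Rightarrow> real \<Rightarrow> real) \<Rightarrow> nat \<Rightarrow>
   (nat \<Rightarrow> real \<Rightarrow> complex) \<Rightarrow> (nat \<Rightarrow> real \<Rightarrow> complex) \<Rightarrow> complex" where
  "green_det k s q n F G =
     Determinant.det (Matrix.mat n n (\<lambda>(i, j). green_form_inf k s q (F i) (G j)))"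

end

theory Submission
  imports Defs
begin

text \<open>
  Write \<open>m = 2k-1\<close>, let \<open>N\<^sub>+\<close> and \<open>N\<^sub>-\<close> be the dimensions of the defect spaces, and regard \<open>[fg](\<infinity>)\<close> as a
  sesquilinear form on \<open>\<Delta>\<close>. Determinants of size \<open>n+1\<close> vanish exactly when the rank of that form is at
  most \<open>n\<close>, so everything follows from two facts: the rank equals \<open>N\<^sub>+ + N\<^sub>- - m\<close>, and
  \<open>k-1 \<le> N\<^sub>+ \<le> m\<close>, \<open>k \<le> N\<^sub>- \<le> m\<close>. With \<open>N\<^sub>+ = k-1+a\<close> and \<open>N\<^sub>- = k+b\<close> the rank is \<open>a+b\<close>.

  For the rank, von Neumann's decomposition (\<open>defect_decomposition\<close>) writes every \<open>f \<in> \<Delta>\<close> as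
  \<open>u + v\<close> with \<open>M u = iu\<close> and \<open>M v = -iv\<close>, up to a function whose derivatives of order below \<open>m\<close> vanish
  at \<open>1\<close> and whose form at infinity with all of \<open>\<Delta>\<close> vanishes. Some functions in \<open>\<Delta>\<close> have arbitrary
  data at \<open>1\<close> and vanish near infinity (\<open>compactly_supported_data\<close>); these \<open>m\<close> dimensions are independent
  of any functions detected by the form, which gives rank at most \<open>N\<^sub>+ + N\<^sub>- - m\<close> (\<open>rank_le_defect\<close>).
  Conversely, if the rank were smaller, some nonzero \<open>u + v\<close> would have zero data at \<open>1\<close> and lie in the
  radical of the form; Green's formula for \<open>u + v\<close> and \<open>u - v\<close> then forces \<open>u = v = 0\<close>
  (\<open>rank_ge_defect\<close>).

  The lower bounds on \<open>N\<^sub>+\<close> and \<open>N\<^sub>-\<close> come from Weyl's limiting argument (\<open>defect_dim_lower\<close>): solutions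
  satisfying boundary conditions at a moving endpoint that give the boundary form there a favourable
  sign are bounded in \<open>L\<^sup>2\<close>. The form at a point is given by a matrix, in the values of the derivatives,
  that vanishes beyond its antidiagonal and has \<open>i q\<^sub>k\<^sub>-\<^sub>1\<close> in the middle; since \<open>q\<^sub>k\<^sub>-\<^sub>1 > 0\<close>, imposing \<open>k-1\<close>
  conditions is enough for one sign and \<open>k\<close> are needed for the other, whence the asymmetry. The upper
  bounds hold because a solution is determined by its \<open>m\<close> derivatives at \<open>1\<close>.

  The decomposition is proved without operator theory. Subtracting an element of the defect space for
  \<open>i\<close>, one may assume that \<open>h = (M+i)f\<close> is orthogonal to it on \<open>[1,\<infinity>)\<close>. On each \<open>[1,X]\<close>, removing from
  \<open>h\<close> its projection on the solutions of \<open>M v = iv\<close> makes the equation solvable with zero data at both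
  endpoints and with a bound independent of \<open>X\<close> (\<open>truncated_problem\<close>). As \<open>X\<close> grows the projections tend
  to zero by orthogonality, and weak convergence of the truncated solutions shows that \<open>f\<close> differs from a
  square-integrable solution \<open>u\<close> of \<open>M u = -iu\<close> by an element of the radical (\<open>orthogonal_to_defect\<close>).

  The base point \<open>1\<close> replaces \<open>0\<close> because functions in \<open>\<Delta>\<close> are only controlled on compact subsets of
  \<open>(0,\<infinity>)\<close>. Green's formula holds for them through the fundamental theorem of calculus for absolutely
  continuous functions (\<open>abs_cont_FTC\<close>). Solutions with prescribed data are Picard series
  (\<open>linear_equation_exists\<close>), and they are unique because Green's formula pairs them with the solutions of
  the conjugate equation (\<open>solution_unique\<close>).
\<close>

section \<open>Absolutely continuous functions on an interval\<close>

text \<open>Degenerate intervals are excluded, so that distinct members have disjoint nonempty interiors and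
  the lengths add up to the measure of the union.\<close>

definition interval_family :: "real \<Rightarrow> real \<Rightarrow> (real \<times> real) set \<Rightarrow> bool" where
  "interval_family a b I \<longleftrightarrow> finite I \<and> (\<forall>(u,v)\<in>I. a \<le> u \<and> u < v \<and> v \<le> b) \<and>
     pairwise (\<lambda>(u,v) (u',v'). {u<..<v} \<inter> {u'<..<v'} = {}) I"

definition variation_over :: "(real \<Rightarrow> 'a::real_normed_vector) \<Rightarrow> (real \<times> real) set \<Rightarrow> real" where
  "variation_over f I = (\<Sum>(u,v)\<in>I. norm (f v - f u))"

definition total_length :: "(real \<times> real) set \<Rightarrow> real" where
  "total_length I = (\<Sum>(u,v)\<in>I. v - u)"

lemma abs_cont_on_familyD:
  assumes "abs_cont_on a b f" "e > 0"
  obtains d where "d > 0"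
    "\<And>I. interval_family a b I \<Longrightarrow> total_length I < d \<Longrightarrow> variation_over f I < e"
proof -
  obtain d where d: "d > 0" "\<forall>I. finite I \<longrightarrow>
        (\<forall>(u,v)\<in>I. a \<le> u \<and> u \<le> v \<and> v \<le> b) \<longrightarrow>
        pairwise (\<lambda>(u,v) (u',v'). {u<..<v} \<inter> {u'<..<v'} = {}) I \<longrightarrow>
        (\<Sum>(u,v)\<in>I. v - u) < d \<longrightarrow> (\<Sum>(u,v)\<in>I. norm (f v - f u)) < e"
    using assms unfolding abs_cont_on_def by blast
  show ?thesis
  proof (rule that[OF d(1)])
    fix I assume I: "interval_family a b I" "total_length I < d"
    have "\<forall>(u,v)\<in>I. a \<le> u \<and> u \<le> v \<and> v \<le> b"
      using I(1) by (force simp: interval_family_def)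
    with d(2) I show "variation_over f I < e"
      unfolding interval_family_def variation_over_def total_length_def by blast
  qed
qed

lemma interval_family_disjoint:
  assumes "interval_family a b I" "p \<in> I" "q \<in> I" "p \<noteq> q"
  shows "{fst p<..<snd p} \<inter> {fst q<..<snd q} = {}"
proof -
  have "pairwise (\<lambda>(u,v) (u',v'). {u<..<v} \<inter> {u'<..<v'} = {}) I"
    using assms(1) by (simp add: interval_family_def)
  from pairwiseD[OF this assms(2-4)] show ?thesis by (simp add: case_prod_beta)
qed

lemma interval_family_mono:
  "interval_family a b I \<Longrightarrow> a' \<le> a \<Longrightarrow> b \<le> b' \<Longrightarrow> interval_family a' b' I"
  unfolding interval_family_def by fastforce

lemma abs_cont_on_subset:
  assumes "abs_cont_on a b f" "a \<le> a'" "b' \<le> b"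
  shows "abs_cont_on a' b' f"
  unfolding abs_cont_on_def
proof (intro allI impI)
  fix e :: real assume "e > 0"
  then obtain d where d: "d > 0" "\<forall>I. finite I \<longrightarrow>
        (\<forall>(u,v)\<in>I. a \<le> u \<and> u \<le> v \<and> v \<le> b) \<longrightarrow>
        pairwise (\<lambda>(u,v) (u',v'). {u<..<v} \<inter> {u'<..<v'} = {}) I \<longrightarrow>
        (\<Sum>(u,v)\<in>I. v - u) < d \<longrightarrow> (\<Sum>(u,v)\<in>I. norm (f v - f u)) < e"
    using assms(1) unfolding abs_cont_on_def by blast
  show "\<exists>d>0. \<forall>I. finite I \<longrightarrow>
        (\<forall>(u,v)\<in>I. a' \<le> u \<and> u \<le> v \<and> v \<le> b') \<longrightarrow>
        pairwise (\<lambda>(u,v) (u',v'). {u<..<v} \<inter> {u'<..<v'} = {}) I \<longrightarrow>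
        (\<Sum>(u,v)\<in>I. v - u) < d \<longrightarrow> (\<Sum>(u,v)\<in>I. norm (f v - f u)) < e"
  proof (intro exI[of _ d] conjI allI impI)
    fix I assume *: "finite I" "\<forall>(u,v)\<in>I. a' \<le> u \<and> u \<le> v \<and> v \<le> b'"
      "pairwise (\<lambda>(u,v) (u',v'). {u<..<v} \<inter> {u'<..<v'} = {}) I" "(\<Sum>(u,v)\<in>I. v - u) < d"
    have "\<forall>(u,v)\<in>I. a \<le> u \<and> u \<le> v \<and> v \<le> b" using *(2) assms by fastforce
    with d * show "(\<Sum>(u,v)\<in>I. norm (f v - f u)) < e" by blast
  qed fact
qed

lemma interval_family_singleton: "a \<le> u \<Longrightarrow> u < v \<Longrightarrow> v \<le> b \<Longrightarrow> interval_family a b {(u,v)}"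
  by (simp add: interval_family_def)

lemma abs_cont_on_continuous:
  fixes f :: "real \<Rightarrow> 'a::real_normed_vector"
  assumes "abs_cont_on a b f"
  shows "continuous_on {a..b} f"
  unfolding continuous_on_iff
proof (intro ballI allI impI)
  fix x e :: real assume x: "x \<in> {a..b}" and "e > 0"
  obtain d where d: "d > 0"
    "\<And>I. interval_family a b I \<Longrightarrow> total_length I < d \<Longrightarrow> variation_over f I < e"
    using abs_cont_on_familyD[OF assms \<open>e > 0\<close>] by blast
  have close: "norm (f v - f u) < e" if "a \<le> u" "u < v" "v \<le> b" "v - u < d" for u v
    using d(2)[OF interval_family_singleton[OF that(1-3)]] that
    by (simp add: variation_over_def total_length_def)
  show "\<exists>d>0. \<forall>x'\<in>{a..b}. dist x' x < d \<longrightarrow> dist (f x') (f x) < e"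
  proof (intro exI[of _ d] conjI ballI impI)
    fix y assume y: "y \<in> {a..b}" "dist y x < d"
    consider "y < x" | "y = x" | "x < y" by linarith
    then show "dist (f y) (f x) < e"
    proof cases
      case 1 then show ?thesis using close[of y x] x y by (simp add: dist_norm norm_minus_commute)
    next
      case 3 then show ?thesis using close[of x y] x y by (simp add: dist_norm)
    qed (use \<open>e > 0\<close> in simp)
  qed fact
qed

lemma interval_family_disjoint_Un:
  assumes I: "interval_family a b I" and J: "interval_family b c J" and "a \<le> b" "b \<le> c"
  shows "interval_family a c (I \<union> J)" "I \<inter> J = {}"
proof -
  have "pairwise (\<lambda>(u,v) (u',v'). {u<..<v} \<inter> {u'<..<v'} = {}) (I \<union> J)"
    unfolding pairwise_def
  proof (intro ballI impI)
    fix x y assume xy: "x \<in> I \<union> J" "y \<in> I \<union> J" "x \<noteq> y"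
    obtain u v u' v' where [simp]: "x = (u,v)" "y = (u',v')" by (cases x, cases y) auto
    have *: "v \<le> b" if "(u,v) \<in> I" for u v using I that by (auto simp: interval_family_def)
    have **: "b \<le> u" if "(u,v) \<in> J" for u v using J that by (auto simp: interval_family_def)
    from xy consider "x \<in> I" "y \<in> I" | "x \<in> J" "y \<in> J" | "x \<in> I" "y \<in> J" | "x \<in> J" "y \<in> I" by auto
    then show "(case x of (u,v) \<Rightarrow> \<lambda>(u',v'). {u<..<v} \<inter> {u'<..<v'} = {}) y"
    proof cases
      case 1
      then show ?thesis using I xy by (auto simp: interval_family_def pairwise_def)
    next
      case 2
      then show ?thesis using J xy by (auto simp: interval_family_def pairwise_def)
    next
      case 3
      then show ?thesis using *[of u v] **[of u' v'] by auto
    next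
      case 4
      then show ?thesis using *[of u' v'] **[of u v] by auto
    qed
  qed
  then show "interval_family a c (I \<union> J)"
    using assms by (fastforce simp: interval_family_def)
  show "I \<inter> J = {}"
    using assms by (fastforce simp: interval_family_def)
qed

lemma total_length_eq_measure:
  assumes "interval_family a b I"
  shows "total_length I = measure lebesgue (\<Union>p\<in>I. {fst p<..<snd p})"
proof -
  have fin: "finite I" using assms by (simp add: interval_family_def)
  have "total_length I = (\<Sum>p\<in>I. measure lebesgue {fst p<..<snd p})"
    unfolding total_length_def
    by (intro sum.cong) (use assms in \<open>auto simp: interval_family_def\<close>)
  also have "\<dots> = measure lebesgue (\<Union>p\<in>I. {fst p<..<snd p})"
  proof (rule measure_finite_Union[symmetric, OF fin])
    show "disjoint_family_on (\<lambda>p. {fst p<..<snd p}) I"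
      using interval_family_disjoint[OF assms] unfolding disjoint_family_on_def by blast
    show "emeasure lebesgue {fst p<..<snd p} \<noteq> \<infinity>" if "p \<in> I" for p
      using that assms by (auto simp: interval_family_def)
  qed auto
  finally show ?thesis .
qed

lemma total_length_le:
  assumes "interval_family a b I" "a \<le> b"
  shows "total_length I \<le> b - a"
proof -
  have "total_length I = measure lebesgue (\<Union>p\<in>I. {fst p<..<snd p})"
    by (rule total_length_eq_measure[OF assms(1)])
  also have "\<dots> \<le> measure lebesgue {a..b}"
  proof (rule measure_mono_fmeasurable)
    show "(\<Union>p\<in>I. {fst p<..<snd p}) \<subseteq> {a..b}"
      using assms by (fastforce simp: interval_family_def)
    have "open (\<Union>p\<in>I. {fst p<..<snd p})" by auto
    then show "(\<Union>p\<in>I. {fst p<..<snd p}) \<in> sets lebesgue" by (simp add: borel_open)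
    show "{a..b} \<in> lmeasurable" using lmeasurable_cbox[of a b] by simp
  qed
  finally show ?thesis using assms by simp
qed

text \<open>Cut every interval at \<open>c\<close> and discard the degenerate pieces; by the triangle inequality the
  variation does not decrease. This gives the subadditivity of the total variation.\<close>

lemma interval_family_split:
  assumes I: "interval_family a b I" and c: "a \<le> c" "c \<le> b"
  obtains J K where "interval_family a c J" "interval_family c b K"
    "variation_over f I \<le> variation_over f J + variation_over f K"
proof -
  define l r where "l = (\<lambda>(u,v). (min u c, min v c))" and "r = (\<lambda>(u,v). (max u c, max v c))"
  define J K where "J = {p \<in> l ` I. fst p < snd p}" and "K = {p \<in> r ` I. fst p < snd p}"
  have fin: "finite I" using I by (simp add: interval_family_def)
  have dis: "{u<..<v} \<inter> {u'<..<v'} = {}" if "(u,v) \<in> I" "(u',v') \<in> I" "(u,v) \<noteq> (u',v')" for u v u' v'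
    using interval_family_disjoint[OF I that] by simp
  have bd: "a \<le> u \<and> u < v \<and> v \<le> b" if "(u,v) \<in> I" for u v
    using I that by (auto simp: interval_family_def)
  have J: "interval_family a c J"
    unfolding interval_family_def
  proof (intro conjI)
    show "finite J" using fin by (simp add: J_def)
    show "\<forall>(u,v)\<in>J. a \<le> u \<and> u < v \<and> v \<le> c"
      using c by (auto simp: J_def l_def dest!: bd)
    show "pairwise (\<lambda>(u,v) (u',v'). {u<..<v} \<inter> {u'<..<v'} = {}) J"
      unfolding pairwise_def
    proof (intro ballI impI)
      fix x y assume xy: "x \<in> J" "y \<in> J" "x \<noteq> y"
      then obtain u v u' v' where *: "(u,v) \<in> I" "(u',v') \<in> I" "x = l (u,v)" "y = l (u',v')"
        by (auto simp: J_def)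
      then have "(u,v) \<noteq> (u',v')" using xy by auto
      from dis[OF *(1,2) this] show "(case x of (u,v) \<Rightarrow> \<lambda>(u',v'). {u<..<v} \<inter> {u'<..<v'} = {}) y"
        by (auto simp: * l_def disjoint_iff)
    qed
  qed
  have K: "interval_family c b K"
    unfolding interval_family_def
  proof (intro conjI)
    show "finite K" using fin by (simp add: K_def)
    show "\<forall>(u,v)\<in>K. c \<le> u \<and> u < v \<and> v \<le> b"
      using c by (auto simp: K_def r_def dest!: bd)
    show "pairwise (\<lambda>(u,v) (u',v'). {u<..<v} \<inter> {u'<..<v'} = {}) K"
      unfolding pairwise_def
    proof (intro ballI impI)
      fix x y assume xy: "x \<in> K" "y \<in> K" "x \<noteq> y"
      then obtain u v u' v' where *: "(u,v) \<in> I" "(u',v') \<in> I" "x = r (u,v)" "y = r (u',v')"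
        by (auto simp: K_def)
      then have "(u,v) \<noteq> (u',v')" using xy by auto
      from dis[OF *(1,2) this] show "(case x of (u,v) \<Rightarrow> \<lambda>(u',v'). {u<..<v} \<inter> {u'<..<v'} = {}) y"
        by (auto simp: * r_def disjoint_iff)
    qed
  qed
  define n where "n p = norm (f (snd p) - f (fst p))" for p
  have inj: "n (g x) = 0" if "g = l \<or> g = r" "x \<in> I" "y \<in> I" "x \<noteq> y" "g x = g y" for g x y
  proof (rule ccontr)
    assume ne: "n (g x) \<noteq> 0"
    obtain u v u' v' where [simp]: "x = (u,v)" "y = (u',v')" by (cases x, cases y) auto
    have "fst (g x) \<noteq> snd (g x)" using ne by (auto simp: n_def)
    then have "fst (g x) < snd (g x)" using bd[of u v] that by (auto simp: l_def r_def)
    then have "(fst (g x) + snd (g x))/2 \<in> {u<..<v} \<inter> {u'<..<v'}"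
      using that by (auto simp: l_def r_def min_def max_def split: if_splits)
    then show False using dis[of u v u' v'] that by auto
  qed
  have var: "(\<Sum>p\<in>I. n (g p)) = variation_over f {p \<in> g ` I. fst p < snd p}" if g: "g = l \<or> g = r" for g
  proof -
    have "(\<Sum>p\<in>I. n (g p)) = (\<Sum>p\<in>g ` I. n p)"
      by (subst sum.reindex_nontrivial[OF fin]) (use inj[OF g] in \<open>auto simp: o_def\<close>)
    also have "\<dots> = (\<Sum>p\<in>{p \<in> g ` I. fst p < snd p}. n p)"
    proof (rule sum.mono_neutral_right)
      show "\<forall>i\<in>g ` I - {p \<in> g ` I. fst p < snd p}. n i = 0"
      proof
        fix p assume p: "p \<in> g ` I - {p \<in> g ` I. fst p < snd p}"
        obtain u v where "(u,v) \<in> I" "p = g (u,v)" using p by auto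
        then have "fst p \<le> snd p" using g bd[of u v] by (auto simp: l_def r_def)
        then have "fst p = snd p" using p by auto
        then show "n p = 0" by (simp add: n_def)
      qed
    qed (use fin in auto)
    finally show ?thesis by (simp add: variation_over_def n_def case_prod_beta)
  qed
  have "variation_over f I = (\<Sum>p\<in>I. n p)"
    by (simp add: variation_over_def n_def case_prod_beta)
  also have "\<dots> \<le> (\<Sum>p\<in>I. n (l p) + n (r p))"
  proof (rule sum_mono)
    fix p assume "p \<in> I"
    obtain u v where p: "p = (u,v)" by (cases p)
    have uv: "u < v" using bd \<open>p \<in> I\<close> p by auto
    consider "v \<le> c" | "c \<le> u" | "u < c" "c < v" by linarith
    then show "n p \<le> n (l p) + n (r p)"
    proof cases
      case 3
      have "norm (f v - f u) = norm ((f c - f u) + (f v - f c))" by simp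
      also have "\<dots> \<le> norm (f c - f u) + norm (f v - f c)" by (rule norm_triangle_ineq)
      finally show ?thesis using 3 unfolding p n_def l_def r_def
        by (simp add: min_def max_def)
    qed (use uv in \<open>auto simp: p n_def l_def r_def min_def max_def\<close>)
  qed
  also have "\<dots> = variation_over f J + variation_over f K"
    by (simp add: sum.distrib var J_def K_def)
  finally show ?thesis using that J K by blast
qed

text \<open>The supremum is only meaningful when it is bounded; the lemmas below carry a bound for that reason.\<close>

definition total_variation :: "(real \<Rightarrow> 'a::real_normed_vector) \<Rightarrow> real \<Rightarrow> real \<Rightarrow> real" where
  "total_variation f u v = (SUP I\<in>{I. interval_family u v I}. variation_over f I)"

lemma interval_family_empty: "interval_family u v {}"
  by (simp add: interval_family_def)

lemma total_variation_bdd: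
  assumes "\<And>I. interval_family a b I \<Longrightarrow> variation_over f I \<le> B" "a \<le> u" "v \<le> b"
  shows "bdd_above (variation_over f ` {I. interval_family u v I})"
  using assms interval_family_mono[of u v _ a b] by (auto intro!: bdd_aboveI)

lemma variation_over_le_total:
  assumes "\<And>I. interval_family a b I \<Longrightarrow> variation_over f I \<le> B" "a \<le> u" "v \<le> b"
    and "interval_family u v I"
  shows "variation_over f I \<le> total_variation f u v"
  unfolding total_variation_def
  by (rule cSUP_upper[OF _ total_variation_bdd[OF assms(1-3)]]) (use assms(4) in auto)

lemma total_variation_subadd:
  assumes bd: "\<And>I. interval_family a b I \<Longrightarrow> variation_over f I \<le> B"
    and "a \<le> u" "u \<le> v" "v \<le> w" "w \<le> b"
  shows "total_variation f u w \<le> total_variation f u v + total_variation f v w"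
  unfolding total_variation_def[of f u w]
proof (rule cSUP_least)
  show "{I. interval_family u w I} \<noteq> {}" using interval_family_empty by blast
next
  fix I assume "I \<in> {I. interval_family u w I}"
  then obtain J K where JK: "interval_family u v J" "interval_family v w K"
    "variation_over f I \<le> variation_over f J + variation_over f K"
    using interval_family_split[of u w I v f] assms by auto
  have "variation_over f J \<le> total_variation f u v" "variation_over f K \<le> total_variation f v w"
    using assms JK variation_over_le_total[OF bd] by auto
  with JK(3) show "variation_over f I \<le> total_variation f u v + total_variation f v w" by linarith
qed

lemma total_variation_increment:
  assumes bd: "\<And>I. interval_family a b I \<Longrightarrow> variation_over f I \<le> B"
    and "a \<le> u" "u < v" "v \<le> b"
  shows "total_variation f a u + norm (f v - f u) \<le> total_variation f a v"
proof -
  have "variation_over f I \<le> total_variation f a v - norm (f v - f u)" if I: "interval_family a u I" for I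
  proof -
    have s: "interval_family u v {(u,v)}" using assms by (intro interval_family_singleton) auto
    note U = interval_family_disjoint_Un[OF I s]
    have fin: "finite I" using I by (simp add: interval_family_def)
    have "variation_over f (I \<union> {(u,v)}) = variation_over f I + norm (f v - f u)"
      unfolding variation_over_def using U(2) assms fin by (subst sum.union_disjoint) auto
    moreover have "variation_over f (I \<union> {(u,v)}) \<le> total_variation f a v"
      using U(1) assms by (intro variation_over_le_total[OF bd]) auto
    ultimately show ?thesis by linarith
  qed
  then have "total_variation f a u \<le> total_variation f a v - norm (f v - f u)"
    unfolding total_variation_def[of f a u]
    by (intro cSUP_least) (use interval_family_empty in auto)
  then show ?thesis by linarith
qed

text \<open>Inside each interval of \<open>I\<close> choose a family that almost attains the total variation there. The
  union of these families is no longer than \<open>I\<close>, so the modulus of absolute continuity applies to it.\<close>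

lemma sum_total_variation_le:
  assumes bd: "\<And>I. interval_family a b I \<Longrightarrow> variation_over f I \<le> B"
    and d: "\<And>I. interval_family a b I \<Longrightarrow> total_length I < d \<Longrightarrow> variation_over f I \<le> e"
    and I: "interval_family a b I" "total_length I < d"
  shows "(\<Sum>(u,v)\<in>I. total_variation f u v) \<le> e"
proof (rule field_le_epsilon)
  fix \<eta> :: real assume "\<eta> > 0"
  define \<delta> where "\<delta> = \<eta> / (card I + 1)"
  have "\<delta> > 0" using \<open>\<eta> > 0\<close> by (simp add: \<delta>_def)
  have fin: "finite I" using I by (simp add: interval_family_def)
  have I': "a \<le> u" "u < v" "v \<le> b" if "(u,v) \<in> I" for u v
    using I that by (auto simp: interval_family_def)
  have "\<exists>J. interval_family (fst p) (snd p) J \<and> total_variation f (fst p) (snd p) - \<delta> < variation_over f J"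
    if "p \<in> I" for p
  proof -
    obtain u v where [simp]: "p = (u,v)" by (cases p)
    have "\<exists>J\<in>{J. interval_family u v J}. total_variation f u v - \<delta> < variation_over f J"
    proof (subst less_cSUP_iff[symmetric])
      show "{J. interval_family u v J} \<noteq> {}" using interval_family_empty by blast
      show "bdd_above (variation_over f ` {J. interval_family u v J})"
        by (rule total_variation_bdd[OF bd]) (use I'[of u v] that in auto)
      show "total_variation f u v - \<delta> < (SUP J\<in>{J. interval_family u v J}. variation_over f J)"
        using \<open>\<delta> > 0\<close> by (simp add: total_variation_def)
    qed
    then show ?thesis by auto
  qed
  then obtain J where J: "\<And>p. p \<in> I \<Longrightarrow> interval_family (fst p) (snd p) (J p)"
    "\<And>p. p \<in> I \<Longrightarrow> total_variation f (fst p) (snd p) - \<delta> < variation_over f (J p)"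
    by metis
  have Jb: "fst p \<le> u" "u < v" "v \<le> snd p" if "p \<in> I" "(u,v) \<in> J p" for p u v
    using J(1)[OF that(1)] that(2) by (auto simp: interval_family_def)
  have finJ: "finite (J p)" if "p \<in> I" for p
    using J(1)[OF that] by (simp add: interval_family_def)
  have disI: "{fst p<..<snd p} \<inter> {fst q<..<snd q} = {}" if "p \<in> I" "q \<in> I" "p \<noteq> q" for p q
    using interval_family_disjoint[OF I(1) that] .
  have dis: "{u<..<v} \<inter> {u'<..<v'} = {}"
    if "p \<in> I" "q \<in> I" "(u,v) \<in> J p" "(u',v') \<in> J q" "(u,v) \<noteq> (u',v')" for p q u v u' v'
  proof (cases "p = q")
    case True
    with interval_family_disjoint[OF J(1)[OF that(1)] that(3), of "(u',v')"] that show ?thesis by simp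
  next
    case False
    have "{u<..<v} \<subseteq> {fst p<..<snd p}" "{u'<..<v'} \<subseteq> {fst q<..<snd q}"
      using Jb[OF that(1,3)] Jb[OF that(2,4)] by auto
    with disI[OF that(1,2) False] show ?thesis by blast
  qed
  define U where "U = (\<Union>p\<in>I. J p)"
  have U: "interval_family a b U"
    unfolding interval_family_def
  proof (intro conjI)
    show "finite U" using fin finJ by (simp add: U_def)
    show "\<forall>(u,v)\<in>U. a \<le> u \<and> u < v \<and> v \<le> b"
    proof clarify
      fix u v assume "(u,v) \<in> U"
      then obtain p where "p \<in> I" "(u,v) \<in> J p" by (auto simp: U_def)
      with Jb[of p u v] I'[of "fst p" "snd p"] show "a \<le> u \<and> u < v \<and> v \<le> b" by auto
    qed
    show "pairwise (\<lambda>(u,v) (u',v'). {u<..<v} \<inter> {u'<..<v'} = {}) U"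
      unfolding pairwise_def
    proof (intro ballI impI)
      fix x y assume "x \<in> U" "y \<in> U" "x \<noteq> y"
      then obtain p q where "p \<in> I" "x \<in> J p" "q \<in> I" "y \<in> J q" by (auto simp: U_def)
      with \<open>x \<noteq> y\<close> show "(case x of (u,v) \<Rightarrow> \<lambda>(u',v'). {u<..<v} \<inter> {u'<..<v'} = {}) y"
        using dis[of p q "fst x" "snd x" "fst y" "snd y"] by (cases x, cases y) auto
    qed
  qed
  have Jdis: "\<forall>p\<in>I. \<forall>q\<in>I. p \<noteq> q \<longrightarrow> J p \<inter> J q = {}"
  proof (intro ballI impI, rule ccontr)
    fix p q assume pq: "p \<in> I" "q \<in> I" "p \<noteq> q" "J p \<inter> J q \<noteq> {}"
    then obtain u v where "(u,v) \<in> J p" "(u,v) \<in> J q" by auto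
    then have "(u + v)/2 \<in> {fst p<..<snd p} \<inter> {fst q<..<snd q}"
      using Jb[of p u v] Jb[of q u v] pq by auto
    with disI[OF pq(1-3)] show False by blast
  qed
  have sumU: "sum g U = (\<Sum>p\<in>I. sum g (J p))" for g :: "real \<times> real \<Rightarrow> real"
    unfolding U_def using Jdis fin finJ by (intro sum.UNION_disjoint) auto
  have "total_length U = (\<Sum>p\<in>I. total_length (J p))"
    by (simp add: total_length_def sumU)
  also have "\<dots> \<le> (\<Sum>p\<in>I. snd p - fst p)"
    by (intro sum_mono total_length_le J(1)) (use I' in force)+
  also have "\<dots> = total_length I" by (simp add: total_length_def case_prod_beta)
  finally have "variation_over f U \<le> e" using I(2) U by (intro d) auto
  have "(\<Sum>(u,v)\<in>I. total_variation f u v) = (\<Sum>p\<in>I. total_variation f (fst p) (snd p))"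
    by (simp add: case_prod_beta)
  also have "\<dots> \<le> (\<Sum>p\<in>I. variation_over f (J p) + \<delta>)"
    by (intro sum_mono) (use J(2) in force)
  also have "\<dots> = variation_over f U + card I * \<delta>"
    by (simp add: sum.distrib variation_over_def sumU)
  also have "\<dots> \<le> e + \<eta>"
  proof -
    have "card I * \<delta> \<le> \<eta>" using \<open>\<eta> > 0\<close> by (simp add: \<delta>_def field_simps)
    then show ?thesis using \<open>variation_over f U \<le> e\<close> by linarith
  qed
  finally show "(\<Sum>(u,v)\<in>I. total_variation f u v) \<le> e + \<eta>" .
qed

text \<open>The Lebesgue--Stieltjes measure of \<open>G\<close> vanishes on Lebesgue null sets, because such sets are covered
  by intervals of small total length; its Radon--Nikodym density is the required function.\<close>

lemma mono_abs_cont_has_density: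
  fixes G :: "real \<Rightarrow> real"
  assumes ab: "a < b" and mono: "\<And>x y. a \<le> x \<Longrightarrow> x \<le> y \<Longrightarrow> y \<le> b \<Longrightarrow> G x \<le> G y"
    and ac: "\<And>e. e > 0 \<Longrightarrow> \<exists>d>0. \<forall>I. interval_family a b I \<longrightarrow> total_length I < d \<longrightarrow>
      (\<Sum>(u,v)\<in>I. G v - G u) \<le> e"
  shows "\<exists>\<phi>. \<phi> absolutely_integrable_on {a..b} \<and> (\<forall>x\<in>{a..b}. (\<phi> has_integral G x - G a) {a..x})"
proof -
  \<comment> \<open>constant continuation of \<open>G\<close> outside \<open>[a,b]\<close>, as an interval measure needs a function on the whole line\<close>
  define H where "H x = G (max a (min b x))" for x
  have monoH: "H x \<le> H y" if "x \<le> y" for x y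
    unfolding H_def using that ab by (intro mono) auto
  have HG: "H x = G x" if "a \<le> x" "x \<le> b" for x
    using that by (simp add: H_def max_def min_def)
  have contG: "continuous_on {a..b} G"
    unfolding continuous_on_iff
  proof (intro ballI allI impI)
    fix x e :: real assume x: "x \<in> {a..b}" and "e > 0"
    then obtain d where d: "d > 0"
      "\<And>I. interval_family a b I \<Longrightarrow> total_length I < d \<Longrightarrow> (\<Sum>(u,v)\<in>I. G v - G u) \<le> e/2"
      using ac[of "e/2"] by auto
    have close: "G v - G u < e" if "a \<le> u" "u < v" "v \<le> b" "v - u < d" for u v
      using d(2)[OF interval_family_singleton[OF that(1-3)]] that \<open>e > 0\<close>
      by (simp add: total_length_def)
    show "\<exists>d>0. \<forall>x'\<in>{a..b}. dist x' x < d \<longrightarrow> dist (G x') (G x) < e"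
    proof (intro exI[of _ d] conjI ballI impI)
      fix y assume y: "y \<in> {a..b}" "dist y x < d"
      consider "y < x" | "y = x" | "x < y" by linarith
      then show "dist (G y) (G x) < e"
      proof cases
        case 1 then show ?thesis using close[of y x] x y mono[of y x] by (simp add: dist_real_def)
      next
        case 3 then show ?thesis using close[of x y] x y mono[of x y] by (simp add: dist_real_def)
      qed (use \<open>e > 0\<close> in simp)
    qed fact
  qed
  have contH: "continuous_on UNIV H"
    unfolding H_def
    by (rule continuous_on_compose2[OF contG]) (use ab in \<open>auto intro!: continuous_intros\<close>)
  define \<mu> where "\<mu> = interval_measure H"
  have sets_mu[simp, measurable_cong]: "sets \<mu> = sets borel" by (simp add: \<mu>_def)
  have mu_Icc: "emeasure \<mu> {u..v} = ennreal (G v - G u)" if "a \<le> u" "u \<le> v" "v \<le> b" for u v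
    unfolding \<mu>_def using that
    by (subst emeasure_interval_measure_Icc[OF _ monoH contH]) (auto simp: HG)
  have null: "emeasure \<mu> (N \<inter> {a..b}) = 0" if N: "N \<in> null_sets lborel" for N
  proof -
    have Nb: "N \<in> sets borel" using N by auto
    have "emeasure \<mu> (N \<inter> {a..b}) \<le> ennreal e" if "e > 0" for e
    proof -
      obtain d where d: "d > 0"
        "\<And>I. interval_family a b I \<Longrightarrow> total_length I < d \<Longrightarrow> (\<Sum>(u,v)\<in>I. G v - G u) \<le> e"
        using ac[OF \<open>e > 0\<close>] by auto
      have nullN: "N \<inter> {a..b} \<in> null_sets lebesgue"
        using N by (intro null_set_Int2) (auto intro: null_sets_completionI)
      have m0: "measure lebesgue (N \<inter> {a..b}) = 0"
        using nullN by (simp add: measure_eq_0_null_sets)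
      have lm: "N \<inter> {a..b} \<in> lmeasurable"
        using nullN by (simp add: fmeasurableI_null_sets)
      have sub: "N \<inter> {a..b} \<subseteq> cbox a b" and d2: "d/2 > 0" using \<open>d > 0\<close> by auto
      obtain \<D> where D: "countable \<D>"
        "\<And>K. K \<in> \<D> \<Longrightarrow> K \<subseteq> cbox a b \<and> K \<noteq> {} \<and> (\<exists>c d. K = cbox c d)"
        "pairwise (\<lambda>A B. interior A \<inter> interior B = {}) \<D>"
        "\<And>K. \<lbrakk>K \<in> \<D>; box a b \<noteq> {}\<rbrakk> \<Longrightarrow> interior K \<noteq> {}"
        "N \<inter> {a..b} \<subseteq> \<Union>\<D>" "\<Union>\<D> \<in> lmeasurable"
        "measure lebesgue (\<Union>\<D>) \<le> measure lebesgue (N \<inter> {a..b}) + d/2"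
        by (rule measurable_outer_intervals_bounded[OF lm sub d2], rule that)
      have K: "\<exists>u v. K = {u..v} \<and> a \<le> u \<and> u < v \<and> v \<le> b" if "K \<in> \<D>" for K
      proof -
        obtain u v where uv: "K = {u..v}" using D(2)[OF \<open>K \<in> \<D>\<close>] by (metis cbox_interval)
        have "interior K \<noteq> {}" using D(4)[OF that] ab by auto
        then have "u < v" using uv by (auto simp: interior_atLeastAtMost_real)
        then show ?thesis using uv D(2)[OF that] by auto
      qed
      have fin: "emeasure \<mu> (\<Union>F) \<le> ennreal e" if F: "finite F" "F \<subseteq> \<D>" for F
      proof -
        have "\<forall>K\<in>F. \<exists>p. K = {fst p..snd p} \<and> a \<le> fst p \<and> fst p < snd p \<and> snd p \<le> b"
        proof
          fix K assume "K \<in> F"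
          then obtain u v where "K = {u..v}" "a \<le> u" "u < v" "v \<le> b" using K F(2) by blast
          then show "\<exists>p. K = {fst p..snd p} \<and> a \<le> fst p \<and> fst p < snd p \<and> snd p \<le> b"
            by (intro exI[of _ "(u,v)"]) simp
        qed
        then obtain p where p: "\<And>K. K \<in> F \<Longrightarrow> K = {fst (p K)..snd (p K)}"
          "\<And>K. K \<in> F \<Longrightarrow> a \<le> fst (p K) \<and> fst (p K) < snd (p K) \<and> snd (p K) \<le> b" by metis
        have inj: "inj_on p F" using p(1) by (metis inj_onI)
        have int: "interior K = {fst (p K)<..<snd (p K)}" if "K \<in> F" for K
          using p(1)[OF that] interior_atLeastAtMost_real by metis
        have I: "interval_family a b (p ` F)"
          unfolding interval_family_def
        proof (intro conjI)
          show "finite (p ` F)" using F by simp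
          show "\<forall>(u,v)\<in>p ` F. a \<le> u \<and> u < v \<and> v \<le> b"
            using p(2) by (auto simp: case_prod_beta)
          show "pairwise (\<lambda>(u,v) (u',v'). {u<..<v} \<inter> {u'<..<v'} = {}) (p ` F)"
            unfolding pairwise_def
          proof (intro ballI impI)
            fix x y assume "x \<in> p ` F" "y \<in> p ` F" "x \<noteq> y"
            then obtain K L where KL: "K \<in> F" "L \<in> F" "K \<noteq> L" "x = p K" "y = p L" by auto
            then have "interior K \<inter> interior L = {}"
              using D(3) F(2) by (auto simp: pairwise_def)
            then show "(case x of (u,v) \<Rightarrow> \<lambda>(u',v'). {u<..<v} \<inter> {u'<..<v'} = {}) y"
              using int KL by (auto simp: case_prod_beta)
          qed
        qed
        have "total_length (p ` F) = measure lebesgue (\<Union>q\<in>p ` F. {fst q<..<snd q})"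
          by (rule total_length_eq_measure[OF I])
        also have "\<dots> \<le> measure lebesgue (\<Union>\<D>)"
        proof (rule measure_mono_fmeasurable)
          show "(\<Union>q\<in>p ` F. {fst q<..<snd q}) \<subseteq> \<Union>\<D>"
          proof
            fix t assume "t \<in> (\<Union>q\<in>p ` F. {fst q<..<snd q})"
            then obtain K where "K \<in> F" "t \<in> {fst (p K)<..<snd (p K)}" by auto
            then have "t \<in> {fst (p K)..snd (p K)}" by auto
            then have "t \<in> K" using p(1)[OF \<open>K \<in> F\<close>] by simp
            then show "t \<in> \<Union>\<D>" using \<open>K \<in> F\<close> F(2) by blast
          qed
          have "open (\<Union>q\<in>p ` F. {fst q<..<snd q})" by auto
          then show "(\<Union>q\<in>p ` F. {fst q<..<snd q}) \<in> sets lebesgue" by (simp add: borel_open)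
        qed (fact D)
        also have "\<dots> < d" using D(7) m0 \<open>d > 0\<close> by simp
        finally have "(\<Sum>(u,v)\<in>p ` F. G v - G u) \<le> e" using d(2) I by blast
        then have *: "(\<Sum>K\<in>F. G (snd (p K)) - G (fst (p K))) \<le> e"
          using inj by (simp add: sum.reindex case_prod_beta)
        have "emeasure \<mu> (\<Union>F) \<le> (\<Sum>K\<in>F. emeasure \<mu> K)"
        proof -
          have "K \<in> sets \<mu>" if "K \<in> F" for K
          proof -
            have "{fst (p K)..snd (p K)} \<in> sets \<mu>" by simp
            then show ?thesis using p(1)[OF that] by simp
          qed
          then have "(\<lambda>K. K) ` F \<subseteq> sets \<mu>" by auto
          from emeasure_subadditive_finite[OF F(1) this] show ?thesis by simp
        qed
        also have "\<dots> = (\<Sum>K\<in>F. ennreal (G (snd (p K)) - G (fst (p K))))"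
        proof (rule sum.cong)
          fix K assume "K \<in> F"
          then show "emeasure \<mu> K = ennreal (G (snd (p K)) - G (fst (p K)))"
            using p(1)[of K] p(2)[of K] mu_Icc[of "fst (p K)" "snd (p K)"] by auto
        qed simp
        also have "\<dots> = ennreal (\<Sum>K\<in>F. G (snd (p K)) - G (fst (p K)))"
        proof (rule sum_ennreal)
          fix K assume "K \<in> F"
          from p(2)[OF this] show "0 \<le> G (snd (p K)) - G (fst (p K))"
            using mono[of "fst (p K)" "snd (p K)"] by simp
        qed
        also have "\<dots> \<le> ennreal e" using * by (simp add: ennreal_leI)
        finally show ?thesis .
      qed
      show ?thesis
      proof (cases "\<D> = {}")
        case True
        then show ?thesis using D(5) by simp
      next
        case False
        \<comment> \<open>finite subfamilies have measure at most \<open>e\<close>; exhaust the countable cover by them\<close>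
        define A where "A n = \<Union>(from_nat_into \<D> ` {..n})" for n
        have Ab: "A n \<in> sets \<mu>" for n
          unfolding A_def
        proof (rule sets.finite_Union)
          show "from_nat_into \<D> ` {..n} \<subseteq> sets \<mu>"
          proof clarify
            fix i
            have "from_nat_into \<D> i \<in> \<D>" using False by (rule from_nat_into)
            then obtain u v where "from_nat_into \<D> i = {u..v}" using K by blast
            then show "from_nat_into \<D> i \<in> sets \<mu>" by simp
          qed
        qed simp
        have UA: "\<Union>\<D> = (\<Union>n. A n)"
        proof -
          have "\<Union>(range (from_nat_into \<D>)) = (\<Union>n. A n)" unfolding A_def by auto
          then show ?thesis using range_from_nat_into[OF False D(1)] by simp
        qed
        have "emeasure \<mu> (N \<inter> {a..b}) \<le> emeasure \<mu> (\<Union>n. A n)"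
          using D(5) UA Ab by (intro emeasure_mono) auto
        also have "\<dots> = (SUP n. emeasure \<mu> (A n))"
        proof (rule SUP_emeasure_incseq[symmetric])
          show "incseq A" unfolding incseq_def A_def by (intro allI impI Union_mono image_mono) auto
        qed (use Ab in auto)
        also have "\<dots> \<le> ennreal e"
        proof (rule SUP_least)
          fix n
          show "emeasure \<mu> (A n) \<le> ennreal e"
            unfolding A_def by (rule fin) (use False in \<open>auto intro: from_nat_into\<close>)
        qed
        finally show ?thesis .
      qed
    qed
    note small = this
    have "emeasure \<mu> (N \<inter> {a..b}) \<le> 0"
      by (rule ennreal_le_epsilon) (simp add: small)
    then show ?thesis by simp
  qed
  \<comment> \<open>restricting to \<open>[a,b]\<close> keeps the measure of Lebesgue null sets at zero\<close>
  define \<nu> where "\<nu> = density \<mu> (indicator {a..b})"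
  have nu: "emeasure \<nu> A = emeasure \<mu> (A \<inter> {a..b})" if "A \<in> sets borel" for A
  proof -
    have "emeasure \<nu> A = (\<integral>\<^sup>+t. indicator {a..b} t * indicator A t \<partial>\<mu>)"
      unfolding \<nu>_def using that by (simp add: emeasure_density)
    also have "\<dots> = (\<integral>\<^sup>+t. indicator (A \<inter> {a..b}) t \<partial>\<mu>)"
      by (intro nn_integral_cong) (auto simp: indicator_def)
    also have "\<dots> = emeasure \<mu> (A \<inter> {a..b})"
      using that by (intro nn_integral_indicator) simp
    finally show ?thesis .
  qed
  have ac_nu: "absolutely_continuous lborel \<nu>"
    unfolding absolutely_continuous_def
  proof
    fix N assume "N \<in> null_sets (lborel :: real measure)"
    then have "N \<in> sets borel" "emeasure \<nu> N = 0" using null[of N] nu[of N] by auto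
    then show "N \<in> null_sets \<nu>" by (simp add: null_sets_def \<nu>_def)
  qed
  have "sets \<nu> = sets lborel" by (simp add: \<nu>_def)
  then have "\<exists>f\<in>borel_measurable lborel. density lborel f = \<nu>"
    by (rule sigma_finite_measure.Radon_Nikodym[OF lborel.sigma_finite_measure_axioms ac_nu])
  then obtain f where f: "f \<in> borel_measurable lborel" "density lborel f = \<nu>"
    by (elim bexE)
  have f_int: "(\<integral>\<^sup>+t\<in>{a..x}. f t \<partial>lborel) = ennreal (G x - G a)" if "a \<le> x" "x \<le> b" for x
  proof -
    have "(\<integral>\<^sup>+t\<in>{a..x}. f t \<partial>lborel) = emeasure \<nu> {a..x}"
      unfolding f(2)[symmetric] using f(1) by (simp add: emeasure_density)
    also have "\<dots> = emeasure \<mu> {a..x}" using that by (simp add: nu inf.absorb1)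
    finally show ?thesis using mu_Icc[of a x] that by simp
  qed
  have "AE t in lborel. f t * indicator {a..b} t \<noteq> \<infinity>"
  proof (rule nn_integral_PInf_AE)
    show "(\<lambda>t. f t * indicator {a..b} t) \<in> borel_measurable lborel" using f(1) by measurable
    show "(\<integral>\<^sup>+t. f t * indicator {a..b} t \<partial>lborel) \<noteq> \<infinity>"
      using f_int[of b] ab by simp
  qed
  then have AE: "AE t in lborel. t \<in> {a..b} \<longrightarrow> f t \<noteq> \<infinity>"
    by eventually_elim (auto simp: indicator_def split: if_splits)
  define \<phi> where "\<phi> t = enn2real (f t)" for t
  have [measurable]: "\<phi> \<in> borel_measurable borel" using f(1) by (simp add: \<phi>_def[abs_def])
  have hi: "(\<phi> has_integral G x - G a) {a..x}" if x: "x \<in> {a..b}" for x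
  proof -
    have "((\<lambda>t. indicator {a..x} t * \<phi> t) has_integral G x - G a) UNIV"
    proof (rule nn_integral_has_integral)
      have "(\<integral>\<^sup>+t. ennreal (indicator {a..x} t * \<phi> t) \<partial>lborel) = (\<integral>\<^sup>+t\<in>{a..x}. f t \<partial>lborel)"
      proof (rule nn_integral_cong_AE)
        show "AE t in lborel. ennreal (indicator {a..x} t * \<phi> t) = f t * indicator {a..x} t"
          using AE
        proof eventually_elim
          case (elim t)
          show ?case
          proof (cases "t \<in> {a..x}")
            case True
            then have "f t < \<infinity>" using elim x by (simp add: less_top)
            then show ?thesis using True by (simp add: \<phi>_def ennreal_enn2real)
          qed simp
        qed
      qed
      then show "(\<integral>\<^sup>+t. ennreal (indicator {a..x} t * \<phi> t) \<partial>lborel) = ennreal (G x - G a)"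
        using f_int x by simp
    next
      show "(\<lambda>t. indicator {a..x} t * \<phi> t) \<in> borel_measurable borel" by measurable
      show "0 \<le> indicator {a..x} t * \<phi> t" for t by (simp add: \<phi>_def)
      show "0 \<le> G x - G a" using mono[of a x] x by simp
    qed
    also have "(\<lambda>t. indicator {a..x} t * \<phi> t) = (\<lambda>t. if t \<in> {a..x} then \<phi> t else 0)" by auto
    finally show ?thesis unfolding has_integral_restrict_UNIV .
  qed
  have "\<phi> absolutely_integrable_on {a..b}"
    by (rule nonnegative_absolutely_integrable_1) (use hi[of b] ab in \<open>auto simp: \<phi>_def\<close>)
  with hi show ?thesis by blast
qed

definition has_density :: "(real \<Rightarrow> 'a::euclidean_space) \<Rightarrow> real \<Rightarrow> real \<Rightarrow> bool" where
  "has_density F a b \<longleftrightarrow> (\<exists>\<phi>. \<phi> absolutely_integrable_on {a..b} \<and>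
     (\<forall>x\<in>{a..b}. (\<phi> has_integral F x - F a) {a..x}))"

text \<open>Jordan decomposition: with \<open>V\<close> the total variation from \<open>a\<close>, both \<open>V\<close> and \<open>V - F\<close> are increasing, and
  both inherit the modulus of absolute continuity of \<open>F\<close>.\<close>

lemma abs_cont_bounded_variation_has_density:
  fixes F :: "real \<Rightarrow> real"
  assumes ac: "abs_cont_on a b F" and ab: "a < b"
    and bd: "\<And>I. interval_family a b I \<Longrightarrow> variation_over F I \<le> B"
  shows "has_density F a b"
proof -
  define V where "V = total_variation F a"
  have inc: "norm (F v - F u) \<le> V v - V u" if "a \<le> u" "u \<le> v" "v \<le> b" for u v
  proof (cases "u = v")
    case False
    have "total_variation F a u + norm (F v - F u) \<le> total_variation F a v"
      by (rule total_variation_increment[of a b F B]) (use bd that False in auto)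
    then show ?thesis by (simp add: V_def)
  qed simp
  have ub: "V v - V u \<le> total_variation F u v" if "a \<le> u" "u \<le> v" "v \<le> b" for u v
  proof -
    have "total_variation F a v \<le> total_variation F a u + total_variation F u v"
      by (rule total_variation_subadd[of a b F B]) (use bd that in auto)
    then show ?thesis by (simp add: V_def)
  qed
  have small: "\<exists>d>0. \<forall>I. interval_family a b I \<longrightarrow> total_length I < d \<longrightarrow>
      (\<Sum>(u,v)\<in>I. G v - G u) \<le> e"
    if "e > 0" and G: "\<And>u v. a \<le> u \<Longrightarrow> u \<le> v \<Longrightarrow> v \<le> b \<Longrightarrow> G v - G u \<le> 2 * total_variation F u v"
    for e and G :: "real \<Rightarrow> real"
  proof -
    obtain d where d: "d > 0"
      "\<And>I. interval_family a b I \<Longrightarrow> total_length I < d \<Longrightarrow> variation_over F I < e/2"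
      using abs_cont_on_familyD[OF ac, of "e/2"] \<open>e > 0\<close> by auto
    show ?thesis
    proof (intro exI[of _ d] conjI allI impI)
      fix I assume I: "interval_family a b I" "total_length I < d"
      have "(\<Sum>(u,v)\<in>I. G v - G u) \<le> (\<Sum>(u,v)\<in>I. 2 * total_variation F u v)"
      proof (rule sum_mono)
        fix p assume "p \<in> I"
        obtain u v where [simp]: "p = (u,v)" by (cases p)
        have "a \<le> u" "u < v" "v \<le> b" using I \<open>p \<in> I\<close> by (auto simp: interval_family_def)
        then show "(case p of (u,v) \<Rightarrow> G v - G u) \<le> (case p of (u,v) \<Rightarrow> 2 * total_variation F u v)"
          using G[of u v] by simp
      qed
      also have "\<dots> = 2 * (\<Sum>(u,v)\<in>I. total_variation F u v)"
        by (simp add: sum_distrib_left case_prod_beta)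
      also have "\<dots> \<le> 2 * (e/2)"
      proof (rule mult_left_mono)
        show "(\<Sum>(u,v)\<in>I. total_variation F u v) \<le> e/2"
          by (rule sum_total_variation_le[of a b F B d "e/2"]) (use bd d(2) I in \<open>auto intro: less_imp_le\<close>)
      qed simp
      finally show "(\<Sum>(u,v)\<in>I. G v - G u) \<le> e" by simp
    qed fact
  qed
  have nn: "0 \<le> total_variation F u v" if "a \<le> u" "u \<le> v" "v \<le> b" for u v
    using inc[OF that] ub[OF that] norm_ge_zero[of "F v - F u"] by linarith
  have 1: "\<exists>\<phi>. \<phi> absolutely_integrable_on {a..b} \<and> (\<forall>x\<in>{a..b}. (\<phi> has_integral V x - V a) {a..x})"
  proof (rule mono_abs_cont_has_density[OF ab])
    show "V x \<le> V y" if "a \<le> x" "x \<le> y" "y \<le> b" for x y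
      using inc[OF that] norm_ge_zero[of "F y - F x"] by linarith
    show "\<exists>d>0. \<forall>I. interval_family a b I \<longrightarrow> total_length I < d \<longrightarrow> (\<Sum>(u,v)\<in>I. V v - V u) \<le> e"
      if "e > 0" for e
    proof (rule small[OF that])
      fix u v assume "a \<le> u" "u \<le> v" "v \<le> b"
      with ub[OF this] nn[OF this] show "V v - V u \<le> 2 * total_variation F u v" by linarith
    qed
  qed
  have 2: "\<exists>\<phi>. \<phi> absolutely_integrable_on {a..b} \<and>
      (\<forall>x\<in>{a..b}. (\<phi> has_integral (V x - F x) - (V a - F a)) {a..x})"
  proof (rule mono_abs_cont_has_density[OF ab])
    show "V x - F x \<le> V y - F y" if "a \<le> x" "x \<le> y" "y \<le> b" for x y
      using inc[OF that] by (simp add: abs_le_iff)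
    show "\<exists>d>0. \<forall>I. interval_family a b I \<longrightarrow> total_length I < d \<longrightarrow>
        (\<Sum>(u,v)\<in>I. (V v - F v) - (V u - F u)) \<le> e"
      if "e > 0" for e
    proof (rule small[OF that])
      fix u v assume *: "a \<le> u" "u \<le> v" "v \<le> b"
      show "(V v - F v) - (V u - F u) \<le> 2 * total_variation F u v"
        using ub[OF *] inc[OF *] unfolding real_norm_def by linarith
    qed
  qed
  from 1 obtain \<phi> where \<phi>: "\<phi> absolutely_integrable_on {a..b}"
    "\<And>x. x \<in> {a..b} \<Longrightarrow> (\<phi> has_integral V x - V a) {a..x}" by blast
  from 2 obtain \<psi> where \<psi>: "\<psi> absolutely_integrable_on {a..b}"
    "\<And>x. x \<in> {a..b} \<Longrightarrow> (\<psi> has_integral (V x - F x) - (V a - F a)) {a..x}" by blast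
  have "(\<lambda>x. \<phi> x - \<psi> x) absolutely_integrable_on {a..b}"
    using \<phi>(1) \<psi>(1) by (rule set_integral_diff)
  moreover have "((\<lambda>x. \<phi> x - \<psi> x) has_integral F x - F a) {a..x}" if "x \<in> {a..b}" for x
    using has_integral_diff[OF \<phi>(2)[OF that] \<psi>(2)[OF that]] by (simp add: algebra_simps)
  ultimately show ?thesis unfolding has_density_def by blast
qed

lemma has_density_trivial: "has_density F a a"
  unfolding has_density_def by (intro exI[of _ "\<lambda>_. 0"]) auto

lemma has_density_trans:
  assumes ab: "has_density F a b" "a \<le> b" and bc: "has_density F b c" "b \<le> c"
  shows "has_density F a c"
proof -
  obtain \<phi> where \<phi>: "\<phi> absolutely_integrable_on {a..b}"
    "\<And>x. x \<in> {a..b} \<Longrightarrow> (\<phi> has_integral F x - F a) {a..x}" using ab unfolding has_density_def by blast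
  obtain \<psi> where \<psi>: "\<psi> absolutely_integrable_on {b..c}"
    "\<And>x. x \<in> {b..c} \<Longrightarrow> (\<psi> has_integral F x - F b) {b..x}" using bc unfolding has_density_def by blast
  define \<theta> where "\<theta> x = (if x \<le> b then \<phi> x else \<psi> x)" for x
  have 1: "\<theta> absolutely_integrable_on {a..b}"
    by (rule absolutely_integrable_spike[OF \<phi>(1), of "{}"]) (auto simp: \<theta>_def)
  have 2: "\<theta> absolutely_integrable_on {b..c}"
    by (rule absolutely_integrable_spike[OF \<psi>(1), of "{b}"]) (auto simp: \<theta>_def)
  have "\<theta> absolutely_integrable_on {a..b} \<union> {b..c}"
    by (rule absolutely_integrable_Un[OF 1 2])
  then have 3: "\<theta> absolutely_integrable_on {a..c}"
    using ab(2) bc(2) by (simp add: ivl_disj_un_two_touch)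
  have h1: "(\<theta> has_integral F x - F a) {a..x}" if "x \<in> {a..b}" for x
    by (rule has_integral_spike[OF _ _ \<phi>(2)[OF that], of "{}"]) (use that in \<open>auto simp: \<theta>_def\<close>)
  have h2: "(\<theta> has_integral F x - F b) {b..x}" if "x \<in> {b..c}" for x
    by (rule has_integral_spike[OF _ _ \<psi>(2)[OF that], of "{b}"]) (use that in \<open>auto simp: \<theta>_def\<close>)
  have "(\<theta> has_integral F x - F a) {a..x}" if "x \<in> {a..c}" for x
  proof (cases "x \<le> b")
    case True
    then show ?thesis using h1 that by auto
  next
    case False
    then have "(\<theta> has_integral (F b - F a) + (F x - F b)) {a..x}"
      using ab(2) that by (intro has_integral_combine[OF _ _ h1 h2]) auto
    then show ?thesis by simp
  qed
  with 3 show ?thesis unfolding has_density_def by blast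
qed

text \<open>On intervals shorter than the \<open>\<delta>\<close> that belongs to \<open>\<epsilon> = 1\<close> the variation is at most \<open>1\<close>; finitely
  many such intervals are glued together by bisection.\<close>

lemma abs_cont_has_density_real:
  fixes F :: "real \<Rightarrow> real"
  assumes ac: "abs_cont_on a b F" and ab: "a \<le> b"
  shows "has_density F a b"
proof -
  obtain d where d: "d > 0"
    "\<And>I. interval_family a b I \<Longrightarrow> total_length I < d \<Longrightarrow> variation_over F I < 1"
    using abs_cont_on_familyD[OF ac, of 1] by auto
  have "a \<le> u \<Longrightarrow> v \<le> b \<Longrightarrow> u \<le> v \<Longrightarrow> has_density F u v" if "u \<le> v" for u v
    using that
  proof (induction u v rule: Bolzano)
    case (trans u v w)
    then show ?case
      using has_density_trans[of F u v w] by auto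
  next
    case (local x)
    show ?case
    proof (intro exI[of _ d] conjI allI impI)
      fix u v :: real assume uv: "u \<le> x \<and> x \<le> v \<and> v - u < d" "a \<le> u" "v \<le> b" "u \<le> v"
      show "has_density F u v"
      proof (cases "u = v")
        case True
        then show ?thesis by (simp add: has_density_trivial)
      next
        case False
        show ?thesis
        proof (rule abs_cont_bounded_variation_has_density[of u v F 1])
          show "abs_cont_on u v F" by (rule abs_cont_on_subset[OF ac]) (use uv in auto)
          fix I assume I: "interval_family u v I"
          have "total_length I < d" using total_length_le[OF I] uv by simp
          then show "variation_over F I \<le> 1"
            using d(2)[of I] interval_family_mono[OF I, of a b] uv by simp
        qed (use uv False in auto)
      qed
    qed (use d in auto)
  qed
  with ab show ?thesis by blast
qed

text \<open>Increments controlled by those of two absolutely continuous functions: the common source of the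
  closure properties below.\<close>

lemma abs_cont_on_dominated:
  assumes f: "abs_cont_on a b f" and h: "abs_cont_on a b h" and C: "C > 0"
    and le: "\<And>u v. a \<le> u \<Longrightarrow> u \<le> v \<Longrightarrow> v \<le> b \<Longrightarrow>
      norm (g v - g u) \<le> C * norm (f v - f u) + C * norm (h v - h u)"
  shows "abs_cont_on a b g"
  unfolding abs_cont_on_def
proof (intro allI impI)
  fix e :: real assume "e > 0"
  then have e': "e / (2*C) > 0" using C by simp
  let ?ok = "\<lambda>I. finite I \<and> (\<forall>(u,v)\<in>I. a \<le> u \<and> u \<le> v \<and> v \<le> b) \<and>
    pairwise (\<lambda>(u,v) (u',v'). {u<..<v} \<inter> {u'<..<v'} = {}) I"
  obtain d1 where d1: "d1 > 0" "\<And>I. ?ok I \<Longrightarrow> (\<Sum>(u,v)\<in>I. v - u) < d1 \<Longrightarrow>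
      (\<Sum>(u,v)\<in>I. norm (f v - f u)) < e / (2*C)"
    using f e' unfolding abs_cont_on_def by meson
  obtain d2 where d2: "d2 > 0" "\<And>I. ?ok I \<Longrightarrow> (\<Sum>(u,v)\<in>I. v - u) < d2 \<Longrightarrow>
      (\<Sum>(u,v)\<in>I. norm (h v - h u)) < e / (2*C)"
    using h e' unfolding abs_cont_on_def by meson
  have "(\<Sum>(u,v)\<in>I. norm (g v - g u)) < e"
    if I: "?ok I" "(\<Sum>(u,v)\<in>I. v - u) < min d1 d2" for I
  proof -
    have "(\<Sum>(u,v)\<in>I. norm (g v - g u)) \<le>
        (\<Sum>(u,v)\<in>I. C * norm (f v - f u) + C * norm (h v - h u))"
      by (rule sum_mono) (use I(1) le in auto)
    also have "\<dots> = C * (\<Sum>(u,v)\<in>I. norm (f v - f u)) + C * (\<Sum>(u,v)\<in>I. norm (h v - h u))"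
      by (simp add: sum.distrib sum_distrib_left case_prod_beta)
    also have "\<dots> < C * (e / (2*C)) + C * (e / (2*C))"
      using d1(2)[OF I(1)] d2(2)[OF I(1)] I(2) C by (intro add_strict_mono mult_strict_left_mono) auto
    also have "\<dots> = e" using C by (simp add: field_simps)
    finally show ?thesis .
  qed
  then show "\<exists>d>0. \<forall>I. finite I \<longrightarrow> (\<forall>(u,v)\<in>I. a \<le> u \<and> u \<le> v \<and> v \<le> b) \<longrightarrow>
      pairwise (\<lambda>(u,v) (u',v'). {u<..<v} \<inter> {u'<..<v'} = {}) I \<longrightarrow>
      (\<Sum>(u,v)\<in>I. v - u) < d \<longrightarrow> (\<Sum>(u,v)\<in>I. norm (g v - g u)) < e"
    using d1(1) d2(1) by (intro exI[of _ "min d1 d2"]) auto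
qed

lemma abs_cont_on_ident: "abs_cont_on a b (\<lambda>x::real. x)"
  unfolding abs_cont_on_def
proof (intro allI impI exI conjI)
  fix e :: real and I assume "e > 0" "\<forall>(u,v)\<in>I. a \<le> u \<and> u \<le> v \<and> v \<le> b" "(\<Sum>(u,v)\<in>I. v - u) < e"
  moreover have "(\<Sum>(u,v)\<in>I. norm (v - u)) = (\<Sum>(u,v)\<in>I. v - u)"
    using calculation(2) by (intro sum.cong) auto
  ultimately show "(\<Sum>(u,v)\<in>I. norm (v - u)) < e" by simp
qed

lemma abs_cont_on_lipschitz:
  assumes "\<And>u v. a \<le> u \<Longrightarrow> u \<le> v \<Longrightarrow> v \<le> b \<Longrightarrow> norm (g v - g u) \<le> C * (v - u)"
  shows "abs_cont_on a b g"
proof (rule abs_cont_on_dominated[OF abs_cont_on_ident abs_cont_on_ident, of "max C 1"])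
  fix u v assume uv: "a \<le> u" "u \<le> v" "v \<le> b"
  have "norm (g v - g u) \<le> C * (v - u)" using assms uv by blast
  also have "\<dots> \<le> max C 1 * (v - u)" using uv by (intro mult_right_mono) auto
  also have "\<dots> \<le> max C 1 * norm (v - u) + max C 1 * norm (v - u)" using uv by simp
  finally show "norm (g v - g u) \<le> max C 1 * norm (v - u) + max C 1 * norm (v - u)" .
qed simp

lemma abs_cont_on_add:
  assumes "abs_cont_on a b f" "abs_cont_on a b g"
  shows "abs_cont_on a b (\<lambda>x. f x + g x)"
proof (rule abs_cont_on_dominated[OF assms, of 1])
  fix u v :: real
  have "(f v + g v) - (f u + g u) = (f v - f u) + (g v - g u)" by simp
  then show "norm ((f v + g v) - (f u + g u)) \<le> 1 * norm (f v - f u) + 1 * norm (g v - g u)"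
    using norm_triangle_ineq[of "f v - f u" "g v - g u"] by (simp only: mult_1_left)
qed simp

lemma abs_cont_on_cnj: "abs_cont_on a b f \<Longrightarrow> abs_cont_on a b (\<lambda>x. cnj (f x))"
  by (rule abs_cont_on_dominated[of a b f f 1])
     (simp_all del: complex_cnj_diff add: complex_cnj_diff[symmetric])

lemma abs_cont_on_mult:
  fixes f g :: "real \<Rightarrow> 'a::real_normed_algebra"
  assumes f: "abs_cont_on a b f" and g: "abs_cont_on a b g"
  shows "abs_cont_on a b (\<lambda>x. f x * g x)"
proof -
  have "bounded (f ` {a..b})" "bounded (g ` {a..b})"
    using f g abs_cont_on_continuous by (auto intro!: compact_imp_bounded compact_continuous_image)
  then obtain B1 B2 where "\<forall>y\<in>f ` {a..b}. norm y \<le> B1" "\<forall>y\<in>g ` {a..b}. norm y \<le> B2"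
    unfolding bounded_iff by blast
  then have B1: "norm (f x) \<le> B1" and B2: "norm (g x) \<le> B2" if "x \<in> {a..b}" for x using that by auto
  define B where "B = max 1 (max B1 B2)"
  show ?thesis
  proof (rule abs_cont_on_dominated[OF f g, of B])
    fix u v assume uv: "a \<le> u" "u \<le> v" "v \<le> b"
    have Bf: "norm (f v) \<le> B" and Bg: "norm (g u) \<le> B" using B1[of v] B2[of u] uv by (auto simp: B_def)
    have "f v * g v - f u * g u = (f v - f u) * g u + f v * (g v - g u)" by (simp add: algebra_simps)
    then have "norm (f v * g v - f u * g u) \<le> norm ((f v - f u) * g u) + norm (f v * (g v - g u))"
      by (metis norm_triangle_ineq)
    also have "\<dots> \<le> norm (f v - f u) * norm (g u) + norm (f v) * norm (g v - g u)"
      by (intro add_mono norm_mult_ineq)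
    also have "\<dots> \<le> norm (f v - f u) * B + B * norm (g v - g u)"
      by (intro add_mono mult_mono Bf Bg) (auto simp: B_def)
    finally show "norm (f v * g v - f u * g u) \<le> B * norm (f v - f u) + B * norm (g v - g u)"
      by (simp add: mult.commute)
  qed (simp add: B_def)
qed

lemma abs_cont_on_const: "abs_cont_on a b (\<lambda>_. c)"
  by (rule abs_cont_on_lipschitz[of _ _ _ 0]) simp

lemma abs_cont_on_sum:
  "finite A \<Longrightarrow> (\<And>i. i \<in> A \<Longrightarrow> abs_cont_on a b (f i)) \<Longrightarrow> abs_cont_on a b (\<lambda>x. \<Sum>i\<in>A. f i x)"
  by (induction A rule: finite_induct) (auto intro: abs_cont_on_const abs_cont_on_add)

lemma abs_cont_on_cong:
  assumes "abs_cont_on a b f" "\<And>x. a \<le> x \<Longrightarrow> x \<le> b \<Longrightarrow> g x = f x"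
  shows "abs_cont_on a b g"
  by (rule abs_cont_on_dominated[OF assms(1,1), of 1]) (use assms(2) in auto)

lemma abs_cont_on_C1:
  fixes f :: "real \<Rightarrow> 'a::euclidean_space"
  assumes d: "\<And>x. a \<le> x \<Longrightarrow> x \<le> b \<Longrightarrow> (f has_vector_derivative f' x) (at x within {a..b})"
    and c: "continuous_on {a..b} f'"
  shows "abs_cont_on a b f"
proof -
  have "bounded (f' ` {a..b})" using c by (auto intro!: compact_imp_bounded compact_continuous_image)
  then obtain B where B: "\<And>x. x \<in> {a..b} \<Longrightarrow> norm (f' x) \<le> B" unfolding bounded_iff by blast
  show ?thesis
  proof (rule abs_cont_on_lipschitz[of _ _ _ B])
    fix u v assume uv: "a \<le> u" "u \<le> v" "v \<le> b"
    have "(f' has_integral f v - f u) {u..v}"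
    proof (rule fundamental_theorem_of_calculus[OF uv(2)])
      fix x assume "x \<in> {u..v}"
      then show "(f has_vector_derivative f' x) (at x within {u..v})"
        using d[of x] uv by (intro has_vector_derivative_within_subset[OF d]) auto
    qed
    then show "norm (f v - f u) \<le> B * (v - u)"
      using has_integral_bound[of B f' "f v - f u" u v] B uv order_trans[OF norm_ge_zero B[of u]]
      by simp
  qed
qed

lemma abs_cont_has_density:
  fixes F :: "real \<Rightarrow> 'a::euclidean_space"
  assumes ac: "abs_cont_on a b F" and ab: "a \<le> b"
  shows "has_density F a b"
proof -
  have "has_density (\<lambda>x. F x \<bullet> j) a b" if "j \<in> Basis" for j
  proof (rule abs_cont_has_density_real[OF _ ab])
    show "abs_cont_on a b (\<lambda>x. F x \<bullet> j)"
      using Basis_le_norm[OF that]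
      by (intro abs_cont_on_dominated[OF ac abs_cont_on_const[of _ _ "0::real"], of 1])
         (auto simp flip: inner_diff_left)
  qed
  then have "\<forall>j\<in>Basis. \<exists>\<phi>. \<phi> absolutely_integrable_on {a..b} \<and>
      (\<forall>x\<in>{a..b}. (\<phi> has_integral F x \<bullet> j - F a \<bullet> j) {a..x})"
    unfolding has_density_def by blast
  then obtain \<phi> where \<phi>: "\<And>j. j \<in> Basis \<Longrightarrow> \<phi> j absolutely_integrable_on {a..b}"
    "\<And>j x. j \<in> Basis \<Longrightarrow> x \<in> {a..b} \<Longrightarrow> (\<phi> j has_integral F x \<bullet> j - F a \<bullet> j) {a..x}" by metis
  define \<psi> where "\<psi> x = (\<Sum>j\<in>Basis. \<phi> j x *\<^sub>R j)" for x
  have \<psi>: "\<psi> x \<bullet> j = \<phi> j x" if "j \<in> Basis" for x j using that by (simp add: \<psi>_def)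
  show ?thesis
    unfolding has_density_def
  proof (intro exI[of _ \<psi>] conjI ballI)
    show "\<psi> absolutely_integrable_on {a..b}"
      by (rule absolutely_integrable_componentwise) (simp add: \<psi> \<phi>(1))
    fix x assume "x \<in> {a..b}"
    then show "(\<psi> has_integral F x - F a) {a..x}"
      by (subst has_integral_componentwise_iff) (auto simp: \<psi> inner_diff_left intro: \<phi>(2))
  qed
qed

text \<open>Lebesgue's differentiation theorem gives one-sided averages over \<open>[x,x+h]\<close>; applied to the function and
  to its reflection it yields the two-sided derivative.\<close>

lemma has_density_derivative:
  fixes F :: "real \<Rightarrow> 'a::euclidean_space"
  assumes "has_density F a b"
  obtains \<phi> N where "negligible N" "\<phi> absolutely_integrable_on {a..b}"
    "\<And>x. x \<in> {a..b} \<Longrightarrow> (\<phi> has_integral F x - F a) {a..x}"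
    "\<And>x. x \<in> {a<..<b} - N \<Longrightarrow> (F has_vector_derivative \<phi> x) (at x)"
proof -
  obtain \<phi> where \<phi>: "\<phi> absolutely_integrable_on {a..b}"
    "\<And>x. x \<in> {a..b} \<Longrightarrow> (\<phi> has_integral F x - F a) {a..x}"
    using assms unfolding has_density_def by blast
  define f where "f x = (if x \<in> {a..b} then \<phi> x else 0)" for x
  have "f absolutely_integrable_on UNIV"
    using \<phi>(1) absolutely_integrable_restrict_UNIV unfolding f_def by blast
  then have fint: "f integrable_on {u..v}" for u v
    using absolutely_integrable_on_def integrable_on_subinterval by (metis UNIV_I subsetI)
  have gint: "(\<lambda>x. f (- x)) integrable_on {u..v}" for u v
    using Henstock_Kurzweil_Integration.integrable_reflect_real[of f "-u" "-v"] fint by simp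
  obtain N1 where N1: "negligible N1" "\<And>x e. x \<notin> N1 \<Longrightarrow> 0 < e \<Longrightarrow>
      \<exists>d>0. \<forall>h. 0 < h \<and> h < d \<longrightarrow> norm (integral (cbox x (x + h *\<^sub>R One)) f /\<^sub>R h ^ DIM(real) - f x) < e"
    using integrable_ccontinuous_explicit[of f] fint by auto
  obtain N2 where N2: "negligible N2" "\<And>x e. x \<notin> N2 \<Longrightarrow> 0 < e \<Longrightarrow>
      \<exists>d>0. \<forall>h. 0 < h \<and> h < d \<longrightarrow> norm (integral (cbox x (x + h *\<^sub>R One)) (\<lambda>x. f (- x)) /\<^sub>R h ^ DIM(real) - f (- x)) < e"
    using integrable_ccontinuous_explicit[of "\<lambda>x. f (- x)"] gint by auto
  \<comment> \<open>\<open>N1\<close> handles difference quotients from the right, the reflected \<open>N2\<close> those from the left\<close>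
  define N where "N = N1 \<union> uminus ` N2"
  have "negligible (uminus ` N2)"
    by (rule negligible_differentiable_image_negligible[OF order_refl N2(1)])
       (auto intro!: derivative_intros differentiable_on_minus)
  then have N: "negligible N" using N1 by (simp add: N_def)
  have incr: "F v - F u = integral {u..v} f" if "a \<le> u" "u \<le> v" "v \<le> b" for u v
  proof -
    have "(\<phi> has_integral F v - F u) {u..v}"
    proof -
      have i: "\<phi> integrable_on {a..v}" using \<phi>(2)[of v] that by (auto simp: integrable_on_def)
      have "integral {a..u} \<phi> + integral {u..v} \<phi> = integral {a..v} \<phi>"
        using that by (intro Henstock_Kurzweil_Integration.integral_combine i) auto
      moreover have "integral {a..u} \<phi> = F u - F a" "integral {a..v} \<phi> = F v - F a"
        using \<phi>(2)[of u] \<phi>(2)[of v] that by auto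
      moreover have "\<phi> integrable_on {u..v}"
        by (rule integrable_on_subinterval[OF i]) (use that in auto)
      ultimately show ?thesis by (simp add: has_integral_iff algebra_simps)
    qed
    then have "(f has_integral F v - F u) {u..v}"
      by (rule has_integral_spike[of "{}", rotated 2]) (use that in \<open>auto simp: f_def\<close>)
    then show ?thesis by (simp add: has_integral_iff)
  qed
  have "(F has_vector_derivative \<phi> x) (at x)" if x: "x \<in> {a<..<b} - N" for x
    unfolding has_vector_derivative_def has_derivative_iff_norm
  proof (intro conjI bounded_linear_scaleR_left)
    have fx: "f x = \<phi> x" using x by (simp add: f_def)
    have x1: "x \<notin> N1" and x2: "- x \<notin> N2" using x by (auto simp: N_def image_iff)
    show "((\<lambda>y. norm ((F y - F x) - (y - x) *\<^sub>R \<phi> x) / norm (y - x)) \<longlongrightarrow> 0) (at x)"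
      unfolding LIM_eq
    proof (intro allI impI)
      fix e :: real assume "e > 0"
      obtain d1 where d1: "d1 > 0" "\<And>h. 0 < h \<Longrightarrow> h < d1 \<Longrightarrow> norm (integral {x..x+h} f /\<^sub>R h - \<phi> x) < e"
        using N1(2)[OF x1 \<open>e > 0\<close>] fx by auto
      obtain d2 where d2: "d2 > 0" "\<And>h. 0 < h \<Longrightarrow> h < d2 \<Longrightarrow> norm (integral {-x..-x+h} (\<lambda>x. f (-x)) /\<^sub>R h - \<phi> x) < e"
        using N2(2)[OF x2 \<open>e > 0\<close>] fx by auto
      define d where "d = min (min d1 d2) (min (x - a) (b - x))"
      have dd: "norm (I - h *\<^sub>R \<phi> x) / h < e" if "norm (I /\<^sub>R h - \<phi> x) < e" "h > 0" for I h
      proof -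
        have "I /\<^sub>R h - \<phi> x = (I - h *\<^sub>R \<phi> x) /\<^sub>R h" using that by (simp add: scaleR_diff_right)
        then show ?thesis using that by (simp add: divide_inverse mult.commute)
      qed
      have "norm (norm ((F y - F x) - (y - x) *\<^sub>R \<phi> x) / norm (y - x) - 0) < e"
        if y: "y \<noteq> x" "norm (y - x) < d" for y
      proof (cases "x < y")
        case True
        then have "F y - F x = integral {x..y} f" using x y by (intro incr) (auto simp: d_def)
        moreover have "norm (integral {x..x+(y-x)} f - (y-x) *\<^sub>R \<phi> x) / (y-x) < e"
          by (rule dd, rule d1(2)) (use True y in \<open>auto simp: d_def\<close>)
        ultimately show ?thesis using True by simp
      next
        case False
        then have yx: "y < x" using y by simp
        then have "F x - F y = integral {y..x} f" using x y by (intro incr) (auto simp: d_def)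
        moreover have "integral {-x..-y} (\<lambda>x. f (-x)) = integral {y..x} f"
          by (rule Henstock_Kurzweil_Integration.integral_reflect_real)
        moreover have "norm (integral {-x..-x+(x-y)} (\<lambda>x. f (-x)) - (x-y) *\<^sub>R \<phi> x) / (x-y) < e"
          by (rule dd, rule d2(2)) (use yx y in \<open>auto simp: d_def\<close>)
        ultimately have *: "norm ((F x - F y) - (x-y) *\<^sub>R \<phi> x) / (x-y) < e" by simp
        have "(F y - F x) - (y - x) *\<^sub>R \<phi> x = - ((F x - F y) - (x-y) *\<^sub>R \<phi> x)"
          by (simp add: scaleR_diff_left)
        then have "norm ((F y - F x) - (y - x) *\<^sub>R \<phi> x) = norm ((F x - F y) - (x-y) *\<^sub>R \<phi> x)"
          by (metis norm_minus_cancel)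
        then show ?thesis using * yx by simp
      qed
      moreover have "d > 0" using d1(1) d2(1) x by (simp add: d_def)
      ultimately show "\<exists>s>0. \<forall>y. y \<noteq> x \<and> norm (y - x) < s \<longrightarrow>
          norm (norm ((F y - F x) - (y - x) *\<^sub>R \<phi> x) / norm (y - x) - 0) < e" by blast
    qed
  qed
  with that[OF N \<phi>] show ?thesis by blast
qed

lemma abs_cont_differentiable_ae:
  fixes F :: "real \<Rightarrow> 'a::euclidean_space"
  assumes "abs_cont_on a b F"
  shows "\<exists>N. negligible N \<and> (\<forall>x\<in>{a<..<b} - N. F differentiable (at x))"
proof (cases "a \<le> b")
  case True
  from has_density_derivative[OF abs_cont_has_density[OF assms True]] show ?thesis
    by (metis differentiableI_vector)
qed (intro exI[of _ "{}"], auto)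

text \<open>The derivative agrees almost everywhere with the density.\<close>

lemma abs_cont_FTC:
  fixes F :: "real \<Rightarrow> 'a::euclidean_space"
  assumes ac: "abs_cont_on a b F" and ab: "a \<le> b" and N: "negligible N"
    and D: "\<And>x. x \<in> {a<..<b} - N \<Longrightarrow> (F has_vector_derivative D x) (at x)"
  shows "D absolutely_integrable_on {a..b}" "(D has_integral F b - F a) {a..b}"
proof -
  obtain \<phi> N' where \<phi>: "negligible N'" "\<phi> absolutely_integrable_on {a..b}"
    "\<And>x. x \<in> {a..b} \<Longrightarrow> (\<phi> has_integral F x - F a) {a..x}"
    "\<And>x. x \<in> {a<..<b} - N' \<Longrightarrow> (F has_vector_derivative \<phi> x) (at x)"
    using has_density_derivative[OF abs_cont_has_density[OF ac ab]] by metis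
  have neg: "negligible (N \<union> N' \<union> {a,b})" using N \<phi>(1) by auto
  have eq: "D x = \<phi> x" if "x \<in> {a..b} - (N \<union> N' \<union> {a,b})" for x
    using D[of x] \<phi>(4)[of x] that by (auto intro: vector_derivative_unique_at)
  show "D absolutely_integrable_on {a..b}"
    by (rule absolutely_integrable_spike[OF \<phi>(2) neg eq])
  show "(D has_integral F b - F a) {a..b}"
    by (rule has_integral_spike[OF neg eq \<phi>(3)[of b]]) (use ab in auto)
qed

section \<open>Differential operators with differentiable coefficients\<close>

text \<open>Unlike \<open>Ck_halfline\<close>, stated by recursion on the derivative and for complex functions, which is the form
  in which repeated use of the product rule consumes smoothness.\<close>

primrec Ck_coeff :: "nat \<Rightarrow> (real \<Rightarrow> complex) \<Rightarrow> bool" where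
  "Ck_coeff 0 a \<longleftrightarrow> continuous_on {0..} a"
| "Ck_coeff (Suc d) a \<longleftrightarrow>
     (\<exists>a'. (\<forall>x\<ge>0. (a has_vector_derivative a' x) (at x within {0..})) \<and> Ck_coeff d a')"

lemma Ck_coeff_const: "Ck_coeff d (\<lambda>_. c)"
  by (induction d arbitrary: c) (auto intro!: exI[of _ "\<lambda>_. 0"])

lemma Ck_coeff_add: "Ck_coeff d a \<Longrightarrow> Ck_coeff d b \<Longrightarrow> Ck_coeff d (\<lambda>x. a x + b x)"
proof (induction d arbitrary: a b)
  case 0
  then show ?case by (auto intro: continuous_on_add)
next
  case (Suc d)
  obtain a' where "\<forall>x\<ge>0. (a has_vector_derivative a' x) (at x within {0..})" "Ck_coeff d a'"
    using Suc.prems by auto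
  moreover obtain b' where "\<forall>x\<ge>0. (b has_vector_derivative b' x) (at x within {0..})" "Ck_coeff d b'"
    using Suc.prems by auto
  ultimately show ?case using Suc.IH[of a' b']
    by (auto intro!: exI[of _ "\<lambda>x. a' x + b' x"] has_vector_derivative_add)
qed

lemma Ck_coeff_cmult: "Ck_coeff d a \<Longrightarrow> Ck_coeff d (\<lambda>x. c * a x)"
proof (induction d arbitrary: a)
  case 0
  then show ?case by (auto intro: continuous_on_mult_left)
next
  case (Suc d)
  obtain a' where "\<forall>x\<ge>0. (a has_vector_derivative a' x) (at x within {0..})" "Ck_coeff d a'"
    using Suc.prems by auto
  then show ?case using Suc.IH[of a']
    by (auto intro!: exI[of _ "\<lambda>x. c * a' x"] has_vector_derivative_mult_right)
qed

lemma Ck_coeff_continuous: "Ck_coeff d a \<Longrightarrow> continuous_on {0..} a"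
proof (cases d)
  case (Suc e)
  assume "Ck_coeff d a"
  then obtain a' where "\<forall>x\<ge>0. (a has_vector_derivative a' x) (at x within {0..})"
    using Suc by auto
  then show ?thesis
    by (auto simp: continuous_on_eq_continuous_within intro: has_vector_derivative_continuous)
qed simp

lemma Ck_coeff_Suc: "Ck_coeff (Suc d) a \<Longrightarrow> Ck_coeff d a"
proof (induction d arbitrary: a)
  case 0
  then show ?case using Ck_coeff_continuous[of "Suc 0" a] by simp
next
  case (Suc d)
  then show ?case by (auto simp del: Ck_coeff.simps(2) simp: Ck_coeff.simps(2)[of "Suc d"] Ck_coeff.simps(2)[of d])
qed

lemma Ck_coeff_mono: "Ck_coeff d a \<Longrightarrow> e \<le> d \<Longrightarrow> Ck_coeff e a"
  by (induction d) (use Ck_coeff_Suc le_Suc_eq in \<open>auto simp del: Ck_coeff.simps(2)\<close>)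

lemma Ck_halfline_coeff: "Ck_halfline n f \<Longrightarrow> Ck_coeff n (\<lambda>x. complex_of_real (f x))"
proof (induction n arbitrary: f)
  case 0
  then show ?case by (auto simp: Ck_halfline_def intro: continuous_on_of_real)
next
  case (Suc n)
  have h: "hdiff (Suc n) {0..} f" "continuous_on {0..} ((hderiv ^^ Suc n) f)"
    using Suc.prems by (auto simp: Ck_halfline_def simp del: funpow.simps)
  have "(f has_vector_derivative hderiv f x) (at x within {0..})" if "x \<ge> 0" for x
    using hdiffD[OF h(1), of 0 x] that by simp
  then have "((\<lambda>x. complex_of_real (f x)) has_vector_derivative of_real (hderiv f x)) (at x within {0..})"
    if "x \<ge> 0" for x
    using that by (intro bounded_linear.has_vector_derivative[OF bounded_linear_of_real]) auto
  moreover have "Ck_halfline n (hderiv f)"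
    using h by (auto simp: Ck_halfline_def hdiff_Suc funpow_swap1)
  ultimately show ?case using Suc.IH[of "hderiv f"]
    unfolding Ck_coeff.simps by (intro exI[of _ "\<lambda>x. complex_of_real (hderiv f x)"]) auto
qed

lemma hderiv_eqI_pos:
  "(f has_vector_derivative f') (at x within {0..}) \<Longrightarrow> x > 0 \<Longrightarrow> hderiv f x = f'"
  by (rule hderiv_eqI) auto

text \<open>Derivatives at a point of \<open>(0,\<infinity>)\<close> depend only on the values in \<open>(0,\<infinity>)\<close>. This locality is needed
  because functions in the maximal domain are set to zero on \<open>(-\<infinity>,0]\<close> and need not be continuous at \<open>0\<close>.\<close>

lemma vd_cong_pos:
  assumes "\<And>t. t > 0 \<Longrightarrow> f t = g t" "x > 0"
  shows "(f has_vector_derivative d) (at x within {0..}) = (g has_vector_derivative d) (at x within {0..})"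
proof (rule has_vector_derivative_cong_ev)
  have "eventually (\<lambda>t. t \<in> {0<..}) (nhds x)" using assms(2) by (intro eventually_nhds_in_open) auto
  then show "\<forall>\<^sub>F t in nhds x. t \<in> {0..} \<longrightarrow> f t = g t" by eventually_elim (use assms in auto)
qed (use assms in auto)

lemma hderiv_cong_pos:
  assumes "\<And>t. t > 0 \<Longrightarrow> f t = g t" "x > 0"
  shows "hderiv f x = hderiv g x"
  unfolding hderiv_def vector_derivative_def using vd_cong_pos[OF assms] by simp

lemma funpow_hderiv_cong_pos:
  assumes "\<And>t. t > 0 \<Longrightarrow> f t = g t" "x > 0"
  shows "(hderiv ^^ n) f x = (hderiv ^^ n) g x"
  using assms(2)
proof (induction n arbitrary: x)
  case (Suc n)
  then show ?case using hderiv_cong_pos[of "(hderiv ^^ n) f" "(hderiv ^^ n) g"] by simp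
qed (use assms in auto)

lemma differentiable_cong_pos:
  fixes f g :: "real \<Rightarrow> 'a::real_normed_vector"
  assumes "\<And>t. t > 0 \<Longrightarrow> f t = g t" "x > 0"
  shows "f differentiable (at x within {0..}) \<longleftrightarrow> g differentiable (at x within {0..})"
proof -
  have "f differentiable (at x within {0..}) \<longleftrightarrow> (\<exists>d. (f has_vector_derivative d) (at x within {0..}))"
    for f :: "real \<Rightarrow> 'a"
    using differentiableI_vector hderiv_works by blast
  then show ?thesis using vd_cong_pos[of f g x] assms by simp
qed

lemma at_within_half_pos: "x > 0 \<Longrightarrow> at x within {0..} = at (x::real)"
  by (rule at_within_interior) (simp add: interior_real_atLeast)

lemma hdiff_singletonD:
  "hdiff n {x} f \<Longrightarrow> j < n \<Longrightarrow> ((hderiv ^^ j) f has_vector_derivative (hderiv ^^ Suc j) f x) (at x within {0..})"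
  by (simp add: hdiff_def hderiv_works[symmetric])

lemma hdiff_subset: "hdiff n S f \<Longrightarrow> T \<subseteq> S \<Longrightarrow> m \<le> n \<Longrightarrow> hdiff m T f"
  by (auto simp: hdiff_def)

lemma hdiff_cong_pos:
  assumes "\<And>t. t > 0 \<Longrightarrow> f t = g t" "S \<subseteq> {0<..}"
  shows "hdiff n S f \<longleftrightarrow> hdiff n S g"
  unfolding hdiff_def
proof (intro all_cong1 imp_cong refl ball_cong)
  fix j x assume "x \<in> S"
  then have "x > 0" using assms by auto
  then show "(hderiv ^^ j) f differentiable at x within {0..} \<longleftrightarrow> (hderiv ^^ j) g differentiable at x within {0..}"
    using funpow_hderiv_cong_pos[of f g] assms(1) by (intro differentiable_cong_pos) auto
qed

text \<open>\<open>T\<close> is a differential operator of order at most \<open>N\<close> with coefficients of class \<open>C\<^sup>d\<close>, the one of order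
  \<open>N\<close> being \<open>c\<close>. The expansion is required at each point where the derivative of order \<open>N\<close> exists, given
  lower derivatives everywhere: for absolutely continuous functions that is almost every point.\<close>

definition diff_op ::
  "nat \<Rightarrow> nat \<Rightarrow> (real \<Rightarrow> complex) \<Rightarrow> ((real \<Rightarrow> complex) \<Rightarrow> real \<Rightarrow> complex) \<Rightarrow> bool" where
  "diff_op N d c T \<longleftrightarrow> (\<exists>a. (\<forall>j\<le>N. Ck_coeff d (a j)) \<and> (\<forall>x\<ge>0. a N x = c x) \<and>
     (\<forall>f x. x > 0 \<longrightarrow> hdiff (N-1) {0<..} f \<longrightarrow> hdiff N {x} f \<longrightarrow>
        T f x = (\<Sum>j\<le>N. a j x * (hderiv ^^ j) f x)))"

lemma diff_op_multiple:
  assumes "Ck_coeff d p"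
  shows "diff_op r d p (\<lambda>f x. p x * (hderiv ^^ r) f x)"
  unfolding diff_op_def
proof (intro exI[of _ "\<lambda>j. if j = r then p else (\<lambda>_. 0)"] conjI allI impI)
  show "Ck_coeff d (if j = r then p else (\<lambda>_. 0))" for j
    using assms Ck_coeff_const by auto
  fix f :: "real \<Rightarrow> complex" and x
  have "(\<Sum>j\<le>r. (if j = r then p else (\<lambda>_. 0)) x * (hderiv ^^ j) f x)
      = (\<Sum>j\<le>r. if j = r then p x * (hderiv ^^ r) f x else 0)"
    by (intro sum.cong) auto
  then show "p x * (hderiv ^^ r) f x = (\<Sum>j\<le>r. (if j = r then p else (\<lambda>_. 0)) x * (hderiv ^^ j) f x)"
    by simp
qed auto

lemma diff_op_has_derivative:
  fixes a a' :: "nat \<Rightarrow> real \<Rightarrow> complex" and T :: "(real \<Rightarrow> complex) \<Rightarrow> real \<Rightarrow> complex"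
  assumes a: "\<And>j x. j \<le> N \<Longrightarrow> x \<ge> 0 \<Longrightarrow> (a j has_vector_derivative a' j x) (at x within {0..})"
    and T: "\<And>f x. x > 0 \<Longrightarrow> hdiff (N-1) {0<..} f \<Longrightarrow> hdiff N {x} f \<Longrightarrow>
        T f x = (\<Sum>j\<le>N. a j x * (hderiv ^^ j) f x)"
    and f: "hdiff N {0<..} f" "hdiff (Suc N) {x} f" and x: "x > 0"
  shows "(T f has_vector_derivative
    (\<Sum>j\<le>N. a j x * (hderiv ^^ Suc j) f x + a' j x * (hderiv ^^ j) f x)) (at x within {0..})"
proof -
  have eq: "T f t = (\<Sum>j\<le>N. a j t * (hderiv ^^ j) f t)" if "t > 0" for t
    using T that hdiff_subset[OF f(1)] by auto
  show ?thesis
  proof (rule iffD2[OF vd_cong_pos[OF eq x]])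
    show "((\<lambda>t. \<Sum>j\<le>N. a j t * (hderiv ^^ j) f t) has_vector_derivative
      (\<Sum>j\<le>N. a j x * (hderiv ^^ Suc j) f x + a' j x * (hderiv ^^ j) f x)) (at x within {0..})"
      using x f(2) by (intro has_vector_derivative_sum has_vector_derivative_mult[OF a hdiff_singletonD]) auto
  qed
qed

lemma diff_op_hderiv:
  assumes "diff_op N (Suc d) c T"
  shows "diff_op (Suc N) d c (\<lambda>f. hderiv (T f))"
proof -
  obtain a where a: "\<And>j. j \<le> N \<Longrightarrow> Ck_coeff (Suc d) (a j)" "\<And>x. x \<ge> 0 \<Longrightarrow> a N x = c x"
    "\<And>f x. x > 0 \<Longrightarrow> hdiff (N-1) {0<..} f \<Longrightarrow> hdiff N {x} f \<Longrightarrow>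
        T f x = (\<Sum>j\<le>N. a j x * (hderiv ^^ j) f x)"
    using assms unfolding diff_op_def by blast
  have "\<forall>j\<in>{..N}. \<exists>a'. (\<forall>x\<ge>0. (a j has_vector_derivative a' x) (at x within {0..})) \<and> Ck_coeff d a'"
    using a(1) by auto
  then obtain a' where a': "\<And>j x. j \<le> N \<Longrightarrow> x \<ge> 0 \<Longrightarrow> (a j has_vector_derivative a' j x) (at x within {0..})"
    "\<And>j. j \<le> N \<Longrightarrow> Ck_coeff d (a' j)" by (metis atMost_iff)
  define b where "b j x = (if j = 0 then 0 else a (j-1) x) + (if j \<le> N then a' j x else 0)" for j x
  show ?thesis
    unfolding diff_op_def
  proof (intro exI[of _ b] conjI allI impI)
    fix j assume "j \<le> Suc N"
    moreover have "Ck_coeff d (\<lambda>x. if j = 0 then 0 else a (j-1) x)"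
      using calculation a(1)[of "j-1"] Ck_coeff_Suc[of d "a (j-1)"] Ck_coeff_const
      by (cases j) (auto simp del: Ck_coeff.simps)
    moreover have "Ck_coeff d (\<lambda>x. if j \<le> N then a' j x else 0)"
      using a'(2)[of j] Ck_coeff_const by (cases "j \<le> N") auto
    ultimately show "Ck_coeff d (b j)" unfolding b_def[abs_def] by (intro Ck_coeff_add)
  next
    fix f :: "real \<Rightarrow> complex" and x :: real
    assume *: "x > 0" "hdiff (Suc N - 1) {0<..} f" "hdiff (Suc N) {x} f"
    have "hderiv (T f) x = (\<Sum>j\<le>N. a j x * (hderiv ^^ Suc j) f x + a' j x * (hderiv ^^ j) f x)"
      by (rule hderiv_eqI_pos[OF diff_op_has_derivative[OF a'(1) a(3)]]) (use * in simp_all)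
    also have "\<dots> = (\<Sum>j\<le>N. a j x * (hderiv ^^ Suc j) f x) + (\<Sum>j\<le>N. a' j x * (hderiv ^^ j) f x)"
      by (simp add: sum.distrib)
    also have "(\<Sum>j\<le>N. a j x * (hderiv ^^ Suc j) f x)
        = (\<Sum>j\<le>Suc N. (if j = 0 then 0 else a (j-1) x) * (hderiv ^^ j) f x)"
      by (subst sum.atMost_Suc_shift) simp
    also have "(\<Sum>j\<le>N. a' j x * (hderiv ^^ j) f x)
        = (\<Sum>j\<le>Suc N. (if j \<le> N then a' j x else 0) * (hderiv ^^ j) f x)"
      by simp
    finally show "hderiv (T f) x = (\<Sum>j\<le>Suc N. b j x * (hderiv ^^ j) f x)"
      by (simp add: b_def sum.distrib algebra_simps)
  qed (auto simp: b_def a(2))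
qed

text \<open>Each differentiation raises the order by one, consumes one degree of smoothness of the coefficients and
  keeps the leading one.\<close>

lemma diff_op_hderiv_funpow:
  assumes "Ck_coeff d p" "n + e \<le> d"
  shows "diff_op (r + n) e p (\<lambda>f. (hderiv ^^ n) (\<lambda>t. p t * (hderiv ^^ r) f t))"
  using assms(2)
proof (induction n arbitrary: e)
  case 0
  then show ?case using diff_op_multiple[OF Ck_coeff_mono[OF assms(1)], of e r] by simp
next
  case (Suc n)
  then have "diff_op (r + n) (Suc e) p (\<lambda>f. (hderiv ^^ n) (\<lambda>t. p t * (hderiv ^^ r) f t))" by auto
  from diff_op_hderiv[OF this] show ?case by simp
qed

lemma diff_op_differentiable:
  assumes "diff_op N (Suc d) c T" "hdiff N {0<..} f" "hdiff (Suc N) {x} f" "x > 0"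
  shows "T f differentiable (at x within {0..})"
proof -
  obtain a where a: "\<And>j. j \<le> N \<Longrightarrow> Ck_coeff (Suc d) (a j)" "\<And>x. x \<ge> 0 \<Longrightarrow> a N x = c x"
    "\<And>f x. x > 0 \<Longrightarrow> hdiff (N-1) {0<..} f \<Longrightarrow> hdiff N {x} f \<Longrightarrow>
        T f x = (\<Sum>j\<le>N. a j x * (hderiv ^^ j) f x)"
    using assms(1) unfolding diff_op_def by blast
  have "\<forall>j\<in>{..N}. \<exists>a'. (\<forall>x\<ge>0. (a j has_vector_derivative a' x) (at x within {0..})) \<and> Ck_coeff d a'"
    using a(1) by auto
  then obtain a' where a': "\<And>j x. j \<le> N \<Longrightarrow> x \<ge> 0 \<Longrightarrow> (a j has_vector_derivative a' j x) (at x within {0..})"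
    by (metis atMost_iff)
  show ?thesis
    by (rule differentiableI_vector[OF diff_op_has_derivative[OF a' a(3) assms(2-4)]])
qed

lemma diff_op_cong:
  assumes "diff_op N d c T" "\<And>x. x \<ge> 0 \<Longrightarrow> c x = c' x"
  shows "diff_op N d c' T"
proof -
  have "(\<forall>x\<ge>0. a N x = c x) \<longleftrightarrow> (\<forall>x\<ge>0. a N x = c' x)" for a :: "nat \<Rightarrow> real \<Rightarrow> complex"
    using assms(2) by auto
  with assms(1) show ?thesis unfolding diff_op_def by (simp only:)
qed

lemma diff_op_raise:
  assumes "diff_op N d c T" "N < N'"
  shows "diff_op N' d (\<lambda>_. 0) T"
proof -
  obtain a where a: "\<And>j. j \<le> N \<Longrightarrow> Ck_coeff d (a j)"
    "\<And>f x. x > 0 \<Longrightarrow> hdiff (N-1) {0<..} f \<Longrightarrow> hdiff N {x} f \<Longrightarrow>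
        T f x = (\<Sum>j\<le>N. a j x * (hderiv ^^ j) f x)"
    using assms(1) unfolding diff_op_def by blast
  show ?thesis
    unfolding diff_op_def
  proof (intro exI[of _ "\<lambda>j x. if j \<le> N then a j x else 0"] conjI allI impI)
    fix j
    show "Ck_coeff d (\<lambda>x. if j \<le> N then a j x else 0)"
      using a(1)[of j] Ck_coeff_const by (cases "j \<le> N") auto
  next
    fix f :: "real \<Rightarrow> complex" and x :: real
    assume *: "x > 0" "hdiff (N' - 1) {0<..} f" "hdiff N' {x} f"
    have "T f x = (\<Sum>j\<le>N. a j x * (hderiv ^^ j) f x)"
      by (rule a(2)) (use * assms(2) in \<open>auto intro: hdiff_mono\<close>)
    also have "\<dots> = (\<Sum>j\<le>N'. (if j \<le> N then a j x else 0) * (hderiv ^^ j) f x)"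
      using assms(2) by (intro sum.mono_neutral_cong_left) auto
    finally show "T f x = (\<Sum>j\<le>N'. (if j \<le> N then a j x else 0) * (hderiv ^^ j) f x)" .
  qed (use assms(2) in auto)
qed

lemma diff_op_le:
  assumes "diff_op N d c T" "N \<le> N'"
  shows "diff_op N' d (\<lambda>x. if N = N' then c x else 0) T"
  using assms diff_op_raise[OF assms(1), of N'] by (cases "N = N'") auto

lemma diff_op_add:
  assumes "diff_op N d c S" "diff_op N d c' T"
  shows "diff_op N d (\<lambda>x. c x + c' x) (\<lambda>f x. S f x + T f x)"
proof -
  obtain a where a: "\<And>j. j \<le> N \<Longrightarrow> Ck_coeff d (a j)" "\<And>x. x \<ge> 0 \<Longrightarrow> a N x = c x"
    "\<And>f x. x > 0 \<Longrightarrow> hdiff (N-1) {0<..} f \<Longrightarrow> hdiff N {x} f \<Longrightarrow>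
        S f x = (\<Sum>j\<le>N. a j x * (hderiv ^^ j) f x)"
    using assms(1) unfolding diff_op_def by blast
  obtain b where b: "\<And>j. j \<le> N \<Longrightarrow> Ck_coeff d (b j)" "\<And>x. x \<ge> 0 \<Longrightarrow> b N x = c' x"
    "\<And>f x. x > 0 \<Longrightarrow> hdiff (N-1) {0<..} f \<Longrightarrow> hdiff N {x} f \<Longrightarrow>
        T f x = (\<Sum>j\<le>N. b j x * (hderiv ^^ j) f x)"
    using assms(2) unfolding diff_op_def by blast
  show ?thesis unfolding diff_op_def
    by (intro exI[of _ "\<lambda>j x. a j x + b j x"])
       (auto simp: a b sum.distrib algebra_simps intro: Ck_coeff_add)
qed

lemma diff_op_cmult:
  assumes "diff_op N d c T"
  shows "diff_op N d (\<lambda>x. w * c x) (\<lambda>f x. w * T f x)"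
proof -
  obtain a where a: "\<And>j. j \<le> N \<Longrightarrow> Ck_coeff d (a j)" "\<And>x. x \<ge> 0 \<Longrightarrow> a N x = c x"
    "\<And>f x. x > 0 \<Longrightarrow> hdiff (N-1) {0<..} f \<Longrightarrow> hdiff N {x} f \<Longrightarrow>
        T f x = (\<Sum>j\<le>N. a j x * (hderiv ^^ j) f x)"
    using assms(1) unfolding diff_op_def by blast
  show ?thesis unfolding diff_op_def
    by (intro exI[of _ "\<lambda>j x. w * a j x"])
       (auto simp: a sum_distrib_left algebra_simps intro: Ck_coeff_cmult)
qed

lemma diff_op_zero: "diff_op N d (\<lambda>_. 0) (\<lambda>_ _. 0)"
  unfolding diff_op_def by (intro exI[of _ "\<lambda>_ _. 0"]) (auto intro: Ck_coeff_const)

lemma diff_op_sum: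
  assumes "finite I" "\<And>i. i \<in> I \<Longrightarrow> diff_op N d (c i) (T i)"
  shows "diff_op N d (\<lambda>x. \<Sum>i\<in>I. c i x) (\<lambda>f x. \<Sum>i\<in>I. T i f x)"
  using assms by (induction I rule: finite_induct) (auto intro: diff_op_zero diff_op_add)

lemma hdiff_coeff_mult:
  assumes p: "Ck_coeff d p" "n \<le> d" and f: "hdiff (r+n-1) {0<..} f" "hdiff (r+n) {x} f" and x: "x > 0"
  shows "hdiff n {x} (\<lambda>t. p t * (hderiv ^^ r) f t)"
  unfolding hdiff_def
proof (intro allI impI ballI)
  fix j y assume j: "j < n" "y \<in> {x}"
  have "diff_op (r + j) (Suc 0) p (\<lambda>f. (hderiv ^^ j) (\<lambda>t. p t * (hderiv ^^ r) f t))"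
    using j p by (intro diff_op_hderiv_funpow[OF p(1)]) auto
  then show "(hderiv ^^ j) (\<lambda>t. p t * (hderiv ^^ r) f t) differentiable at y within {0..}"
    using hdiff_mono[OF f(1), of "r+j"] hdiff_mono[OF f(2), of "Suc (r+j)"] j x
    by (intro diff_op_differentiable) auto
qed

text \<open>The alternating sum telescopes under the product rule. Only differentiability at the single point \<open>x\<close> is
  used, so the formula holds at almost every point for absolutely continuous functions.\<close>

lemma parts_term_deriv_at:
  assumes "hdiff n {x} u" "hdiff n {x} v"
  shows "(parts_term n u v has_vector_derivative
     (hderiv ^^ n) u x * cnj (v x) - (-1) ^ n * u x * cnj ((hderiv ^^ n) v x)) (at x within {0..})"
proof -
  define a where "a j = (-1) ^ j * (hderiv ^^ (n-j)) u x * cnj ((hderiv ^^ j) v x)" for j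
  have "((\<lambda>x. (-1) ^ j * (hderiv ^^ (n-1-j)) u x * cnj ((hderiv ^^ j) v x))
      has_vector_derivative (a j - a (Suc j))) (at x within {0..})" if "j < n" for j
  proof -
    have u: "((hderiv ^^ (n-1-j)) u has_vector_derivative (hderiv ^^ (n-j)) u x) (at x within {0..})"
      using hdiff_singletonD[OF assms(1), of "n-1-j"] that by (simp add: Suc_diff_Suc)
    have v: "((hderiv ^^ j) v has_vector_derivative (hderiv ^^ Suc j) v x) (at x within {0..})"
      using hdiff_singletonD[OF assms(2) that] by simp
    show ?thesis unfolding a_def
      by (rule has_vector_derivative_eq_rhs, rule has_vector_derivative_mult,
          rule has_vector_derivative_mult_right, rule u, rule has_vector_derivative_cnj, rule v)
         (simp add: algebra_simps)
  qed
  then have "((\<lambda>x. \<Sum>j<n. (-1) ^ j * (hderiv ^^ (n-1-j)) u x * cnj ((hderiv ^^ j) v x))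
      has_vector_derivative (\<Sum>j<n. a j - a (Suc j))) (at x within {0..})"
    by (intro has_vector_derivative_sum) auto
  moreover have "(\<Sum>j<n. a j - a (Suc j)) = a 0 - a n"
    by (rule sum_lessThan_telescope')
  ultimately show ?thesis
    unfolding parts_term_def[abs_def] by (simp add: a_def)
qed

section \<open>The symmetric expression and its boundary form\<close>

locale odd_expr =
  fixes k :: nat and s q :: "nat \<Rightarrow> real \<Rightarrow> real"
  assumes k2: "k \<ge> 2"
    and s_smooth: "\<And>r. r < k \<Longrightarrow> Ck_halfline r (s r)"
    and q_smooth: "\<And>r. r < k \<Longrightarrow> Ck_halfline (r+1) (q r)"
    and q_pos: "\<And>x. x \<ge> 0 \<Longrightarrow> q (k-1) x > 0"
begin

abbreviation M :: "(real \<Rightarrow> complex) \<Rightarrow> real \<Rightarrow> complex" where "M \<equiv> diff_expr k s q"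
abbreviation B :: "(real \<Rightarrow> complex) \<Rightarrow> (real \<Rightarrow> complex) \<Rightarrow> real \<Rightarrow> complex" where "B \<equiv> green_form k s q"

lemma s_coeff: "r < k \<Longrightarrow> Ck_coeff r (\<lambda>x. complex_of_real (s r x))"
  and q_coeff: "r < k \<Longrightarrow> Ck_coeff (r+1) (\<lambda>x. complex_of_real (q r x))"
  using s_smooth q_smooth by (auto intro!: Ck_halfline_coeff simp del: Ck_coeff.simps)

text \<open>Only the two terms with \<open>r = k-1\<close> in the odd part reach order \<open>2k-1\<close>, each with half the coefficient.\<close>

lemma diff_op_M: "diff_op (2*k-1) 0 (\<lambda>x. \<i> ^ (2*k-1) * of_real (q (k-1) x)) M"
proof -
  have 1: "diff_op (2*k-1) 0 (\<lambda>x. (-1) ^ r * (if r + r = 2*k-1 then of_real (s r x) else 0))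
      (\<lambda>f x. (-1) ^ r * (hderiv ^^ r) (\<lambda>t. of_real (s r t) * (hderiv ^^ r) f t) x)" if "r < k" for r
    using that by (intro diff_op_cmult diff_op_le diff_op_hderiv_funpow[OF s_coeff]) auto
  have 2: "diff_op (2*k-1) 0 (\<lambda>x. if r + (r+1) = 2*k-1 then of_real (q r x) else 0)
      (\<lambda>f. (hderiv ^^ (r+1)) (\<lambda>t. of_real (q r t) * (hderiv ^^ r) f t))" if "r < k" for r
    using that by (intro diff_op_le diff_op_hderiv_funpow[OF q_coeff]) auto
  have 3: "diff_op (2*k-1) 0 (\<lambda>x. if (r+1) + r = 2*k-1 then of_real (q r x) else 0)
      (\<lambda>f. (hderiv ^^ r) (\<lambda>t. of_real (q r t) * (hderiv ^^ (r+1)) f t))" if "r < k" for r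
    using that by (intro diff_op_le diff_op_hderiv_funpow[OF q_coeff]) auto
  have "diff_op (2*k-1) 0 (\<lambda>x. (\<Sum>r<k. (-1) ^ r * (if r + r = 2*k-1 then of_real (s r x) else 0))
      + 1/2 * (\<Sum>r<k. \<i> ^ (2*r+1) * ((if r + (r+1) = 2*k-1 then of_real (q r x) else 0)
          + (if (r+1) + r = 2*k-1 then of_real (q r x) else 0)))) M"
    unfolding diff_expr_def[abs_def]
    by (intro diff_op_add diff_op_cmult diff_op_sum 1 2 3) auto
  then show ?thesis
  proof (rule diff_op_cong)
    fix x :: real
    have "(\<Sum>r<k. (-1) ^ r * (if r + r = 2*k-1 then of_real (s r x) else 0)) = (0::complex)"
    proof (intro sum.neutral ballI)
      fix r
      have "r + r \<noteq> 2*k-1" using k2 by presburger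
      then show "(-1) ^ r * (if r + r = 2*k-1 then of_real (s r x) else 0) = (0::complex)" by simp
    qed
    moreover have "(\<Sum>r<k. \<i> ^ (2*r+1) * ((if r + (r+1) = 2*k-1 then of_real (q r x) else 0)
          + (if (r+1) + r = 2*k-1 then of_real (q r x) else 0)))
        = (\<Sum>r<k. if r = k-1 then \<i> ^ (2*k-1) * (2 * of_real (q (k-1) x)) else 0)"
    proof (intro sum.cong refl)
      fix r assume "r \<in> {..<k}"
      show "\<i> ^ (2*r+1) * ((if r + (r+1) = 2*k-1 then of_real (q r x) else 0)
          + (if (r+1) + r = 2*k-1 then of_real (q r x) else 0))
        = (if r = k-1 then \<i> ^ (2*k-1) * (2 * complex_of_real (q (k-1) x)) else 0)"
      proof (cases "r = k - 1")
        case True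
        then have "2*r+1 = 2*k-1" "r + (r+1) = 2*k-1" "(r+1) + r = 2*k-1" using k2 by auto
        then show ?thesis using True by (simp only:) simp
      next
        case False
        then have "r + (r+1) \<noteq> 2*k-1" "(r+1) + r \<noteq> 2*k-1" using k2 \<open>r \<in> {..<k}\<close> by auto
        then show ?thesis using False by simp
      qed
    qed
    ultimately show "(\<Sum>r<k. (-1) ^ r * (if r + r = 2*k-1 then of_real (s r x) else 0))
      + 1/2 * (\<Sum>r<k. \<i> ^ (2*r+1) * ((if r + (r+1) = 2*k-1 then of_real (q r x) else 0)
          + (if (r+1) + r = 2*k-1 then of_real (q r x) else 0))) = \<i> ^ (2*k-1) * complex_of_real (q (k-1) x)"
      using k2 by simp
  qed
qed

text \<open>The coefficient of \<open>cnj (g\<^sup>(\<^sup>b\<^sup>) x)\<close> in \<open>half_form k s q f g x\<close>.\<close>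

definition boundary_op :: "nat \<Rightarrow> (real \<Rightarrow> complex) \<Rightarrow> real \<Rightarrow> complex" where
  "boundary_op b f x =
     (\<Sum>r<k. (-1) ^ r * (if b < r then (-1) ^ b * (hderiv ^^ (r-1-b)) (\<lambda>t. of_real (s r t) * (hderiv ^^ r) f t) x else 0))
     + 1/2 * (\<Sum>r<k. \<i> ^ (2*r+1) *
         ((if b < r+1 then (-1) ^ b * (hderiv ^^ (r+1-1-b)) (\<lambda>t. of_real (q r t) * (hderiv ^^ r) f t) x else 0)
          + (if b < r then (-1) ^ b * (hderiv ^^ (r-1-b)) (\<lambda>t. of_real (q r t) * (hderiv ^^ (r+1)) f t) x else 0)))"

lemma half_form_boundary_op:
  "half_form k s q f g x = (\<Sum>b<k. boundary_op b f x * cnj ((hderiv ^^ b) g x))"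
proof -
  have pt: "parts_term n u g x = (\<Sum>b<k. (if b < n then (-1) ^ b * (hderiv ^^ (n-1-b)) u x else 0)
      * cnj ((hderiv ^^ b) g x))" if "n \<le> k" for n u
    unfolding parts_term_def using that by (intro sum.mono_neutral_cong_left) auto
  have 1: "(\<Sum>r<k. (-1) ^ r * parts_term r (\<lambda>t. of_real (s r t) * (hderiv ^^ r) f t) g x)
     = (\<Sum>b<k. (\<Sum>r<k. (-1) ^ r * (if b < r then (-1) ^ b * (hderiv ^^ (r-1-b)) (\<lambda>t. of_real (s r t) * (hderiv ^^ r) f t) x else 0))
          * cnj ((hderiv ^^ b) g x))"
    unfolding sum_distrib_right by (subst sum.swap, intro sum.cong refl) (simp add: pt sum_distrib_left mult.assoc)
  have 2: "(\<Sum>r<k. \<i> ^ (2*r+1) *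
         (parts_term (r+1) (\<lambda>t. of_real (q r t) * (hderiv ^^ r) f t) g x
          + parts_term r (\<lambda>t. of_real (q r t) * (hderiv ^^ (r+1)) f t) g x))
     = (\<Sum>b<k. (\<Sum>r<k. \<i> ^ (2*r+1) *
         ((if b < r+1 then (-1) ^ b * (hderiv ^^ (r+1-1-b)) (\<lambda>t. of_real (q r t) * (hderiv ^^ r) f t) x else 0)
          + (if b < r then (-1) ^ b * (hderiv ^^ (r-1-b)) (\<lambda>t. of_real (q r t) * (hderiv ^^ (r+1)) f t) x else 0)))
          * cnj ((hderiv ^^ b) g x))"
    unfolding sum_distrib_right
  proof (subst sum.swap, intro sum.cong refl)
    fix r assume "r \<in> {..<k}"
    then show "\<i> ^ (2*r+1) * (parts_term (r+1) (\<lambda>t. of_real (q r t) * (hderiv ^^ r) f t) g x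
          + parts_term r (\<lambda>t. of_real (q r t) * (hderiv ^^ (r+1)) f t) g x)
      = (\<Sum>b<k. \<i> ^ (2*r+1) *
         ((if b < r+1 then (-1) ^ b * (hderiv ^^ (r+1-1-b)) (\<lambda>t. of_real (q r t) * (hderiv ^^ r) f t) x else 0)
          + (if b < r then (-1) ^ b * (hderiv ^^ (r-1-b)) (\<lambda>t. of_real (q r t) * (hderiv ^^ (r+1)) f t) x else 0))
          * cnj ((hderiv ^^ b) g x))"
      using pt[of "r+1"] pt[of r]
      by (simp only: lessThan_iff Suc_eq_plus1[symmetric] Suc_le_eq less_imp_le distrib_right distrib_left sum.distrib
          sum_distrib_left mult.assoc)
  qed
  show ?thesis
    unfolding half_form_def 1 2 boundary_op_def
    by (simp only: distrib_right sum.distrib mult.assoc sum_distrib_left[of "1/2", symmetric])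
qed

text \<open>The coefficient of \<open>f\<^sup>(\<^sup>2\<^sup>k\<^sup>-\<^sup>2\<^sup>-\<^sup>b\<^sup>)\<close> in \<open>boundary_op b f\<close>: for \<open>b < k-1\<close> both odd terms with \<open>r = k-1\<close> contribute,
  for \<open>b = k-1\<close> only one of them does.\<close>

definition boundary_lead :: "nat \<Rightarrow> real \<Rightarrow> complex" where
  "boundary_lead b x = \<i> ^ (2*k-1) * (-1) ^ b * of_real (q (k-1) x) * (if b < k-1 then 1 else 1/2)"

lemma diff_op_boundary:
  assumes b: "b < k"
  shows "diff_op (2*k-2-b) 1 (boundary_lead b) (boundary_op b)"
proof -
  have 1: "diff_op (2*k-2-b) 1 (\<lambda>x. 0)
      (\<lambda>f x. (-1) ^ r * (if b < r then (-1) ^ b * (hderiv ^^ (r-1-b)) (\<lambda>t. of_real (s r t) * (hderiv ^^ r) f t) x else 0))"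
    if "r < k" for r
  proof (cases "b < r")
    case True
    have "diff_op (2*k-2-b) 1 (\<lambda>x. (-1) ^ r * ((-1) ^ b * (if r + (r-1-b) = 2*k-2-b then of_real (s r x) else 0)))
      (\<lambda>f x. (-1) ^ r * ((-1) ^ b * (hderiv ^^ (r-1-b)) (\<lambda>t. of_real (s r t) * (hderiv ^^ r) f t) x))"
      using that True by (intro diff_op_cmult diff_op_le diff_op_hderiv_funpow[OF s_coeff]) auto
    moreover have "r + (r-1-b) \<noteq> 2*k-2-b" using that True by auto
    ultimately show ?thesis using True by simp
  qed (simp add: diff_op_zero)
  have 2: "diff_op (2*k-2-b) 1 (\<lambda>x. if r = k-1 then (-1) ^ b * of_real (q (k-1) x) else 0)
      (\<lambda>f x. if b < r+1 then (-1) ^ b * (hderiv ^^ (r+1-1-b)) (\<lambda>t. of_real (q r t) * (hderiv ^^ r) f t) x else 0)"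
    if "r < k" for r
  proof (cases "b < r + 1")
    case True
    have "diff_op (2*k-2-b) 1 (\<lambda>x. (-1) ^ b * (if r + (r+1-1-b) = 2*k-2-b then of_real (q r x) else 0))
      (\<lambda>f x. (-1) ^ b * (hderiv ^^ (r+1-1-b)) (\<lambda>t. of_real (q r t) * (hderiv ^^ r) f t) x)"
      using that True by (intro diff_op_cmult diff_op_le diff_op_hderiv_funpow[OF q_coeff]) auto
    moreover have "r + (r+1-1-b) = 2*k-2-b \<longleftrightarrow> r = k-1" using that True b k2 by auto
    ultimately show ?thesis using True by (simp add: if_distrib cong: if_cong)
  next
    case False
    then have "r \<noteq> k-1" using b by auto
    with False show ?thesis by (simp add: diff_op_zero)
  qed
  have 3: "diff_op (2*k-2-b) 1 (\<lambda>x. if r = k-1 \<and> b < k-1 then (-1) ^ b * of_real (q (k-1) x) else 0)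
      (\<lambda>f x. if b < r then (-1) ^ b * (hderiv ^^ (r-1-b)) (\<lambda>t. of_real (q r t) * (hderiv ^^ (r+1)) f t) x else 0)"
    if "r < k" for r
  proof (cases "b < r")
    case True
    have "diff_op (2*k-2-b) 1 (\<lambda>x. (-1) ^ b * (if (r+1) + (r-1-b) = 2*k-2-b then of_real (q r x) else 0))
      (\<lambda>f x. (-1) ^ b * (hderiv ^^ (r-1-b)) (\<lambda>t. of_real (q r t) * (hderiv ^^ (r+1)) f t) x)"
      using that True by (intro diff_op_cmult diff_op_le diff_op_hderiv_funpow[OF q_coeff]) auto
    moreover have "(r+1) + (r-1-b) = 2*k-2-b \<longleftrightarrow> r = k-1 \<and> b < k-1" using that True b k2 by auto
    ultimately show ?thesis using True by (simp add: if_distrib cong: if_cong)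
  next
    case False
    then have e: "(r = k-1 \<and> b < k-1) = False" by auto
    have e': "(b < r) = False" using False by simp
    show ?thesis unfolding e e' if_False by (rule diff_op_zero)
  qed
  have "diff_op (2*k-2-b) 1 (\<lambda>x. (\<Sum>r<k. 0) + 1/2 * (\<Sum>r<k. \<i> ^ (2*r+1) *
      ((if r = k-1 then (-1) ^ b * of_real (q (k-1) x) else 0)
       + (if r = k-1 \<and> b < k-1 then (-1) ^ b * of_real (q (k-1) x) else 0)))) (boundary_op b)"
    unfolding boundary_op_def[abs_def]
    by (intro diff_op_add diff_op_cmult diff_op_sum 1 2 3) auto
  then show ?thesis
  proof (rule diff_op_cong)
    fix x :: real
    have "(\<Sum>r<k. \<i> ^ (2*r+1) * ((if r = k-1 then (-1) ^ b * complex_of_real (q (k-1) x) else 0)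
       + (if r = k-1 \<and> b < k-1 then (-1) ^ b * of_real (q (k-1) x) else 0)))
      = (\<Sum>r<k. if r = k-1 then \<i> ^ (2*k-1) * (-1) ^ b * of_real (q (k-1) x) * (if b < k-1 then 2 else 1) else 0)"
    proof (intro sum.cong refl)
      fix r
      show "\<i> ^ (2*r+1) * ((if r = k-1 then (-1) ^ b * complex_of_real (q (k-1) x) else 0)
       + (if r = k-1 \<and> b < k-1 then (-1) ^ b * of_real (q (k-1) x) else 0))
       = (if r = k-1 then \<i> ^ (2*k-1) * (-1) ^ b * of_real (q (k-1) x) * (if b < k-1 then 2 else 1) else 0)"
      proof (cases "r = k - 1")
        case True
        then have "2*r+1 = 2*k-1" using k2 by auto
        then show ?thesis using True by (simp only:) simp
      qed simp
    qed
    then show "(\<Sum>r<k. 0) + 1/2 * (\<Sum>r<k. \<i> ^ (2*r+1) *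
      ((if r = k-1 then (-1) ^ b * of_real (q (k-1) x) else 0)
       + (if r = k-1 \<and> b < k-1 then (-1) ^ b * of_real (q (k-1) x) else 0))) = boundary_lead b x"
      using k2 by (simp add: boundary_lead_def)
  qed
qed

text \<open>Expanding the boundary operators gives a triangular coefficient matrix for \<open>half_form\<close>; antisymmetrising
  it gives \<open>\<beta>\<close>. Away from the centre just one of the two halves meets the antidiagonal, and in the centre
  the two halves, each \<open>i q\<^sub>k\<^sub>-\<^sub>1 / 2\<close>, add up. The positive sign found there is what distinguishes \<open>N\<^sub>+\<close> from
  \<open>N\<^sub>-\<close>.\<close>

lemma boundary_matrix_exists:
  "\<exists>\<beta>. \<forall>x>0.
     (\<forall>f g. hdiff (2*k-2) {0<..} f \<longrightarrow> hdiff (2*k-2) {0<..} g \<longrightarrow>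
        B f g x = (\<Sum>a\<le>2*k-2. \<Sum>b\<le>2*k-2. \<beta> a b x * (hderiv ^^ a) f x * cnj ((hderiv ^^ b) g x))) \<and>
     (\<forall>a b. a + b > 2*k-2 \<longrightarrow> \<beta> a b x = 0) \<and>
     (\<forall>a b. a + b = 2*k-2 \<longrightarrow> \<beta> a b x \<noteq> 0) \<and>
     \<beta> (k-1) (k-1) x = \<i> * of_real (q (k-1) x)"
proof -
  have "\<forall>b\<in>{..<k}. \<exists>a. (\<forall>x\<ge>0. a (2*k-2-b) x = boundary_lead b x) \<and>
     (\<forall>f x. x > 0 \<longrightarrow> hdiff (2*k-2) {0<..} f \<longrightarrow>
        boundary_op b f x = (\<Sum>j\<le>2*k-2-b. a j x * (hderiv ^^ j) f x))"
  proof
    fix b assume "b \<in> {..<k}"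
    then obtain a where a: "\<And>x. x \<ge> 0 \<Longrightarrow> a (2*k-2-b) x = boundary_lead b x"
      "\<And>f x. x > 0 \<Longrightarrow> hdiff (2*k-2-b-1) {0<..} f \<Longrightarrow> hdiff (2*k-2-b) {x} f \<Longrightarrow>
        boundary_op b f x = (\<Sum>j\<le>2*k-2-b. a j x * (hderiv ^^ j) f x)"
      using diff_op_boundary[of b] unfolding diff_op_def by blast
    have "boundary_op b f x = (\<Sum>j\<le>2*k-2-b. a j x * (hderiv ^^ j) f x)"
      if "x > 0" "hdiff (2*k-2) {0<..} f" for f x
      by (rule a(2)) (use that in \<open>auto intro: hdiff_subset\<close>)
    with a(1) show "\<exists>a. (\<forall>x\<ge>0. a (2*k-2-b) x = boundary_lead b x) \<and>
     (\<forall>f x. x > 0 \<longrightarrow> hdiff (2*k-2) {0<..} f \<longrightarrow>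
        boundary_op b f x = (\<Sum>j\<le>2*k-2-b. a j x * (hderiv ^^ j) f x))" by blast
  qed
  from bchoice[OF this] obtain c where c0: "\<forall>b\<in>{..<k}. (\<forall>x\<ge>0. c b (2*k-2-b) x = boundary_lead b x) \<and>
     (\<forall>f x. x > 0 \<longrightarrow> hdiff (2*k-2) {0<..} f \<longrightarrow>
        boundary_op b f x = (\<Sum>j\<le>2*k-2-b. c b j x * (hderiv ^^ j) f x))" by (elim exE)
  have c: "\<And>b x. b < k \<Longrightarrow> x \<ge> 0 \<Longrightarrow> c b (2*k-2-b) x = boundary_lead b x"
    "\<And>b f x. b < k \<Longrightarrow> x > 0 \<Longrightarrow> hdiff (2*k-2) {0<..} f \<Longrightarrow>
        boundary_op b f x = (\<Sum>j\<le>2*k-2-b. c b j x * (hderiv ^^ j) f x)"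
    using c0 by blast+
  define t where "t b j x = (if b < k \<and> j \<le> 2*k-2-b then c b j x else 0)" for b j x
  have half: "half_form k s q f g x = (\<Sum>b\<le>2*k-2. \<Sum>a\<le>2*k-2. t b a x * (hderiv ^^ a) f x * cnj ((hderiv ^^ b) g x))"
    if "hdiff (2*k-2) {0<..} f" "x > 0" for f g x
  proof -
    have "half_form k s q f g x = (\<Sum>b<k. (\<Sum>a\<le>2*k-2. t b a x * (hderiv ^^ a) f x) * cnj ((hderiv ^^ b) g x))"
      unfolding half_form_boundary_op
    proof (intro sum.cong refl arg_cong2[where f = "(*)"])
      fix b assume b: "b \<in> {..<k}"
      then have "boundary_op b f x = (\<Sum>j\<le>2*k-2-b. c b j x * (hderiv ^^ j) f x)"
        using c(2) that by auto
      also have "\<dots> = (\<Sum>a\<le>2*k-2. t b a x * (hderiv ^^ a) f x)"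
        using b by (intro sum.mono_neutral_cong_left) (auto simp: t_def)
      finally show "boundary_op b f x = (\<Sum>a\<le>2*k-2. t b a x * (hderiv ^^ a) f x)" .
    qed
    also have "\<dots> = (\<Sum>b\<le>2*k-2. (\<Sum>a\<le>2*k-2. t b a x * (hderiv ^^ a) f x) * cnj ((hderiv ^^ b) g x))"
      using k2 by (intro sum.mono_neutral_left) (auto simp: t_def)
    finally show ?thesis by (simp add: sum_distrib_right)
  qed
  define \<beta> where "\<beta> a b x = t b a x - cnj (t a b x)" for a b x
  show ?thesis
  proof (intro exI[of _ \<beta>] allI impI conjI)
    fix x :: real assume x: "x > 0"
    show "B f g x = (\<Sum>a\<le>2*k-2. \<Sum>b\<le>2*k-2. \<beta> a b x * (hderiv ^^ a) f x * cnj ((hderiv ^^ b) g x))"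
      if "hdiff (2*k-2) {0<..} f" "hdiff (2*k-2) {0<..} g" for f g
    proof -
      have 1: "half_form k s q f g x = (\<Sum>a\<le>2*k-2. \<Sum>b\<le>2*k-2. t b a x * (hderiv ^^ a) f x * cnj ((hderiv ^^ b) g x))"
        unfolding half[OF that(1) x] by (rule sum.swap)
      have "cnj (half_form k s q g f x) = (\<Sum>a\<le>2*k-2. \<Sum>b\<le>2*k-2. cnj (t a b x) * (hderiv ^^ a) f x * cnj ((hderiv ^^ b) g x))"
        unfolding half[OF that(2) x] by (simp add: mult_ac)
      with 1 show ?thesis unfolding green_form_def \<beta>_def
        by (simp only: sum_subtractf[symmetric] left_diff_distrib)
    qed
    show "\<beta> a b x = 0" if "a + b > 2*k-2" for a b
      using that by (auto simp: \<beta>_def t_def)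
    have qp: "q (k-1) x > 0" using q_pos x by simp
    have i: "\<i> ^ (2*k-1) = \<i> * (-1) ^ (k-1)"
    proof -
      have "2*k-1 = Suc (2*(k-1))" using k2 by simp
      then show ?thesis by (simp add: power_mult)
    qed
    have pw: "(-1) ^ n * ((-1) ^ n * z) = (z::complex)" for n z
      by (simp flip: mult.assoc power_mult_distrib)
    show mid: "\<beta> (k-1) (k-1) x = \<i> * of_real (q (k-1) x)"
    proof -
      have e: "2*k-2-(k-1) = k-1" using k2 by simp
      have "boundary_lead (k-1) x = \<i> * of_real (q (k-1) x) / 2"
        unfolding boundary_lead_def i by (simp add: mult.assoc pw)
      then have tt: "t (k-1) (k-1) x = \<i> * of_real (q (k-1) x) / 2"
        using c(1)[of "k-1" x] x k2 e by (simp add: t_def)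
      show ?thesis unfolding \<beta>_def tt by simp
    qed
    show "\<beta> a b x \<noteq> 0" if ab: "a + b = 2*k-2" for a b
    proof -
      have lead: "t n (2*k-2-n) x = boundary_lead n x" if "n < k" for n
        using c(1)[OF that, of x] x that by (simp add: t_def)
      consider "b < k-1" | "b = k-1" | "b > k-1" by linarith
      then show ?thesis
      proof cases
        case 1
        then have "a = 2*k-2-b" "a \<ge> k" using ab by auto
        then have "\<beta> a b x = boundary_lead b x" using lead[of b] 1 by (simp add: \<beta>_def t_def)
        then show ?thesis using 1 qp by (simp add: boundary_lead_def i)
      next
        case 2
        then have "a = k-1" using ab by auto
        with 2 mid qp show ?thesis by simp
      next
        case 3
        then have "b = 2*k-2-a" "a < k-1" "b \<ge> k" using ab by auto
        then have "\<beta> a b x = - cnj (boundary_lead a x)" using lead[of a] by (simp add: \<beta>_def t_def)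
        then show ?thesis using \<open>a < k-1\<close> qp by (simp add: boundary_lead_def i)
      qed
    qed
  qed
qed

definition boundary_matrix :: "nat \<Rightarrow> nat \<Rightarrow> real \<Rightarrow> complex" where
  "boundary_matrix = (SOME \<beta>. \<forall>x>0.
     (\<forall>f g. hdiff (2*k-2) {0<..} f \<longrightarrow> hdiff (2*k-2) {0<..} g \<longrightarrow>
        B f g x = (\<Sum>a\<le>2*k-2. \<Sum>b\<le>2*k-2. \<beta> a b x * (hderiv ^^ a) f x * cnj ((hderiv ^^ b) g x))) \<and>
     (\<forall>a b. a + b > 2*k-2 \<longrightarrow> \<beta> a b x = 0) \<and>
     (\<forall>a b. a + b = 2*k-2 \<longrightarrow> \<beta> a b x \<noteq> 0) \<and>
     \<beta> (k-1) (k-1) x = \<i> * of_real (q (k-1) x))"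

lemma boundary_matrix:
  assumes "x > 0"
  shows "\<And>f g. hdiff (2*k-2) {0<..} f \<Longrightarrow> hdiff (2*k-2) {0<..} g \<Longrightarrow>
      B f g x = (\<Sum>a\<le>2*k-2. \<Sum>b\<le>2*k-2. boundary_matrix a b x * (hderiv ^^ a) f x * cnj ((hderiv ^^ b) g x))"
    and "\<And>a b. a + b > 2*k-2 \<Longrightarrow> boundary_matrix a b x = 0"
    and "\<And>a b. a + b = 2*k-2 \<Longrightarrow> boundary_matrix a b x \<noteq> 0"
    and "boundary_matrix (k-1) (k-1) x = \<i> * of_real (q (k-1) x)"
proof -
  let ?P = "\<lambda>\<beta> x. (\<forall>f g. hdiff (2*k-2) {0<..} f \<longrightarrow> hdiff (2*k-2) {0<..} g \<longrightarrow>
        B f g x = (\<Sum>a\<le>2*k-2. \<Sum>b\<le>2*k-2. \<beta> a b x * (hderiv ^^ a) f x * cnj ((hderiv ^^ b) g x))) \<and>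
     (\<forall>a b. a + b > 2*k-2 \<longrightarrow> \<beta> a b x = 0) \<and>
     (\<forall>a b. a + b = 2*k-2 \<longrightarrow> \<beta> a b x \<noteq> 0) \<and>
     \<beta> (k-1) (k-1) x = \<i> * of_real (q (k-1) x)"
  have "\<forall>x>0. ?P boundary_matrix x"
    unfolding boundary_matrix_def by (rule someI_ex[OF boundary_matrix_exists])
  then have P: "?P boundary_matrix x" using assms by simp
  show "\<And>f g. hdiff (2*k-2) {0<..} f \<Longrightarrow> hdiff (2*k-2) {0<..} g \<Longrightarrow>
      B f g x = (\<Sum>a\<le>2*k-2. \<Sum>b\<le>2*k-2. boundary_matrix a b x * (hderiv ^^ a) f x * cnj ((hderiv ^^ b) g x))"
    using conjunct1[OF P] by blast
  show "\<And>a b. a + b > 2*k-2 \<Longrightarrow> boundary_matrix a b x = 0"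
    using conjunct1[OF conjunct2[OF P]] by blast
  show "\<And>a b. a + b = 2*k-2 \<Longrightarrow> boundary_matrix a b x \<noteq> 0"
    using conjunct1[OF conjunct2[OF conjunct2[OF P]]] by blast
  show "boundary_matrix (k-1) (k-1) x = \<i> * of_real (q (k-1) x)"
    by (rule conjunct2[OF conjunct2[OF conjunct2[OF P]]])
qed

text \<open>A triangular matrix with nonzero antidiagonal is invertible: solve for the entries of \<open>c\<close> in increasing
  order, testing \<open>c a\<close> against the column \<open>b = 2k-2-a\<close>.\<close>

lemma boundary_form_nondegenerate:
  assumes x: "x > 0"
    and zero: "\<And>b. b \<le> 2*k-2 \<Longrightarrow> (\<Sum>a\<le>2*k-2. boundary_matrix a b x * c a) = 0"
    and a: "a \<le> 2*k-2"
  shows "c a = 0"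
  using a
proof (induction a rule: less_induct)
  case (less a)
  define b where "b = 2*k-2-a"
  have "(\<Sum>a'\<le>2*k-2. boundary_matrix a' b x * c a') = boundary_matrix a b x * c a"
  proof (subst sum.remove[of _ a])
    have "boundary_matrix a' b x * c a' = 0" if "a' \<in> {..2*k-2} - {a}" for a'
    proof (cases "a' < a")
      case True
      then show ?thesis using less that by auto
    next
      case False
      then have "a' + b > 2*k-2" using that less.prems by (auto simp: b_def)
      then show ?thesis using boundary_matrix(2)[OF x] by simp
    qed
    then show "boundary_matrix a b x * c a + (\<Sum>a'\<in>{..2*k-2} - {a}. boundary_matrix a' b x * c a')
        = boundary_matrix a b x * c a" by (simp add: sum.neutral)
  qed (use less in auto)
  then have "boundary_matrix a b x * c a = 0" using zero[of b] by (simp add: b_def)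
  moreover have "boundary_matrix a b x \<noteq> 0"
    using boundary_matrix(3)[OF x, of a b] less.prems by (simp add: b_def)
  ultimately show ?case by simp
qed

text \<open>What \<open>half_form\<close> leaves besides \<open>cnj g \<cdot> M f\<close> is Hermitian in \<open>(f,g)\<close>, hence cancels in \<open>green_form\<close>.\<close>

lemma half_form_deriv_at:
  assumes f: "hdiff (2*k-2) {0<..} f" "hdiff (2*k-1) {t} f"
    and g: "hdiff (2*k-2) {0<..} g" "hdiff (2*k-1) {t} g" and t: "t > 0"
  shows "(half_form k s q f g has_vector_derivative
      (cnj (g t) * M f t -
       ((\<Sum>r<k. of_real (s r t) * (hderiv ^^ r) f t * cnj ((hderiv ^^ r) g t))
     + \<i>/2 * (\<Sum>r<k. of_real (q r t) * ((hderiv ^^ (r+1)) f t * cnj ((hderiv ^^ r) g t)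
         - (hderiv ^^ r) f t * cnj ((hderiv ^^ (r+1)) g t)))))) (at t within {0..})"
proof -
  have pw: "(-1) ^ r * ((-1) ^ r * z) = (z::complex)" for r z
    by (simp flip: mult.assoc power_mult_distrib)
  have ipw: "\<i> ^ (2*r+1) = \<i> * (-1) ^ r" for r
    by (simp add: power_mult)
  let ?u = "\<lambda>r t. of_real (s r t) * (hderiv ^^ r) f t"
  let ?v = "\<lambda>r t. of_real (q r t) * (hderiv ^^ r) f t"
  let ?w = "\<lambda>r t. of_real (q r t) * (hderiv ^^ (r+1)) f t"
  have 1: "(parts_term r (?u r) g has_vector_derivative
      (hderiv ^^ r) (?u r) t * cnj (g t)
      - (-1) ^ r * ?u r t * cnj ((hderiv ^^ r) g t)) (at t within {0..})"
    if "r < k" for r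
  proof (rule parts_term_deriv_at)
    show "hdiff r {t} (?u r)"
      by (rule hdiff_coeff_mult[OF s_coeff[OF that]]) (use that f t in \<open>auto intro: hdiff_mono\<close>)
    show "hdiff r {t} g" by (rule hdiff_mono[OF g(2)]) (use that in auto)
  qed
  have 2: "(parts_term (r+1) (?v r) g has_vector_derivative
      (hderiv ^^ (r+1)) (?v r) t * cnj (g t)
      - (-1) ^ (r+1) * ?v r t * cnj ((hderiv ^^ (r+1)) g t)) (at t within {0..})"
    if "r < k" for r
  proof (rule parts_term_deriv_at)
    show "hdiff (r+1) {t} (?v r)"
      by (rule hdiff_coeff_mult[OF q_coeff[OF that]]) (use that f t in \<open>auto intro: hdiff_mono\<close>)
    show "hdiff (r+1) {t} g" by (rule hdiff_mono[OF g(2)]) (use that in auto)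
  qed
  have 3: "(parts_term r (?w r) g has_vector_derivative
      (hderiv ^^ r) (?w r) t * cnj (g t)
      - (-1) ^ r * ?w r t * cnj ((hderiv ^^ r) g t)) (at t within {0..})"
    if "r < k" for r
  proof (rule parts_term_deriv_at)
    show "hdiff r {t} (?w r)"
      by (rule hdiff_coeff_mult[OF q_coeff[OF that]]) (use that f t in \<open>auto intro: hdiff_mono\<close>)
    show "hdiff r {t} g" by (rule hdiff_mono[OF g(2)]) (use that in auto)
  qed
  show ?thesis
    unfolding half_form_def[abs_def]
  proof (rule has_vector_derivative_eq_rhs[OF has_vector_derivative_add[OF
        has_vector_derivative_sum[OF has_vector_derivative_mult_right[OF 1]]
        has_vector_derivative_mult_right[OF has_vector_derivative_sum[OF
          has_vector_derivative_mult_right[OF has_vector_derivative_add[OF 2 3]]]]]])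
    have A: "(\<Sum>r<k. (-1) ^ r * ((hderiv ^^ r) (?u r) t * cnj (g t)
          - (-1) ^ r * ?u r t * cnj ((hderiv ^^ r) g t)))
        = cnj (g t) * (\<Sum>r<k. (-1) ^ r * (hderiv ^^ r) (?u r) t)
          - (\<Sum>r<k. ?u r t * cnj ((hderiv ^^ r) g t))"
      unfolding sum_distrib_left sum_subtractf[symmetric]
      by (rule sum.cong) (simp_all add: algebra_simps pw)
    have C: "(\<Sum>r<k. \<i> ^ (2*r+1) * (((hderiv ^^ (r+1)) (?v r) t * cnj (g t)
            - (-1) ^ (r+1) * ?v r t * cnj ((hderiv ^^ (r+1)) g t))
          + ((hderiv ^^ r) (?w r) t * cnj (g t) - (-1) ^ r * ?w r t * cnj ((hderiv ^^ r) g t))))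
        = cnj (g t) * (\<Sum>r<k. \<i> ^ (2*r+1) * ((hderiv ^^ (r+1)) (?v r) t + (hderiv ^^ r) (?w r) t))
          - \<i> * (\<Sum>r<k. of_real (q r t) * ((hderiv ^^ (r+1)) f t * cnj ((hderiv ^^ r) g t)
             - (hderiv ^^ r) f t * cnj ((hderiv ^^ (r+1)) g t)))"
      unfolding sum_distrib_left sum_subtractf[symmetric] ipw
      by (rule sum.cong) (simp_all add: algebra_simps pw)
    show "(\<Sum>r<k. (-1) ^ r * ((hderiv ^^ r) (?u r) t * cnj (g t)
          - (-1) ^ r * ?u r t * cnj ((hderiv ^^ r) g t)))
        + 1/2 * (\<Sum>r<k. \<i> ^ (2*r+1) * (((hderiv ^^ (r+1)) (?v r) t * cnj (g t)
            - (-1) ^ (r+1) * ?v r t * cnj ((hderiv ^^ (r+1)) g t))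
          + ((hderiv ^^ r) (?w r) t * cnj (g t) - (-1) ^ r * ?w r t * cnj ((hderiv ^^ r) g t))))
        = cnj (g t) * M f t -
       ((\<Sum>r<k. of_real (s r t) * (hderiv ^^ r) f t * cnj ((hderiv ^^ r) g t))
     + \<i>/2 * (\<Sum>r<k. of_real (q r t) * ((hderiv ^^ (r+1)) f t * cnj ((hderiv ^^ r) g t)
         - (hderiv ^^ r) f t * cnj ((hderiv ^^ (r+1)) g t))))"
      unfolding A C diff_expr_def by (simp only: algebra_simps) simp
  qed simp_all
qed

lemma green_form_deriv_at:
  assumes f: "hdiff (2*k-2) {0<..} f" "hdiff (2*k-1) {t} f"
    and g: "hdiff (2*k-2) {0<..} g" "hdiff (2*k-1) {t} g" and t: "t > 0"
  shows "(B f g has_vector_derivative cnj (g t) * M f t - f t * cnj (M g t)) (at t)"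
proof -
  have "(B f g has_vector_derivative cnj (g t) * M f t - f t * cnj (M g t)) (at t within {0..})"
    unfolding green_form_def[abs_def]
    by (rule has_vector_derivative_eq_rhs[OF has_vector_derivative_diff[OF
          half_form_deriv_at[OF f g t] has_vector_derivative_cnj[OF half_form_deriv_at[OF g f t]]]])
       (simp add: algebra_simps sum_subtractf sum_negf sum_distrib_left)
  then show ?thesis using at_within_half_pos[OF t] by simp
qed

end

section \<open>Linear differential equations with continuous coefficients\<close>

lemma at_within_Icc_half: "0 \<le> x \<Longrightarrow> x < R \<Longrightarrow> at x within {0..R} = at (x::real) within {0..}"
  by (rule at_within_nhd[of x "{..<R}"]) auto

definition antiderivative :: "real \<Rightarrow> (real \<Rightarrow> complex) \<Rightarrow> real \<Rightarrow> complex" where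
  "antiderivative x0 F x = integral {0..x} F - integral {0..x0} F"

lemma antiderivative_deriv:
  assumes "continuous_on {0..} F" "x \<ge> 0"
  shows "(antiderivative x0 F has_vector_derivative F x) (at x within {0..})"
proof -
  have "((\<lambda>u. integral {0..u} F) has_vector_derivative F x) (at x within {0..x+1})"
    using assms by (intro integral_has_vector_derivative continuous_on_subset[OF assms(1)]) auto
  then have "((\<lambda>u. integral {0..u} F) has_vector_derivative F x) (at x within {0..})"
    using at_within_Icc_half[of x "x+1"] assms by simp
  then show ?thesis
    unfolding antiderivative_def[abs_def]
    using has_vector_derivative_diff[OF _ has_vector_derivative_const] by fastforce
qed

text \<open>The power of the distance to \<open>x0\<close> improves with each integration, which produces the factorials that
  make the Picard series converge.\<close>

lemma antiderivative_bound:
  assumes F: "continuous_on {0..} F" and x0: "0 \<le> x0" "x0 \<le> R" and x: "0 \<le> x" "x \<le> R"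
    and bd: "\<And>t. 0 \<le> t \<Longrightarrow> t \<le> R \<Longrightarrow> norm (F t) \<le> C * \<bar>t - x0\<bar> ^ n"
  shows "norm (antiderivative x0 F x) \<le> C * \<bar>x - x0\<bar> ^ Suc n / real (Suc n)"
proof -
  have int: "F integrable_on {u..v}" if "0 \<le> u" for u v
    using that by (intro integrable_continuous_interval continuous_on_subset[OF F]) auto
  show ?thesis
  proof (cases "x0 \<le> x")
    case True
    have "integral {0..x0} F + integral {x0..x} F = integral {0..x} F"
      using True x0 by (intro Henstock_Kurzweil_Integration.integral_combine int) auto
    then have eq: "antiderivative x0 F x = integral {x0..x} F" by (simp add: antiderivative_def algebra_simps)
    have "((\<lambda>t. C * (t - x0) ^ n) has_integral
        C * (x - x0) ^ Suc n / real (Suc n) - C * (x0 - x0) ^ Suc n / real (Suc n)) {x0..x}"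
    proof (rule fundamental_theorem_of_calculus[OF True])
      fix t
      show "((\<lambda>t. C * (t - x0) ^ Suc n / real (Suc n)) has_vector_derivative C * (t - x0) ^ n) (at t within {x0..x})"
        unfolding has_real_derivative_iff_has_vector_derivative[symmetric]
        by (rule derivative_eq_intros refl | simp add: field_simps del: of_nat_Suc)+
    qed
    then have hi: "((\<lambda>t. C * (t - x0) ^ n) has_integral C * (x - x0) ^ Suc n / real (Suc n)) {x0..x}"
      by simp
    have "norm (integral {x0..x} F) \<le> integral {x0..x} (\<lambda>t. C * (t - x0) ^ n)"
    proof (rule integral_norm_bound_integral)
      show "F integrable_on {x0..x}" using int x0 by simp
      show "(\<lambda>t. C * (t - x0) ^ n) integrable_on {x0..x}" using hi by (auto simp: integrable_on_def)
      show "norm (F t) \<le> C * (t - x0) ^ n" if "t \<in> {x0..x}" for t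
        using bd[of t] that x0 x by auto
    qed
    also have "\<dots> = C * (x - x0) ^ Suc n / real (Suc n)" by (rule integral_unique[OF hi])
    finally have "norm (integral {x0..x} F) \<le> C * (x - x0) ^ Suc n / real (Suc n)" .
    moreover have "\<bar>x - x0\<bar> = x - x0" using True by simp
    ultimately show ?thesis unfolding eq by (simp only:)
  next
    case False
    then have le: "x \<le> x0" by simp
    have "integral {0..x} F + integral {x..x0} F = integral {0..x0} F"
      using le x by (intro Henstock_Kurzweil_Integration.integral_combine int) auto
    then have eq: "antiderivative x0 F x = - integral {x..x0} F" by (simp add: antiderivative_def algebra_simps)
    have "((\<lambda>t. C * (x0 - t) ^ n) has_integral
        (- (C * (x0 - x0) ^ Suc n / real (Suc n))) - (- (C * (x0 - x) ^ Suc n / real (Suc n)))) {x..x0}"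
    proof (rule fundamental_theorem_of_calculus[OF le])
      fix t
      show "((\<lambda>t. - (C * (x0 - t) ^ Suc n / real (Suc n))) has_vector_derivative C * (x0 - t) ^ n) (at t within {x..x0})"
        unfolding has_real_derivative_iff_has_vector_derivative[symmetric]
        by (rule derivative_eq_intros refl | simp add: field_simps del: of_nat_Suc)+
    qed
    then have hi: "((\<lambda>t. C * (x0 - t) ^ n) has_integral C * (x0 - x) ^ Suc n / real (Suc n)) {x..x0}"
      by simp
    have "norm (integral {x..x0} F) \<le> integral {x..x0} (\<lambda>t. C * (x0 - t) ^ n)"
    proof (rule integral_norm_bound_integral)
      show "F integrable_on {x..x0}" using int x by simp
      show "(\<lambda>t. C * (x0 - t) ^ n) integrable_on {x..x0}" using hi by (auto simp: integrable_on_def)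
      show "norm (F t) \<le> C * (x0 - t) ^ n" if "t \<in> {x..x0}" for t
        using bd[of t] that x0 x by (auto simp: abs_minus_commute)
    qed
    also have "\<dots> = C * (x0 - x) ^ Suc n / real (Suc n)" by (rule integral_unique[OF hi])
    finally have "norm (integral {x..x0} F) \<le> C * (x0 - x) ^ Suc n / real (Suc n)" .
    moreover have "\<bar>x - x0\<bar> = x0 - x" using le by simp
    ultimately show ?thesis unfolding eq by (simp only: norm_minus_cancel)
  qed
qed

primrec picard :: "nat \<Rightarrow> (nat \<Rightarrow> nat \<Rightarrow> real \<Rightarrow> complex) \<Rightarrow> real \<Rightarrow> (nat \<Rightarrow> complex) \<Rightarrow> nat \<Rightarrow> nat \<Rightarrow> real \<Rightarrow> complex" where
  "picard m A x0 c 0 = (\<lambda>i x. c i)"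
| "picard m A x0 c (Suc n) = (\<lambda>i. antiderivative x0 (\<lambda>t. \<Sum>j<m. A i j t * picard m A x0 c n j t))"

lemma picard_continuous:
  assumes A: "\<And>i j. i < m \<Longrightarrow> j < m \<Longrightarrow> continuous_on {0..} (A i j)" and "i < m"
  shows "continuous_on {0..} (picard m A x0 c n i)"
  using assms(2)
proof (induction n arbitrary: i)
  case (Suc n)
  have "continuous_on {0..} (\<lambda>t. \<Sum>j<m. A i j t * picard m A x0 c n j t)"
    using Suc A by (intro continuous_on_sum continuous_on_mult) auto
  from antiderivative_deriv[OF this] show ?case
    by (auto simp: continuous_on_eq_continuous_within intro!: has_vector_derivative_continuous)
qed simp

lemma picard_deriv:
  assumes A: "\<And>i j. i < m \<Longrightarrow> j < m \<Longrightarrow> continuous_on {0..} (A i j)" and "i < m" "x \<ge> 0"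
  shows "(picard m A x0 c (Suc n) i has_vector_derivative (\<Sum>j<m. A i j x * picard m A x0 c n j x)) (at x within {0..})"
  unfolding picard.simps
  by (rule antiderivative_deriv[OF _ assms(3)])
     (use assms(2) picard_continuous[OF A] in \<open>auto intro!: continuous_on_sum continuous_on_mult A\<close>)

lemma picard_bound:
  assumes A: "\<And>i j. i < m \<Longrightarrow> j < m \<Longrightarrow> continuous_on {0..} (A i j)"
    and K: "\<And>i j t. i < m \<Longrightarrow> j < m \<Longrightarrow> 0 \<le> t \<Longrightarrow> t \<le> R \<Longrightarrow> norm (A i j t) \<le> K"
    and C: "\<And>i. i < m \<Longrightarrow> norm (c i) \<le> C" and x0: "0 \<le> x0" "x0 \<le> R" and "0 \<le> x" "x \<le> R" "i < m"
  shows "norm (picard m A x0 c n i x) \<le> C * (m * K) ^ n / fact n * \<bar>x - x0\<bar> ^ n"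
  using assms(6-8)
proof (induction n arbitrary: i x)
  case 0
  then show ?case using C by simp
next
  case (Suc n)
  have K0: "0 \<le> K" using order_trans[OF norm_ge_zero K[OF Suc.prems(3,3), of x]] Suc.prems by simp
  have "norm (antiderivative x0 (\<lambda>t. \<Sum>j<m. A i j t * picard m A x0 c n j t) x)
      \<le> (C * (m * K) ^ Suc n / fact n) * \<bar>x - x0\<bar> ^ Suc n / real (Suc n)"
  proof (rule antiderivative_bound[OF _ x0 Suc.prems(1,2)])
    show "continuous_on {0..} (\<lambda>t. \<Sum>j<m. A i j t * picard m A x0 c n j t)"
      using Suc.prems(3) picard_continuous[OF A] by (intro continuous_on_sum continuous_on_mult A) auto
    fix t assume t: "0 \<le> t" "t \<le> R"
    have "norm (\<Sum>j<m. A i j t * picard m A x0 c n j t) \<le> (\<Sum>j<m. K * (C * (m * K) ^ n / fact n * \<bar>t - x0\<bar> ^ n))"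
    proof (rule sum_norm_le)
      fix j assume "j \<in> {..<m}"
      then show "norm (A i j t * picard m A x0 c n j t) \<le> K * (C * (m * K) ^ n / fact n * \<bar>t - x0\<bar> ^ n)"
        unfolding norm_mult using Suc.IH[OF t, of j] K[of i j t] t Suc.prems K0 by (intro mult_mono) auto
    qed
    also have "\<dots> = C * (m * K) ^ Suc n / fact n * \<bar>t - x0\<bar> ^ n" by (simp add: algebra_simps)
    finally show "norm (\<Sum>j<m. A i j t * picard m A x0 c n j t) \<le> C * (m * K) ^ Suc n / fact n * \<bar>t - x0\<bar> ^ n" .
  qed
  also have "\<dots> = C * (m * K) ^ Suc n / fact (Suc n) * \<bar>x - x0\<bar> ^ Suc n"
    by (simp add: field_simps del: of_nat_Suc)
  finally show ?case by simp
qed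

text \<open>Sum of the Picard iterates, each the integral of \<open>A\<close> applied to the previous one. On compact intervals
  the series and its termwise derivative are dominated by an exponential series.\<close>

theorem linear_system_exists:
  fixes A :: "nat \<Rightarrow> nat \<Rightarrow> real \<Rightarrow> complex"
  assumes A: "\<And>i j. i < m \<Longrightarrow> j < m \<Longrightarrow> continuous_on {0..} (A i j)" and x0: "x0 \<ge> 0"
  obtains u where "\<And>i. i < m \<Longrightarrow> u i x0 = c i"
    "\<And>i x. i < m \<Longrightarrow> x \<ge> 0 \<Longrightarrow> (u i has_vector_derivative (\<Sum>j<m. A i j x * u j x)) (at x within {0..})"
proof -
  define P where "P = picard m A x0 c"
  define D where "D n i x = (case n of 0 \<Rightarrow> 0 | Suc n \<Rightarrow> (\<Sum>j<m. A i j x * P n j x))" for n i x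
  define u where "u i x = (\<Sum>n. P n i x)" for i x
  have dP: "(P n i has_vector_derivative D n i x) (at x within {0..})" if "i < m" "x \<ge> 0" for n i x
    using picard_deriv[OF A that] by (cases n) (auto simp: P_def D_def)
  have main: "(\<forall>j<m. summable (\<lambda>n. P n j x)) \<and> (u i has_vector_derivative (\<Sum>j<m. A i j x * u j x)) (at x within {0..})"
    if i: "i < m" and x: "x \<ge> 0" for i x
  proof -
    define R where "R = max x0 x + 1"
    have R: "x0 \<le> R" "x < R" "0 \<le> R" using x0 x by (auto simp: R_def)
    have exK: "\<exists>K. \<forall>t\<in>{0..R}. norm (A i j t) \<le> K" if "i < m" "j < m" for i j
    proof -
      have "compact (A i j ` {0..R})"
        by (rule compact_continuous_image[OF continuous_on_subset[OF A[OF that]]]) auto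
      then have "bounded (A i j ` {0..R})" by (rule compact_imp_bounded)
      then show ?thesis unfolding bounded_iff by auto
    qed
    define K' where "K' i j = (SOME K. \<forall>t\<in>{0..R}. norm (A i j t) \<le> K)" for i j
    have K': "norm (A i j t) \<le> K' i j" if "i < m" "j < m" "t \<in> {0..R}" for i j t
      using someI_ex[OF exK[OF that(1,2)]] that(3) unfolding K'_def by blast
    define K where "K = (\<Sum>i<m. \<Sum>j<m. \<bar>K' i j\<bar>)"
    have K: "norm (A i j t) \<le> K" if "i < m" "j < m" "0 \<le> t" "t \<le> R" for i j t
    proof -
      have "norm (A i j t) \<le> \<bar>K' i j\<bar>" using K'[of i j t] that by simp
      also have "\<dots> \<le> (\<Sum>j<m. \<bar>K' i j\<bar>)" using that by (intro member_le_sum) auto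
      also have "\<dots> \<le> K" unfolding K_def using that
        by (intro member_le_sum[of i _ "\<lambda>i. \<Sum>j<m. \<bar>K' i j\<bar>"]) (auto intro: sum_nonneg)
      finally show ?thesis .
    qed
    define C where "C = (\<Sum>i<m. norm (c i))"
    have C: "norm (c i) \<le> C" if "i < m" for i unfolding C_def using that by (intro member_le_sum) auto
    have C0: "0 \<le> C" by (simp add: C_def sum_nonneg)
    have K0: "0 \<le> K" by (simp add: K_def sum_nonneg)
    define E where "E n = C * (m * K) ^ n / fact n * R ^ n" for n
    have sE: "summable E"
    proof -
      have "summable (\<lambda>n. C * (inverse (fact n) * (m * K * R) ^ n))"
        by (intro summable_mult summable_exp)
      also have "(\<lambda>n. C * (inverse (fact n) * (m * K * R) ^ n)) = E"
        by (auto simp: E_def power_mult_distrib field_simps)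
      finally show ?thesis .
    qed
    have bP: "norm (P n j t) \<le> E n" if "j < m" "t \<in> {0..R}" for n j t
    proof -
      have "norm (P n j t) \<le> C * (m * K) ^ n / fact n * \<bar>t - x0\<bar> ^ n"
        unfolding P_def using that by (intro picard_bound[OF A K C x0 R(1)]) auto
      also have "\<dots> \<le> E n"
        unfolding E_def using that x0 R C0 K0 by (intro mult_left_mono power_mono) auto
      finally show ?thesis .
    qed
    define E' where "E' n = (case n of 0 \<Rightarrow> 0 | Suc n \<Rightarrow> (m * K) * E n)" for n
    have sE': "summable E'"
      by (subst summable_Suc_iff[symmetric]) (simp add: E'_def sE summable_mult)
    have bD: "norm (D n i t) \<le> E' n" if "t \<in> {0..R}" for n t
    proof (cases n)
      case (Suc n')
      have "norm (\<Sum>j<m. A i j t * P n' j t) \<le> (\<Sum>j<m. K * E n')"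
        using bP[of _ t n'] K[of i _ t] that i K0
        by (intro sum_norm_le) (auto simp: norm_mult intro!: mult_mono)
      then show ?thesis by (simp add: Suc D_def E'_def algebra_simps)
    qed (simp add: D_def E'_def)
    have sP: "summable (\<lambda>n. P n j t)" if "j < m" "t \<in> {0..R}" for j t
      by (rule summable_comparison_test[OF _ sE]) (use bP that in auto)
    have U: "uniform_limit {0..R} (\<lambda>n t. \<Sum>i'<n. D i' i t) (\<lambda>t. suminf (\<lambda>n. D n i t)) sequentially"
      by (rule Weierstrass_m_test[OF _ sE']) (use bD in auto)
    have "\<exists>g. \<forall>t\<in>{0..R}. (\<lambda>n. P n i t) sums (g t) \<and>
        (g has_derivative (\<lambda>h. h *\<^sub>R suminf (\<lambda>n. D n i t))) (at t within {0..R})"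
    proof (rule has_derivative_series)
      show "(P n i has_derivative (\<lambda>h. h *\<^sub>R D n i t)) (at t within {0..R})" if "t \<in> {0..R}" for n t
        using has_vector_derivative_within_subset[OF dP[of i t n], of "{0..R}"] that i
        by (auto simp: has_vector_derivative_def)
      show "\<forall>\<^sub>F n in sequentially. \<forall>t\<in>{0..R}. \<forall>h::real. norm ((\<Sum>i'<n. h *\<^sub>R D i' i t) - h *\<^sub>R suminf (\<lambda>n. D n i t)) \<le> e * norm h"
        if "e > 0" for e
        using uniform_limitD[OF U that]
      proof eventually_elim
        case (elim n)
        show ?case
        proof (intro ballI allI)
          fix t h :: real assume "t \<in> {0..R}"
          then have "norm ((\<Sum>i'<n. D i' i t) - suminf (\<lambda>n. D n i t)) \<le> e"
            using elim by (auto simp: dist_norm intro: less_imp_le)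
          then have "norm h * norm ((\<Sum>i'<n. D i' i t) - suminf (\<lambda>n. D n i t)) \<le> norm h * e"
            by (intro mult_left_mono) auto
          then show "norm ((\<Sum>i'<n. h *\<^sub>R D i' i t) - h *\<^sub>R suminf (\<lambda>n. D n i t)) \<le> e * norm h"
            by (simp flip: scaleR_right.sum scaleR_diff_right add: mult.commute)
        qed
      qed
      show "x \<in> {0..R}" using x R by simp
      show "(\<lambda>n. P n i x) sums (\<Sum>n. P n i x)" using sP[OF i, of x] x R by (simp add: summable_sums)
    qed auto
    then obtain g where g: "\<And>t. t \<in> {0..R} \<Longrightarrow> (\<lambda>n. P n i t) sums (g t)"
      "\<And>t. t \<in> {0..R} \<Longrightarrow> (g has_vector_derivative suminf (\<lambda>n. D n i t)) (at t within {0..R})"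
      unfolding has_vector_derivative_def by blast
    have gu: "g t = u i t" if "t \<in> {0..R}" for t
      using g(1)[OF that] by (simp add: u_def sums_iff)
    have "(u i has_vector_derivative suminf (\<lambda>n. D n i x)) (at x within {0..R})"
      by (rule has_vector_derivative_transform[OF _ gu[symmetric] g(2)]) (use x R in auto)
    moreover have "suminf (\<lambda>n. D n i x) = (\<Sum>j<m. A i j x * u j x)"
    proof -
      have sPx: "summable (\<lambda>n. P n j x)" if "j < m" for j using sP[OF that, of x] x R by simp
      have sD: "summable (\<lambda>n. D n i x)"
        by (rule summable_comparison_test[OF _ sE']) (use bD[of x] x R in auto)
      have "suminf (\<lambda>n. D n i x) = (\<Sum>n. D (Suc n) i x)"
        using suminf_split_head[OF sD] by (simp add: D_def)
      also have "\<dots> = (\<Sum>n. \<Sum>j<m. A i j x * P n j x)" by (simp add: D_def)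
      also have "\<dots> = (\<Sum>j<m. \<Sum>n. A i j x * P n j x)"
        by (rule suminf_sum) (use sPx in \<open>auto intro: summable_mult\<close>)
      also have "\<dots> = (\<Sum>j<m. A i j x * u j x)"
        by (intro sum.cong refl) (use sPx in \<open>auto simp: u_def suminf_mult\<close>)
      finally show ?thesis .
    qed
    ultimately show ?thesis using at_within_Icc_half[OF x R(2)] sP x R by simp
  qed
  show ?thesis
  proof (rule that[of u])
    fix i assume i: "i < m"
    have "P n i x0 = (if n = 0 then c i else 0)" for n
      by (cases n) (auto simp: P_def antiderivative_def)
    then have "(\<lambda>n. P n i x0) = (\<lambda>n. if n = 0 then c i else 0)" by auto
    then show "u i x0 = c i" using sums_single[of 0 "\<lambda>_. c i"] by (simp add: u_def sums_iff)
  qed (use main in auto)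
qed

text \<open>The companion system, enlarged by an unknown with derivative zero and value \<open>1\<close> that carries the
  inhomogeneity \<open>r\<close>.\<close>

theorem linear_equation_exists:
  fixes p :: "nat \<Rightarrow> real \<Rightarrow> complex"
  assumes p: "\<And>j. j < n \<Longrightarrow> continuous_on {0..} (p j)" and r: "continuous_on {0..} r"
    and n: "n > 0" and x0: "x0 \<ge> 0"
  obtains y where "hdiff n {0..} y" "\<And>j. j < n \<Longrightarrow> (hderiv ^^ j) y x0 = c j"
    "\<And>x. x \<ge> 0 \<Longrightarrow> (hderiv ^^ n) y x = (\<Sum>j<n. p j x * (hderiv ^^ j) y x) + r x"
proof -
  define A where "A i j x = (if i = n then 0 else if i = n-1 then (if j = n then r x else p j x)
      else if j = Suc i then 1 else 0)" for i j x
  have contA: "continuous_on {0..} (A i j)" if ij: "i < Suc n" "j < Suc n" for i j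
  proof -
    consider "A i j = (\<lambda>_. 0)" | "A i j = (\<lambda>_. 1)" | "A i j = r" | "j < n" "A i j = p j"
      using ij unfolding A_def[abs_def] by (cases "i = n"; cases "i = n - 1"; cases "j = n"; cases "j = Suc i") auto
    then show ?thesis by cases (use p r in auto)
  qed
  obtain u where u: "\<And>i. i < Suc n \<Longrightarrow> u i x0 = (if i = n then 1 else c i)"
    "\<And>i x. i < Suc n \<Longrightarrow> x \<ge> 0 \<Longrightarrow> (u i has_vector_derivative (\<Sum>j<Suc n. A i j x * u j x)) (at x within {0..})"
  proof (rule linear_system_exists[of "Suc n" A x0 "\<lambda>i. if i = n then 1 else c i"])
    show "continuous_on {0..} (A i j)" if "i < Suc n" "j < Suc n" for i j by (rule contA[OF that])
    show "x0 \<ge> 0" by (rule x0)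
  qed (rule that)
  have un: "u n x = 1" if x: "x \<ge> 0" for x
  proof -
    have d0: "(u n has_vector_derivative 0) (at x within {0..})" if "x \<ge> 0" for x
      using u(2)[of n x] that by (simp add: A_def)
    have "\<exists>c. \<forall>x\<in>{0..}. u n x = c"
      by (rule has_derivative_zero_constant) (use d0 in \<open>auto simp: has_vector_derivative_def\<close>)
    then have "u n x = u n x0" using x x0 by auto
    then show ?thesis using u(1)[of n] by simp
  qed
  have du: "(u i has_vector_derivative u (Suc i) x) (at x within {0..})" if "Suc i < n" "x \<ge> 0" for i x
  proof -
    have "(\<Sum>j<Suc n. A i j x * u j x) = (\<Sum>j<Suc n. if j = Suc i then u j x else 0)"
      using that by (intro sum.cong) (auto simp: A_def)
    also have "\<dots> = u (Suc i) x" using that by simp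
    finally show ?thesis using u(2)[of i x] that by simp
  qed
  have dn: "(u (n-1) has_vector_derivative (\<Sum>j<n. p j x * u j x) + r x) (at x within {0..})" if "x \<ge> 0" for x
  proof -
    have "(\<Sum>j<Suc n. A (n-1) j x * u j x) = (\<Sum>j<n. p j x * u j x) + r x"
      using n un[OF that] by (simp add: A_def)
    then show ?thesis using u(2)[of "n-1" x] that n by simp
  qed
  define y where "y = u 0"
  have Dy: "(hderiv ^^ j) y x = u j x" if "j < n" "x \<ge> 0" for j x
    using that
  proof (induction j arbitrary: x)
    case (Suc j)
    have "(hderiv ^^ Suc j) y x = hderiv ((hderiv ^^ j) y) x" by simp
    also have "\<dots> = hderiv (u j) x"
      by (rule hderiv_cong) (use Suc in auto)
    also have "\<dots> = u (Suc j) x"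
      using du[of j x] Suc.prems by (intro hderiv_eqI) auto
    finally show ?case .
  qed (simp add: y_def)
  have hd: "((hderiv ^^ j) y has_vector_derivative (if Suc j = n then (\<Sum>j<n. p j x * u j x) + r x else u (Suc j) x))
      (at x within {0..})" if "j < n" "x \<ge> 0" for j x
  proof (subst vd_cong[of _ "u j"])
    show "(hderiv ^^ j) y t = u j t" if "t \<ge> 0" for t using Dy \<open>j < n\<close> that by simp
    show "(u j has_vector_derivative (if Suc j = n then (\<Sum>j<n. p j x * u j x) + r x else u (Suc j) x)) (at x within {0..})"
    proof (cases "Suc j = n")
      case True
      then have "j = n - 1" by simp
      then show ?thesis using dn[OF that(2)] True by simp
    next
      case False
      then show ?thesis using du[of j x] that by simp
    qed
  qed (use that in auto)
  show ?thesis
  proof (rule that[of y])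
    show "hdiff n {0..} y"
      unfolding hdiff_def using hd by (auto intro!: differentiableI_vector)
    show "(hderiv ^^ j) y x0 = c j" if "j < n" for j using Dy[OF that x0] u(1)[of j] that by simp
    fix x :: real assume x: "x \<ge> 0"
    obtain n' where n': "n = Suc n'" using n by (cases n) auto
    have "(hderiv ^^ n) y x = hderiv ((hderiv ^^ n') y) x" using n' by simp
    also have "\<dots> = (\<Sum>j<n. p j x * u j x) + r x"
      by (rule hderiv_eqI) (use hd[of n' x] n' x in auto)
    also have "\<dots> = (\<Sum>j<n. p j x * (hderiv ^^ j) y x) + r x" using Dy x by simp
    finally show "(hderiv ^^ n) y x = (\<Sum>j<n. p j x * (hderiv ^^ j) y x) + r x" .
  qed
qed

section \<open>Green's formula for locally absolutely continuous functions\<close>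

lemma hderiv_lincomb_step:
  fixes F :: "'i \<Rightarrow> real \<Rightarrow> complex"
  assumes I: "finite I" and eq: "\<And>t. t > 0 \<Longrightarrow> G t = (\<Sum>i\<in>I. c i * F i t)"
    and d: "\<And>i. i \<in> I \<Longrightarrow> F i differentiable (at x within {0..})" and x: "x > 0"
  shows "(G has_vector_derivative (\<Sum>i\<in>I. c i * hderiv (F i) x)) (at x within {0..})"
proof (rule iffD2[OF vd_cong_pos[OF eq x]])
  show "((\<lambda>t. \<Sum>i\<in>I. c i * F i t) has_vector_derivative (\<Sum>i\<in>I. c i * hderiv (F i) x)) (at x within {0..})"
    using d by (intro has_vector_derivative_sum has_vector_derivative_mult_right) (auto simp: hderiv_works)
qed

lemma hderiv_lincomb:
  fixes F :: "'i \<Rightarrow> real \<Rightarrow> complex"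
  assumes I: "finite I" and F: "\<And>i. i \<in> I \<Longrightarrow> hdiff n {0<..} (F i)" and j: "j \<le> n" and x: "x > 0"
  shows "(hderiv ^^ j) (\<lambda>x. \<Sum>i\<in>I. c i * F i x) x = (\<Sum>i\<in>I. c i * (hderiv ^^ j) (F i) x)"
  using j x
proof (induction j arbitrary: x)
  case (Suc j)
  have "((hderiv ^^ j) (\<lambda>x. \<Sum>i\<in>I. c i * F i x) has_vector_derivative
      (\<Sum>i\<in>I. c i * hderiv ((hderiv ^^ j) (F i)) x)) (at x within {0..})"
    by (rule hderiv_lincomb_step[OF I]) (use Suc F in \<open>auto simp: hdiff_def\<close>)
  then show ?case using Suc.prems by (simp add: hderiv_eqI_pos)
qed simp

lemma hdiff_lincomb:
  fixes F :: "'i \<Rightarrow> real \<Rightarrow> complex"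
  assumes I: "finite I" and F: "\<And>i. i \<in> I \<Longrightarrow> hdiff n {0<..} (F i)"
    and Fx: "\<And>i. i \<in> I \<Longrightarrow> hdiff (Suc n) {x} (F i)" and x: "x > 0"
  shows "hdiff (Suc n) {x} (\<lambda>x. \<Sum>i\<in>I. c i * F i x)"
    and "(hderiv ^^ Suc n) (\<lambda>x. \<Sum>i\<in>I. c i * F i x) x = (\<Sum>i\<in>I. c i * (hderiv ^^ Suc n) (F i) x)"
proof -
  have d: "((hderiv ^^ j) (\<lambda>x. \<Sum>i\<in>I. c i * F i x) has_vector_derivative
      (\<Sum>i\<in>I. c i * hderiv ((hderiv ^^ j) (F i)) x)) (at x within {0..})" if "j \<le> n" for j
    by (rule hderiv_lincomb_step[OF I hderiv_lincomb[OF I F]]) (use that Fx x in \<open>auto simp: hdiff_def\<close>)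
  then show "hdiff (Suc n) {x} (\<lambda>x. \<Sum>i\<in>I. c i * F i x)"
    unfolding hdiff_def
  proof (intro allI impI ballI)
    fix j y assume "j < Suc n" "y \<in> {x}"
    then show "(hderiv ^^ j) (\<lambda>x. \<Sum>i\<in>I. c i * F i x) differentiable at y within {0..}"
      using differentiableI_vector[OF d[of j]] by simp
  qed
  show "(hderiv ^^ Suc n) (\<lambda>x. \<Sum>i\<in>I. c i * F i x) x = (\<Sum>i\<in>I. c i * (hderiv ^^ Suc n) (F i) x)"
    using hderiv_eqI_pos[OF d[OF order_refl] x] by simp
qed

lemma hdiff_lincomb_half:
  fixes F :: "'i \<Rightarrow> real \<Rightarrow> complex"
  assumes I: "finite I" and F: "\<And>i. i \<in> I \<Longrightarrow> hdiff n {0<..} (F i)"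
  shows "hdiff n {0<..} (\<lambda>x. \<Sum>i\<in>I. c i * F i x)"
proof -
  have "hdiff n {x} (\<lambda>x. \<Sum>i\<in>I. c i * F i x)" if x: "x > 0" for x
  proof (cases n)
    case (Suc m)
    have "hdiff m {0<..} (F i)" "hdiff (Suc m) {x} (F i)" if "i \<in> I" for i
      using F[OF that] x Suc by (auto intro: hdiff_subset)
    then show ?thesis using hdiff_lincomb(1)[OF I] x Suc by blast
  qed (simp add: hdiff_def)
  then show ?thesis by (auto simp: hdiff_def)
qed

context odd_expr
begin

text \<open>The regularity part of membership in the maximal domain.\<close>

definition ac_dom :: "(real \<Rightarrow> complex) \<Rightarrow> bool" where
  "ac_dom f \<longleftrightarrow> hdiff (2*k-2) {0<..} f \<and> ac_loc ((hderiv ^^ (2*k-2)) f)"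

lemma order_Suc: "2*k-1 = Suc (2*k-2)" using k2 by simp

lemma ac_dom_hdiff: "ac_dom f \<Longrightarrow> hdiff (2*k-2) {0<..} f"
  by (simp add: ac_dom_def)

text \<open>The derivative of order \<open>2k-1\<close> exists almost everywhere; exhaust \<open>(0,\<infinity>)\<close> by the compact intervals
  \<open>[1/n,n]\<close>.\<close>

lemma ac_dom_regular_ae:
  assumes "ac_dom f"
  shows "\<exists>N. negligible N \<and> (\<forall>x>0. x \<notin> N \<longrightarrow> hdiff (2*k-1) {x} f)"
proof -
  let ?D = "(hderiv ^^ (2*k-2)) f"
  have "\<exists>N. negligible N \<and> (\<forall>x\<in>{1/real (Suc n)<..<real (Suc n)} - N. ?D differentiable (at x))" for n
  proof (rule abs_cont_differentiable_ae)
    have "1 / real (Suc n) \<le> 1" "1 \<le> real (Suc n)" by auto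
    then have "1 / real (Suc n) \<le> real (Suc n)" by linarith
    then show "abs_cont_on (1 / real (Suc n)) (real (Suc n)) ?D"
      using assms unfolding ac_dom_def ac_loc_def by simp
  qed
  then obtain N where N: "\<And>n. negligible (N n)"
    "\<And>n x. x \<in> {1/real (Suc n)<..<real (Suc n)} - N n \<Longrightarrow> ?D differentiable (at x)" by metis
  show ?thesis
  proof (intro exI[of _ "\<Union>n. N n"] conjI allI impI)
    show "negligible (\<Union>n. N n)" using N(1) by (rule negligible_Union_nat)
    fix x :: real assume x: "x > 0" "x \<notin> (\<Union>n. N n)"
    obtain n1 :: nat where n1: "x < real n1" using reals_Archimedean2 by blast
    obtain n2 where n2: "1 / real (Suc n2) < x" using x(1) nat_approx_posE by blast
    define n where "n = max n1 n2"
    have "1 / real (Suc n) \<le> 1 / real (Suc n2)" by (intro divide_left_mono) (auto simp: n_def)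
    then have "x \<in> {1/real (Suc n)<..<real (Suc n)} - N n"
      using n1 n2 x by (auto simp: n_def)
    then have "?D differentiable (at x within {0..})" using N(2) at_within_half_pos[OF x(1)] by simp
    then show "hdiff (2*k-1) {x} f"
      using ac_dom_hdiff[OF assms] x unfolding order_Suc by (auto simp: hdiff_def less_Suc_eq)
  qed
qed

lemma ac_dom_continuous:
  assumes "ac_dom f" "j \<le> 2*k-2" "0 < a"
  shows "continuous_on {a..b} ((hderiv ^^ j) f)"
proof (cases "j = 2*k-2")
  case True
  show ?thesis
  proof (cases "a \<le> b")
    case le: True
    then show ?thesis
      using assms True by (intro abs_cont_on_continuous) (auto simp: ac_dom_def ac_loc_def)
  qed simp
next
  case False
  have "(hderiv ^^ j) f differentiable (at x within {0..})" if "x \<in> {a..b}" for x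
    using assms False that by (auto simp: ac_dom_def hdiff_def)
  then have "continuous (at x within {a..b}) ((hderiv ^^ j) f)" if "x \<in> {a..b}" for x
    using that assms(3) by (intro continuous_within_subset[OF differentiable_imp_continuous_within, of _ _ "{0..}"]) auto
  then show ?thesis by (simp add: continuous_on_eq_continuous_within)
qed

lemma ac_dom_continuous_half: "ac_dom f \<Longrightarrow> continuous_on {0<..} f"
proof -
  assume "ac_dom f"
  then have *: "\<forall>x\<in>{0<..}. f differentiable (at x within {0..})"
    using k2 by (auto simp: ac_dom_def hdiff_def dest!: spec[of _ 0])
  have "f differentiable (at x)" if "x > 0" for x
  proof -
    have "f differentiable (at x within {0..})" using * that by simp
    then show ?thesis unfolding at_within_half_pos[OF that] .
  qed
  then show ?thesis
    by (auto simp: continuous_on_eq_continuous_at intro: differentiable_imp_continuous_within)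
qed

lemma ac_dom_abs_cont:
  assumes f: "ac_dom f" and j: "j \<le> 2*k-2" and ab: "0 < a" "a \<le> b"
  shows "abs_cont_on a b ((hderiv ^^ j) f)"
proof (cases "j = 2*k-2")
  case True
  then show ?thesis using f ab by (auto simp: ac_dom_def ac_loc_def)
next
  case False
  show ?thesis
  proof (rule abs_cont_on_C1[where f' = "(hderiv ^^ Suc j) f"])
    fix x assume x: "a \<le> x" "x \<le> b"
    have "((hderiv ^^ j) f has_vector_derivative (hderiv ^^ Suc j) f x) (at x within {0..})"
      using f j False x ab by (intro hdiff_singletonD[of "2*k-2"]) (auto simp: ac_dom_def hdiff_def)
    then show "((hderiv ^^ j) f has_vector_derivative (hderiv ^^ Suc j) f x) (at x within {a..b})"
      by (rule has_vector_derivative_within_subset) (use ab in auto)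
  next
    show "continuous_on {a..b} ((hderiv ^^ Suc j) f)"
      using ac_dom_continuous[OF f, of "Suc j" a b] j False ab by simp
  qed
qed

lemma diff_op_abs_cont:
  assumes T: "diff_op N 1 c T" "N \<le> 2*k-2" and f: "ac_dom f" and ab: "0 < a" "a \<le> b"
  shows "abs_cont_on a b (T f)"
proof -
  obtain p where p: "\<And>j. j \<le> N \<Longrightarrow> Ck_coeff 1 (p j)"
    "\<And>f x. x > 0 \<Longrightarrow> hdiff (N-1) {0<..} f \<Longrightarrow> hdiff N {x} f \<Longrightarrow>
        T f x = (\<Sum>j\<le>N. p j x * (hderiv ^^ j) f x)"
    using T(1) unfolding diff_op_def by blast
  have pa: "abs_cont_on a b (p j)" if jN: "j \<le> N" for j
  proof -
    obtain p' where p': "\<And>x. x \<ge> 0 \<Longrightarrow> (p j has_vector_derivative p' x) (at x within {0..})"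
      "continuous_on {0..} p'" using p(1)[OF jN] by auto
    show ?thesis
    proof (rule abs_cont_on_C1[where f' = p'])
      show "continuous_on {a..b} p'" by (rule continuous_on_subset[OF p'(2)]) (use ab in auto)
      show "(p j has_vector_derivative p' x) (at x within {a..b})" if "a \<le> x" "x \<le> b" for x
        by (rule has_vector_derivative_within_subset[OF p'(1)]) (use ab that in auto)
    qed
  qed
  have "abs_cont_on a b (\<lambda>x. \<Sum>j\<le>N. p j x * (hderiv ^^ j) f x)"
    using pa T(2) ab by (intro abs_cont_on_sum abs_cont_on_mult ac_dom_abs_cont[OF f]) auto
  then show ?thesis
  proof (rule abs_cont_on_cong)
    fix x assume "a \<le> x" "x \<le> b"
    then show "T f x = (\<Sum>j\<le>N. p j x * (hderiv ^^ j) f x)"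
      using T(2) ab hdiff_subset[OF ac_dom_hdiff[OF f]] by (intro p(2)) auto
  qed
qed

text \<open>The form is a sum of products of derivatives of \<open>g\<close> with differential operators of order at most \<open>2k-2\<close>
  and \<open>C\<^sup>1\<close> coefficients applied to \<open>f\<close>, and vice versa.\<close>

lemma green_form_abs_cont:
  assumes f: "ac_dom f" and g: "ac_dom g" and ab: "0 < a" "a \<le> b"
  shows "abs_cont_on a b (B f g)"
proof -
  have half: "abs_cont_on a b (half_form k s q f g)" if f: "ac_dom f" and g: "ac_dom g" for f g
    unfolding half_form_boundary_op[abs_def]
  proof (intro abs_cont_on_sum abs_cont_on_mult abs_cont_on_cnj)
    fix b' assume "b' \<in> {..<k}"
    then show "abs_cont_on a b (boundary_op b' f)"
      by (intro diff_op_abs_cont[OF diff_op_boundary _ f ab]) auto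
    show "abs_cont_on a b ((hderiv ^^ b') g)"
      using \<open>b' \<in> {..<k}\<close> k2 by (intro ac_dom_abs_cont[OF g _ ab]) auto
  qed simp
  have "abs_cont_on a b (\<lambda>x. half_form k s q f g x + (- 1) * cnj (half_form k s q g f x))"
    by (intro abs_cont_on_add abs_cont_on_mult abs_cont_on_const abs_cont_on_cnj half f g)
  then show ?thesis unfolding green_form_def[abs_def] by simp
qed

text \<open>The pointwise derivative of the form holds at almost every point, and the form is absolutely continuous.\<close>

theorem green_formula_ac:
  assumes f: "ac_dom f" and g: "ac_dom g" and ab: "0 < a" "a \<le> b"
  shows "(\<lambda>t. cnj (g t) * M f t - f t * cnj (M g t)) absolutely_integrable_on {a..b}"
    and "((\<lambda>t. cnj (g t) * M f t - f t * cnj (M g t)) has_integral B f g b - B f g a) {a..b}"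
proof -
  obtain N1 where N1: "negligible N1" "\<And>x. x > 0 \<Longrightarrow> x \<notin> N1 \<Longrightarrow> hdiff (2*k-1) {x} f"
    using ac_dom_regular_ae[OF f] by blast
  obtain N2 where N2: "negligible N2" "\<And>x. x > 0 \<Longrightarrow> x \<notin> N2 \<Longrightarrow> hdiff (2*k-1) {x} g"
    using ac_dom_regular_ae[OF g] by blast
  have N: "negligible (N1 \<union> N2)" using N1 N2 by auto
  have d: "(B f g has_vector_derivative cnj (g t) * M f t - f t * cnj (M g t)) (at t)"
    if "t \<in> {a<..<b} - (N1 \<union> N2)" for t
    using that ab N1 N2 by (intro green_form_deriv_at ac_dom_hdiff f g) auto
  note FTC = abs_cont_FTC[OF green_form_abs_cont[OF f g ab] ab(2) N d]
  show "(\<lambda>t. cnj (g t) * M f t - f t * cnj (M g t)) absolutely_integrable_on {a..b}"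
    by (rule FTC(1))
  show "((\<lambda>t. cnj (g t) * M f t - f t * cnj (M g t)) has_integral B f g b - B f g a) {a..b}"
    by (rule FTC(2))
qed

lemma M_lincomb:
  assumes I: "finite I" and F: "\<And>i. i \<in> I \<Longrightarrow> hdiff (2*k-2) {0<..} (F i)"
    and Fx: "\<And>i. i \<in> I \<Longrightarrow> hdiff (2*k-1) {x} (F i)" and x: "x > 0"
  shows "M (\<lambda>x. \<Sum>i\<in>I. c i * F i x) x = (\<Sum>i\<in>I. c i * M (F i) x)"
proof -
  obtain a where a: "\<And>f x. x > 0 \<Longrightarrow> hdiff (2*k-1-1) {0<..} f \<Longrightarrow> hdiff (2*k-1) {x} f \<Longrightarrow>
        M f x = (\<Sum>j\<le>2*k-1. a j x * (hderiv ^^ j) f x)"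
    using diff_op_M unfolding diff_op_def by blast
  have e: "2*k-1-1 = 2*k-2" by simp
  have D: "(hderiv ^^ j) (\<lambda>x. \<Sum>i\<in>I. c i * F i x) x = (\<Sum>i\<in>I. c i * (hderiv ^^ j) (F i) x)"
    if "j \<le> 2*k-1" for j
  proof (cases "j = 2*k-1")
    case True
    then show ?thesis using hdiff_lincomb(2)[OF I F Fx[unfolded order_Suc] x, where c = c] order_Suc by simp
  next
    case False
    then show ?thesis using that by (intro hderiv_lincomb[OF I F _ x]) auto
  qed
  have "M (\<lambda>x. \<Sum>i\<in>I. c i * F i x) x = (\<Sum>j\<le>2*k-1. a j x * (hderiv ^^ j) (\<lambda>x. \<Sum>i\<in>I. c i * F i x) x)"
    by (rule a[OF x]) (use hdiff_lincomb_half[OF I F] hdiff_lincomb(1)[OF I F Fx[unfolded order_Suc] x] e order_Suc in auto)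
  also have "\<dots> = (\<Sum>j\<le>2*k-1. a j x * (\<Sum>i\<in>I. c i * (hderiv ^^ j) (F i) x))"
    using D by (intro sum.cong) auto
  also have "\<dots> = (\<Sum>i\<in>I. c i * (\<Sum>j\<le>2*k-1. a j x * (hderiv ^^ j) (F i) x))"
    unfolding sum_distrib_left by (subst sum.swap) (simp add: mult_ac)
  also have "\<dots> = (\<Sum>i\<in>I. c i * M (F i) x)"
    using F Fx x e by (intro sum.cong refl arg_cong2[where f = "(*)"] a[symmetric]) auto
  finally show ?thesis .
qed

lemma ac_dom_lincomb:
  assumes I: "finite I" and F: "\<And>i. i \<in> I \<Longrightarrow> ac_dom (F i)"
  shows "ac_dom (\<lambda>x. \<Sum>i\<in>I. c i * F i x)"
  unfolding ac_dom_def ac_loc_def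
proof (intro conjI allI impI)
  show "hdiff (2*k-2) {0<..} (\<lambda>x. \<Sum>i\<in>I. c i * F i x)"
    using F by (intro hdiff_lincomb_half[OF I]) (auto simp: ac_dom_def)
  fix a b :: real assume ab: "0 < a" "a \<le> b"
  have "abs_cont_on a b (\<lambda>x. \<Sum>i\<in>I. c i * (hderiv ^^ (2*k-2)) (F i) x)"
    by (intro abs_cont_on_sum[OF I] abs_cont_on_mult abs_cont_on_const ac_dom_abs_cont F ab) auto
  then show "abs_cont_on a b ((hderiv ^^ (2*k-2)) (\<lambda>x. \<Sum>i\<in>I. c i * F i x))"
    by (rule abs_cont_on_cong) (use ab F in \<open>auto intro!: hderiv_lincomb[OF I] simp: ac_dom_def\<close>)
qed

lemma M_lincomb_ae:
  assumes I: "finite I" and F: "\<And>i. i \<in> I \<Longrightarrow> ac_dom (F i)"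
  shows "AE x in lebesgue. x > 0 \<longrightarrow> M (\<lambda>x. \<Sum>i\<in>I. c i * F i x) x = (\<Sum>i\<in>I. c i * M (F i) x)"
proof -
  have "\<forall>i\<in>I. \<exists>N. negligible N \<and> (\<forall>x>0. x \<notin> N \<longrightarrow> hdiff (2*k-1) {x} (F i))"
    using F ac_dom_regular_ae by blast
  from bchoice[OF this] obtain N where N: "\<forall>i\<in>I. negligible (N i) \<and> (\<forall>x>0. x \<notin> N i \<longrightarrow> hdiff (2*k-1) {x} (F i))"
    by (elim exE)
  show ?thesis
  proof (rule AE_I')
    have "negligible (\<Union>(N ` I))" using I N by (intro negligible_Union) auto
    then show "\<Union>(N ` I) \<in> null_sets lebesgue" by (simp add: negligible_iff_null_sets)
    show "{x \<in> space lebesgue. \<not> (x > 0 \<longrightarrow> M (\<lambda>x. \<Sum>i\<in>I. c i * F i x) x = (\<Sum>i\<in>I. c i * M (F i) x))} \<subseteq> \<Union>(N ` I)"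
    proof clarsimp
      fix x :: real
      assume x: "0 < x" "M (\<lambda>x. \<Sum>i\<in>I. c i * F i x) x \<noteq> (\<Sum>i\<in>I. c i * M (F i) x)"
      show "\<exists>i\<in>I. x \<in> N i"
      proof (rule ccontr)
        assume "\<not> (\<exists>i\<in>I. x \<in> N i)"
        then have "M (\<lambda>x. \<Sum>i\<in>I. c i * F i x) x = (\<Sum>i\<in>I. c i * M (F i) x)"
          using N x(1) F by (intro M_lincomb[OF I]) (auto simp: ac_dom_def)
        with x(2) show False by simp
      qed
    qed
  qed
qed

lemma green_form_lincomb_left:
  assumes I: "finite I" and F: "\<And>i. i \<in> I \<Longrightarrow> ac_dom (F i)" and g: "ac_dom g" and x: "x > 0"
  shows "B (\<lambda>x. \<Sum>i\<in>I. c i * F i x) g x = (\<Sum>i\<in>I. c i * B (F i) g x)"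
proof -
  let ?\<beta> = "\<lambda>a b. boundary_matrix a b x"
  have "B (\<lambda>x. \<Sum>i\<in>I. c i * F i x) g x = (\<Sum>a\<le>2*k-2. \<Sum>b\<le>2*k-2.
      ?\<beta> a b * (hderiv ^^ a) (\<lambda>x. \<Sum>i\<in>I. c i * F i x) x * cnj ((hderiv ^^ b) g x))"
    using ac_dom_hdiff[OF ac_dom_lincomb[OF I F]] ac_dom_hdiff[OF g] by (intro boundary_matrix(1)[OF x]) auto
  also have "\<dots> = (\<Sum>a\<le>2*k-2. \<Sum>b\<le>2*k-2.
      ?\<beta> a b * (\<Sum>i\<in>I. c i * (hderiv ^^ a) (F i) x) * cnj ((hderiv ^^ b) g x))"
    using hderiv_lincomb[OF I ac_dom_hdiff[OF F] _ x] by (intro sum.cong refl) auto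
  also have "\<dots> = (\<Sum>a\<le>2*k-2. \<Sum>b\<le>2*k-2. \<Sum>i\<in>I.
      c i * (?\<beta> a b * (hderiv ^^ a) (F i) x * cnj ((hderiv ^^ b) g x)))"
    by (simp add: sum_distrib_left sum_distrib_right mult_ac)
  also have "\<dots> = (\<Sum>a\<le>2*k-2. \<Sum>i\<in>I. \<Sum>b\<le>2*k-2.
      c i * (?\<beta> a b * (hderiv ^^ a) (F i) x * cnj ((hderiv ^^ b) g x)))"
    by (intro sum.cong refl, rule sum.swap)
  also have "\<dots> = (\<Sum>i\<in>I. \<Sum>a\<le>2*k-2. \<Sum>b\<le>2*k-2.
      c i * (?\<beta> a b * (hderiv ^^ a) (F i) x * cnj ((hderiv ^^ b) g x)))"
    by (rule sum.swap)
  also have "\<dots> = (\<Sum>i\<in>I. c i * B (F i) g x)"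
    using boundary_matrix(1)[OF x ac_dom_hdiff[OF F] ac_dom_hdiff[OF g]]
    by (intro sum.cong refl) (simp add: sum_distrib_left)
  finally show ?thesis .
qed

end

section \<open>Square-integrable functions\<close>

definition L2on :: "real set \<Rightarrow> (real \<Rightarrow> complex) \<Rightarrow> bool" where
  "L2on S f \<longleftrightarrow> set_borel_measurable lebesgue S f \<and> set_integrable lebesgue S (\<lambda>x. (norm (f x))\<^sup>2)"

definition ip :: "real set \<Rightarrow> (real \<Rightarrow> complex) \<Rightarrow> (real \<Rightarrow> complex) \<Rightarrow> complex" where
  "ip S f g = (LINT x:S|lebesgue. f x * cnj (g x))"

definition nsq :: "real set \<Rightarrow> (real \<Rightarrow> complex) \<Rightarrow> real" where
  "nsq S f = (LINT x:S|lebesgue. (norm (f x))\<^sup>2)"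

lemma L2_halfline_L2on: "L2_halfline f \<longleftrightarrow> L2on {0<..} f"
  by (simp add: L2_halfline_def L2on_def)

lemma set_measurable_mult:
  fixes f g :: "real \<Rightarrow> complex"
  assumes "set_borel_measurable lebesgue S f" "set_borel_measurable lebesgue S g"
  shows "set_borel_measurable lebesgue S (\<lambda>x. f x * g x)"
proof -
  have "(\<lambda>x. (indicator S x *\<^sub>R f x) * (indicator S x *\<^sub>R g x)) \<in> borel_measurable lebesgue"
    using assms unfolding set_borel_measurable_def by (rule borel_measurable_times)
  also have "(\<lambda>x. (indicator S x *\<^sub>R f x) * (indicator S x *\<^sub>R g x)) = (\<lambda>x. indicator S x *\<^sub>R (f x * g x))"
    by (auto simp: indicator_def)
  finally show ?thesis by (simp add: set_borel_measurable_def)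
qed

lemma set_measurable_add:
  fixes f g :: "real \<Rightarrow> complex"
  assumes "set_borel_measurable lebesgue S f" "set_borel_measurable lebesgue S g"
  shows "set_borel_measurable lebesgue S (\<lambda>x. f x + g x)"
  using borel_measurable_add[OF assms[unfolded set_borel_measurable_def]]
  by (simp add: set_borel_measurable_def scaleR_add_right)

lemma set_measurable_compose:
  fixes f :: "real \<Rightarrow> complex" and h :: "complex \<Rightarrow> 'b::real_normed_vector"
  assumes "set_borel_measurable lebesgue S f" "h \<in> borel_measurable borel" "h 0 = 0"
  shows "set_borel_measurable lebesgue S (\<lambda>x. h (f x))"
proof -
  have "(\<lambda>x. h (indicator S x *\<^sub>R f x)) \<in> borel_measurable lebesgue"
    by (rule measurable_compose[OF assms(1)[unfolded set_borel_measurable_def] assms(2)])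
  also have "(\<lambda>x. h (indicator S x *\<^sub>R f x)) = (\<lambda>x. indicator S x *\<^sub>R h (f x))"
    using assms(3) by (auto simp: indicator_def)
  finally show ?thesis by (simp add: set_borel_measurable_def)
qed

lemma L2onI_bound:
  assumes "set_borel_measurable lebesgue S f" "set_integrable lebesgue S h"
    and "\<And>x. x \<in> S \<Longrightarrow> (norm (f x))\<^sup>2 \<le> h x"
  shows "L2on S f"
  unfolding L2on_def
proof
  have "set_borel_measurable lebesgue S (\<lambda>x. (norm (f x))\<^sup>2)"
    by (rule set_measurable_compose[OF assms(1), where h = "\<lambda>z. (norm z)\<^sup>2"]) auto
  then show "set_integrable lebesgue S (\<lambda>x. (norm (f x))\<^sup>2)"
  proof (rule set_integrable_bound[OF assms(2)])
    show "AE x in lebesgue. x \<in> S \<longrightarrow> norm ((norm (f x))\<^sup>2) \<le> norm (h x)"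
      using assms(3) by (intro AE_I2 impI) (simp add: order_trans[OF _ abs_ge_self])
  qed
qed fact

lemma L2on_subset:
  assumes "L2on S f" "T \<subseteq> S" "T \<in> sets lebesgue"
  shows "L2on T f"
proof -
  have "set_borel_measurable lebesgue T f"
  proof -
    have "(\<lambda>x. indicator S x *\<^sub>R f x) \<in> borel_measurable lebesgue"
      using assms(1) by (simp add: L2on_def set_borel_measurable_def)
    then have "(\<lambda>x. indicator T x *\<^sub>R (indicator S x *\<^sub>R f x)) \<in> borel_measurable lebesgue"
      by (rule borel_measurable_scaleR[OF borel_measurable_indicator[OF assms(3)]])
    also have "(\<lambda>x. indicator T x *\<^sub>R (indicator S x *\<^sub>R f x)) = (\<lambda>x. indicator T x *\<^sub>R f x)"
      by (intro ext) (use assms(2) in \<open>auto simp: indicator_def\<close>)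
    finally show ?thesis by (simp add: set_borel_measurable_def)
  qed
  then show ?thesis using assms set_integrable_subset unfolding L2on_def by blast
qed

lemma L2on_add:
  assumes "L2on S f" "L2on S g"
  shows "L2on S (\<lambda>x. f x + g x)"
proof (rule L2onI_bound)
  show "set_borel_measurable lebesgue S (\<lambda>x. f x + g x)"
    using assms set_measurable_add unfolding L2on_def by blast
  show "set_integrable lebesgue S (\<lambda>x. 2 * (norm (f x))\<^sup>2 + 2 * (norm (g x))\<^sup>2)"
    using assms unfolding L2on_def by (intro set_integral_add set_integrable_mult_right) auto
  fix x
  have "(norm (f x + g x))\<^sup>2 \<le> (norm (f x) + norm (g x))\<^sup>2"
    by (intro power_mono norm_triangle_ineq) auto
  also have "\<dots> \<le> 2 * (norm (f x))\<^sup>2 + 2 * (norm (g x))\<^sup>2"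
    using sum_squares_bound[of "norm (f x)" "norm (g x)"] by (simp add: power2_sum)
  finally show "(norm (f x + g x))\<^sup>2 \<le> 2 * (norm (f x))\<^sup>2 + 2 * (norm (g x))\<^sup>2" .
qed

lemma L2on_cmult:
  assumes "L2on S f"
  shows "L2on S (\<lambda>x. c * f x)"
proof (rule L2onI_bound)
  show "set_borel_measurable lebesgue S (\<lambda>x. c * f x)"
    using assms unfolding L2on_def by (intro set_measurable_compose[where h = "\<lambda>z. c * z"]) auto
  show "set_integrable lebesgue S (\<lambda>x. (norm c)\<^sup>2 * (norm (f x))\<^sup>2)"
    using assms unfolding L2on_def by (intro set_integrable_mult_right) auto
qed (simp add: norm_mult power_mult_distrib)

lemma L2on_zero: "L2on S (\<lambda>_. 0)"
  by (simp add: L2on_def set_borel_measurable_def set_integrable_def)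

lemma L2on_lincomb:
  assumes "finite I" "\<And>i. i \<in> I \<Longrightarrow> L2on S (F i)"
  shows "L2on S (\<lambda>x. \<Sum>i\<in>I. c i * F i x)"
  using assms
proof (induction I rule: finite_induct)
  case (insert i I)
  then have "L2on S (\<lambda>x. c i * F i x)" "L2on S (\<lambda>x. \<Sum>i\<in>I. c i * F i x)" by (auto intro: L2on_cmult)
  from L2on_add[OF this] show ?case using insert by simp
qed (simp add: L2on_zero)

lemma L2on_cong_AE:
  assumes "L2on S f" "AE x in lebesgue. x \<in> S \<longrightarrow> f x = g x"
  shows "L2on S g"
proof -
  have m: "set_borel_measurable lebesgue S g"
    unfolding set_borel_measurable_def
  proof (rule borel_measurable_AE)
    show "(\<lambda>x. indicator S x *\<^sub>R f x) \<in> borel_measurable lebesgue"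
      using assms(1) by (simp add: L2on_def set_borel_measurable_def)
    show "AE x in lebesgue. indicator S x *\<^sub>R f x = indicator S x *\<^sub>R g x"
      using assms(2) by eventually_elim (auto simp: indicator_def)
  qed
  have m2: "set_borel_measurable lebesgue S (\<lambda>x. (norm (g x))\<^sup>2)"
    by (rule set_measurable_compose[OF m, where h = "\<lambda>z. (norm z)\<^sup>2"]) auto
  have "set_integrable lebesgue S (\<lambda>x. (norm (g x))\<^sup>2)"
  proof (rule set_integrable_bound[OF _ m2])
    show "set_integrable lebesgue S (\<lambda>x. (norm (f x))\<^sup>2)" using assms(1) by (simp add: L2on_def)
    show "AE x in lebesgue. x \<in> S \<longrightarrow> norm ((norm (g x))\<^sup>2) \<le> norm ((norm (f x))\<^sup>2)"
      using assms(2) by eventually_elim auto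
  qed
  with m show ?thesis by (simp add: L2on_def)
qed

lemma L2on_bounded:
  fixes f :: "real \<Rightarrow> complex"
  assumes "continuous_on S f" "S \<in> sets borel" "emeasure lborel S < \<infinity>" "\<And>x. x \<in> S \<Longrightarrow> norm (f x) \<le> C"
  shows "L2on S f"
proof (rule L2onI_bound)
  have "(\<lambda>x. indicator S x *\<^sub>R f x) \<in> borel_measurable borel"
    by (rule borel_measurable_continuous_on_indicator[OF assms(2,1)])
  then show "set_borel_measurable lebesgue S f"
    unfolding set_borel_measurable_def by (simp add: measurable_completion)
  show "set_integrable lebesgue S (\<lambda>x. C\<^sup>2)"
    unfolding set_integrable_def using assms(2,3) by (intro integrable_scaleR_left) (simp add: integrable_real_indicator)
  show "(norm (f x))\<^sup>2 \<le> C\<^sup>2" if "x \<in> S" for x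
    using assms(4)[OF that] by (intro power_mono) auto
qed

lemma L2on_continuous:
  assumes "continuous_on {a..b} f"
  shows "L2on {a..b} f"
proof -
  have "bounded (f ` {a..b})" using assms by (intro compact_imp_bounded compact_continuous_image) auto
  then obtain C where "\<forall>y\<in>f ` {a..b}. norm y \<le> C" unfolding bounded_iff by auto
  then show ?thesis using assms by (intro L2on_bounded[of _ _ C]) (auto simp: emeasure_lborel_Icc_eq)
qed

lemma L2on_Un:
  assumes "L2on S f" "L2on T f" "S \<in> sets lebesgue" "T \<in> sets lebesgue"
  shows "L2on (S \<union> T) f"
proof -
  have "set_borel_measurable lebesgue (S \<union> T) f"
  proof -
    have m: "(\<lambda>x. indicator S x *\<^sub>R f x) \<in> borel_measurable lebesgue"
      "(\<lambda>x. indicator T x *\<^sub>R f x) \<in> borel_measurable lebesgue"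
      using assms(1,2) by (auto simp: L2on_def set_borel_measurable_def)
    have "(\<lambda>x. indicator S x *\<^sub>R f x + indicator (T - S) x *\<^sub>R (indicator T x *\<^sub>R f x)) \<in> borel_measurable lebesgue"
      by (rule borel_measurable_add[OF m(1) borel_measurable_scaleR[OF
            borel_measurable_indicator[OF sets.Diff[OF assms(4,3)]] m(2)]])
    also have "(\<lambda>x. indicator S x *\<^sub>R f x + indicator (T - S) x *\<^sub>R (indicator T x *\<^sub>R f x)) = (\<lambda>x. indicator (S \<union> T) x *\<^sub>R f x)"
      by (auto simp: indicator_def)
    finally show ?thesis by (simp add: set_borel_measurable_def)
  qed
  then show ?thesis using assms set_integrable_Un unfolding L2on_def by blast
qed

lemma L2on_mult_integrable:
  assumes "L2on S f" "L2on S g"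
  shows "set_integrable lebesgue S (\<lambda>x. f x * cnj (g x))"
proof (rule set_integrable_bound)
  show "set_integrable lebesgue S (\<lambda>x. (norm (f x))\<^sup>2 + (norm (g x))\<^sup>2)"
    using assms unfolding L2on_def by (intro set_integral_add) auto
  have "set_borel_measurable lebesgue S (\<lambda>x. cnj (g x))"
    using assms unfolding L2on_def by (intro set_measurable_compose[where h = cnj]) (auto intro: borel_measurable_continuous_onI continuous_intros)
  then show "set_borel_measurable lebesgue S (\<lambda>x. f x * cnj (g x))"
    using assms unfolding L2on_def by (intro set_measurable_mult) auto
  have "norm (f x) * norm (g x) \<le> (norm (f x))\<^sup>2 + (norm (g x))\<^sup>2" for x
  proof -
    have "2 * (norm (f x) * norm (g x)) \<le> (norm (f x))\<^sup>2 + (norm (g x))\<^sup>2"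
      using sum_squares_bound[of "norm (f x)" "norm (g x)"] by simp
    moreover have "0 \<le> norm (f x) * norm (g x)" by simp
    ultimately show ?thesis by linarith
  qed
  then show "AE x in lebesgue. x \<in> S \<longrightarrow> norm (f x * cnj (g x)) \<le> norm ((norm (f x))\<^sup>2 + (norm (g x))\<^sup>2)"
    by (intro AE_I2) (simp add: norm_mult)
qed

lemma nsq_nonneg: "nsq S f \<ge> 0"
  unfolding nsq_def set_lebesgue_integral_def by (intro integral_nonneg_AE AE_I2) simp

lemma ip_self: "ip S f f = of_real (nsq S f)"
  unfolding ip_def nsq_def set_lebesgue_integral_def
  by (simp add: complex_norm_square[symmetric] flip: integral_complex_of_real of_real_power)
     (simp add: scaleR_conv_of_real)

lemma nsq_mono:
  assumes "L2on S f" "T \<subseteq> S" "T \<in> sets lebesgue"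
  shows "nsq T f \<le> nsq S f"
  unfolding nsq_def set_lebesgue_integral_def
proof (rule integral_mono)
  show "integrable lebesgue (\<lambda>x. indicator T x *\<^sub>R (norm (f x))\<^sup>2)"
    "integrable lebesgue (\<lambda>x. indicator S x *\<^sub>R (norm (f x))\<^sup>2)"
    using assms L2on_subset[OF assms] by (auto simp: L2on_def set_integrable_def)
  show "indicator T x *\<^sub>R (norm (f x))\<^sup>2 \<le> indicator S x *\<^sub>R (norm (f x))\<^sup>2" for x
    using assms(2) by (auto simp: indicator_def)
qed

lemma ip_lincomb:
  assumes "finite I" "\<And>i. i \<in> I \<Longrightarrow> L2on S (F i)" "L2on S g"
  shows "ip S (\<lambda>x. \<Sum>i\<in>I. c i * F i x) g = (\<Sum>i\<in>I. c i * ip S (F i) g)"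
proof -
  have eq: "(\<lambda>x. indicator S x *\<^sub>R ((\<Sum>i\<in>I. c i * F i x) * cnj (g x)))
      = (\<lambda>x. \<Sum>i\<in>I. c i * (indicator S x *\<^sub>R (F i x * cnj (g x))))"
    unfolding sum_distrib_right scaleR_sum_right by (intro ext sum.cong) (simp_all add: mult_ac)
  have "integrable lebesgue (\<lambda>x. c i * (indicator S x *\<^sub>R (F i x * cnj (g x))))" if "i \<in> I" for i
    using L2on_mult_integrable[OF assms(2)[OF that] assms(3)] unfolding set_integrable_def
    by (rule integrable_mult_right)
  then show ?thesis
    unfolding ip_def set_lebesgue_integral_def eq
    by (subst Bochner_Integration.integral_sum) (simp_all only: integral_mult_right_zero)
qed

lemma ip_cnj: "ip S g f = cnj (ip S f g)"
proof -
  have "cnj (ip S f g) = (LINT x|lebesgue. cnj (indicator S x *\<^sub>R (f x * cnj (g x))))"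
    unfolding ip_def set_lebesgue_integral_def by (rule Bochner_Integration.integral_cnj[symmetric])
  then show ?thesis
    unfolding ip_def set_lebesgue_integral_def by (simp add: mult.commute)
qed

lemma ip_add_left:
  assumes "L2on S f" "L2on S f'" "L2on S g"
  shows "ip S (\<lambda>x. f x + f' x) g = ip S f g + ip S f' g"
  using ip_lincomb[of "{True,False}" S "\<lambda>b. if b then f else f'" g "\<lambda>_. 1"] assms by simp

lemma ip_cmult_left:
  assumes "L2on S f" "L2on S g"
  shows "ip S (\<lambda>x. c * f x) g = c * ip S f g"
  using ip_lincomb[of "{True}" S "\<lambda>b. f" g "\<lambda>_. c"] assms by simp

lemma ip_add_right:
  assumes "L2on S f" "L2on S g" "L2on S g'"
  shows "ip S f (\<lambda>x. g x + g' x) = ip S f g + ip S f g'"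
  using ip_add_left[OF assms(2,3,1)] by (metis complex_cnj_add ip_cnj)

lemma ip_cmult_right:
  assumes "L2on S f" "L2on S g"
  shows "ip S f (\<lambda>x. c * g x) = cnj c * ip S f g"
  using ip_cmult_left[OF assms(2,1), of c] by (metis complex_cnj_mult ip_cnj)

lemma ip_cong_AE:
  assumes f: "L2on S f" "AE x in lebesgue. x \<in> S \<longrightarrow> f x = f' x"
    and g: "L2on S g" "AE x in lebesgue. x \<in> S \<longrightarrow> g x = g' x"
  shows "ip S f g = ip S f' g'"
  unfolding ip_def set_lebesgue_integral_def
proof (rule integral_cong_AE)
  have "set_integrable lebesgue S (\<lambda>x. f x * cnj (g x))" by (rule L2on_mult_integrable[OF f(1) g(1)])
  then show "(\<lambda>x. indicator S x *\<^sub>R (f x * cnj (g x))) \<in> borel_measurable lebesgue"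
    by (auto simp: set_integrable_def)
  have "set_integrable lebesgue S (\<lambda>x. f' x * cnj (g' x))"
    by (rule L2on_mult_integrable[OF L2on_cong_AE[OF f] L2on_cong_AE[OF g]])
  then show "(\<lambda>x. indicator S x *\<^sub>R (f' x * cnj (g' x))) \<in> borel_measurable lebesgue"
    by (auto simp: set_integrable_def)
  show "AE x in lebesgue. indicator S x *\<^sub>R (f x * cnj (g x)) = indicator S x *\<^sub>R (f' x * cnj (g' x))"
    using f(2) g(2) by eventually_elim (auto simp: indicator_def)
qed

text \<open>The Cauchy--Schwarz inequality in its arithmetic-geometric mean form, with the scale \<open>t\<close> left free.\<close>

lemma ip_bound:
  assumes f: "L2on S f" and g: "L2on S g" and t: "t > 0"
  shows "norm (ip S f g) \<le> (t * nsq S f + nsq S g / t) / 2"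
proof -
  have i: "integrable lebesgue (\<lambda>x. indicator S x *\<^sub>R (norm (f x))\<^sup>2)"
    "integrable lebesgue (\<lambda>x. indicator S x *\<^sub>R (norm (g x))\<^sup>2)"
    using f g by (auto simp: L2on_def set_integrable_def)
  have "norm (ip S f g) \<le> (LINT x|lebesgue. norm (indicator S x *\<^sub>R (f x * cnj (g x))))"
    unfolding ip_def set_lebesgue_integral_def by (rule integral_norm_bound)
  also have "\<dots> \<le> (LINT x|lebesgue. t/2 * (indicator S x *\<^sub>R (norm (f x))\<^sup>2) + 1/(2*t) * (indicator S x *\<^sub>R (norm (g x))\<^sup>2))"
  proof (rule integral_mono)
    show "integrable lebesgue (\<lambda>x. norm (indicator S x *\<^sub>R (f x * cnj (g x))))"
      using L2on_mult_integrable[OF f g] unfolding set_integrable_def by (rule integrable_norm)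
    show "integrable lebesgue (\<lambda>x. t/2 * (indicator S x *\<^sub>R (norm (f x))\<^sup>2) + 1/(2*t) * (indicator S x *\<^sub>R (norm (g x))\<^sup>2))"
      by (intro Bochner_Integration.integrable_add integrable_mult_right i)
    fix x
    have "norm (f x) * norm (g x) \<le> t/2 * (norm (f x))\<^sup>2 + 1/(2*t) * (norm (g x))\<^sup>2"
    proof -
      have "0 \<le> (t * norm (f x) - norm (g x))\<^sup>2" by simp
      then have "2 * t * (norm (f x) * norm (g x)) \<le> t * t * (norm (f x))\<^sup>2 + (norm (g x))\<^sup>2"
        by (simp add: power2_diff power_mult_distrib power2_eq_square algebra_simps)
      then show ?thesis using t by (simp add: field_simps power2_eq_square)
    qed
    then show "norm (indicator S x *\<^sub>R (f x * cnj (g x))) \<le>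
        t/2 * (indicator S x *\<^sub>R (norm (f x))\<^sup>2) + 1/(2*t) * (indicator S x *\<^sub>R (norm (g x))\<^sup>2)"
      by (auto simp: indicator_def norm_mult)
  qed
  also have "\<dots> = (t * nsq S f + nsq S g / t) / 2"
    unfolding nsq_def set_lebesgue_integral_def
    by (subst Bochner_Integration.integral_add[OF integrable_mult_right[OF i(1)] integrable_mult_right[OF i(2)]],
        subst integral_mult_right_zero, subst integral_mult_right_zero) (simp add: field_simps)
  finally show ?thesis .
qed

lemma nsq_lincomb:
  assumes I: "finite I" and F: "\<And>i. i \<in> I \<Longrightarrow> L2on S (F i)"
  shows "nsq S (\<lambda>x. \<Sum>i\<in>I. c i * F i x) \<le> card I * (\<Sum>i\<in>I. (norm (c i))\<^sup>2 * nsq S (F i))"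
proof -
  have int: "integrable lebesgue (\<lambda>x. indicator S x *\<^sub>R (norm (F i x))\<^sup>2)" if "i \<in> I" for i
    using F[OF that] by (simp add: L2on_def set_integrable_def)
  have "nsq S (\<lambda>x. \<Sum>i\<in>I. c i * F i x)
      \<le> (LINT x|lebesgue. card I * (\<Sum>i\<in>I. (norm (c i))\<^sup>2 * (indicator S x *\<^sub>R (norm (F i x))\<^sup>2)))"
    unfolding nsq_def set_lebesgue_integral_def
  proof (rule integral_mono)
    show "integrable lebesgue (\<lambda>x. indicator S x *\<^sub>R (norm (\<Sum>i\<in>I. c i * F i x))\<^sup>2)"
      using L2on_lincomb[OF I F] by (simp add: L2on_def set_integrable_def)
    show "integrable lebesgue (\<lambda>x. card I * (\<Sum>i\<in>I. (norm (c i))\<^sup>2 * (indicator S x *\<^sub>R (norm (F i x))\<^sup>2)))"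
      using int by (intro integrable_mult_right integrable_sum) auto
    fix x
    have "(norm (\<Sum>i\<in>I. c i * F i x))\<^sup>2 \<le> (\<Sum>i\<in>I. norm (c i * F i x))\<^sup>2"
      by (intro power_mono norm_sum) auto
    also have "\<dots> \<le> card I * (\<Sum>i\<in>I. (norm (c i * F i x))\<^sup>2)"
      using Cauchy_Schwarz_ineq_sum[of "\<lambda>_. 1" "\<lambda>i. norm (c i * F i x)" I] by simp
    finally have "(norm (\<Sum>i\<in>I. c i * F i x))\<^sup>2 \<le> card I * (\<Sum>i\<in>I. (norm (c i))\<^sup>2 * (norm (F i x))\<^sup>2)"
      by (simp add: norm_mult power_mult_distrib)
    then show "indicator S x *\<^sub>R (norm (\<Sum>i\<in>I. c i * F i x))\<^sup>2
        \<le> card I * (\<Sum>i\<in>I. (norm (c i))\<^sup>2 * (indicator S x *\<^sub>R (norm (F i x))\<^sup>2))"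
      by (auto simp: indicator_def)
  qed
  also have "\<dots> = card I * (\<Sum>i\<in>I. (norm (c i))\<^sup>2 * nsq S (F i))"
    using int unfolding nsq_def set_lebesgue_integral_def by (simp add: integral_sum)
  finally show ?thesis .
qed

lemma ip_tendsto:
  assumes f: "L2on {a..} f" and g: "L2on {a..} g"
  shows "((\<lambda>X. ip {a..X} f g) \<longlongrightarrow> ip {a..} f g) at_top"
  unfolding ip_def set_lebesgue_integral_def
proof (rule integral_dominated_convergence_at_top)
  have "set_integrable lebesgue {a..} (\<lambda>x. f x * cnj (g x))"
    by (rule L2on_mult_integrable[OF f g])
  then have i: "integrable lebesgue (\<lambda>x. indicator {a..} x *\<^sub>R (f x * cnj (g x)))"
    by (simp add: set_integrable_def)
  then show "(\<lambda>x. indicator {a..} x *\<^sub>R (f x * cnj (g x))) \<in> borel_measurable lebesgue" by auto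
  show "integrable lebesgue (\<lambda>x. norm (indicator {a..} x *\<^sub>R (f x * cnj (g x))))"
    using i by (rule integrable_norm)
  show "(\<lambda>x. indicator {a..X} x *\<^sub>R (f x * cnj (g x))) \<in> borel_measurable lebesgue" for X
  proof -
    have "L2on {a..X} f" "L2on {a..X} g" using f g by (auto intro: L2on_subset)
    from L2on_mult_integrable[OF this] show ?thesis by (auto simp: set_integrable_def)
  qed
  show "\<forall>\<^sub>F X in at_top. AE x in lebesgue. norm (indicator {a..X} x *\<^sub>R (f x * cnj (g x)))
      \<le> norm (indicator {a..} x *\<^sub>R (f x * cnj (g x)))"
    by (intro always_eventually allI AE_I2) (auto simp: indicator_def)
  show "AE x in lebesgue. ((\<lambda>X. indicator {a..X} x *\<^sub>R (f x * cnj (g x))) \<longlongrightarrow>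
      indicator {a..} x *\<^sub>R (f x * cnj (g x))) at_top"
  proof (intro AE_I2 tendsto_eventually)
    fix x
    show "\<forall>\<^sub>F X in at_top. indicator {a..X} x *\<^sub>R (f x * cnj (g x)) = indicator {a..} x *\<^sub>R (f x * cnj (g x))"
      using eventually_ge_at_top[of x] by eventually_elim (auto simp: indicator_def)
  qed
qed

lemma nsq_tail:
  assumes g: "L2on {a..} g" and e: "e > 0"
  obtains R where "R \<ge> a" "nsq {R<..} g < e"
proof -
  have "((\<lambda>X. ip {a..X} g g) \<longlongrightarrow> ip {a..} g g) at_top" by (rule ip_tendsto[OF g g])
  then have "((\<lambda>X. nsq {a..X} g) \<longlongrightarrow> nsq {a..} g) at_top" by (simp add: ip_self tendsto_of_real_iff)
  then have "\<forall>\<^sub>F X in at_top. nsq {a..X} g > nsq {a..} g - e"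
    by (rule order_tendstoD) (use e in simp)
  with eventually_ge_at_top[of a] have "\<forall>\<^sub>F X in at_top. X \<ge> a \<and> nsq {a..X} g > nsq {a..} g - e"
    by eventually_elim simp
  then obtain R where R: "R \<ge> a" "nsq {a..R} g > nsq {a..} g - e"
    unfolding eventually_at_top_linorder by blast
  have "nsq {a..} g = nsq {a..R} g + nsq {R<..} g"
  proof -
    have un: "{a..} = {a..R} \<union> {R<..}" using R by auto
    have i: "set_integrable lebesgue {a..} (\<lambda>x. (norm (g x))\<^sup>2)" using g by (simp add: L2on_def)
    have "set_integrable lebesgue {a..R} (\<lambda>x. (norm (g x))\<^sup>2)" "set_integrable lebesgue {R<..} (\<lambda>x. (norm (g x))\<^sup>2)"
      using R by (auto intro: set_integrable_subset[OF i])
    then show ?thesis unfolding nsq_def un by (intro set_integral_Un) auto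
  qed
  with R have "nsq {R<..} g < e" by simp
  with R(1) that show ?thesis by blast
qed

text \<open>Monotone convergence along the intervals \<open>[a,a+n]\<close>.\<close>

lemma nsq_limit_bound:
  assumes loc: "\<And>X. L2on {a..X} f" and bd: "\<And>X. nsq {a..X} f \<le> C"
  shows "L2on {a..} f" "nsq {a..} f \<le> C"
proof -
  define A where "A n = {a..a + real n}" for n
  have UA: "{a..} = (\<Union>n. A n)"
  proof -
    have "\<exists>n. x \<le> a + real n" if "a \<le> x" for x using real_arch_simple[of "x - a"] by (auto simp: algebra_simps)
    then show ?thesis by (auto simp: A_def)
  qed
  have lim: "(\<lambda>n. indicator (A n) x *\<^sub>R f x) \<longlonglongrightarrow> indicator {a..} x *\<^sub>R f x" for x
  proof (rule tendsto_eventually)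
    obtain n0 where "x \<le> a + real n0" using real_arch_simple[of "x - a"] by (auto simp: algebra_simps)
    then have "indicator (A n) x *\<^sub>R f x = indicator {a..} x *\<^sub>R f x" if "n \<ge> n0" for n
      using that by (auto simp: A_def indicator_def)
    then show "\<forall>\<^sub>F n in sequentially. indicator (A n) x *\<^sub>R f x = indicator {a..} x *\<^sub>R f x"
      unfolding eventually_sequentially by blast
  qed
  have meas: "set_borel_measurable lebesgue {a..} f"
    unfolding set_borel_measurable_def
    by (rule borel_measurable_LIMSEQ_metric[OF _ lim])
       (use loc in \<open>auto simp: A_def L2on_def set_borel_measurable_def\<close>)
  have "(\<integral>\<^sup>+x. ennreal (indicator {a..} x * (norm (f x))\<^sup>2) \<partial>lebesgue) \<le> ennreal C"
  proof -
    have sup: "ennreal (indicator {a..} x * (norm (f x))\<^sup>2) = (SUP n. ennreal (indicator (A n) x * (norm (f x))\<^sup>2))" for x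
    proof (rule antisym)
      obtain n0 where n0: "x \<le> a + real n0" using real_arch_simple[of "x - a"] by (auto simp: algebra_simps)
      have "ennreal (indicator {a..} x * (norm (f x))\<^sup>2) = ennreal (indicator (A n0) x * (norm (f x))\<^sup>2)"
        using n0 by (auto simp: A_def indicator_def)
      also have "\<dots> \<le> (SUP n. ennreal (indicator (A n) x * (norm (f x))\<^sup>2))" by (rule SUP_upper) auto
      finally show "ennreal (indicator {a..} x * (norm (f x))\<^sup>2) \<le> (SUP n. ennreal (indicator (A n) x * (norm (f x))\<^sup>2))" .
      show "(SUP n. ennreal (indicator (A n) x * (norm (f x))\<^sup>2)) \<le> ennreal (indicator {a..} x * (norm (f x))\<^sup>2)"
        by (rule SUP_least) (auto simp: A_def indicator_def)
    qed
    have m2: "(\<lambda>x. ennreal (indicator (A n) x * (norm (f x))\<^sup>2)) \<in> borel_measurable lebesgue" for n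
    proof -
      have "integrable lebesgue (\<lambda>x. indicator (A n) x *\<^sub>R (norm (f x))\<^sup>2)"
        using loc[of "a + real n"] by (auto simp: L2on_def set_integrable_def A_def)
      then have "(\<lambda>x. indicator (A n) x * (norm (f x))\<^sup>2) \<in> borel_measurable lebesgue" by simp
      then show ?thesis by simp
    qed
    have "(\<integral>\<^sup>+x. ennreal (indicator {a..} x * (norm (f x))\<^sup>2) \<partial>lebesgue)
        = (SUP n. \<integral>\<^sup>+x. ennreal (indicator (A n) x * (norm (f x))\<^sup>2) \<partial>lebesgue)"
      unfolding sup
      by (rule nn_integral_monotone_convergence_SUP)
         (use m2 in \<open>auto simp: incseq_def le_fun_def A_def indicator_def intro!: ennreal_leI\<close>)
    also have "\<dots> \<le> ennreal C"
    proof (rule SUP_least)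
      fix n
      have "(\<integral>\<^sup>+x. ennreal (indicator (A n) x * (norm (f x))\<^sup>2) \<partial>lebesgue) = ennreal (nsq (A n) f)"
        unfolding nsq_def set_lebesgue_integral_def
        using loc[of "a + real n"] by (subst nn_integral_eq_integral) (auto simp: L2on_def set_integrable_def A_def)
      also have "\<dots> \<le> ennreal C" using bd[of "a + real n"] by (auto simp: A_def intro: ennreal_leI)
      finally show "(\<integral>\<^sup>+x. ennreal (indicator (A n) x * (norm (f x))\<^sup>2) \<partial>lebesgue) \<le> ennreal C" .
    qed
    finally show ?thesis .
  qed
  note nn = this
  have m2: "set_borel_measurable lebesgue {a..} (\<lambda>x. (norm (f x))\<^sup>2)"
    by (rule set_measurable_compose[OF meas, where h = "\<lambda>z. (norm z)\<^sup>2"]) auto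
  have "integrable lebesgue (\<lambda>x. indicator {a..} x *\<^sub>R (norm (f x))\<^sup>2)"
  proof (rule integrableI_bounded)
    show "(\<lambda>x. indicator {a..} x *\<^sub>R (norm (f x))\<^sup>2) \<in> borel_measurable lebesgue"
      using m2 by (simp add: set_borel_measurable_def)
    have "(\<integral>\<^sup>+x. ennreal (norm (indicator {a..} x *\<^sub>R (norm (f x))\<^sup>2)) \<partial>lebesgue)
        = (\<integral>\<^sup>+x. ennreal (indicator {a..} x * (norm (f x))\<^sup>2) \<partial>lebesgue)"
      by (intro nn_integral_cong) (auto simp: indicator_def)
    also have "\<dots> < \<infinity>" using nn by (rule le_less_trans) simp
    finally show "(\<integral>\<^sup>+x. ennreal (norm (indicator {a..} x *\<^sub>R (norm (f x))\<^sup>2)) \<partial>lebesgue) < \<infinity>" .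
  qed
  then show L: "L2on {a..} f" using meas by (simp add: L2on_def set_integrable_def)
  have "((\<lambda>X. ip {a..X} f f) \<longlongrightarrow> ip {a..} f f) at_top" by (rule ip_tendsto[OF L L])
  then have "((\<lambda>X. nsq {a..X} f) \<longlongrightarrow> nsq {a..} f) at_top" by (simp add: ip_self tendsto_of_real_iff)
  then show "nsq {a..} f \<le> C"
    by (rule tendsto_upperbound) (use bd in auto)
qed

lemma AE_negligible:
  assumes "AE x in lebesgue. P x"
  shows "\<exists>N. negligible N \<and> (\<forall>x. x \<notin> N \<longrightarrow> P x)"
proof -
  obtain N where "N \<in> null_sets lebesgue" "\<And>x. x \<in> space lebesgue - N \<Longrightarrow> P x"
    using AE_E3[OF assms] by blast
  then show ?thesis by (auto simp: negligible_iff_null_sets)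
qed

context odd_expr
begin

section \<open>Solutions of the differential equation\<close>

text \<open>Functions are set to zero on \<open>(-\<infinity>,0]\<close>, as the maximal domain demands. The bound near \<open>0\<close> makes them
  square integrable there, so that membership in \<open>\<Delta>\<close> depends on the behaviour at infinity alone
  (\<open>classical_max_dom\<close>).\<close>

definition classical :: "(real \<Rightarrow> complex) \<Rightarrow> bool" where
  "classical y \<longleftrightarrow> (\<forall>x\<le>0. y x = 0) \<and> ac_dom y \<and> (\<forall>x>0. hdiff (2*k-1) {x} y) \<and>
     (\<forall>X. \<exists>C. \<forall>x. 0 < x \<longrightarrow> x \<le> X \<longrightarrow> norm (y x) \<le> C)"

text \<open>Solving for the highest derivative is possible because its coefficient \<open>i\<^sup>2\<^sup>k\<^sup>-\<^sup>1 q\<^sub>k\<^sub>-\<^sub>1\<close> does not vanish.\<close>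

theorem solution_exists:
  assumes x0: "x0 > 0" and h: "continuous_on {0..} h"
  obtains y where "classical y" "\<And>j. j \<le> 2*k-2 \<Longrightarrow> (hderiv ^^ j) y x0 = c j"
    "\<And>x. x > 0 \<Longrightarrow> M y x = z * y x + h x"
proof -
  obtain a where a: "\<And>j. j \<le> 2*k-1 \<Longrightarrow> Ck_coeff 0 (a j)"
    "\<And>x. x \<ge> 0 \<Longrightarrow> a (2*k-1) x = \<i> ^ (2*k-1) * of_real (q (k-1) x)"
    "\<And>f x. x > 0 \<Longrightarrow> hdiff (2*k-1-1) {0<..} f \<Longrightarrow> hdiff (2*k-1) {x} f \<Longrightarrow>
        M f x = (\<Sum>j\<le>2*k-1. a j x * (hderiv ^^ j) f x)"
    using diff_op_M unfolding diff_op_def by blast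
  define l where "l = a (2*k-1)"
  have l0: "l x \<noteq> 0" if "x \<ge> 0" for x
    using a(2)[OF that] q_pos[OF that] by (simp add: l_def)
  have ac: "continuous_on {0..} (a j)" if "j \<le> 2*k-1" for j using a(1)[OF that] by simp
  have lc: "continuous_on {0..} l" unfolding l_def by (rule ac) simp
  define p where "p j x = ((if j = 0 then z else 0) - a j x) / l x" for j x
  define r where "r x = h x / l x" for x
  have pc: "continuous_on {0..} (p j)" if "j < 2*k-1" for j
    unfolding p_def using l0 that by (intro continuous_intros ac lc) auto
  have rc: "continuous_on {0..} r"
    unfolding r_def using l0 by (intro continuous_intros h lc) auto
  have n0: "0 < 2*k-1" using k2 by simp
  obtain y0 where y0: "hdiff (2*k-1) {0..} y0" "\<And>j. j < 2*k-1 \<Longrightarrow> (hderiv ^^ j) y0 x0 = c j"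
    "\<And>x. x \<ge> 0 \<Longrightarrow> (hderiv ^^ (2*k-1)) y0 x = (\<Sum>j<2*k-1. p j x * (hderiv ^^ j) y0 x) + r x"
  proof (rule linear_equation_exists[of "2*k-1" p r x0 c])
    show "continuous_on {0..} (p j)" if "j < 2*k-1" for j by (rule pc[OF that])
  qed (use rc n0 x0 in \<open>auto\<close>)
  define y where "y x = (if x > 0 then y0 x else 0)" for x
  have yy: "\<And>t. t > 0 \<Longrightarrow> y t = y0 t" by (simp add: y_def)
  have D: "(hderiv ^^ j) y x = (hderiv ^^ j) y0 x" if "x > 0" for j x
    by (rule funpow_hderiv_cong_pos[OF yy that])
  have Dc: "continuous_on {0..} ((hderiv ^^ j) y0)" if "j < 2*k-1" for j
    using y0(1) that by (auto simp: hdiff_def continuous_on_eq_continuous_within intro: differentiable_imp_continuous_within)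
  have Dtop: "continuous_on {0..} ((hderiv ^^ (2*k-1)) y0)"
  proof -
    have "continuous_on {0..} (\<lambda>x. (\<Sum>j<2*k-1. p j x * (hderiv ^^ j) y0 x) + r x)"
      by (intro continuous_on_add continuous_on_sum continuous_on_mult pc Dc rc) auto
    then show ?thesis
      by (rule continuous_on_eq) (use y0(3) in simp)
  qed
  have hd: "hdiff (2*k-1) {0<..} y"
  proof -
    have "hdiff (2*k-1) {0<..} y0" by (rule hdiff_subset[OF y0(1)]) auto
    moreover have "hdiff (2*k-1) {0<..} y \<longleftrightarrow> hdiff (2*k-1) {0<..} y0"
      by (rule hdiff_cong_pos) (use yy in auto)
    ultimately show ?thesis by simp
  qed
  have acl: "abs_cont_on s t ((hderiv ^^ (2*k-2)) y)" if st: "0 < s" "s \<le> t" for s t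
  proof (rule abs_cont_on_cong)
    show "abs_cont_on s t ((hderiv ^^ (2*k-2)) y0)"
    proof (rule abs_cont_on_C1[where f' = "(hderiv ^^ (2*k-1)) y0"])
      show "continuous_on {s..t} ((hderiv ^^ (2*k-1)) y0)"
        by (rule continuous_on_subset[OF Dtop]) (use st in auto)
      fix x assume x: "s \<le> x" "x \<le> t"
      have "((hderiv ^^ (2*k-2)) y0 has_vector_derivative (hderiv ^^ Suc (2*k-2)) y0 x) (at x within {0..})"
        using hdiffD[OF y0(1), of "2*k-2" x] x st k2 by simp
      then show "((hderiv ^^ (2*k-2)) y0 has_vector_derivative (hderiv ^^ (2*k-1)) y0 x) (at x within {s..t})"
        unfolding order_Suc by (rule has_vector_derivative_within_subset) (use st in auto)
    qed
  qed (use D st in auto)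
  have "classical y"
    unfolding classical_def ac_dom_def ac_loc_def
  proof (intro conjI allI impI)
    show "hdiff (2*k-2) {0<..} y" by (rule hdiff_mono[OF hd]) simp
    show "hdiff (2*k-1) {x} y" if "x > 0" for x by (rule hdiff_subset[OF hd]) (use that in auto)
    fix X :: real
    have "bounded (y0 ` {0..X})"
      using Dc[of 0] k2 by (intro compact_imp_bounded compact_continuous_image) (auto intro: continuous_on_subset)
    then obtain C where "\<forall>v\<in>y0 ` {0..X}. norm v \<le> C" unfolding bounded_iff by auto
    then have "norm (y x) \<le> C" if "0 < x" "x \<le> X" for x using that by (simp add: y_def)
    then show "\<exists>C. \<forall>x. 0 < x \<longrightarrow> x \<le> X \<longrightarrow> norm (y x) \<le> C" by blast
  qed (use acl in \<open>auto simp: y_def\<close>)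
  moreover have "(hderiv ^^ j) y x0 = c j" if "j \<le> 2*k-2" for j
    using D[OF x0] y0(2)[of j] that k2 by simp
  moreover have "M y x = z * y x + h x" if x: "x > 0" for x
  proof -
    have "M y x = (\<Sum>j\<le>2*k-1. a j x * (hderiv ^^ j) y x)"
      by (rule a(3)[OF x]) (use hd x in \<open>auto intro: hdiff_subset hdiff_mono\<close>)
    also have "\<dots> = (\<Sum>j<2*k-1. a j x * (hderiv ^^ j) y0 x) + l x * (hderiv ^^ (2*k-1)) y0 x"
      using D[OF x] by (simp add: l_def lessThan_Suc_atMost[symmetric])
    also have "l x * (hderiv ^^ (2*k-1)) y0 x = (\<Sum>j<2*k-1. ((if j = 0 then z else 0) - a j x) * (hderiv ^^ j) y0 x) + h x"
      using y0(3)[of x] l0[of x] x by (simp add: p_def r_def distrib_left sum_distrib_left)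
    also have "(\<Sum>j<2*k-1. a j x * (hderiv ^^ j) y0 x) + \<dots>
        = (\<Sum>j<2*k-1. (if j = 0 then z else 0) * (hderiv ^^ j) y0 x) + h x"
      by (simp add: left_diff_distrib sum_subtractf)
    also have "(\<Sum>j<2*k-1. (if j = 0 then z else 0) * (hderiv ^^ j) y0 x) = (\<Sum>j<2*k-1. if j = 0 then z * y0 x else 0)"
      by (intro sum.cong) auto
    also have "\<dots> = z * y x" using n0 x by (simp add: y_def)
    finally show ?thesis .
  qed
  ultimately show ?thesis using that by blast
qed

text \<open>Uniqueness by duality: against any \<open>g\<close> with \<open>M g = cnj z \<cdot> g\<close> the form \<open>B f g\<close> is constant between \<open>x0\<close>
  and \<open>x\<close>, hence zero. As \<open>g\<close> may have arbitrary data at \<open>x\<close>, nondegeneracy annihilates the data of \<open>f\<close>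
  there.\<close>

theorem solution_unique:
  assumes f: "ac_dom f" and M: "AE t in lebesgue. min x0 x \<le> t \<and> t \<le> max x0 x \<longrightarrow> M f t = z * f t"
    and x0: "x0 > 0" and data: "\<And>j. j \<le> 2*k-2 \<Longrightarrow> (hderiv ^^ j) f x0 = 0"
    and x: "x > 0" and j: "j \<le> 2*k-2"
  shows "(hderiv ^^ j) f x = 0"
proof (rule boundary_form_nondegenerate[OF x _ j])
  fix b assume b: "b \<le> 2*k-2"
  obtain g where g: "classical g" "\<And>j. j \<le> 2*k-2 \<Longrightarrow> (hderiv ^^ j) g x = (if j = b then 1 else 0)"
    "\<And>x. x > 0 \<Longrightarrow> M g x = cnj z * g x + 0"
    by (rule solution_exists[OF x continuous_on_const[of _ 0], where c = "\<lambda>j. if j = b then 1 else 0" and z = "cnj z"], rule that)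
  have ag: "ac_dom g" using g(1) by (simp add: classical_def)
  obtain N where N: "negligible N"
    "\<And>t. min x0 x \<le> t \<Longrightarrow> t \<le> max x0 x \<Longrightarrow> t \<notin> N \<Longrightarrow> M f t = z * f t"
    using AE_negligible[OF M] by blast
  have const: "B f g v = B f g u" if uv: "0 < u" "u \<le> v" and uv': "min x0 x \<le> u" "v \<le> max x0 x" for u v
  proof -
    have h1: "((\<lambda>t. cnj (g t) * M f t - f t * cnj (M g t)) has_integral B f g v - B f g u) {u..v}"
      by (rule green_formula_ac[OF f ag uv])
    have h2: "((\<lambda>t. cnj (g t) * M f t - f t * cnj (M g t)) has_integral 0) {u..v}"
      by (rule has_integral_spike[OF N(1) _ has_integral_0]) (use N(2) g(3) uv uv' in auto)
    show ?thesis using has_integral_unique[OF h1 h2] by simp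
  qed
  have "B f g x0 = 0"
    using boundary_matrix(1)[OF x0 ac_dom_hdiff[OF f] ac_dom_hdiff[OF ag]] data by simp
  then have "B f g x = 0"
    using const[of x0 x] const[of x x0] x x0 by (cases "x0 \<le> x") auto
  moreover have "B f g x = (\<Sum>a\<le>2*k-2. boundary_matrix a b x * (hderiv ^^ a) f x)"
  proof -
    have "B f g x = (\<Sum>a\<le>2*k-2. \<Sum>b'\<le>2*k-2. if b' = b then boundary_matrix a b x * (hderiv ^^ a) f x else 0)"
      unfolding boundary_matrix(1)[OF x ac_dom_hdiff[OF f] ac_dom_hdiff[OF ag]]
      using g(2) by (intro sum.cong refl) auto
    then show ?thesis using b by simp
  qed
  ultimately show "(\<Sum>a\<le>2*k-2. boundary_matrix a b x * (hderiv ^^ a) f x) = 0" by simp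
qed

lemma solution_unique_global:
  assumes f: "ac_dom f" and M: "AE x in lebesgue. x > 0 \<longrightarrow> M f x = z * f x"
    and x0: "x0 > 0" and data: "\<And>j. j \<le> 2*k-2 \<Longrightarrow> (hderiv ^^ j) f x0 = 0" and x: "x > 0"
  shows "f x = 0"
proof -
  have "AE t in lebesgue. min x0 x \<le> t \<and> t \<le> max x0 x \<longrightarrow> M f t = z * f t"
    using M by eventually_elim (use x0 x in auto)
  from solution_unique[OF f this x0 data x, of 0] show ?thesis by simp
qed

section \<open>The form at infinity on the maximal domain\<close>

abbreviation \<Delta> :: "(real \<Rightarrow> complex) set" where "\<Delta> \<equiv> max_dom k s q"

lemma max_dom_iff:
  "f \<in> \<Delta> \<longleftrightarrow> (\<forall>x\<le>0. f x = 0) \<and> L2on {0<..} f \<and> ac_dom f \<and> L2on {0<..} (M f)"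
  by (auto simp: max_dom_def L2_halfline_L2on ac_dom_def)

lemma max_domD:
  assumes "f \<in> \<Delta>"
  shows "ac_dom f" "L2on {1..} f" "L2on {1..} (M f)" "\<And>X. L2on {1..X} f" "\<And>X. L2on {1..X} (M f)"
proof -
  have *: "L2on {0<..} f" "L2on {0<..} (M f)" using assms by (auto simp: max_dom_iff)
  show "L2on {1..} f" "L2on {1..} (M f)" "\<And>X. L2on {1..X} f" "\<And>X. L2on {1..X} (M f)"
    by (rule L2on_subset[OF *(1)] L2on_subset[OF *(2)]; auto)+
qed (use assms in \<open>simp add: max_dom_iff\<close>)

lemma max_dom_lincomb:
  assumes I: "finite I" and F: "\<And>i. i \<in> I \<Longrightarrow> F i \<in> \<Delta>"
  shows "(\<lambda>x. \<Sum>i\<in>I. c i * F i x) \<in> \<Delta>"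
  unfolding max_dom_iff
proof (intro conjI allI impI)
  have aF: "ac_dom (F i)" and LF: "L2on {0<..} (F i)" and LM: "L2on {0<..} (M (F i))" if "i \<in> I" for i
    using F[OF that] by (auto simp: max_dom_iff)
  show "ac_dom (\<lambda>x. \<Sum>i\<in>I. c i * F i x)" by (rule ac_dom_lincomb[OF I aF])
  show "L2on {0<..} (\<lambda>x. \<Sum>i\<in>I. c i * F i x)" by (rule L2on_lincomb[OF I LF])
  show "L2on {0<..} (M (\<lambda>x. \<Sum>i\<in>I. c i * F i x))"
  proof (rule L2on_cong_AE)
    show "L2on {0<..} (\<lambda>x. \<Sum>i\<in>I. c i * M (F i) x)" by (rule L2on_lincomb[OF I LM])
    have "AE x in lebesgue. x > 0 \<longrightarrow> M (\<lambda>x. \<Sum>i\<in>I. c i * F i x) x = (\<Sum>i\<in>I. c i * M (F i) x)"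
      by (rule M_lincomb_ae[OF I aF])
    then show "AE x in lebesgue. x \<in> {0<..} \<longrightarrow>
        (\<Sum>i\<in>I. c i * M (F i) x) = M (\<lambda>x. \<Sum>i\<in>I. c i * F i x) x"
      by eventually_elim simp
  qed
qed (use F in \<open>auto simp: max_dom_iff intro!: sum.neutral\<close>)

lemma green_ip:
  assumes f: "ac_dom f" and g: "ac_dom g" and ab: "0 < a" "a \<le> b"
    and Lf: "L2on {a..b} f" "L2on {a..b} (M f)" and Lg: "L2on {a..b} g" "L2on {a..b} (M g)"
  shows "B f g b - B f g a = ip {a..b} (M f) g - ip {a..b} f (M g)"
proof -
  have i: "set_integrable lebesgue {a..b} (\<lambda>t. M f t * cnj (g t))"
    "set_integrable lebesgue {a..b} (\<lambda>t. f t * cnj (M g t))"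
    using L2on_mult_integrable Lf Lg by auto
  have "B f g b - B f g a = integral {a..b} (\<lambda>t. cnj (g t) * M f t - f t * cnj (M g t))"
    using green_formula_ac(2)[OF f g ab] by (simp add: integral_unique)
  also have "\<dots> = (LINT t:{a..b}|lebesgue. cnj (g t) * M f t - f t * cnj (M g t))"
    by (rule set_lebesgue_integral_eq_integral(2)[symmetric, OF green_formula_ac(1)[OF f g ab]])
  also have "\<dots> = ip {a..b} (M f) g - ip {a..b} f (M g)"
    unfolding ip_def using i by (subst set_integral_diff(2)[symmetric]) (auto simp: mult.commute)
  finally show ?thesis .
qed

abbreviation Binf :: "(real \<Rightarrow> complex) \<Rightarrow> (real \<Rightarrow> complex) \<Rightarrow> complex" where
  "Binf \<equiv> green_form_inf k s q"

lemma Binf_limit: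
  assumes f: "f \<in> \<Delta>" and g: "g \<in> \<Delta>"
  shows "((B f g) \<longlongrightarrow> Binf f g) at_top"
    and "Binf f g - B f g 1 = ip {1..} (M f) g - ip {1..} f (M g)"
proof -
  note f' = max_domD[OF f] and g' = max_domD[OF g]
  have "((\<lambda>X. B f g 1 + (ip {1..X} (M f) g - ip {1..X} f (M g))) \<longlongrightarrow>
      B f g 1 + (ip {1..} (M f) g - ip {1..} f (M g))) at_top"
    by (intro tendsto_add tendsto_diff tendsto_const ip_tendsto f' g')
  moreover have "\<forall>\<^sub>F X in at_top. B f g 1 + (ip {1..X} (M f) g - ip {1..X} f (M g)) = B f g X"
    using eventually_ge_at_top[of 1]
  proof eventually_elim
    case (elim X)
    then show ?case using green_ip[OF f'(1) g'(1) _ elim f'(4,5) g'(4,5)] by (simp add: algebra_simps)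
  qed
  ultimately have l: "(B f g \<longlongrightarrow> B f g 1 + (ip {1..} (M f) g - ip {1..} f (M g))) at_top"
    by (rule Lim_transform_eventually)
  then have e: "Binf f g = B f g 1 + (ip {1..} (M f) g - ip {1..} f (M g))"
    unfolding green_form_inf_def by (intro tendsto_Lim) auto
  show "((B f g) \<longlongrightarrow> Binf f g) at_top" using l e by simp
  show "Binf f g - B f g 1 = ip {1..} (M f) g - ip {1..} f (M g)" using e by simp
qed

lemma Binf_lincomb_left:
  assumes I: "finite I" and F: "\<And>i. i \<in> I \<Longrightarrow> F i \<in> \<Delta>" and g: "g \<in> \<Delta>"
  shows "Binf (\<lambda>x. \<Sum>i\<in>I. c i * F i x) g = (\<Sum>i\<in>I. c i * Binf (F i) g)"
proof (rule tendsto_unique)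
  show "(B (\<lambda>x. \<Sum>i\<in>I. c i * F i x) g \<longlongrightarrow> Binf (\<lambda>x. \<Sum>i\<in>I. c i * F i x) g) at_top"
    by (rule Binf_limit[OF max_dom_lincomb[OF I F] g])
  have "((\<lambda>X. \<Sum>i\<in>I. c i * B (F i) g X) \<longlongrightarrow> (\<Sum>i\<in>I. c i * Binf (F i) g)) at_top"
    by (intro tendsto_sum tendsto_mult tendsto_const Binf_limit F g)
  moreover have "\<forall>\<^sub>F X in at_top. (\<Sum>i\<in>I. c i * B (F i) g X) = B (\<lambda>x. \<Sum>i\<in>I. c i * F i x) g X"
    using eventually_gt_at_top[of 0]
  proof eventually_elim
    case (elim X)
    then show ?case
      using green_form_lincomb_left[OF I max_domD(1)[OF F] max_domD(1)[OF g] elim, where c = c] by simp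
  qed
  ultimately show "(B (\<lambda>x. \<Sum>i\<in>I. c i * F i x) g \<longlongrightarrow> (\<Sum>i\<in>I. c i * Binf (F i) g)) at_top"
    by (rule Lim_transform_eventually)
qed simp

lemma classical_L2on:
  assumes "classical y"
  shows "L2on {1..X} y" "L2on {0<..1} y"
proof -
  have c: "continuous_on {0<..} y" using assms ac_dom_continuous_half by (simp add: classical_def)
  show "L2on {1..X} y" by (rule L2on_continuous[OF continuous_on_subset[OF c]]) auto
  obtain C where "\<And>x. 0 < x \<Longrightarrow> x \<le> 1 \<Longrightarrow> norm (y x) \<le> C" using assms unfolding classical_def by meson
  then show "L2on {0<..1} y"
    by (intro L2on_bounded[of _ _ C] continuous_on_subset[OF c]) auto
qed

lemma classical_max_dom:
  assumes y: "classical y" and M: "\<And>x. x > 0 \<Longrightarrow> M y x = z * y x + h x"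
    and h: "continuous_on {0..} h" "L2on {1..} h" and L: "L2on {1..} y"
  shows "y \<in> \<Delta>"
proof -
  have un: "{0<..1} \<union> {1..} = {0::real<..}" by auto
  have Ly: "L2on {0<..} y"
    using L2on_Un[OF classical_L2on(2)[OF y] L] by (simp add: un)
  have "L2on {0..1} h" by (rule L2on_continuous[OF continuous_on_subset[OF h(1)]]) auto
  then have "L2on {0<..1} h" by (rule L2on_subset) auto
  from L2on_Un[OF this h(2)] have Lh: "L2on {0<..} h" by (simp add: un)
  have "L2on {0<..} (\<lambda>x. z * y x + h x)" by (intro L2on_add L2on_cmult Ly Lh)
  then have "L2on {0<..} (M y)" by (rule L2on_cong_AE) (use M in auto)
  with Ly y show ?thesis by (simp add: max_dom_iff classical_def)
qed

end

section \<open>Linear systems over the complex numbers\<close>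

lemma homogeneous_solution_if_det_zero:
  fixes A :: "nat \<Rightarrow> nat \<Rightarrow> complex"
  assumes "Determinant.det (Matrix.mat n n (\<lambda>(i,j). A i j)) = 0"
  shows "\<exists>c. (\<exists>j<n. c j \<noteq> 0) \<and> (\<forall>i<n. (\<Sum>j<n. A i j * c j) = 0)"
proof -
  let ?M = "Matrix.mat n n (\<lambda>(i,j). A i j)"
  have M: "?M \<in> carrier_mat n n" by simp
  obtain v where v: "v \<in> carrier_vec n" "v \<noteq> 0\<^sub>v n" "?M *\<^sub>v v = 0\<^sub>v n"
    using det_0_iff_vec_prod_zero[OF M] assms by blast
  show ?thesis
  proof (intro exI[of _ "\<lambda>j. vec_index v j"] conjI allI impI)
    show "\<exists>j<n. vec_index v j \<noteq> 0"
    proof (rule ccontr)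
      assume "\<not> (\<exists>j<n. vec_index v j \<noteq> 0)"
      then have "v = 0\<^sub>v n" using v(1) by (intro eq_vecI) auto
      with v(2) show False by simp
    qed
    fix i assume i: "i < n"
    have "vec_index (?M *\<^sub>v v) i = 0" using v(3) i by simp
    moreover have "vec_index (?M *\<^sub>v v) i = (\<Sum>j<n. A i j * vec_index v j)"
      using i v(1) by (simp add: scalar_prod_def lessThan_atLeast0)
    ultimately show "(\<Sum>j<n. A i j * vec_index v j) = 0" by simp
  qed
qed

lemma only_zero_solution_if_det_nonzero:
  fixes A :: "nat \<Rightarrow> nat \<Rightarrow> complex"
  assumes "Determinant.det (Matrix.mat n n (\<lambda>(i,j). A i j)) \<noteq> 0"
    and "\<And>i. i < n \<Longrightarrow> (\<Sum>j<n. A i j * c j) = 0" and "j < n"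
  shows "c j = 0"
proof -
  let ?M = "Matrix.mat n n (\<lambda>(i,j). A i j)"
  have M: "?M \<in> carrier_mat n n" by simp
  have "?M *\<^sub>v (Matrix.vec n c) = 0\<^sub>v n"
    using assms(2) by (intro eq_vecI) (auto simp: scalar_prod_def lessThan_atLeast0)
  then have "Matrix.vec n c = 0\<^sub>v n"
    using det_0_iff_vec_prod_zero[OF M] assms(1) vec_carrier[of n c] by blast
  then have "vec_index (Matrix.vec n c) j = vec_index (0\<^sub>v n) j" by simp
  then show ?thesis using assms(3) by simp
qed

lemma square_system_solvable:
  fixes A :: "nat \<Rightarrow> nat \<Rightarrow> complex"
  assumes inj: "\<And>c. (\<And>i. i < n \<Longrightarrow> (\<Sum>j<n. A i j * c j) = 0) \<Longrightarrow> (\<forall>j<n. c j = 0)"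
  shows "\<exists>c. \<forall>i<n. (\<Sum>j<n. A i j * c j) = b i"
proof -
  let ?M = "Matrix.mat n n (\<lambda>(i,j). A i j)"
  have M: "?M \<in> carrier_mat n n" by simp
  have "Determinant.det ?M \<noteq> 0"
    using homogeneous_solution_if_det_zero[of n A] inj by blast
  from det_non_zero_imp_unit[OF M this]
  have "?M \<in> Units (ring_mat TYPE(complex) n undefined)" .
  then obtain N where N: "N \<in> carrier_mat n n" "?M * N = 1\<^sub>m n"
    unfolding Units_def by (auto simp: ring_mat_simps)
  define v where "v = N *\<^sub>v Matrix.vec n b"
  have v: "v \<in> carrier_vec n" using N by (simp add: v_def)
  have "?M *\<^sub>v v = (?M * N) *\<^sub>v Matrix.vec n b"
    unfolding v_def by (rule assoc_mult_mat_vec[OF M N(1) vec_carrier, symmetric])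
  also have "\<dots> = Matrix.vec n b" unfolding N(2) by (rule one_mult_mat_vec[OF vec_carrier])
  finally have eq: "?M *\<^sub>v v = Matrix.vec n b" .
  show ?thesis
  proof (intro exI[of _ "\<lambda>j. vec_index v j"] allI impI)
    fix i assume i: "i < n"
    have "vec_index (?M *\<^sub>v v) i = b i" using eq i by simp
    moreover have "vec_index (?M *\<^sub>v v) i = (\<Sum>j<n. A i j * vec_index v j)"
      using i v by (simp add: scalar_prod_def lessThan_atLeast0)
    ultimately show "(\<Sum>j<n. A i j * vec_index v j) = b i" by simp
  qed
qed

lemma underdetermined_system:
  fixes A :: "nat \<Rightarrow> nat \<Rightarrow> complex"
  assumes "p < n"
  shows "\<exists>c. (\<exists>j<n. c j \<noteq> 0) \<and> (\<forall>i<p. (\<Sum>j<n. A i j * c j) = 0)"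
proof -
  define A' where "A' i j = (if i < p then A i j else 0)" for i j
  have "\<exists>c. (\<exists>j<n. c j \<noteq> 0) \<and> (\<forall>i<n. (\<Sum>j<n. A' i j * c j) = 0)"
  proof (rule ccontr)
    assume no: "\<not> ?thesis"
    have "\<exists>c. \<forall>i<n. (\<Sum>j<n. A' i j * c j) = 1"
      by (rule square_system_solvable) (use no in blast)
    then obtain c where "(\<Sum>j<n. A' p j * c j) = 1" using assms by blast
    then show False by (simp add: A'_def)
  qed
  then obtain c where c: "\<exists>j<n. c j \<noteq> 0" "\<And>i. i < n \<Longrightarrow> (\<Sum>j<n. A' i j * c j) = 0" by blast
  have "(\<Sum>j<n. A i j * c j) = 0" if "i < p" for i
    using c(2)[of i] that assms by (simp add: A'_def)
  with c(1) show ?thesis by blast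
qed

text \<open>Cramer's argument: solve \<open>b f (G j) = (\<Sum>i. a i * b (F i) (G j))\<close> for \<open>a\<close> by means of the nonzero minor. A
  null vector of the bordered matrix must have a nonzero last entry, hence is proportional to \<open>(-a, 1)\<close>,
  and its row for \<open>g\<close> is the claim.\<close>

lemma bordered_minors:
  fixes b :: "'a \<Rightarrow> 'a \<Rightarrow> complex"
  assumes det: "Determinant.det (Matrix.mat r r (\<lambda>(i,j). b (F i) (G j))) \<noteq> 0"
    and border: "\<And>f g. f \<in> S \<Longrightarrow> g \<in> S \<Longrightarrow>
      Determinant.det (Matrix.mat (Suc r) (Suc r) (\<lambda>(i,j). b ((F(r := f)) i) ((G(r := g)) j))) = 0"
    and f: "f \<in> S"
  shows "\<exists>a. \<forall>g\<in>S. b f g = (\<Sum>i<r. a i * b (F i) g)"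
proof -
  have detT: "Determinant.det (Matrix.mat r r (\<lambda>(i,j). b (F j) (G i))) \<noteq> 0"
  proof -
    have "transpose_mat (Matrix.mat r r (\<lambda>(i,j). b (F i) (G j))) = Matrix.mat r r (\<lambda>(i,j). b (F j) (G i))"
      by (intro eq_matI) auto
    then show ?thesis using det det_transpose[of "Matrix.mat r r (\<lambda>(i,j). b (F i) (G j))" r] by simp
  qed
  obtain a where a: "\<And>j. j < r \<Longrightarrow> (\<Sum>i<r. b (F i) (G j) * a i) = b f (G j)"
    using square_system_solvable[of r "\<lambda>j i. b (F i) (G j)" "\<lambda>j. b f (G j)"]
      only_zero_solution_if_det_nonzero[OF detT] by blast
  show ?thesis
  proof (intro exI[of _ a] ballI)
    fix g assume g: "g \<in> S"
    let ?A = "\<lambda>i j. b ((F(r := f)) j) ((G(r := g)) i)"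
    have "transpose_mat (Matrix.mat (Suc r) (Suc r) (\<lambda>(i,j). b ((F(r := f)) i) ((G(r := g)) j)))
        = Matrix.mat (Suc r) (Suc r) (\<lambda>(i,j). ?A i j)"
      by (intro eq_matI) auto
    then have "Determinant.det (Matrix.mat (Suc r) (Suc r) (\<lambda>(i,j). ?A i j)) = 0"
      using border[OF f g] det_transpose[of "Matrix.mat (Suc r) (Suc r) (\<lambda>(i,j). b ((F(r := f)) i) ((G(r := g)) j))" "Suc r"]
      by simp
    from homogeneous_solution_if_det_zero[OF this]
    obtain c where c: "\<exists>j<Suc r. c j \<noteq> 0" "\<And>i. i < Suc r \<Longrightarrow> (\<Sum>j<Suc r. ?A i j * c j) = 0" by blast
    have row: "(\<Sum>j<r. b (F j) (G i) * c j) + b f (G i) * c r = 0" if "i < r" for i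
      using c(2)[of i] that by simp
    have last: "(\<Sum>j<r. b (F j) g * c j) + b f g * c r = 0"
      using c(2)[of r] by simp
    have cr: "c r \<noteq> 0"
    proof
      assume "c r = 0"
      then have "c j = 0" if "j < r" for j
        using only_zero_solution_if_det_nonzero[OF detT, of c j] row that by simp
      with c(1) \<open>c r = 0\<close> show False by (auto simp: less_Suc_eq)
    qed
    have "c j + c r * a j = 0" if "j < r" for j
    proof (rule only_zero_solution_if_det_nonzero[OF detT _ that])
      fix i assume i: "i < r"
      have "(\<Sum>j<r. b (F j) (G i) * (c j + c r * a j)) = (\<Sum>j<r. b (F j) (G i) * c j) + c r * (\<Sum>j<r. b (F j) (G i) * a j)"
        by (simp add: algebra_simps sum.distrib sum_distrib_left)
      then show "(\<Sum>j<r. b (F j) (G i) * (c j + c r * a j)) = 0"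
        using row[OF i] a[OF i] by (simp add: algebra_simps)
    qed
    then have cj: "c j = - (c r * a j)" if "j < r" for j
      using that by (simp add: eq_neg_iff_add_eq_0)
    have "(\<Sum>j<r. b (F j) g * c j) = - (c r * (\<Sum>j<r. a j * b (F j) g))"
      using cj by (simp add: sum_distrib_left sum_negf mult_ac)
    then have "c r * (b f g - (\<Sum>j<r. a j * b (F j) g)) = 0"
      using last by (simp add: algebra_simps)
    then show "b f g = (\<Sum>i<r. a i * b (F i) g)" using cr by simp
  qed
qed

lemma bounded_coordinates_convergent_subseq:
  fixes c :: "nat \<Rightarrow> nat \<Rightarrow> complex"
  assumes "\<And>n j. j < m \<Longrightarrow> norm (c n j) \<le> C"
  shows "\<exists>\<sigma> l. strict_mono (\<sigma> :: nat \<Rightarrow> nat) \<and> (\<forall>j<m. (\<lambda>n. c (\<sigma> n) j) \<longlonglongrightarrow> l j)"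
  using assms
proof (induction m)
  case 0
  show ?case by (intro exI[of _ id]) (auto simp: strict_mono_def)
next
  case (Suc m)
  then obtain \<sigma> l where \<sigma>: "strict_mono (\<sigma> :: nat \<Rightarrow> nat)" "\<And>j. j < m \<Longrightarrow> (\<lambda>n. c (\<sigma> n) j) \<longlonglongrightarrow> l j"
    by (metis less_SucI)
  have "bounded (range (\<lambda>n. c (\<sigma> n) m))"
    unfolding bounded_iff using Suc.prems by (intro exI[of _ C]) auto
  then obtain l' \<tau> where \<tau>: "strict_mono (\<tau> :: nat \<Rightarrow> nat)" "((\<lambda>n. c (\<sigma> n) m) \<circ> \<tau>) \<longlonglongrightarrow> l'"
    using bounded_imp_convergent_subsequence by blast
  show ?case
  proof (intro exI[of _ "\<sigma> \<circ> \<tau>"] exI[of _ "\<lambda>j. if j = m then l' else l j"] conjI allI impI)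
    show "strict_mono (\<sigma> \<circ> \<tau>)" using \<sigma>(1) \<tau>(1) by (rule strict_mono_o)
    fix j assume "j < Suc m"
    then consider "j = m" | "j < m" by linarith
    then show "(\<lambda>n. c ((\<sigma> \<circ> \<tau>) n) j) \<longlonglongrightarrow> (if j = m then l' else l j)"
    proof cases
      case 1
      then show ?thesis using \<tau>(2) by (simp add: o_def)
    next
      case 2
      then show ?thesis using LIMSEQ_subseq_LIMSEQ[OF \<sigma>(2)[OF 2] \<tau>(1)] by (simp add: o_def)
    qed
  qed
qed

section \<open>Fundamental systems and defect spaces\<close>

lemma nsq_eq_integral:
  assumes c: "continuous_on {a..b} f"
  shows "nsq {a..b} f = integral {a..b} (\<lambda>x. (norm (f x))\<^sup>2)"
proof -
  have "set_integrable lebesgue {a..b} (\<lambda>x. (norm (f x))\<^sup>2)"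
    using L2on_continuous[OF c] by (simp add: L2on_def)
  then show ?thesis unfolding nsq_def by (rule set_lebesgue_integral_eq_integral(2))
qed

lemma one_pos: "(0::real) < 1" by simp

lemma sum_fun_apply: "(\<Sum>v\<in>S. F v) x = (\<Sum>v\<in>S. (F v :: 'a \<Rightarrow> complex) x)"
  by (induction S rule: infinite_finite_induct) auto

lemma hderiv_zero_open:
  assumes f: "\<And>t. a < t \<Longrightarrow> t < b \<Longrightarrow> f t = 0" and x: "0 \<le> a" "a < x" "x < b"
  shows "(hderiv ^^ j) f x = 0"
  using x(2,3)
proof (induction j arbitrary: x)
  case (Suc j)
  have "((hderiv ^^ j) f has_vector_derivative 0) (at x within {0..})"
  proof (rule iffD2[OF has_vector_derivative_cong_ev])
    have "eventually (\<lambda>t. t \<in> {a<..<b}) (nhds x)" using Suc.prems by (intro eventually_nhds_in_open) auto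
    then show "\<forall>\<^sub>F t in nhds x. t \<in> {0..} \<longrightarrow> (hderiv ^^ j) f t = 0"
      by eventually_elim (use Suc.IH in auto)
    show "((\<lambda>_. 0) has_vector_derivative 0) (at x within {0..})" by simp
    show "(hderiv ^^ j) f x = 0" using Suc by auto
  qed
  then show ?case using x(1) Suc.prems by (simp add: hderiv_eqI_pos)
qed (use f in auto)

context odd_expr
begin

definition fund :: "complex \<Rightarrow> nat \<Rightarrow> real \<Rightarrow> complex" where
  "fund z j = (SOME y. classical y \<and> (\<forall>i\<le>2*k-2. (hderiv ^^ i) y 1 = (if i = j then 1 else 0)) \<and>
     (\<forall>x>0. M y x = z * y x))"

lemma fund:
  shows fund_classical: "classical (fund z j)"
    and fund_data: "i \<le> 2*k-2 \<Longrightarrow> (hderiv ^^ i) (fund z j) 1 = (if i = j then 1 else 0)"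
    and fund_M: "x > 0 \<Longrightarrow> M (fund z j) x = z * fund z j x"
proof -
  have "\<exists>y. classical y \<and> (\<forall>i\<le>2*k-2. (hderiv ^^ i) y 1 = (if i = j then 1 else 0)) \<and>
     (\<forall>x>0. M y x = z * y x)"
  proof (rule solution_exists[of 1 "\<lambda>_. 0" "\<lambda>i. if i = j then 1 else 0" z])
    fix y assume "classical y" "\<And>i. i \<le> 2*k-2 \<Longrightarrow> (hderiv ^^ i) y 1 = (if i = j then 1 else 0)"
      "\<And>x. x > 0 \<Longrightarrow> M y x = z * y x + 0"
    then show ?thesis by (intro exI[of _ y]) auto
  qed auto
  from someI_ex[OF this, folded fund_def] show "classical (fund z j)"
    "i \<le> 2*k-2 \<Longrightarrow> (hderiv ^^ i) (fund z j) 1 = (if i = j then 1 else 0)"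
    "x > 0 \<Longrightarrow> M (fund z j) x = z * fund z j x" by auto
qed

definition sol :: "complex \<Rightarrow> (nat \<Rightarrow> complex) \<Rightarrow> real \<Rightarrow> complex" where
  "sol z c = (\<lambda>x. \<Sum>j<2*k-1. c j * fund z j x)"

lemma classicalD:
  assumes "classical y"
  shows "ac_dom y" "\<And>x. x > 0 \<Longrightarrow> hdiff (2*k-1) {x} y" "\<And>x. x \<le> 0 \<Longrightarrow> y x = 0" "hdiff (2*k-2) {0<..} y"
  using assms by (auto simp: classical_def ac_dom_def)

lemma classical_lincomb:
  assumes I: "finite I" and F: "\<And>i. i \<in> I \<Longrightarrow> classical (F i)"
  shows "classical (\<lambda>x. \<Sum>i\<in>I. c i * F i x)"
  unfolding classical_def
proof (intro conjI allI impI)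
  show "(\<Sum>i\<in>I. c i * F i x) = 0" if "x \<le> 0" for x
    using classicalD(3)[OF F] that by (auto intro: sum.neutral)
  show "ac_dom (\<lambda>x. \<Sum>i\<in>I. c i * F i x)" by (rule ac_dom_lincomb[OF I classicalD(1)[OF F]])
  show "hdiff (2*k-1) {x} (\<lambda>x. \<Sum>i\<in>I. c i * F i x)" if "x > 0" for x
    unfolding order_Suc
    by (rule hdiff_lincomb(1)[OF I classicalD(4)[OF F] classicalD(2)[OF F that, unfolded order_Suc] that])
  fix X :: real
  have "\<forall>i\<in>I. \<exists>C. \<forall>x. 0 < x \<longrightarrow> x \<le> X \<longrightarrow> norm (F i x) \<le> C" using F by (auto simp: classical_def)
  from bchoice[OF this] obtain C where C: "\<forall>i\<in>I. \<forall>x. 0 < x \<longrightarrow> x \<le> X \<longrightarrow> norm (F i x) \<le> C i" by (elim exE)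
  have "norm (\<Sum>i\<in>I. c i * F i x) \<le> (\<Sum>i\<in>I. norm (c i) * C i)" if "0 < x" "x \<le> X" for x
    using C that by (intro sum_norm_le) (auto simp: norm_mult intro!: mult_left_mono)
  then show "\<exists>C. \<forall>x. 0 < x \<longrightarrow> x \<le> X \<longrightarrow> norm (\<Sum>i\<in>I. c i * F i x) \<le> C" by blast
qed

lemma sol_classical: "classical (sol z c)"
  unfolding sol_def by (rule classical_lincomb) (auto intro: fund_classical)

lemma sol_deriv:
  assumes "x > 0" "i \<le> 2*k-2"
  shows "(hderiv ^^ i) (sol z c) x = (\<Sum>j<2*k-1. c j * (hderiv ^^ i) (fund z j) x)"
  unfolding sol_def using assms classicalD(4)[OF fund_classical] by (intro hderiv_lincomb) auto

lemma sol_data: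
  assumes "i \<le> 2*k-2"
  shows "(hderiv ^^ i) (sol z c) 1 = c i"
proof -
  have "(hderiv ^^ i) (sol z c) 1 = (\<Sum>j<2*k-1. if j = i then c j else 0)"
    unfolding sol_deriv[OF one_pos assms] using assms by (intro sum.cong) (auto simp: fund_data)
  then show ?thesis using assms k2 by simp
qed

lemma sol_M:
  assumes "x > 0"
  shows "M (sol z c) x = z * sol z c x"
proof -
  have "M (sol z c) x = (\<Sum>j<2*k-1. c j * M (fund z j) x)"
    unfolding sol_def
    by (rule M_lincomb[OF _ classicalD(4)[OF fund_classical] classicalD(2)[OF fund_classical] assms])
       (use assms in auto)
  then show ?thesis using assms by (simp add: fund_M sol_def sum_distrib_left mult_ac)
qed

text \<open>Differences are linear combinations over the two-element index type, which transfers the results on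
  linear combinations to them.\<close>

lemma sub_lincomb: "(\<lambda>x. f x - g x) = (\<lambda>x. \<Sum>b\<in>UNIV. (if b then 1 else -1) * (if b then f else g) (x::real) :: complex)"
  by (simp add: UNIV_bool)

lemma ac_dom_diff:
  assumes "ac_dom f" "ac_dom g"
  shows "ac_dom (\<lambda>x. f x - g x)"
  unfolding sub_lincomb by (rule ac_dom_lincomb) (use assms in auto)

lemma hderiv_diff:
  assumes "ac_dom f" "ac_dom g" "x > 0" "j \<le> 2*k-2"
  shows "(hderiv ^^ j) (\<lambda>x. f x - g x) x = (hderiv ^^ j) f x - (hderiv ^^ j) g x"
  unfolding sub_lincomb
  by (subst hderiv_lincomb[where n = "2*k-2"]) (use assms in \<open>auto simp: UNIV_bool ac_dom_def\<close>)

lemma M_diff_ae: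
  assumes "ac_dom f" "ac_dom g"
  shows "AE x in lebesgue. x > 0 \<longrightarrow> M (\<lambda>x. f x - g x) x = M f x - M g x"
proof -
  have "AE x in lebesgue. x > 0 \<longrightarrow> M (\<lambda>x. \<Sum>b\<in>UNIV. (if b then 1 else -1) * (if b then f else g) x) x
      = (\<Sum>b\<in>UNIV. (if b then 1 else -1) * M (if b then f else g) x)"
    by (rule M_lincomb_ae) (use assms in auto)
  then show ?thesis unfolding sub_lincomb by eventually_elim (simp add: UNIV_bool)
qed

lemma green_form_diff_left:
  assumes "ac_dom f" "ac_dom g" "ac_dom h" "x > 0"
  shows "B (\<lambda>x. f x - g x) h x = B f h x - B g h x"
  unfolding sub_lincomb
  by (subst green_form_lincomb_left) (use assms in \<open>auto simp: UNIV_bool\<close>)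

lemma max_dom_diff: "f \<in> \<Delta> \<Longrightarrow> g \<in> \<Delta> \<Longrightarrow> (\<lambda>x. f x - g x) \<in> \<Delta>"
  unfolding sub_lincomb by (rule max_dom_lincomb) auto

lemma Binf_diff_left:
  assumes "f \<in> \<Delta>" "g \<in> \<Delta>" "h \<in> \<Delta>"
  shows "Binf (\<lambda>x. f x - g x) h = Binf f h - Binf g h"
  unfolding sub_lincomb
  by (subst Binf_lincomb_left) (use assms in \<open>auto simp: UNIV_bool\<close>)

lemma sol_unique:
  assumes f: "ac_dom f" and z: "\<And>x. x \<le> 0 \<Longrightarrow> f x = 0"
    and M: "AE x in lebesgue. x > 0 \<longrightarrow> M f x = z * f x"
  shows "f = sol z (\<lambda>j. (hderiv ^^ j) f 1)"
proof
  fix x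
  let ?s = "sol z (\<lambda>j. (hderiv ^^ j) f 1)"
  note s = classicalD[OF sol_classical, where z1 = z and c1 = "\<lambda>j. (hderiv ^^ j) f 1"]
  show "f x = ?s x"
  proof (cases "x > 0")
    case True
    have "(\<lambda>x. f x - ?s x) x = 0"
    proof (rule solution_unique_global[OF ac_dom_diff[OF f s(1)] _ one_pos _ True])
      show "AE x in lebesgue. 0 < x \<longrightarrow> M (\<lambda>x. f x - ?s x) x = z * (f x - ?s x)"
        using M M_diff_ae[OF f s(1)] by eventually_elim (simp add: sol_M algebra_simps)
      show "(hderiv ^^ j) (\<lambda>x. f x - ?s x) 1 = 0" if "j \<le> 2*k-2" for j
        using hderiv_diff[OF f s(1) one_pos that] sol_data[OF that] by simp
    qed
    then show ?thesis by simp
  qed (use z s(3) in auto)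
qed

lemma sol_zero_on_interval:
  assumes z0: "\<And>t. a < t \<Longrightarrow> t < b \<Longrightarrow> sol z c t = 0" and ab: "0 \<le> a" "a < b" and j: "j < 2*k-1"
  shows "c j = 0"
proof -
  let ?x = "(a+b)/2"
  have x: "?x > 0" "a < ?x" "?x < b" using ab by auto
  have "(hderiv ^^ j) (sol z c) 1 = 0"
  proof (rule solution_unique[OF classicalD(1)[OF sol_classical] _ x(1) _ one_pos])
    show "AE t in lebesgue. min ?x 1 \<le> t \<and> t \<le> max ?x 1 \<longrightarrow> M (sol z c) t = z * sol z c t"
      using sol_M x by (intro AE_I2) (auto simp: min_def split: if_splits)
    show "(hderiv ^^ j) (sol z c) ?x = 0" for j
      by (rule hderiv_zero_open[OF z0 ab(1) x(2,3)])
  qed (use j in auto)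
  then show ?thesis using sol_data[of j] j by simp
qed

lemma sol_continuous: "0 < a \<Longrightarrow> continuous_on {a..b} (sol z c)"
  using ac_dom_continuous_half[OF classicalD(1)[OF sol_classical]]
  by (rule continuous_on_subset) auto

lemma sol_L2on: "L2on {1..X} (sol z c)"
  by (rule classical_L2on[OF sol_classical])

lemma fund_L2on: "L2on {1..X} (fund z j)"
  by (rule classical_L2on[OF fund_classical])

text \<open>A null vector of the weighted Gram matrix is the coefficient vector of a solution whose weighted norm is
  zero; it vanishes on \<open>(1,X)\<close>, hence everywhere. The weight is used to switch a forcing term off continuously.\<close>

lemma gram_injective:
  assumes \<psi>: "continuous_on {1..X} \<psi>" "\<And>x. x \<in> {1..X} \<Longrightarrow> \<psi> x \<ge> 0" "\<And>x. 1 < x \<Longrightarrow> x < X \<Longrightarrow> \<psi> x > (0::real)"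
    and X: "1 < X"
    and zero: "\<And>i. i < 2*k-1 \<Longrightarrow> (\<Sum>j<2*k-1. ip {1..X} (\<lambda>x. of_real (\<psi> x) * fund z j x) (fund z i) * c j) = 0"
  shows "\<forall>j<2*k-1. c j = 0"
proof -
  have fc: "continuous_on {1..X} (fund z j)" for j
    using ac_dom_continuous_half[OF classicalD(1)[OF fund_classical]] by (rule continuous_on_subset) auto
  have L\<psi>: "L2on {1..X} (\<lambda>x. of_real (\<psi> x) * fund z j x)" for j
    by (intro L2on_continuous continuous_on_mult continuous_on_of_real \<psi>(1) fc)
  define w where "w x = of_real (\<psi> x) * sol z c x" for x
  have w: "w = (\<lambda>x. \<Sum>j<2*k-1. c j * (of_real (\<psi> x) * fund z j x))"
    by (auto simp: w_def sol_def sum_distrib_left mult_ac)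
  have Lw: "L2on {1..X} w" unfolding w by (rule L2on_lincomb) (auto intro: L\<psi>)
  have wi: "ip {1..X} w (fund z i) = 0" if "i < 2*k-1" for i
    using zero[OF that] unfolding w by (subst ip_lincomb) (auto intro: L\<psi> fund_L2on simp: mult.commute)
  have "ip {1..X} (sol z c) w = (\<Sum>j<2*k-1. c j * ip {1..X} (fund z j) w)"
    unfolding sol_def by (rule ip_lincomb) (auto intro: fund_L2on Lw)
  also have "\<dots> = 0" using wi ip_cnj[of "{1..X}" "fund z _" w] by simp
  finally have "ip {1..X} (sol z c) w = 0" .
  moreover have "ip {1..X} (sol z c) w = of_real (nsq {1..X} (\<lambda>x. of_real (sqrt (\<psi> x)) * sol z c x))"
    unfolding ip_self[symmetric] unfolding ip_def
  proof (rule set_lebesgue_integral_cong)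
    show "\<forall>x. x \<in> {1..X} \<longrightarrow> sol z c x * cnj (w x)
        = of_real (sqrt (\<psi> x)) * sol z c x * cnj (of_real (sqrt (\<psi> x)) * sol z c x)"
    proof (intro allI impI)
      fix x assume "x \<in> {1..X}"
      then have "of_real (sqrt (\<psi> x)) * of_real (sqrt (\<psi> x)) = complex_of_real (\<psi> x)"
        using \<psi>(2) by (simp flip: of_real_mult)
      then show "sol z c x * cnj (w x)
        = of_real (sqrt (\<psi> x)) * sol z c x * cnj (of_real (sqrt (\<psi> x)) * sol z c x)"
        unfolding w_def by (metis complex_cnj_complex_of_real complex_cnj_mult mult.assoc mult.left_commute)
    qed
  qed simp
  ultimately have n0: "nsq {1..X} (\<lambda>x. of_real (sqrt (\<psi> x)) * sol z c x) = 0" by simp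
  have cont: "continuous_on {1..X} (\<lambda>x. of_real (sqrt (\<psi> x)) * sol z c x)"
    by (intro continuous_on_mult continuous_on_of_real continuous_on_real_sqrt \<psi>(1) sol_continuous) auto
  have "sol z c x = 0" if x: "1 < x" "x < X" for x
  proof -
    have "integral {1..X} (\<lambda>x. (norm (of_real (sqrt (\<psi> x)) * sol z c x))\<^sup>2) = 0"
      using n0 nsq_eq_integral[OF cont] by simp
    moreover have "continuous_on {1..X} (\<lambda>x. (norm (of_real (sqrt (\<psi> x)) * sol z c x))\<^sup>2)"
      by (intro continuous_on_power continuous_on_norm cont)
    ultimately have "\<forall>x\<in>{1..X}. (norm (of_real (sqrt (\<psi> x)) * sol z c x))\<^sup>2 = 0"
      using integral_eq_0_iff[of 1 X "\<lambda>x. (norm (of_real (sqrt (\<psi> x)) * sol z c x))\<^sup>2"] X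
      by simp
    then have "of_real (sqrt (\<psi> x)) * sol z c x = 0" using x by auto
    then show ?thesis using \<psi>(3)[OF x] by simp
  qed
  then show ?thesis using sol_zero_on_interval[of 1 X] X by auto
qed

lemma sol_nsq_zero:
  assumes "nsq {1..X} (sol z c) = 0" "1 < X"
  shows "\<forall>j<2*k-1. c j = 0"
proof -
  have "sol z c x = 0" if x: "1 < x" "x < X" for x
  proof -
    have "integral {1..X} (\<lambda>x. (norm (sol z c x))\<^sup>2) = 0"
      using assms nsq_eq_integral[OF sol_continuous] by simp
    moreover have "continuous_on {1..X} (\<lambda>x. (norm (sol z c x))\<^sup>2)"
      by (intro continuous_on_power continuous_on_norm sol_continuous) simp
    ultimately have "\<forall>x\<in>{1..X}. (norm (sol z c x))\<^sup>2 = 0"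
      using integral_eq_0_iff[of 1 X "\<lambda>x. (norm (sol z c x))\<^sup>2"] assms(2) by simp
    then show ?thesis using x by auto
  qed
  then show ?thesis using sol_zero_on_interval[of 1 X] assms by auto
qed

abbreviation defect :: "complex \<Rightarrow> (real \<Rightarrow> complex) set" where "defect \<equiv> defect_space k s q"

lemma defectD:
  assumes "f \<in> defect z"
  shows "f \<in> \<Delta>" "AE x in lebesgue. x > 0 \<longrightarrow> M f x = z * f x" "f = sol z (\<lambda>j. (hderiv ^^ j) f 1)"
proof -
  show 1: "f \<in> \<Delta>" and 2: "AE x in lebesgue. x > 0 \<longrightarrow> M f x = z * f x"
    using assms by (auto simp: defect_space_def)
  show "f = sol z (\<lambda>j. (hderiv ^^ j) f 1)"
    using 1 by (intro sol_unique 2) (auto simp: max_dom_iff)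
qed

lemma sol_defect: "L2on {1..} (sol z c) \<Longrightarrow> sol z c \<in> defect z"
proof -
  assume L: "L2on {1..} (sol z c)"
  have "sol z c \<in> \<Delta>"
    by (rule classical_max_dom[OF sol_classical, where z = z and h = "\<lambda>_. 0"])
       (use L sol_M L2on_zero in simp_all)
  then show ?thesis unfolding defect_space_def using sol_M by simp
qed

lemma defect_lincomb:
  assumes I: "finite I" and F: "\<And>i. i \<in> I \<Longrightarrow> F i \<in> defect z"
  shows "(\<lambda>x. \<Sum>i\<in>I. c i * F i x) \<in> defect z"
proof -
  have D: "F i \<in> \<Delta>" if "i \<in> I" for i using F[OF that] defectD by blast
  have a: "ac_dom (F i)" if "i \<in> I" for i using D[OF that] max_domD by blast
  have "AE x in lebesgue. \<forall>i\<in>I. x > 0 \<longrightarrow> M (F i) x = z * F i x"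
    using defectD(2)[OF F] I by (intro AE_finite_allI) auto
  moreover have "AE x in lebesgue. x > 0 \<longrightarrow> M (\<lambda>x. \<Sum>i\<in>I. c i * F i x) x = (\<Sum>i\<in>I. c i * M (F i) x)"
    by (rule M_lincomb_ae[OF I a])
  ultimately have "AE x in lebesgue. x > 0 \<longrightarrow> M (\<lambda>x. \<Sum>i\<in>I. c i * F i x) x = z * (\<Sum>i\<in>I. c i * F i x)"
    by eventually_elim (auto simp: sum_distrib_left mult_ac intro!: sum.cong)
  then show ?thesis using max_dom_lincomb[OF I D] by (simp add: defect_space_def)
qed

lemma defect_data_zero:
  assumes "f \<in> defect z" "\<And>j. j \<le> 2*k-2 \<Longrightarrow> (hderiv ^^ j) f 1 = 0"
  shows "f = (\<lambda>_. 0)"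
proof -
  have "sol z (\<lambda>j. (hderiv ^^ j) f 1) = (\<lambda>_. 0)"
    unfolding sol_def using assms(2) by (auto intro!: ext sum.neutral)
  then show ?thesis using defectD(3)[OF assms(1)] by simp
qed

text \<open>Elements of the defect space are determined by their \<open>2k-1\<close> data at \<open>1\<close>, so more than \<open>2k-1\<close> of them
  are dependent. This makes the library dimension usable: it is the length of an explicit basis.\<close>

lemma defect_basis:
  obtains e where "cfun.dim (defect z) \<le> 2*k-1"
    "\<And>i. i < cfun.dim (defect z) \<Longrightarrow> e i \<in> defect z"
    "\<And>f. f \<in> defect z \<Longrightarrow> \<exists>c. f = (\<lambda>x. \<Sum>i<cfun.dim (defect z). c i * e i x)"
    "\<And>c i. (\<lambda>x. \<Sum>i<cfun.dim (defect z). c i * e i x) = (\<lambda>_. 0) \<Longrightarrow> i < cfun.dim (defect z) \<Longrightarrow> c i = 0"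
proof -
  obtain Bs where Bs: "Bs \<subseteq> defect z" "cfun.independent Bs" "defect z \<subseteq> cfun.span Bs" "card Bs = cfun.dim (defect z)"
    by (rule cfun.basis_exists[of "defect z"], rule that)
  have indep: "\<forall>i<n. c i = 0"
    if T: "T \<subseteq> Bs" "bij_betw h {0..<n} T" and zero: "(\<lambda>x. \<Sum>i<n. c i * h i x) = (\<lambda>_. 0)" for T h c and n :: nat
  proof (rule ccontr)
    assume "\<not> (\<forall>i<n. c i = 0)"
    then obtain i where i: "i < n" "c i \<noteq> 0" by blast
    have finT: "finite T" using bij_betw_finite[OF T(2)] by simp
    have inj: "inj_on h {0..<n}" and im: "h ` {0..<n} = T" using T(2) by (auto simp: bij_betw_def)
    define u where "u v = c (inv_into {0..<n} h v)" for v
    have uh: "u (h i) = c i" if "i < n" for i using inj that by (simp add: u_def)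
    have "(\<Sum>v\<in>T. (\<lambda>x. u v * v x)) = (\<lambda>_. 0)"
    proof
      fix x
      have "(\<Sum>v\<in>T. (\<lambda>x. u v * v x)) x = (\<Sum>v\<in>T. u v * v x)" by (rule sum_fun_apply)
      also have "\<dots> = (\<Sum>i\<in>{0..<n}. u (h i) * h i x)"
        unfolding im[symmetric] using inj by (simp add: sum.reindex)
      also have "\<dots> = (\<Sum>i<n. c i * h i x)" using uh by (simp add: lessThan_atLeast0)
      also have "\<dots> = 0" using zero by meson
      finally show "(\<Sum>v\<in>T. (\<lambda>x. u v * v x)) x = 0" .
    qed
    then have "(\<Sum>v\<in>T. (\<lambda>x. u v * v x)) = 0" by (simp add: zero_fun_def)
    moreover have "h i \<in> T" "u (h i) \<noteq> 0" using i im uh by auto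
    ultimately have "cfun.dependent T" unfolding cfun.dependent_finite[OF finT] by blast
    then show False using cfun.independent_mono[OF Bs(2) T(1)] by simp
  qed
  have small: "card T \<le> 2*k-1" if T: "finite T" "T \<subseteq> Bs" for T
  proof (rule ccontr)
    assume "\<not> card T \<le> 2*k-1"
    then have lt: "2*k-1 < card T" by simp
    obtain h where h: "bij_betw h {0..<card T} T" using ex_bij_betw_nat_finite[OF T(1)] by blast
    have hd: "h i \<in> defect z" if "i < card T" for i
    proof -
      have "h i \<in> T" using bij_betwE[OF h] that by simp
      then show ?thesis using T(2) Bs(1) by blast
    qed
    obtain c where c: "\<exists>j<card T. c j \<noteq> 0" "\<And>i. i < 2*k-1 \<Longrightarrow> (\<Sum>j<card T. (hderiv ^^ i) (h j) 1 * c j) = 0"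
      using underdetermined_system[OF lt, of "\<lambda>i j. (hderiv ^^ i) (h j) 1"] by blast
    have "(\<lambda>x. \<Sum>i<card T. c i * h i x) = (\<lambda>_. 0)"
    proof (rule defect_data_zero)
      show "(\<lambda>x. \<Sum>i<card T. c i * h i x) \<in> defect z" by (rule defect_lincomb) (use hd in auto)
      fix j assume j: "j \<le> 2*k-2"
      have "(hderiv ^^ j) (\<lambda>x. \<Sum>i<card T. c i * h i x) 1 = (\<Sum>i<card T. c i * (hderiv ^^ j) (h i) 1)"
        by (rule hderiv_lincomb[OF _ _ j]) (use hd defectD(1) in \<open>auto simp: max_dom_iff ac_dom_def\<close>)
      then show "(hderiv ^^ j) (\<lambda>x. \<Sum>i<card T. c i * h i x) 1 = 0"
        using c(2)[of j] j k2 by (simp add: mult.commute)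
    qed
    from indep[OF T(2) h this] c(1) show False by blast
  qed
  have fin: "finite Bs"
  proof (rule ccontr)
    assume "infinite Bs"
    then obtain T where "finite T" "card T = 2*k" "T \<subseteq> Bs" using infinite_arbitrarily_large by blast
    with small[of T] k2 show False by simp
  qed
  obtain e where e: "bij_betw e {0..<card Bs} Bs" using ex_bij_betw_nat_finite[OF fin] by blast
  show ?thesis
  proof (rule that[of e])
    show "cfun.dim (defect z) \<le> 2*k-1" using small[OF fin order_refl] Bs(4) by simp
    show "e i \<in> defect z" if "i < cfun.dim (defect z)" for i
    proof -
      have "e i \<in> Bs" using bij_betwE[OF e] that Bs(4) by simp
      then show ?thesis using Bs(1) by blast
    qed
    show "\<exists>c. f = (\<lambda>x. \<Sum>i<cfun.dim (defect z). c i * e i x)" if fd: "f \<in> defect z" for f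
    proof -
      obtain u where u: "f = (\<Sum>v\<in>Bs. (\<lambda>x. u v * v x))"
        using fd Bs(3) unfolding cfun.span_finite[OF fin] by blast
      have "f = (\<lambda>x. \<Sum>i<cfun.dim (defect z). u (e i) * e i x)"
      proof
        fix x
        have "f x = (\<Sum>v\<in>Bs. u v * v x)" unfolding u by (rule sum_fun_apply)
        also have "\<dots> = (\<Sum>i\<in>{0..<card Bs}. u (e i) * e i x)"
          using e by (intro sum.reindex_bij_betw[symmetric, of e]) auto
        finally show "f x = (\<Sum>i<cfun.dim (defect z). u (e i) * e i x)"
          by (simp add: Bs(4) lessThan_atLeast0)
      qed
      then show ?thesis by (rule exI[of _ "\<lambda>i. u (e i)"])
    qed
    show "c i = 0" if "(\<lambda>x. \<Sum>i<cfun.dim (defect z). c i * e i x) = (\<lambda>_. 0)" "i < cfun.dim (defect z)" for c i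
      using indep[OF order_refl e, of c] that Bs(4) by auto
  qed
qed

end

section \<open>Local and weak limits of square-integrable functions\<close>

lemma ip_cong:
  assumes "S \<in> sets lebesgue" "\<And>x. x \<in> S \<Longrightarrow> f x = f' x" "\<And>x. x \<in> S \<Longrightarrow> g x = g' x"
  shows "ip S f g = ip S f' g'"
  unfolding ip_def by (rule set_lebesgue_integral_cong) (use assms in auto)

lemma L2on_cong:
  assumes "L2on S f" "\<And>x. x \<in> S \<Longrightarrow> f x = g x"
  shows "L2on S g"
  by (rule L2on_cong_AE[OF assms(1)]) (use assms(2) in auto)

lemma L2on_diff: "L2on S f \<Longrightarrow> L2on S g \<Longrightarrow> L2on S (\<lambda>x. f x - g x)"
  using L2on_add[of S f "\<lambda>x. (-1) * g x"] L2on_cmult[of S g "-1"] by simp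

lemma ip_diff_left:
  assumes "L2on S f" "L2on S f'" "L2on S g"
  shows "ip S (\<lambda>x. f x - f' x) g = ip S f g - ip S f' g"
  using ip_add_left[of S f "\<lambda>x. (-1) * f' x" g] ip_cmult_left[of S f' g "-1"] L2on_cmult[of S f' "-1"] assms by simp

lemma nsq_add_le:
  assumes "L2on S f" "L2on S g"
  shows "nsq S (\<lambda>x. f x + g x) \<le> 2 * nsq S f + 2 * nsq S g"
  using nsq_lincomb[of "UNIV :: bool set" S "\<lambda>b. if b then f else g" "\<lambda>_. 1"] assms
  by (simp add: UNIV_bool add_ac)

lemma nsq_le_diff:
  assumes "L2on S f" "L2on S g"
  shows "nsq S f \<le> 2 * nsq S (\<lambda>x. f x - g x) + 2 * nsq S g"
  using nsq_add_le[OF L2on_diff[OF assms] assms(2)] by simp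

lemma nsq_lincomb_tendsto_0:
  fixes \<psi> :: "nat \<Rightarrow> real \<Rightarrow> complex"
  assumes \<psi>: "\<And>j. j < n \<Longrightarrow> L2on S (\<psi> j)" and d: "\<And>j. j < n \<Longrightarrow> (\<lambda>i. d i j) \<longlonglongrightarrow> 0"
  shows "(\<lambda>i. nsq S (\<lambda>x. \<Sum>j<n. d i j * \<psi> j x)) \<longlonglongrightarrow> 0"
proof (rule tendsto_sandwich[OF _ _ tendsto_const])
  show "\<forall>\<^sub>F i in sequentially. 0 \<le> nsq S (\<lambda>x. \<Sum>j<n. d i j * \<psi> j x)" by (simp add: nsq_nonneg)
  show "\<forall>\<^sub>F i in sequentially. nsq S (\<lambda>x. \<Sum>j<n. d i j * \<psi> j x)
      \<le> card {..<n} * (\<Sum>j<n. (norm (d i j))\<^sup>2 * nsq S (\<psi> j))"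
    by (intro always_eventually allI nsq_lincomb) (use \<psi> in auto)
  have "(\<lambda>i. card {..<n} * (\<Sum>j<n. (norm (d i j))\<^sup>2 * nsq S (\<psi> j)))
      \<longlonglongrightarrow> card {..<n} * (\<Sum>j<n. (norm (0::complex))\<^sup>2 * nsq S (\<psi> j))"
    by (intro tendsto_intros) (use d in auto)
  then show "(\<lambda>i. card {..<n} * (\<Sum>j<n. (norm (d i j))\<^sup>2 * nsq S (\<psi> j))) \<longlonglongrightarrow> 0" by simp
qed

text \<open>On \<open>[1,Y]\<close> the function is as close as desired to some \<open>G i\<close> with \<open>X i \<ge> Y\<close>, whose norm there is
  bounded by that on \<open>[1,X i]\<close>; the factor \<open>2\<close> comes from the crude triangle inequality for squared norms.\<close>

lemma L2on_of_local_limit: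
  assumes F: "\<And>Y. L2on {1..Y} F" and G: "\<And>i Y. L2on {1..Y} (G i)"
    and lim: "\<And>Y. (\<lambda>i. nsq {1..Y} (\<lambda>x. F x - G i x)) \<longlonglongrightarrow> 0"
    and X: "filterlim X at_top sequentially" and bd: "\<And>i. nsq {1..X i} (G i) \<le> K"
  shows "L2on {1..} F" "nsq {1..} F \<le> 2 * K"
proof -
  have "nsq {1..Y} F \<le> 2 * K" for Y
  proof (rule tendsto_lowerbound)
    have "(\<lambda>i. 2 * nsq {1..Y} (\<lambda>x. F x - G i x) + 2 * K) \<longlonglongrightarrow> 2 * 0 + 2 * K"
      by (intro tendsto_intros lim)
    then show "(\<lambda>i. 2 * nsq {1..Y} (\<lambda>x. F x - G i x) + 2 * K) \<longlonglongrightarrow> 2 * K" by simp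
    have "\<forall>\<^sub>F i in sequentially. Y \<le> X i" using X by (simp add: filterlim_at_top)
    then show "\<forall>\<^sub>F i in sequentially. nsq {1..Y} F \<le> 2 * nsq {1..Y} (\<lambda>x. F x - G i x) + 2 * K"
    proof eventually_elim
      case (elim i)
      have "nsq {1..Y} (G i) \<le> nsq {1..X i} (G i)" by (rule nsq_mono[OF G]) (use elim in auto)
      with nsq_le_diff[OF F G, of Y i] bd[of i] show ?case by linarith
    qed
  qed simp
  from nsq_limit_bound[OF F this] show "L2on {1..} F" "nsq {1..} F \<le> 2 * K" by auto
qed

lemma ip_split:
  assumes "L2on {a..c} f" "L2on {a..c} g" "a \<le> b" "b \<le> c"
  shows "ip {a..c} f g = ip {a..b} f g + ip {b<..c} f g"
proof -
  have un: "{a..c} = {a..b} \<union> {b<..c}" using assms by auto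
  have i: "set_integrable lebesgue {a..c} (\<lambda>x. f x * cnj (g x))" by (rule L2on_mult_integrable[OF assms(1,2)])
  have "set_integrable lebesgue {a..b} (\<lambda>x. f x * cnj (g x))" "set_integrable lebesgue {b<..c} (\<lambda>x. f x * cnj (g x))"
    using assms by (auto intro: set_integrable_subset[OF i])
  then show ?thesis unfolding ip_def un by (intro set_integral_Un) auto
qed

text \<open>On a fixed interval the product is small by the local limit; beyond it, the norm bound for \<open>W i\<close>
  meets the small tail of \<open>g\<close>.\<close>

lemma ip_weak_limit:
  assumes W: "\<And>i Y. L2on {1..Y} (W i)" and lim: "\<And>Y. (\<lambda>i. nsq {1..Y} (W i)) \<longlonglongrightarrow> 0"
    and X: "filterlim X at_top sequentially" and bd: "\<And>i. nsq {1..X i} (W i) \<le> K"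
    and g: "L2on {1..} g"
  shows "(\<lambda>i. ip {1..X i} (W i) g) \<longlonglongrightarrow> 0"
proof (rule LIMSEQ_I)
  fix \<epsilon>' :: real assume "\<epsilon>' > 0"
  define \<epsilon> where "\<epsilon> = \<epsilon>' / 3"
  have e: "\<epsilon> > 0" using \<open>\<epsilon>' > 0\<close> by (simp add: \<epsilon>_def)
  have K0: "K \<ge> 0" using order_trans[OF nsq_nonneg bd] .
  \<comment> \<open>\<open>t\<close> balances the tail estimate and \<open>t'\<close> the local one\<close>
  define t where "t = \<epsilon> / (K + 1)"
  have t: "t > 0" using e K0 by (simp add: t_def)
  have tK: "t * K \<le> \<epsilon>" using e K0 by (simp add: t_def field_simps)
  obtain R where R: "R \<ge> 1" "nsq {R<..} g < t * \<epsilon>" using nsq_tail[OF g, of "t * \<epsilon>"] t e by auto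
  define t' where "t' = (nsq {1..} g + 1) / \<epsilon>"
  have t': "t' > 0" unfolding t'_def using e nsq_nonneg[of "{1..}" g] by (intro divide_pos_pos) auto
  have tg: "nsq {1..} g / t' \<le> \<epsilon>"
    using e nsq_nonneg[of "{1..}" g] by (simp add: t'_def field_simps)
  have ev: "\<forall>\<^sub>F i in sequentially. nsq {1..R} (W i) < \<epsilon> / t'"
    by (rule order_tendstoD(2)[OF lim]) (use e t' in simp)
  have "\<forall>\<^sub>F i in sequentially. R \<le> X i" using X by (simp add: filterlim_at_top)
  with ev have "\<forall>\<^sub>F i in sequentially. norm (ip {1..X i} (W i) g - 0) < \<epsilon>'"
  proof eventually_elim
    case (elim i)
    have gX: "L2on S g" if "S \<subseteq> {1..}" "S \<in> sets lebesgue" for S by (rule L2on_subset[OF g that])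
    have WR: "L2on {R<..X i} (W i)" by (rule L2on_subset[OF W[of "X i" i]]) (use R in auto)
    have gR: "L2on {R<..X i} g" "L2on {1..R} g" "L2on {1..X i} g" using R by (auto intro: gX)
    have "norm (ip {1..R} (W i) g) \<le> (t' * nsq {1..R} (W i) + nsq {1..R} g / t') / 2"
      by (rule ip_bound[OF W gR(2) t'])
    also have "\<dots> \<le> (\<epsilon> + \<epsilon>) / 2"
    proof -
      have "t' * nsq {1..R} (W i) \<le> \<epsilon>" using elim t' by (simp add: field_simps)
      moreover have "nsq {1..R} g / t' \<le> nsq {1..} g / t'"
        using t' by (intro divide_right_mono nsq_mono[OF g]) auto
      then have "nsq {1..R} g / t' \<le> \<epsilon>" using tg by (rule order_trans)
      ultimately show ?thesis by (intro divide_right_mono add_mono) auto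
    qed
    finally have 1: "norm (ip {1..R} (W i) g) \<le> \<epsilon>" by simp
    have "norm (ip {R<..X i} (W i) g) \<le> (t * nsq {R<..X i} (W i) + nsq {R<..X i} g / t) / 2"
      by (rule ip_bound[OF WR gR(1) t])
    also have "\<dots> \<le> (\<epsilon> + \<epsilon>) / 2"
    proof -
      have "nsq {R<..X i} (W i) \<le> nsq {1..X i} (W i)" by (rule nsq_mono[OF W]) (use R in auto)
      then have "t * nsq {R<..X i} (W i) \<le> t * K" using bd[of i] t by (intro mult_left_mono) auto
      moreover have "nsq {R<..X i} g \<le> nsq {R<..} g"
        by (rule nsq_mono) (use R in \<open>auto intro: gX\<close>)
      then have "nsq {R<..X i} g / t \<le> \<epsilon>" using R(2) t by (simp add: field_simps)
      ultimately show ?thesis using order_trans[OF _ tK] by (intro divide_right_mono add_mono) auto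
    qed
    finally have 2: "norm (ip {R<..X i} (W i) g) \<le> \<epsilon>" by simp
    have "ip {1..X i} (W i) g = ip {1..R} (W i) g + ip {R<..X i} (W i) g"
      by (rule ip_split[OF W gR(3) R(1) elim(2)])
    then have "norm (ip {1..X i} (W i) g) \<le> \<epsilon> + \<epsilon>"
      using 1 2 norm_triangle_ineq[of "ip {1..R} (W i) g" "ip {R<..X i} (W i) g"] by simp
    then show ?case using e by (simp add: \<epsilon>_def)
  qed
  then show "\<exists>no. \<forall>n\<ge>no. norm (ip {1..X n} (W n) g - 0) < \<epsilon>'"
    unfolding eventually_sequentially .
qed

context odd_expr
begin

section \<open>Lower bounds for the defect numbers\<close>

lemma sol_M_L2on: "L2on {1..X} (M (sol z c))"
  by (rule L2on_cong[OF L2on_cmult[OF sol_L2on, of X z z c]]) (simp add: sol_M)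

lemma sol_green:
  assumes "X \<ge> 1"
  shows "B (sol z c) (sol z c) X - B (sol z c) (sol z c) 1 = (z - cnj z) * of_real (nsq {1..X} (sol z c))"
proof -
  let ?f = "sol z c"
  have a: "ac_dom ?f" by (rule classicalD(1)[OF sol_classical])
  have "B ?f ?f X - B ?f ?f 1 = ip {1..X} (M ?f) ?f - ip {1..X} ?f (M ?f)"
    by (rule green_ip[OF a a one_pos assms sol_L2on sol_M_L2on sol_L2on sol_M_L2on])
  also have "ip {1..X} (M ?f) ?f = ip {1..X} (\<lambda>x. z * ?f x) ?f"
    by (rule ip_cong) (auto simp: sol_M)
  also have "ip {1..X} ?f (M ?f) = ip {1..X} ?f (\<lambda>x. z * ?f x)"
    by (rule ip_cong) (auto simp: sol_M)
  finally show ?thesis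
    by (simp add: ip_cmult_left ip_cmult_right sol_L2on ip_self left_diff_distrib)
qed

text \<open>Weyl's argument. If the defect space had dimension less than \<open>p\<close>, there would be, for every \<open>X\<close>, a unit
  coefficient vector that is orthogonal to the data of the defect space and whose solution has its first
  \<open>2k-1-p\<close> derivatives zero at \<open>X\<close>: these are fewer conditions than unknowns. The hypothesis bounds the
  solutions in \<open>L\<^sup>2\<close> independently of \<open>X\<close>, so a limit vector belongs to a solution in the defect space. Its
  data are orthogonal to themselves although the vector has norm one.\<close>

lemma defect_dim_lower:
  assumes p: "p \<le> 2*k-1"
    and bd: "\<And>c X. X \<ge> 1 \<Longrightarrow> (\<And>a. a < 2*k-1-p \<Longrightarrow> (hderiv ^^ a) (sol z c) X = 0) \<Longrightarrow>
      nsq {1..X} (sol z c) \<le> norm (B (sol z c) (sol z c) 1)"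
  shows "p \<le> cfun.dim (defect z)"
proof (rule ccontr)
  define m where "m = 2*k-1"
  define N where "N = cfun.dim (defect z)"
  assume "\<not> p \<le> cfun.dim (defect z)"
  then have Np: "N < p" by (simp add: N_def)
  obtain e where e0: "cfun.dim (defect z) \<le> 2*k-1"
    "\<And>i. i < cfun.dim (defect z) \<Longrightarrow> e i \<in> defect z"
    "\<And>f. f \<in> defect z \<Longrightarrow> \<exists>c. f = (\<lambda>x. \<Sum>i<cfun.dim (defect z). c i * e i x)"
    "\<And>c i. (\<lambda>x. \<Sum>i<cfun.dim (defect z). c i * e i x) = (\<lambda>_. 0) \<Longrightarrow> i < cfun.dim (defect z) \<Longrightarrow> c i = 0"
    by (rule defect_basis[of z], rule that)
  note e = e0(2,3)[folded N_def]
  have "\<exists>c. (\<Sum>j<m. norm (c j)) = 1 \<and> (\<forall>a<m-p. (hderiv ^^ a) (sol z c) (real n + 1) = 0) \<and>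
      (\<forall>i<N. (\<Sum>j<m. c j * cnj ((hderiv ^^ j) (e i) 1)) = 0)" for n
  proof -
    \<comment> \<open>the first \<open>m-p\<close> rows are the conditions at \<open>X = n+1\<close>, the others express the orthogonality\<close>
    define A where "A i j = (if i < m-p then (hderiv ^^ i) (fund z j) (real n + 1)
        else cnj ((hderiv ^^ j) (e (i - (m-p))) 1))" for i j
    have lt: "(m-p) + N < m" using Np p by (simp add: m_def)
    obtain c where c: "\<exists>j<m. c j \<noteq> 0" "\<And>i. i < (m-p) + N \<Longrightarrow> (\<Sum>j<m. A i j * c j) = 0"
      using underdetermined_system[OF lt, of A] by blast
    define S where "S = (\<Sum>j<m. norm (c j))"
    have S: "S > 0"
    proof -
      obtain j where "j < m" "c j \<noteq> 0" using c(1) by blast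
      then have "0 < norm (c j)" "norm (c j) \<le> S"
        unfolding S_def by (auto intro!: member_le_sum)
      then show ?thesis by linarith
    qed
    define d where "d j = c j / of_real S" for j
    have dsum: "(\<Sum>j<m. d j * w j) = (\<Sum>j<m. c j * w j) / of_real S" for w
      by (simp add: d_def sum_divide_distrib)
    show ?thesis
    proof (intro exI[of _ d] conjI allI impI)
      have "(\<Sum>j<m. norm (d j)) = (\<Sum>j<m. norm (c j)) / S"
        using S by (simp add: d_def norm_divide sum_divide_distrib)
      then show "(\<Sum>j<m. norm (d j)) = 1" using S by (simp add: S_def)
      fix a assume a: "a < m - p"
      have "(\<Sum>j<m. c j * (hderiv ^^ a) (fund z j) (real n + 1)) = 0"
        using c(2)[of a] a by (simp add: A_def mult.commute)
      then have "(\<Sum>j<m. d j * (hderiv ^^ a) (fund z j) (real n + 1)) = 0" by (simp add: dsum)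
      moreover have "(hderiv ^^ a) (sol z d) (real n + 1) = (\<Sum>j<2*k-1. d j * (hderiv ^^ a) (fund z j) (real n + 1))"
        by (rule sol_deriv) (use a m_def in auto)
      ultimately show "(hderiv ^^ a) (sol z d) (real n + 1) = 0" by (simp add: m_def)
    next
      fix i assume i: "i < N"
      have "(\<Sum>j<m. c j * cnj ((hderiv ^^ j) (e i) 1)) = 0"
        using c(2)[of "(m-p)+i"] i by (simp add: A_def mult.commute)
      then show "(\<Sum>j<m. d j * cnj ((hderiv ^^ j) (e i) 1)) = 0" by (simp add: dsum)
    qed
  qed
  then have "\<forall>n. \<exists>c. (\<Sum>j<m. norm (c j)) = 1 \<and> (\<forall>a<m-p. (hderiv ^^ a) (sol z c) (real n + 1) = 0) \<and>
      (\<forall>i<N. (\<Sum>j<m. c j * cnj ((hderiv ^^ j) (e i) 1)) = 0)" by blast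
  from choice[OF this] obtain C where C0: "\<forall>n. (\<Sum>j<m. norm (C n j)) = 1 \<and>
      (\<forall>a<m-p. (hderiv ^^ a) (sol z (C n)) (real n + 1) = 0) \<and>
      (\<forall>i<N. (\<Sum>j<m. C n j * cnj ((hderiv ^^ j) (e i) 1)) = 0)" by (elim exE)
  have C: "(\<Sum>j<m. norm (C n j)) = 1" "\<And>a. a < m-p \<Longrightarrow> (hderiv ^^ a) (sol z (C n)) (real n + 1) = 0"
    "\<And>i. i < N \<Longrightarrow> (\<Sum>j<m. C n j * cnj ((hderiv ^^ j) (e i) 1)) = 0" for n
    using C0 by blast+
  have C1: "norm (C n j) \<le> 1" if "j < m" for n j
    using member_le_sum[of j "{..<m}" "\<lambda>j. norm (C n j)"] C(1)[of n] that by simp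
  obtain \<sigma> l where \<sigma>: "strict_mono (\<sigma> :: nat \<Rightarrow> nat)" "\<And>j. j < m \<Longrightarrow> (\<lambda>n. C (\<sigma> n) j) \<longlonglongrightarrow> l j"
    using bounded_coordinates_convergent_subseq[of m C 1] C1 by blast
  define K where "K = (\<Sum>a\<le>2*k-2. \<Sum>b\<le>2*k-2. norm (boundary_matrix a b 1))"
  have BK: "norm (B (sol z (C n)) (sol z (C n)) 1) \<le> K" for n
  proof -
    have h: "hdiff (2*k-2) {0<..} (sol z (C n))" by (rule classicalD(4)[OF sol_classical])
    have "B (sol z (C n)) (sol z (C n)) 1 = (\<Sum>a\<le>2*k-2. \<Sum>b\<le>2*k-2. boundary_matrix a b 1 * C n a * cnj (C n b))"
      unfolding boundary_matrix(1)[OF one_pos h h] by (intro sum.cong refl) (simp add: sol_data)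
    also have "norm \<dots> \<le> K"
      unfolding K_def
    proof (intro sum_norm_le)
      fix a b assume ab: "a \<in> {..2*k-2}" "b \<in> {..2*k-2}"
      then have "norm (C n a) \<le> 1" "norm (C n b) \<le> 1" using C1[of a n] C1[of b n] k2 by (auto simp: m_def)
      then have "norm (C n a) * norm (C n b) \<le> 1 * 1" by (intro mult_mono) auto
      then have "norm (boundary_matrix a b 1) * (norm (C n a) * norm (C n b)) \<le> norm (boundary_matrix a b 1) * 1"
        by (intro mult_left_mono) auto
      then show "norm (boundary_matrix a b 1 * C n a * cnj (C n b)) \<le> norm (boundary_matrix a b 1)"
        by (simp add: norm_mult mult.assoc)
    qed
    finally show ?thesis .
  qed
  have L: "L2on {1..} (sol z l)"
  proof (rule L2on_of_local_limit(1)[where G = "\<lambda>n. sol z (C (\<sigma> n))" and X = "\<lambda>n. real (\<sigma> n) + 1" and K = K])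
    show "(\<lambda>n. nsq {1..Y} (\<lambda>x. sol z l x - sol z (C (\<sigma> n)) x)) \<longlonglongrightarrow> 0" for Y
    proof -
      have "(\<lambda>n. l j - C (\<sigma> n) j) \<longlonglongrightarrow> 0" if "j < m" for j
        using tendsto_diff[OF tendsto_const \<sigma>(2)[OF that], of "l j"] by simp
      then have "(\<lambda>n. nsq {1..Y} (\<lambda>x. \<Sum>j<m. (l j - C (\<sigma> n) j) * fund z j x)) \<longlonglongrightarrow> 0"
        by (intro nsq_lincomb_tendsto_0) (auto intro: fund_L2on)
      then show ?thesis by (simp add: sol_def m_def left_diff_distrib sum_subtractf)
    qed
    have "filterlim (\<lambda>n. real (\<sigma> n)) at_top sequentially"
      by (rule filterlim_compose[OF filterlim_real_sequentially filterlim_subseq[OF \<sigma>(1)]])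
    then show "filterlim (\<lambda>n. real (\<sigma> n) + 1) at_top sequentially"
      by (rule filterlim_at_top_mono) (auto intro: always_eventually)
    show "nsq {1..real (\<sigma> n) + 1} (sol z (C (\<sigma> n))) \<le> K" for n
      using bd[of "real (\<sigma> n) + 1" "C (\<sigma> n)"] C(2)[of _ "\<sigma> n"] BK[of "\<sigma> n"] by (simp add: m_def)
  qed (rule sol_L2on)+
  obtain d where d: "sol z l = (\<lambda>x. \<Sum>i<N. d i * e i x)" using e(2)[OF sol_defect[OF L]] by blast
  have l: "l j = (\<Sum>i<N. d i * (hderiv ^^ j) (e i) 1)" if "j < m" for j
  proof -
    have "l j = (hderiv ^^ j) (sol z l) 1" using that by (simp add: sol_data m_def)
    also have "\<dots> = (\<Sum>i<N. d i * (hderiv ^^ j) (e i) 1)"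
      unfolding d
      by (rule hderiv_lincomb[where n = "2*k-2"])
         (use e(1) defectD(1) that in \<open>auto simp: max_dom_iff ac_dom_def m_def\<close>)
    finally show ?thesis .
  qed
  have orth: "(\<Sum>j<m. l j * cnj ((hderiv ^^ j) (e i) 1)) = 0" if "i < N" for i
  proof -
    have "(\<lambda>n. \<Sum>j<m. C (\<sigma> n) j * cnj ((hderiv ^^ j) (e i) 1)) \<longlonglongrightarrow> (\<Sum>j<m. l j * cnj ((hderiv ^^ j) (e i) 1))"
      by (intro tendsto_sum tendsto_mult tendsto_const \<sigma>(2)) auto
    then show ?thesis using C(3)[OF that] by (simp add: LIMSEQ_const_iff)
  qed
  have "(\<Sum>j<m. l j * cnj (l j)) = (\<Sum>j<m. \<Sum>i<N. cnj (d i) * (l j * cnj ((hderiv ^^ j) (e i) 1)))"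
    by (intro sum.cong refl) (simp add: l sum_distrib_left mult_ac)
  also have "\<dots> = (\<Sum>i<N. cnj (d i) * (\<Sum>j<m. l j * cnj ((hderiv ^^ j) (e i) 1)))"
    by (subst sum.swap) (simp add: sum_distrib_left)
  also have "\<dots> = 0" using orth by simp
  finally have "(\<Sum>j<m. l j * cnj (l j)) = 0" .
  then have "complex_of_real (\<Sum>j<m. (norm (l j))\<^sup>2) = 0"
    by (simp only: of_real_sum complex_norm_square)
  then have "(\<Sum>j<m. (norm (l j))\<^sup>2) = 0" by (simp only: of_real_eq_0_iff)
  then have l0: "l j = 0" if "j < m" for j
    using that by (subst (asm) sum_nonneg_eq_0_iff) auto
  have "(\<lambda>n. \<Sum>j<m. norm (C (\<sigma> n) j)) \<longlonglongrightarrow> (\<Sum>j<m. norm (l j))"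
    by (intro tendsto_sum tendsto_norm \<sigma>(2)) auto
  then show False using C(1) l0 by (simp add: LIMSEQ_const_iff)
qed

text \<open>With the first \<open>k\<close> derivatives zero at \<open>X\<close>, all remaining entries of the boundary matrix lie beyond the
  antidiagonal and the form vanishes there. With only \<open>k-1\<close> of them zero, the central entry survives and
  contributes \<open>i q\<^sub>k\<^sub>-\<^sub>1 \<bar>f\<^sup>(\<^sup>k\<^sup>-\<^sup>1\<^sup>)\<bar>\<^sup>2\<close>, which has the right sign for \<open>z = -i\<close>.\<close>

lemma defect_dim_ge:
  shows "k - 1 \<le> cfun.dim (defect \<i>)" and "k \<le> cfun.dim (defect (-\<i>))"
proof -
  show "k - 1 \<le> cfun.dim (defect \<i>)"
  proof (rule defect_dim_lower)
    fix c and X :: real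
    assume X: "X \<ge> 1" and D: "\<And>a. a < 2*k-1-(k-1) \<Longrightarrow> (hderiv ^^ a) (sol \<i> c) X = 0"
    have Xp: "X > 0" using X by simp
    let ?f = "sol \<i> c"
    have h: "hdiff (2*k-2) {0<..} ?f" by (rule classicalD(4)[OF sol_classical])
    have "B ?f ?f X = 0"
      unfolding boundary_matrix(1)[OF Xp h h]
    proof (intro sum.neutral ballI)
      fix a b
      show "boundary_matrix a b X * (hderiv ^^ a) ?f X * cnj ((hderiv ^^ b) ?f X) = 0"
      proof (cases "a < k \<or> b < k")
        case True
        then show ?thesis using D[of a] D[of b] by auto
      next
        case False
        then have "a + b > 2*k-2" using k2 by linarith
        then show ?thesis using boundary_matrix(2)[OF Xp, of a b] by simp
      qed
    qed
    then have "norm (B ?f ?f 1) = norm (B ?f ?f X - B ?f ?f 1)" by simp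
    also have "\<dots> = 2 * nsq {1..X} ?f"
      unfolding sol_green[OF X, of \<i> c] using nsq_nonneg[of "{1..X}" ?f] by (simp add: norm_mult)
    finally have "norm (B ?f ?f 1) = 2 * nsq {1..X} ?f" .
    then show "nsq {1..X} ?f \<le> norm (B ?f ?f 1)" using nsq_nonneg[of "{1..X}" ?f] by simp
  qed simp
  show "k \<le> cfun.dim (defect (-\<i>))"
  proof (rule defect_dim_lower)
    fix c and X :: real
    assume X: "X \<ge> 1" and D: "\<And>a. a < 2*k-1-k \<Longrightarrow> (hderiv ^^ a) (sol (-\<i>) c) X = 0"
    have Xp: "X > 0" using X by simp
    let ?f = "sol (-\<i>) c"
    define w where "w = (hderiv ^^ (k-1)) ?f X"
    have h: "hdiff (2*k-2) {0<..} ?f" by (rule classicalD(4)[OF sol_classical])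
    have "B ?f ?f X = (\<Sum>a\<le>2*k-2. \<Sum>b\<le>2*k-2. if a = k-1 then if b = k-1 then \<i> * of_real (q (k-1) X) * w * cnj w else 0 else 0)"
      unfolding boundary_matrix(1)[OF Xp h h]
    proof (intro sum.cong refl)
      fix a b
      show "boundary_matrix a b X * (hderiv ^^ a) ?f X * cnj ((hderiv ^^ b) ?f X)
          = (if a = k-1 then if b = k-1 then \<i> * of_real (q (k-1) X) * w * cnj w else 0 else 0)"
      proof (cases "a < k-1 \<or> b < k-1")
        case True
        then show ?thesis using D[of a] D[of b] by auto
      next
        case ge: False
        show ?thesis
        proof (cases "a = k-1 \<and> b = k-1")
          case True
          then show ?thesis using boundary_matrix(4)[OF Xp] by (simp add: w_def)
        next
          case False
          then have "a + b > 2*k-2" using ge by auto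
          then show ?thesis using boundary_matrix(2)[OF Xp, of a b] False by auto
        qed
      qed
    qed
    also have "\<dots> = (\<Sum>a\<le>2*k-2. if a = k-1 then \<i> * of_real (q (k-1) X) * w * cnj w else 0)"
      by (intro sum.cong refl) simp
    also have "\<dots> = \<i> * of_real (q (k-1) X) * w * cnj w" by simp
    also have "\<dots> = \<i> * of_real (q (k-1) X * (norm w)\<^sup>2)"
      by (simp only: of_real_mult complex_norm_square mult.assoc)
    finally have "Im (B ?f ?f X) \<ge> 0" using q_pos[of X] X by simp
    moreover have "Im (B ?f ?f X) - Im (B ?f ?f 1) = - 2 * nsq {1..X} ?f"
      using arg_cong[OF sol_green[OF X, of "-\<i>" c], of Im] by simp
    ultimately have "2 * nsq {1..X} ?f \<le> Im (B ?f ?f 1)" by linarith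
    also have "\<dots> \<le> norm (B ?f ?f 1)" using abs_Im_le_cmod[of "B ?f ?f 1"] by linarith
    finally show "nsq {1..X} ?f \<le> norm (B ?f ?f 1)" using nsq_nonneg[of "{1..X}" ?f] by linarith
  qed (use k2 in simp)
qed

section \<open>Orthogonality to the defect space\<close>

lemma gram_solvable:
  assumes X: "1 < X"
  shows "\<exists>c. \<forall>i<2*k-1. (\<Sum>j<2*k-1. ip {1..X} (fund z j) (fund z i) * c j) = b i"
proof (rule square_system_solvable)
  fix c assume "\<And>i. i < 2*k-1 \<Longrightarrow> (\<Sum>j<2*k-1. ip {1..X} (fund z j) (fund z i) * c j) = 0"
  then show "\<forall>j<2*k-1. c j = 0"
    using gram_injective[of X "\<lambda>_. 1" z c] X by simp
qed

lemma ip_sol_left: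
  assumes "L2on {1..X} g"
  shows "ip {1..X} (sol z c) g = (\<Sum>j<2*k-1. c j * ip {1..X} (fund z j) g)"
  unfolding sol_def by (rule ip_lincomb) (auto intro: fund_L2on assms)

lemma ip_sol_right:
  assumes "L2on {1..X} g"
  shows "ip {1..X} g (sol z c) = (\<Sum>j<2*k-1. cnj (c j) * ip {1..X} g (fund z j))"
proof -
  have "ip {1..X} g (sol z c) = cnj (ip {1..X} (sol z c) g)" by (rule ip_cnj)
  also have "\<dots> = (\<Sum>j<2*k-1. cnj (c j) * ip {1..X} g (fund z j))"
    unfolding ip_sol_left[OF assms] by (simp add: ip_cnj[of _ g])
  finally show ?thesis .
qed

text \<open>Coefficients are inner products with the basis dual to the fundamental system in \<open>L\<^sup>2(1,2)\<close>.\<close>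

lemma sol_coeff_bound:
  shows "\<exists>C. \<forall>c. nsq {1..2} (sol z c) \<le> H \<longrightarrow> (\<forall>j<2*k-1. norm (c j) \<le> C)"
proof -
  have "\<forall>l. \<exists>d. \<forall>i<2*k-1. (\<Sum>j<2*k-1. ip {1..2} (fund z j) (fund z i) * d j) = (if i = l then 1 else 0)"
    using gram_solvable[of 2] by simp
  from choice[OF this] obtain d where
    d: "\<forall>l. \<forall>i<2*k-1. (\<Sum>j<2*k-1. ip {1..2} (fund z j) (fund z i) * d l j) = (if i = l then 1 else 0)"
    by (elim exE)
  define C where "C = (\<bar>H\<bar> + (\<Sum>l<2*k-1. nsq {1..2} (sol z (d l)))) / 2"
  show ?thesis
  proof (intro exI[of _ C] allI impI)
    fix c l assume c: "nsq {1..2} (sol z c) \<le> H" and l: "l < 2*k-1"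
    have dual: "ip {1..2} (sol z (d l)) (fund z i) = (if i = l then 1 else 0)" if "i < 2*k-1" for i
      using d that by (simp add: ip_sol_left fund_L2on mult.commute)
    have "ip {1..2} (sol z (d l)) (sol z c) = (\<Sum>j<2*k-1. if j = l then cnj (c j) else 0)"
      unfolding ip_sol_right[OF sol_L2on] using dual by (intro sum.cong) auto
    also have "\<dots> = cnj (c l)" using l by simp
    finally have "norm (c l) = norm (ip {1..2} (sol z (d l)) (sol z c))" by simp
    also have "\<dots> \<le> (1 * nsq {1..2} (sol z (d l)) + nsq {1..2} (sol z c) / 1) / 2"
      by (rule ip_bound[OF sol_L2on sol_L2on]) simp
    also have "\<dots> \<le> C"
    proof -
      have "nsq {1..2} (sol z (d l)) \<le> (\<Sum>l<2*k-1. nsq {1..2} (sol z (d l)))"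
        using l by (intro member_le_sum) (auto simp: nsq_nonneg)
      then show ?thesis using c by (simp add: C_def)
    qed
    finally show "norm (c l) \<le> C" .
  qed
qed

lemma sol_projection:
  assumes X: "1 < X" and g: "L2on {1..X} g"
  shows "\<exists>c. \<forall>c'. ip {1..X} (\<lambda>x. g x - sol z c x) (sol z c') = 0"
proof -
  obtain c where c: "\<And>i. i < 2*k-1 \<Longrightarrow> (\<Sum>j<2*k-1. ip {1..X} (fund z j) (fund z i) * c j) = ip {1..X} g (fund z i)"
    using gram_solvable[OF X, of z "\<lambda>i. ip {1..X} g (fund z i)"] by blast
  have 0: "ip {1..X} (\<lambda>x. g x - sol z c x) (fund z i) = 0" if "i < 2*k-1" for i
    using c[OF that] by (simp add: ip_diff_left g sol_L2on fund_L2on ip_sol_left mult.commute)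
  have "ip {1..X} (\<lambda>x. g x - sol z c x) (sol z c') = 0" for c'
    unfolding ip_sol_right[OF L2on_diff[OF g sol_L2on]] using 0 by simp
  then show ?thesis by blast
qed

text \<open>Solutions attain arbitrary data at \<open>X\<close>, so nondegeneracy of the boundary form applies.\<close>

lemma sol_boundary_separates:
  assumes y: "ac_dom y" and X: "X > 0" and zero: "\<And>c. B y (sol z c) X = 0" and a: "a \<le> 2*k-2"
  shows "(hderiv ^^ a) y X = 0"
proof (rule boundary_form_nondegenerate[OF X _ a])
  fix b assume b: "b \<le> 2*k-2"
  obtain g where g: "classical g" "\<And>j. j \<le> 2*k-2 \<Longrightarrow> (hderiv ^^ j) g X = (if j = b then 1 else 0)"
    "\<And>x. x > 0 \<Longrightarrow> M g x = z * g x + 0"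
    by (rule solution_exists[OF X continuous_on_const[of _ 0], where c = "\<lambda>j. if j = b then 1 else 0" and z = z], rule that)
  have ag: "ac_dom g" using classicalD(1)[OF g(1)] .
  have gs: "g = sol z (\<lambda>j. (hderiv ^^ j) g 1)"
    by (rule sol_unique[OF ag]) (use g(3) classicalD(3)[OF g(1)] in auto)
  have "B y g X = 0" by (subst gs) (rule zero)
  moreover have "B y g X = (\<Sum>a\<le>2*k-2. \<Sum>b'\<le>2*k-2. if b' = b then boundary_matrix a b X * (hderiv ^^ a) y X else 0)"
    unfolding boundary_matrix(1)[OF X ac_dom_hdiff[OF y] ac_dom_hdiff[OF ag]]
    using g(2) by (intro sum.cong refl) auto
  ultimately show "(\<Sum>a\<le>2*k-2. boundary_matrix a b X * (hderiv ^^ a) y X) = 0" using b by simp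
qed

lemma green_form_zero_data:
  assumes "ac_dom y" "ac_dom g" "X > 0" "\<And>a. a \<le> 2*k-2 \<Longrightarrow> (hderiv ^^ a) y X = 0"
  shows "B y g X = 0"
  using boundary_matrix(1)[OF assms(3) ac_dom_hdiff[OF assms(1)] ac_dom_hdiff[OF assms(2)]] assms(4) by simp

text \<open>The forcing term is continued constantly to the left of \<open>1\<close>, since elements of the fundamental system
  need not be continuous at \<open>0\<close>, where they jump to the value zero.\<close>

lemma forced_exists:
  "\<exists>\<omega>. classical \<omega> \<and> (\<forall>i\<le>2*k-2. (hderiv ^^ i) \<omega> 1 = 0) \<and> (\<forall>x\<ge>1. M \<omega> x = z * \<omega> x + fund z' j x)"
proof (rule solution_exists[of 1 "\<lambda>x. fund z' j (max 1 x)" "\<lambda>_. 0" z])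
  show "continuous_on {0..} (\<lambda>x. fund z' j (max 1 x))"
    by (rule continuous_on_compose2[OF ac_dom_continuous_half[OF classicalD(1)[OF fund_classical]]])
       (auto intro!: continuous_intros)
  fix y assume "classical y" "\<And>i. i \<le> 2*k-2 \<Longrightarrow> (hderiv ^^ i) y 1 = 0"
    "\<And>x. x > 0 \<Longrightarrow> M y x = z * y x + fund z' j (max 1 x)"
  then show ?thesis by (intro exI[of _ y]) auto
qed simp

text \<open>Let \<open>v = sol i c\<close> be the projection of \<open>h = (M+i)f\<close> in \<open>L\<^sup>2(1,X)\<close> on the solutions of \<open>M g = ig\<close>, and \<open>w\<close> its
  response, \<open>(M+i)w = v\<close> with zero data at \<open>1\<close>. Then \<open>y = f - u - w\<close> has zero data at \<open>1\<close> and \<open>(M+i)y = h - v\<close>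
  is orthogonal to all those \<open>g\<close>. By Green's formula the form of \<open>y\<close> and \<open>g\<close> at \<open>X\<close> is zero, so \<open>y\<close> has zero data
  at \<open>X\<close> too. Hence \<open>\<langle>M y, y\<rangle>\<close> is real on \<open>[1,X]\<close>, which bounds the norm of \<open>y\<close> by that of \<open>h - v\<close>.\<close>

lemma truncated_problem:
  fixes \<omega> :: "nat \<Rightarrow> real \<Rightarrow> complex"
  assumes f: "f \<in> \<Delta>" and X: "1 < X"
    and \<omega>: "\<And>j. classical (\<omega> j)" "\<And>i j. i \<le> 2*k-2 \<Longrightarrow> (hderiv ^^ i) (\<omega> j) 1 = 0"
      "\<And>j x. x \<ge> 1 \<Longrightarrow> M (\<omega> j) x = (-\<i>) * \<omega> j x + fund \<i> j x"
    and h_def: "h = (\<lambda>x. M f x + \<i> * f x)"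
    and u_def: "u = sol (-\<i>) (\<lambda>j. (hderiv ^^ j) f 1)"
  shows "\<exists>c. nsq {1..X} (sol \<i> c) \<le> nsq {1..X} h \<and>
      (\<forall>c'. ip {1..X} (\<lambda>x. h x - sol \<i> c x) (sol \<i> c') = 0) \<and>
      nsq {1..X} (\<lambda>x. f x - u x - (\<Sum>j<2*k-1. c j * \<omega> j x)) \<le> nsq {1..X} h \<and>
      (\<forall>g. ac_dom g \<longrightarrow> B (\<lambda>x. f x - u x) g X = B (\<lambda>x. \<Sum>j<2*k-1. c j * \<omega> j x) g X)"
proof -
  note f' = max_domD[OF f]
  have Lh: "L2on {1..X} h" unfolding h_def by (intro L2on_add L2on_cmult f')
  obtain c where c: "\<And>c'. ip {1..X} (\<lambda>x. h x - sol \<i> c x) (sol \<i> c') = 0"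
    using sol_projection[OF X Lh] by blast
  define v where "v = sol \<i> c"
  define w where "w = (\<lambda>x. \<Sum>j<2*k-1. c j * \<omega> j x)"
  define r where "r = (\<lambda>x. h x - v x)"
  define y where "y = (\<lambda>x. f x - u x - w x)"
  have Lv: "L2on {1..X} v" unfolding v_def by (rule sol_L2on)
  have Lr: "L2on {1..X} r" unfolding r_def by (rule L2on_diff[OF Lh Lv])
  have cw: "classical w" unfolding w_def by (rule classical_lincomb) (auto intro: \<omega>(1))
  have cu: "classical u" unfolding u_def by (rule sol_classical)
  note aw = classicalD(1)[OF cw] and au = classicalD(1)[OF cu]
  have afu: "ac_dom (\<lambda>x. f x - u x)" by (rule ac_dom_diff[OF f'(1) au])
  have ay: "ac_dom y" unfolding y_def by (rule ac_dom_diff[OF afu aw])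
  have Ly: "L2on {1..X} y"
    unfolding y_def by (intro L2on_diff f' classical_L2on(1)[OF cu] classical_L2on(1)[OF cw])
  have Mw: "M w x = (-\<i>) * w x + v x" if "x \<ge> 1" for x
  proof -
    have x: "x > 0" using that by simp
    have "M w x = (\<Sum>j<2*k-1. c j * M (\<omega> j) x)"
      unfolding w_def by (rule M_lincomb[OF _ classicalD(4)[OF \<omega>(1)] classicalD(2)[OF \<omega>(1) x] x]) simp
    also have "\<dots> = (\<Sum>j<2*k-1. (-\<i>) * (c j * \<omega> j x) + c j * fund \<i> j x)"
      by (intro sum.cong refl) (subst \<omega>(3)[OF that], simp add: algebra_simps)
    also have "\<dots> = (-\<i>) * w x + v x"
      by (simp only: sum.distrib sum_distrib_left[symmetric] w_def v_def sol_def)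
    finally show ?thesis .
  qed
  have My: "AE x in lebesgue. x \<in> {1..X} \<longrightarrow> M y x = r x - \<i> * y x"
    using M_diff_ae[OF afu aw] M_diff_ae[OF f'(1) au]
  proof eventually_elim
    case (elim x)
    show ?case
    proof
      assume x: "x \<in> {1..X}"
      have Mu: "M u x = (-\<i>) * u x" unfolding u_def by (rule sol_M) (use x in auto)
      have Myx: "M y x = M f x - M u x - M w x" using elim x unfolding y_def by simp
      have Mwx: "M w x = (-\<i>) * w x + v x" by (rule Mw) (use x in simp)
      show "M y x = r x - \<i> * y x"
        unfolding Myx Mu Mwx unfolding r_def h_def y_def by (simp add: algebra_simps)
    qed
  qed
  have Lry: "L2on {1..X} (\<lambda>x. r x - \<i> * y x)" by (intro L2on_diff Lr L2on_cmult Ly)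
  have LMy: "L2on {1..X} (M y)"
    by (rule L2on_cong_AE[OF Lry]) (use My in \<open>auto elim!: eventually_mono\<close>)
  have ipMy: "ip {1..X} (M y) g = ip {1..X} r g - \<i> * ip {1..X} y g" if "L2on {1..X} g" for g
  proof -
    have "ip {1..X} (M y) g = ip {1..X} (\<lambda>x. r x - \<i> * y x) g"
      by (rule ip_cong_AE[OF LMy My that]) simp
    then show ?thesis using that by (simp add: ip_diff_left ip_cmult_left Lr Ly L2on_cmult)
  qed
  have y1: "(hderiv ^^ j) y 1 = 0" if "j \<le> 2*k-2" for j
  proof -
    have "(hderiv ^^ j) w 1 = 0"
      unfolding w_def
      by (subst hderiv_lincomb[where n = "2*k-2"]) (use classicalD(4)[OF \<omega>(1)] \<omega>(2) that in auto)
    then show ?thesis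
      unfolding y_def using hderiv_diff[OF afu aw one_pos that] hderiv_diff[OF f'(1) au one_pos that] sol_data[OF that]
      by (simp add: u_def)
  qed
  have Xp: "X > 0" and X1: "1 \<le> X" using X by auto
  have B1: "B y g 1 = 0" if "ac_dom g" for g by (rule green_form_zero_data[OF ay that one_pos y1])
  have "B y (sol \<i> c') X = 0" for c'
  proof -
    let ?g = "sol \<i> c'"
    have ag: "ac_dom ?g" by (rule classicalD(1)[OF sol_classical])
    have "B y ?g X = ip {1..X} (M y) ?g - ip {1..X} y (M ?g)"
      using green_ip[OF ay ag one_pos X1 Ly LMy sol_L2on sol_M_L2on] B1[OF ag] by simp
    also have "ip {1..X} y (M ?g) = ip {1..X} y (\<lambda>x. \<i> * ?g x)" by (rule ip_cong) (auto simp: sol_M)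
    also have "ip {1..X} (M y) ?g = ip {1..X} r ?g - \<i> * ip {1..X} y ?g" by (rule ipMy[OF sol_L2on])
    also have "ip {1..X} r ?g = 0" unfolding r_def v_def by (rule c)
    finally show ?thesis by (simp add: ip_cmult_right Ly sol_L2on)
  qed
  then have yX: "(hderiv ^^ a) y X = 0" if "a \<le> 2*k-2" for a
    by (rule sol_boundary_separates[OF ay Xp _ that])
  have BX: "B y g X = 0" if "ac_dom g" for g by (rule green_form_zero_data[OF ay that Xp yX])
  have ny: "nsq {1..X} y \<le> nsq {1..X} r"
  proof -
    have "0 = ip {1..X} (M y) y - ip {1..X} y (M y)"
      using green_ip[OF ay ay one_pos X1 Ly LMy Ly LMy] B1[OF ay] BX[OF ay] by simp
    also have "ip {1..X} y (M y) = cnj (ip {1..X} (M y) y)" by (rule ip_cnj)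
    finally have "Im (ip {1..X} (M y) y) = 0" by (simp add: complex_eq_iff)
    then have "nsq {1..X} y = Im (ip {1..X} r y)" using ipMy[OF Ly] by (simp add: ip_self)
    also have "\<dots> \<le> norm (ip {1..X} r y)" using abs_Im_le_cmod[of "ip {1..X} r y"] by linarith
    also have "\<dots> \<le> (1 * nsq {1..X} r + nsq {1..X} y / 1) / 2" by (rule ip_bound[OF Lr Ly]) simp
    finally show ?thesis by simp
  qed
  have nh: "nsq {1..X} h = nsq {1..X} r + nsq {1..X} v"
  proof -
    have rv: "ip {1..X} r v = 0" unfolding r_def v_def by (rule c)
    have vr: "ip {1..X} v r = 0" using rv ip_cnj[of "{1..X}" v r] by simp
    have h: "h = (\<lambda>x. r x + v x)" by (simp add: r_def)
    have "ip {1..X} h h = ip {1..X} r r + ip {1..X} v v"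
      unfolding h using rv vr by (simp add: ip_add_left ip_add_right Lr Lv L2on_add)
    then have "complex_of_real (nsq {1..X} h) = of_real (nsq {1..X} r + nsq {1..X} v)" by (simp add: ip_self)
    then show ?thesis by (simp only: of_real_eq_iff)
  qed
  have "nsq {1..X} v \<le> nsq {1..X} h" "nsq {1..X} y \<le> nsq {1..X} h"
    using nh ny nsq_nonneg[of "{1..X}" r] nsq_nonneg[of "{1..X}" v] by linarith+
  moreover have "B (\<lambda>x. f x - u x) g X = B w g X" if "ac_dom g" for g
    using BX[OF that] green_form_diff_left[OF afu aw that Xp] by (simp add: y_def)
  ultimately show ?thesis using c unfolding v_def w_def y_def by (intro exI[of _ c]) auto
qed

text \<open>Let \<open>X\<close> tend to infinity in the truncated problem. The coefficients of the projections are bounded and,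
  along a subsequence, converge to a square-integrable solution of \<open>M v = iv\<close>; since \<open>h\<close> is orthogonal to it,
  it is zero. So the responses \<open>w\<close> tend to zero locally, and \<open>f - u\<close> is square integrable as a local limit of
  bounded functions. The forms of \<open>f - u\<close> and of \<open>w\<close> with \<open>g\<close> agree at \<open>X\<close>, and the latter are inner products
  that tend to zero weakly.\<close>

theorem orthogonal_to_defect:
  assumes f: "f \<in> \<Delta>" and orth: "\<And>v. v \<in> defect \<i> \<Longrightarrow> ip {1..} (\<lambda>x. M f x + \<i> * f x) v = 0"
  shows "sol (-\<i>) (\<lambda>j. (hderiv ^^ j) f 1) \<in> defect (-\<i>)"
    and "\<And>g. g \<in> \<Delta> \<Longrightarrow> Binf f g = Binf (sol (-\<i>) (\<lambda>j. (hderiv ^^ j) f 1)) g"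
proof -
  define m where "m = 2*k-1"
  define h where "h = (\<lambda>x. M f x + \<i> * f x)"
  define u where "u = sol (-\<i>) (\<lambda>j. (hderiv ^^ j) f 1)"
  note f' = max_domD[OF f]
  have Lh: "L2on {1..} h" unfolding h_def by (intro L2on_add L2on_cmult f')
  have LhX: "L2on {1..X} h" for X by (rule L2on_subset[OF Lh]) auto
  define H where "H = nsq {1..} h"
  have HX: "nsq {1..X} h \<le> H" for X unfolding H_def by (rule nsq_mono[OF Lh]) auto
  have "\<forall>j. \<exists>\<omega>. classical \<omega> \<and> (\<forall>i\<le>2*k-2. (hderiv ^^ i) \<omega> 1 = 0) \<and> (\<forall>x\<ge>1. M \<omega> x = (-\<i>) * \<omega> x + fund \<i> j x)"
    by (intro allI forced_exists)
  from choice[OF this] obtain \<omega> where \<omega>0: "\<forall>j. classical (\<omega> j) \<and> (\<forall>i\<le>2*k-2. (hderiv ^^ i) (\<omega> j) 1 = 0) \<and>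
      (\<forall>x\<ge>1. M (\<omega> j) x = (-\<i>) * \<omega> j x + fund \<i> j x)" by (elim exE)
  have \<omega>: "\<And>j. classical (\<omega> j)" "\<And>i j. i \<le> 2*k-2 \<Longrightarrow> (hderiv ^^ i) (\<omega> j) 1 = 0"
      "\<And>j x. x \<ge> 1 \<Longrightarrow> M (\<omega> j) x = (-\<i>) * \<omega> j x + fund \<i> j x" using \<omega>0 by simp_all
  define w where "w c = (\<lambda>x. \<Sum>j<2*k-1. c j * \<omega> j x)" for c
  \<comment> \<open>intervals \<open>[1,n+2]\<close>, so that all of them contain \<open>[1,2]\<close>, on which coefficients are controlled\<close>
  have "\<forall>n. \<exists>c. nsq {1..real n + 2} (sol \<i> c) \<le> nsq {1..real n + 2} h \<and>
      (\<forall>c'. ip {1..real n + 2} (\<lambda>x. h x - sol \<i> c x) (sol \<i> c') = 0) \<and>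
      nsq {1..real n + 2} (\<lambda>x. f x - u x - w c x) \<le> nsq {1..real n + 2} h \<and>
      (\<forall>g. ac_dom g \<longrightarrow> B (\<lambda>x. f x - u x) g (real n + 2) = B (w c) g (real n + 2))"
    unfolding w_def by (intro allI truncated_problem[OF f _ \<omega> h_def u_def]) auto
  from choice[OF this] obtain c where c0: "\<forall>n. nsq {1..real n + 2} (sol \<i> (c n)) \<le> nsq {1..real n + 2} h \<and>
      (\<forall>c'. ip {1..real n + 2} (\<lambda>x. h x - sol \<i> (c n) x) (sol \<i> c') = 0) \<and>
      nsq {1..real n + 2} (\<lambda>x. f x - u x - w (c n) x) \<le> nsq {1..real n + 2} h \<and>
      (\<forall>g. ac_dom g \<longrightarrow> B (\<lambda>x. f x - u x) g (real n + 2) = B (w (c n)) g (real n + 2))" by (elim exE)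
  have c: "nsq {1..real n + 2} (sol \<i> (c n)) \<le> H"
      "\<And>c'. ip {1..real n + 2} (\<lambda>x. h x - sol \<i> (c n) x) (sol \<i> c') = 0"
      "nsq {1..real n + 2} (\<lambda>x. f x - u x - w (c n) x) \<le> H"
      "\<And>g. ac_dom g \<Longrightarrow> B (\<lambda>x. f x - u x) g (real n + 2) = B (w (c n)) g (real n + 2)" for n
    using spec[OF c0, of n] HX[of "real n + 2"] by auto
  obtain C where C: "\<And>c. nsq {1..2} (sol \<i> c) \<le> H \<Longrightarrow> (\<forall>j<2*k-1. norm (c j) \<le> C)"
    using sol_coeff_bound by blast
  have cb: "norm (c n j) \<le> C" if "j < m" for n j
  proof -
    have "nsq {1..2} (sol \<i> (c n)) \<le> nsq {1..real n + 2} (sol \<i> (c n))"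
      by (rule nsq_mono[OF sol_L2on]) auto
    then have "nsq {1..2} (sol \<i> (c n)) \<le> H" using c(1)[of n] by linarith
    then show ?thesis using C that by (simp add: m_def)
  qed
  obtain \<sigma> l where \<sigma>: "strict_mono (\<sigma> :: nat \<Rightarrow> nat)" "\<And>j. j < m \<Longrightarrow> (\<lambda>n. c (\<sigma> n) j) \<longlonglongrightarrow> l j"
    using bounded_coordinates_convergent_subseq[of m c C] cb by blast
  define X where "X n = real (\<sigma> n) + 2" for n
  have Xtop: "filterlim X at_top sequentially"
  proof -
    have "filterlim (\<lambda>n. real (\<sigma> n)) at_top sequentially"
      by (rule filterlim_compose[OF filterlim_real_sequentially filterlim_subseq[OF \<sigma>(1)]])
    then show ?thesis by (rule filterlim_at_top_mono) (auto intro: always_eventually simp: X_def)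
  qed
  have X1: "1 \<le> X n" and Xp: "0 < X n" for n by (auto simp: X_def)
  define d where "d n = c (\<sigma> n)" for n
  have d: "nsq {1..X n} (sol \<i> (d n)) \<le> H"
      "\<And>c'. ip {1..X n} (\<lambda>x. h x - sol \<i> (d n) x) (sol \<i> c') = 0"
      "nsq {1..X n} (\<lambda>x. f x - u x - w (d n) x) \<le> H"
      "\<And>g. ac_dom g \<Longrightarrow> B (\<lambda>x. f x - u x) g (X n) = B (w (d n)) g (X n)" for n
    unfolding d_def X_def by (rule c; assumption?)+
  have solsub: "(\<lambda>x. sol \<i> a x - sol \<i> b x) = (\<lambda>x. \<Sum>j<m. (a j - b j) * fund \<i> j x)" for a b
    by (simp add: sol_def m_def left_diff_distrib sum_subtractf)
  have dl: "(\<lambda>n. l j - d n j) \<longlonglongrightarrow> 0" if "j < m" for j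
    using tendsto_diff[OF tendsto_const \<sigma>(2)[OF that], of "l j"] by (simp add: d_def)
  have dl': "(\<lambda>n. d n j - l j) \<longlonglongrightarrow> 0" if "j < m" for j
    using tendsto_minus[OF dl[OF that]] by simp
  \<comment> \<open>the limit of the projections is an element of the defect space, to which \<open>h\<close> is orthogonal\<close>
  have Ll: "L2on {1..} (sol \<i> l)"
  proof (rule L2on_of_local_limit(1)[where G = "\<lambda>n. sol \<i> (d n)" and X = X and K = H])
    show "(\<lambda>n. nsq {1..Y} (\<lambda>x. sol \<i> l x - sol \<i> (d n) x)) \<longlonglongrightarrow> 0" for Y
      unfolding solsub by (rule nsq_lincomb_tendsto_0) (auto intro: fund_L2on dl)
  qed (rule sol_L2on Xtop d(1))+
  have lD: "sol \<i> l \<in> defect \<i>" by (rule sol_defect[OF Ll])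
  have l0: "\<forall>j<m. l j = 0"
  proof -
    have t0: "(\<lambda>n. ip {1..X n} (\<lambda>x. sol \<i> (d n) x - sol \<i> l x) (sol \<i> l)) \<longlonglongrightarrow> 0"
    proof (rule ip_weak_limit[OF _ _ Xtop _ Ll, where K = "2 * H + 2 * nsq {1..} (sol \<i> l)"])
      show "L2on {1..Y} (\<lambda>x. sol \<i> (d n) x - sol \<i> l x)" for n Y by (intro L2on_diff sol_L2on)
      show "(\<lambda>n. nsq {1..Y} (\<lambda>x. sol \<i> (d n) x - sol \<i> l x)) \<longlonglongrightarrow> 0" for Y
        unfolding solsub by (rule nsq_lincomb_tendsto_0) (auto intro: fund_L2on dl')
      show "nsq {1..X n} (\<lambda>x. sol \<i> (d n) x - sol \<i> l x) \<le> 2 * H + 2 * nsq {1..} (sol \<i> l)" for n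
      proof -
        have "nsq {1..X n} (\<lambda>x. sol \<i> (d n) x + (- 1) * sol \<i> l x)
            \<le> 2 * nsq {1..X n} (sol \<i> (d n)) + 2 * nsq {1..X n} (\<lambda>x. (- 1) * sol \<i> l x)"
          by (rule nsq_add_le[OF sol_L2on L2on_cmult[OF sol_L2on]])
        also have "nsq {1..X n} (\<lambda>x. (- 1) * sol \<i> l x) = nsq {1..X n} (sol \<i> l)" by (simp add: nsq_def)
        also have "\<dots> \<le> nsq {1..} (sol \<i> l)" by (rule nsq_mono[OF Ll]) auto
        finally show ?thesis using d(1)[of n] by simp
      qed
    qed
    have eq: "ip {1..X n} (\<lambda>x. sol \<i> (d n) x - sol \<i> l x) (sol \<i> l)
        = ip {1..X n} h (sol \<i> l) - ip {1..X n} (sol \<i> l) (sol \<i> l)" for n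
      using d(2)[of n l] by (simp add: ip_diff_left sol_L2on LhX)
    have t1: "(\<lambda>n. ip {1..X n} h (sol \<i> l) - ip {1..X n} (sol \<i> l) (sol \<i> l))
        \<longlonglongrightarrow> ip {1..} h (sol \<i> l) - ip {1..} (sol \<i> l) (sol \<i> l)"
      by (intro tendsto_diff filterlim_compose[OF ip_tendsto[OF Lh Ll] Xtop] filterlim_compose[OF ip_tendsto[OF Ll Ll] Xtop])
    have "ip {1..} h (sol \<i> l) = 0" unfolding h_def by (rule orth[OF lD])
    then have "(0::complex) = 0 - ip {1..} (sol \<i> l) (sol \<i> l)"
      using LIMSEQ_unique[OF t0[unfolded eq] t1] by simp
    then have "nsq {1..} (sol \<i> l) = 0" by (simp add: ip_self)
    moreover have "nsq {1..2} (sol \<i> l) \<le> nsq {1..} (sol \<i> l)" by (rule nsq_mono[OF Ll]) auto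
    ultimately have "nsq {1..2} (sol \<i> l) = 0" using nsq_nonneg[of "{1..2}" "sol \<i> l"] by linarith
    then show ?thesis using sol_nsq_zero[of 2 \<i> l] by (simp add: m_def)
  qed
  have d0: "(\<lambda>n. d n j) \<longlonglongrightarrow> 0" if "j < m" for j
    using dl'[OF that] l0 that by simp
  have \<omega>L: "L2on {1..Y} (\<omega> j)" for Y j by (rule classical_L2on[OF \<omega>(1)])
  have cw: "classical (w a)" for a unfolding w_def by (rule classical_lincomb) (auto intro: \<omega>(1))
  have Lw: "L2on {1..Y} (w a)" for Y a by (rule classical_L2on[OF cw])
  have w0: "(\<lambda>n. nsq {1..Y} (w (d n))) \<longlonglongrightarrow> 0" for Y
    unfolding w_def by (rule nsq_lincomb_tendsto_0) (auto intro: \<omega>L d0 simp: m_def)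
  have v0: "(\<lambda>n. nsq {1..Y} (sol \<i> (d n))) \<longlonglongrightarrow> 0" for Y
    unfolding sol_def by (rule nsq_lincomb_tendsto_0) (auto intro: fund_L2on d0 simp: m_def)
  have cu: "classical u" unfolding u_def by (rule sol_classical)
  have Lu: "L2on {1..Y} u" for Y by (rule classical_L2on[OF cu])
  define y where "y = (\<lambda>x. f x - u x)"
  have LyY: "L2on {1..Y} y" for Y unfolding y_def by (intro L2on_diff f' Lu)
  have Ly: "L2on {1..} y" and ny: "nsq {1..} y \<le> 2 * H"
  proof -
    have lim: "(\<lambda>n. nsq {1..Y} (\<lambda>x. y x - (y x - w (d n) x))) \<longlonglongrightarrow> 0" for Y using w0 by simp
    have LG: "L2on {1..Y} (\<lambda>x. y x - w (d n) x)" for n Y by (intro L2on_diff LyY Lw)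
    have bG: "nsq {1..X n} (\<lambda>x. y x - w (d n) x) \<le> H" for n using d(3)[of n] by (simp add: y_def)
    show "L2on {1..} y" "nsq {1..} y \<le> 2 * H"
      using L2on_of_local_limit[where F = y and G = "\<lambda>n x. y x - w (d n) x", OF LyY LG lim Xtop bG] by auto
  qed
  have "L2on {1..} (\<lambda>x. f x - y x)" by (intro L2on_diff f' Ly)
  then have "L2on {1..} u" by (simp add: y_def)
  then have uD: "u \<in> defect (-\<i>)" unfolding u_def by (rule sol_defect)
  then show "sol (-\<i>) (\<lambda>j. (hderiv ^^ j) f 1) \<in> defect (-\<i>)" by (simp add: u_def)
  have uDelta: "u \<in> \<Delta>" by (rule defectD(1)[OF uD])
  have yDelta: "y \<in> \<Delta>" unfolding y_def by (rule max_dom_diff[OF f uDelta])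
  fix g assume g: "g \<in> \<Delta>"
  note g' = max_domD[OF g]
  have vlim: "(\<lambda>n. ip {1..X n} (sol \<i> (d n)) g) \<longlonglongrightarrow> 0"
    by (rule ip_weak_limit[OF sol_L2on v0 Xtop d(1) g'(2)])
  have wb: "nsq {1..X n} (w (d n)) \<le> 2 * H + 2 * (2 * H)" for n
  proof -
    have "nsq {1..X n} (\<lambda>x. (- 1) * (y x - w (d n) x) + y x)
        \<le> 2 * nsq {1..X n} (\<lambda>x. (- 1) * (y x - w (d n) x)) + 2 * nsq {1..X n} y"
      by (intro nsq_add_le L2on_cmult L2on_diff LyY Lw)
    also have "nsq {1..X n} (\<lambda>x. (- 1) * (y x - w (d n) x)) = nsq {1..X n} (\<lambda>x. y x - w (d n) x)"
      by (simp add: nsq_def norm_minus_commute)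
    also have "\<dots> \<le> H" using d(3)[of n] by (simp add: y_def)
    also have "nsq {1..X n} y \<le> nsq {1..} y" by (rule nsq_mono[OF Ly]) auto
    finally show ?thesis using ny by simp
  qed
  have wlim: "(\<lambda>n. ip {1..X n} (w (d n)) g') \<longlonglongrightarrow> 0" if "L2on {1..} g'" for g'
    by (rule ip_weak_limit[OF Lw w0 Xtop wb that])
  have w1: "B (w a) g 1 = 0" for a
  proof (rule green_form_zero_data[OF classicalD(1)[OF cw] g'(1) one_pos])
    fix j assume "j \<le> 2*k-2"
    then show "(hderiv ^^ j) (w a) 1 = 0"
      unfolding w_def
      by (subst hderiv_lincomb[where n = "2*k-2"]) (use classicalD(4)[OF \<omega>(1)] \<omega>(2) in auto)
  qed
  have Mw: "M (w a) x = (-\<i>) * w a x + sol \<i> a x" if "x \<ge> 1" for x a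
  proof -
    have x: "x > 0" using that by simp
    have "M (w a) x = (\<Sum>j<2*k-1. a j * M (\<omega> j) x)"
      unfolding w_def by (rule M_lincomb[OF _ classicalD(4)[OF \<omega>(1)] classicalD(2)[OF \<omega>(1) x] x]) simp
    also have "\<dots> = (\<Sum>j<2*k-1. (-\<i>) * (a j * \<omega> j x) + a j * fund \<i> j x)"
      by (intro sum.cong refl) (subst \<omega>(3)[OF that], simp add: algebra_simps)
    also have "\<dots> = (-\<i>) * w a x + sol \<i> a x"
      by (simp only: sum.distrib sum_distrib_left[symmetric] w_def sol_def)
    finally show ?thesis .
  qed
  have Bw: "B y g (X n) = (-\<i>) * ip {1..X n} (w (d n)) g + ip {1..X n} (sol \<i> (d n)) g - ip {1..X n} (w (d n)) (M g)" for n
  proof -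
    have LMw: "L2on {1..X n} (M (w (d n)))"
    proof (rule L2on_cong)
      show "L2on {1..X n} (\<lambda>x. (-\<i>) * w (d n) x + sol \<i> (d n) x)"
        by (intro L2on_add L2on_cmult Lw sol_L2on)
    qed (use Mw in simp)
    have "B y g (X n) = B (w (d n)) g (X n)" using d(4)[OF g'(1), of n] by (simp add: y_def)
    also have "\<dots> = ip {1..X n} (M (w (d n))) g - ip {1..X n} (w (d n)) (M g)"
      using green_ip[OF classicalD(1)[OF cw] g'(1) one_pos X1 Lw LMw g'(4,5)] w1 by simp
    also have "ip {1..X n} (M (w (d n))) g = ip {1..X n} (\<lambda>x. (-\<i>) * w (d n) x + sol \<i> (d n) x) g"
      by (rule ip_cong) (auto simp: Mw)
    also have "\<dots> = (-\<i>) * ip {1..X n} (w (d n)) g + ip {1..X n} (sol \<i> (d n)) g"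
      unfolding ip_add_left[OF L2on_cmult[OF Lw] sol_L2on g'(4)] ip_cmult_left[OF Lw g'(4)] ..
    finally show ?thesis .
  qed
  have "(\<lambda>n. B y g (X n)) \<longlonglongrightarrow> (-\<i>) * 0 + 0 - 0"
    unfolding Bw by (intro tendsto_diff tendsto_add tendsto_mult tendsto_const wlim vlim g'(2,3))
  moreover have "(\<lambda>n. B y g (X n)) \<longlonglongrightarrow> Binf y g"
    by (rule filterlim_compose[OF Binf_limit(1)[OF yDelta g] Xtop])
  ultimately have "Binf y g = 0" using LIMSEQ_unique by fastforce
  then show "Binf f g = Binf (sol (-\<i>) (\<lambda>j. (hderiv ^^ j) f 1)) g"
    using Binf_diff_left[OF f uDelta g] by (simp add: y_def u_def)
qed

section \<open>The rank of the form at infinity\<close>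

lemma Binf_zero_left: "g \<in> \<Delta> \<Longrightarrow> Binf (\<lambda>_. 0) g = 0"
  using Binf_lincomb_left[of "{} :: nat set" "\<lambda>_ _. 0" g "\<lambda>_. 0"] by simp

lemma defect_nsq_zero:
  assumes "f \<in> defect z" "nsq {1..2} f = 0"
  shows "f = (\<lambda>_. 0)"
proof -
  let ?c = "\<lambda>j. (hderiv ^^ j) f 1"
  have f: "f = sol z ?c" by (rule defectD(3)[OF assms(1)])
  then have "nsq {1..2} (sol z ?c) = 0" using assms(2) by simp
  then have "\<forall>j<2*k-1. ?c j = 0" by (rule sol_nsq_zero) simp
  then show ?thesis using defect_data_zero[OF assms(1)] k2 by auto
qed

text \<open>Von Neumann's decomposition of the maximal domain, as far as the form at infinity and the data at \<open>1\<close> can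
  see it. For \<open>u\<close> in the defect space of \<open>i\<close> one has \<open>(M+i)u = 2iu\<close>; so if \<open>u\<close> is the projection of
  \<open>(M+i)f / 2i\<close> on that space, \<open>(M+i)(f-u)\<close> is orthogonal to it.\<close>

theorem defect_decomposition:
  assumes f: "f \<in> \<Delta>"
  obtains u v where "u \<in> defect \<i>" "v \<in> defect (-\<i>)"
    "\<And>g. g \<in> \<Delta> \<Longrightarrow> Binf f g = Binf u g + Binf v g"
    "\<And>j. j \<le> 2*k-2 \<Longrightarrow> (hderiv ^^ j) f 1 = (hderiv ^^ j) u 1 + (hderiv ^^ j) v 1"
proof -
  define N where "N = cfun.dim (defect \<i>)"
  obtain e where e0: "cfun.dim (defect \<i>) \<le> 2*k-1"
    "\<And>i. i < cfun.dim (defect \<i>) \<Longrightarrow> e i \<in> defect \<i>"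
    "\<And>f. f \<in> defect \<i> \<Longrightarrow> \<exists>c. f = (\<lambda>x. \<Sum>i<cfun.dim (defect \<i>). c i * e i x)"
    "\<And>c i. (\<lambda>x. \<Sum>i<cfun.dim (defect \<i>). c i * e i x) = (\<lambda>_. 0) \<Longrightarrow> i < cfun.dim (defect \<i>) \<Longrightarrow> c i = 0"
    by (rule defect_basis[of \<i>], rule that)
  note e = e0(2-4)[folded N_def]
  have Le: "L2on {1..} (e i)" if "i < N" for i using max_domD(2)[OF defectD(1)[OF e(1)[OF that]]] .
  define h where "h = (\<lambda>x. M f x + \<i> * f x)"
  note f' = max_domD[OF f]
  have Lh: "L2on {1..} h" unfolding h_def by (intro L2on_add L2on_cmult f')
  \<comment> \<open>normal equations for the projection of \<open>h / 2i\<close>\<close>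
  have "\<exists>c. \<forall>i<N. (\<Sum>j<N. ip {1..} (e j) (e i) * c j) = ip {1..} h (e i) / (2*\<i>)"
  proof (rule square_system_solvable)
    fix c assume c: "\<And>i. i < N \<Longrightarrow> (\<Sum>j<N. ip {1..} (e j) (e i) * c j) = 0"
    define w where "w = (\<lambda>x. \<Sum>j<N. c j * e j x)"
    have wD: "w \<in> defect \<i>" unfolding w_def by (rule defect_lincomb) (use e(1) in auto)
    have Lw: "L2on {1..} w" using max_domD(2)[OF defectD(1)[OF wD]] .
    have we: "ip {1..} w (e i) = 0" if "i < N" for i
      unfolding w_def using c[OF that] by (subst ip_lincomb) (use Le that in \<open>auto simp: mult.commute\<close>)
    have "ip {1..} w w = (\<Sum>j<N. c j * ip {1..} (e j) w)"
      by (subst (1) w_def, rule ip_lincomb) (use Le Lw in auto)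
    also have "\<dots> = 0"
    proof (intro sum.neutral ballI)
      fix j assume "j \<in> {..<N}"
      then show "c j * ip {1..} (e j) w = 0" using we[of j] ip_cnj[of "{1..}" "e j" w] by simp
    qed
    finally have "nsq {1..} w = 0" by (simp add: ip_self)
    moreover have "nsq {1..2} w \<le> nsq {1..} w" by (rule nsq_mono[OF Lw]) auto
    ultimately have "nsq {1..2} w = 0" using nsq_nonneg[of "{1..2}" w] by linarith
    then have "w = (\<lambda>_. 0)" by (rule defect_nsq_zero[OF wD])
    then show "\<forall>j<N. c j = 0" using e(3)[of c] by (simp add: w_def)
  qed
  then obtain c where c: "\<And>i. i < N \<Longrightarrow> (\<Sum>j<N. ip {1..} (e j) (e i) * c j) = ip {1..} h (e i) / (2*\<i>)" by blast
  define u where "u = (\<lambda>x. \<Sum>j<N. c j * e j x)"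
  have uD: "u \<in> defect \<i>" unfolding u_def by (rule defect_lincomb) (use e(1) in auto)
  note ud = defectD(1)[OF uD]
  note u' = max_domD[OF ud]
  define f0 where "f0 = (\<lambda>x. f x - u x)"
  have f0: "f0 \<in> \<Delta>" unfolding f0_def by (rule max_dom_diff[OF f ud])
  note f0' = max_domD[OF f0]
  define v where "v = sol (-\<i>) (\<lambda>j. (hderiv ^^ j) f0 1)"
  have orth: "ip {1..} (\<lambda>x. M f0 x + \<i> * f0 x) w = 0" if w: "w \<in> defect \<i>" for w
  proof -
    have Lw: "L2on {1..} w" using max_domD(2)[OF defectD(1)[OF w]] .
    have ae: "AE x in lebesgue. x \<in> {1..} \<longrightarrow> M f0 x + \<i> * f0 x = h x - (2*\<i>) * u x"
      using M_diff_ae[OF f'(1) u'(1)] defectD(2)[OF uD]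
      by eventually_elim (auto simp: f0_def h_def algebra_simps)
    have L0: "L2on {1..} (\<lambda>x. M f0 x + \<i> * f0 x)" by (intro L2on_add L2on_cmult f0')
    have z: "ip {1..} (\<lambda>x. M f0 x + \<i> * f0 x) (e i) = 0" if i: "i < N" for i
    proof -
      have "ip {1..} (\<lambda>x. M f0 x + \<i> * f0 x) (e i) = ip {1..} (\<lambda>x. h x - (2*\<i>) * u x) (e i)"
        by (rule ip_cong_AE[OF L0 ae Le[OF i]]) simp
      also have "\<dots> = ip {1..} h (e i) - (2*\<i>) * ip {1..} u (e i)"
        unfolding ip_diff_left[OF Lh L2on_cmult[OF u'(2)] Le[OF i]] ip_cmult_left[OF u'(2) Le[OF i]] ..
      also have "ip {1..} u (e i) = (\<Sum>j<N. c j * ip {1..} (e j) (e i))"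
        unfolding u_def by (rule ip_lincomb) (use Le i in auto)
      also have "\<dots> = ip {1..} h (e i) / (2*\<i>)" using c[OF i] by (simp add: mult.commute)
      finally show ?thesis by simp
    qed
    obtain b where b: "w = (\<lambda>x. \<Sum>i<N. b i * e i x)" using e(2)[OF w] by (elim exE)
    have "ip {1..} w (\<lambda>x. M f0 x + \<i> * f0 x) = (\<Sum>i<N. b i * ip {1..} (e i) (\<lambda>x. M f0 x + \<i> * f0 x))"
      unfolding b by (rule ip_lincomb) (use Le L0 in auto)
    also have "\<dots> = 0"
    proof (intro sum.neutral ballI)
      fix i assume "i \<in> {..<N}"
      then show "b i * ip {1..} (e i) (\<lambda>x. M f0 x + \<i> * f0 x) = 0"
        using z[of i] ip_cnj[of "{1..}" "e i" "\<lambda>x. M f0 x + \<i> * f0 x"] by simp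
    qed
    finally show ?thesis using ip_cnj[of "{1..}" "\<lambda>x. M f0 x + \<i> * f0 x" w] by simp
  qed
  have main: "v \<in> defect (-\<i>)" "\<And>g. g \<in> \<Delta> \<Longrightarrow> Binf f0 g = Binf v g"
    unfolding v_def by (rule orthogonal_to_defect[OF f0], rule orth, assumption)+
  show ?thesis
  proof (rule that[OF uD main(1)])
    show "Binf f g = Binf u g + Binf v g" if "g \<in> \<Delta>" for g
      using main(2)[OF that] Binf_diff_left[OF f ud that] by (simp add: f0_def algebra_simps)
    show "(hderiv ^^ j) f 1 = (hderiv ^^ j) u 1 + (hderiv ^^ j) v 1" if "j \<le> 2*k-2" for j
      using hderiv_diff[OF f'(1) u'(1) one_pos that] sol_data[OF that] by (simp add: v_def f0_def)
  qed
qed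

text \<open>The witness vanishes on \<open>[2,\<infinity>)\<close>. By Green's formula a solution of \<open>(M-i)y = \<eta>\<close> vanishes at \<open>2\<close> when \<open>\<eta>\<close>
  has prescribed inner products with the solutions of \<open>M g = -ig\<close>; these are attained by a combination of
  the latter, weighted with a bump supported in \<open>[1,2]\<close>.\<close>

lemma compactly_supported_data:
  obtains y where "y \<in> \<Delta>" "\<And>j. j \<le> 2*k-2 \<Longrightarrow> (hderiv ^^ j) y 1 = c j" "\<And>g. g \<in> \<Delta> \<Longrightarrow> Binf y g = 0"
proof -
  define \<psi> where "\<psi> x = max 0 ((x - 1) * (2 - x))" for x :: real
  have \<psi>c: "continuous_on S \<psi>" for S unfolding \<psi>_def by (intro continuous_intros)
  have \<psi>pos: "\<psi> x > 0" if "1 < x" "x < 2" for x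
    unfolding \<psi>_def using that by (simp add: less_max_iff_disj)
  have \<psi>0: "\<psi> x = 0" if "x \<le> 1 \<or> x \<ge> 2" for x
    unfolding \<psi>_def using that mult_nonpos_nonneg[of "x-1" "2-x"] mult_nonneg_nonpos[of "x-1" "2-x"] by (auto simp: max_def)
  let ?\<theta> = "fund (-\<i>)"
  have \<theta>c: "continuous_on {0..} (\<lambda>x. ?\<theta> j (max 1 x))" for j
    by (rule continuous_on_compose2[OF ac_dom_continuous_half[OF classicalD(1)[OF fund_classical]]])
       (auto intro!: continuous_intros)
  have \<theta>c2: "continuous_on {1..2} (?\<theta> j)" for j
    by (rule continuous_on_subset[OF ac_dom_continuous_half[OF classicalD(1)[OF fund_classical]]]) auto
  have L\<psi>: "L2on {1..2} (\<lambda>x. of_real (\<psi> x) * ?\<theta> j x)" for j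
    by (intro L2on_continuous continuous_on_mult continuous_on_of_real \<psi>c \<theta>c2)
  \<comment> \<open>the inner products with the forcing term that make the form at \<open>2\<close> vanish\<close>
  define b where "b i = - (\<Sum>a\<le>2*k-2. \<Sum>b\<le>2*k-2. boundary_matrix a b 1 * c a * cnj ((hderiv ^^ b) (?\<theta> i) 1))" for i
  have "\<exists>d. \<forall>i<2*k-1. (\<Sum>j<2*k-1. ip {1..2} (\<lambda>x. of_real (\<psi> x) * ?\<theta> j x) (?\<theta> i) * d j) = b i"
  proof (rule square_system_solvable)
    fix d assume "\<And>i. i < 2*k-1 \<Longrightarrow> (\<Sum>j<2*k-1. ip {1..2} (\<lambda>x. of_real (\<psi> x) * ?\<theta> j x) (?\<theta> i) * d j) = 0"
    then show "\<forall>j<2*k-1. d j = 0"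
    proof (intro gram_injective[of 2 \<psi>, where z = "-\<i>"] \<psi>c \<psi>pos)
      show "\<psi> x \<ge> 0" for x by (simp add: \<psi>_def)
    qed auto
  qed
  then obtain d where d: "\<And>i. i < 2*k-1 \<Longrightarrow> (\<Sum>j<2*k-1. ip {1..2} (\<lambda>x. of_real (\<psi> x) * ?\<theta> j x) (?\<theta> i) * d j) = b i" by blast
  define \<eta> where "\<eta> x = (\<Sum>j<2*k-1. d j * (of_real (\<psi> x) * ?\<theta> j (max 1 x)))" for x
  have \<eta>c: "continuous_on {0..} \<eta>"
    unfolding \<eta>_def by (intro continuous_on_sum continuous_on_mult continuous_on_const continuous_on_of_real \<psi>c \<theta>c)
  have \<eta>0: "\<eta> x = 0" if "x \<ge> 2" for x unfolding \<eta>_def using \<psi>0 that by simp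
  obtain y where y: "classical y" "\<And>j. j \<le> 2*k-2 \<Longrightarrow> (hderiv ^^ j) y 1 = c j"
    "\<And>x. x > 0 \<Longrightarrow> M y x = \<i> * y x + \<eta> x"
    by (rule solution_exists[OF one_pos \<eta>c, where c = c and z = \<i>], rule that)
  note ay = classicalD(1)[OF y(1)]
  have Ly: "L2on {1..X} y" for X by (rule classical_L2on(1)[OF y(1)])
  have L\<eta>: "L2on {1..X} \<eta>" for X
    by (rule L2on_continuous[OF continuous_on_subset[OF \<eta>c]]) auto
  have LMy: "L2on {1..2} (M y)"
  proof (rule L2on_cong)
    show "L2on {1..2} (\<lambda>x. \<i> * y x + \<eta> x)" by (intro L2on_add L2on_cmult Ly L\<eta>)
  qed (use y(3) in simp)
  have \<theta>i: "B y (?\<theta> i) 2 = 0" if i: "i < 2*k-1" for i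
  proof -
    have a\<theta>: "ac_dom (?\<theta> i)" by (rule classicalD(1)[OF fund_classical])
    have LM\<theta>: "L2on {1..2} (M (?\<theta> i))"
      by (rule L2on_cong[OF L2on_cmult[OF fund_L2on, of 2 "-\<i>" "-\<i>" i]]) (simp add: fund_M)
    have B1: "B y (?\<theta> i) 1 = - b i"
      unfolding boundary_matrix(1)[OF one_pos ac_dom_hdiff[OF ay] ac_dom_hdiff[OF a\<theta>]] b_def
      by (simp add: y(2))
    have "B y (?\<theta> i) 2 - B y (?\<theta> i) 1 = ip {1..2} (M y) (?\<theta> i) - ip {1..2} y (M (?\<theta> i))"
      by (rule green_ip[OF ay a\<theta> one_pos _ Ly LMy fund_L2on LM\<theta>]) simp
    also have "ip {1..2} (M y) (?\<theta> i) = ip {1..2} (\<lambda>x. \<i> * y x + \<eta> x) (?\<theta> i)"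
      by (rule ip_cong) (auto simp: y(3))
    also have "\<dots> = \<i> * ip {1..2} y (?\<theta> i) + ip {1..2} \<eta> (?\<theta> i)"
      unfolding ip_add_left[OF L2on_cmult[OF Ly] L\<eta> fund_L2on] ip_cmult_left[OF Ly fund_L2on] ..
    also have "ip {1..2} y (M (?\<theta> i)) = ip {1..2} y (\<lambda>x. (-\<i>) * ?\<theta> i x)"
      by (rule ip_cong) (auto simp: fund_M)
    also have "\<dots> = \<i> * ip {1..2} y (?\<theta> i)"
      unfolding ip_cmult_right[OF Ly fund_L2on] by simp
    also have "ip {1..2} \<eta> (?\<theta> i) = ip {1..2} (\<lambda>x. \<Sum>j<2*k-1. d j * (of_real (\<psi> x) * ?\<theta> j x)) (?\<theta> i)"
      by (rule ip_cong) (auto simp: \<eta>_def max_def)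
    also have "\<dots> = (\<Sum>j<2*k-1. d j * ip {1..2} (\<lambda>x. of_real (\<psi> x) * ?\<theta> j x) (?\<theta> i))"
      by (rule ip_lincomb) (auto intro: L\<psi> fund_L2on)
    also have "\<dots> = b i" using d[OF i] by (simp add: mult.commute)
    finally show ?thesis using B1 by simp
  qed
  have y2: "(hderiv ^^ a) y 2 = 0" if "a \<le> 2*k-2" for a
  proof (rule sol_boundary_separates[OF ay _ _ that])
    fix c'
    have two: "(0::real) < 2" by simp
    have as: "ac_dom (sol (-\<i>) c')" by (rule classicalD(1)[OF sol_classical])
    have "B y (sol (-\<i>) c') 2 = (\<Sum>a\<le>2*k-2. \<Sum>b\<le>2*k-2. \<Sum>j<2*k-1.
        cnj (c' j) * (boundary_matrix a b 2 * (hderiv ^^ a) y 2 * cnj ((hderiv ^^ b) (?\<theta> j) 2)))"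
      unfolding boundary_matrix(1)[OF two ac_dom_hdiff[OF ay] ac_dom_hdiff[OF as]]
      by (intro sum.cong refl) (simp add: sol_deriv sum_distrib_left mult_ac)
    also have "\<dots> = (\<Sum>a\<le>2*k-2. \<Sum>j<2*k-1. \<Sum>b\<le>2*k-2.
        cnj (c' j) * (boundary_matrix a b 2 * (hderiv ^^ a) y 2 * cnj ((hderiv ^^ b) (?\<theta> j) 2)))"
      by (rule sum.cong[OF refl], rule sum.swap)
    also have "\<dots> = (\<Sum>j<2*k-1. \<Sum>a\<le>2*k-2. \<Sum>b\<le>2*k-2.
        cnj (c' j) * (boundary_matrix a b 2 * (hderiv ^^ a) y 2 * cnj ((hderiv ^^ b) (?\<theta> j) 2)))"
      by (rule sum.swap)
    also have "\<dots> = (\<Sum>j<2*k-1. cnj (c' j) * B y (?\<theta> j) 2)"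
      unfolding boundary_matrix(1)[OF two ac_dom_hdiff[OF ay] ac_dom_hdiff[OF classicalD(1)[OF fund_classical]]]
      by (simp add: sum_distrib_left)
    also have "\<dots> = 0" using \<theta>i by simp
    finally show "B y (sol (-\<i>) c') 2 = 0" .
  qed simp
  have yX: "(hderiv ^^ j) y X = 0" if "X \<ge> 2" "j \<le> 2*k-2" for X j
  proof (rule solution_unique[OF ay, where z = \<i> and ?x0.0 = 2])
    show "AE t in lebesgue. min 2 X \<le> t \<and> t \<le> max 2 X \<longrightarrow> M y t = \<i> * y t"
      using that \<eta>0 y(3) by (intro AE_I2) auto
  qed (use that y2 in auto)
  have y0: "y X = 0" if "X \<ge> 2" for X using yX[OF that, of 0] by simp
  have un: "{1..2} \<union> {2<..} = {1::real..}" by auto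
  have "L2on {2<..} y" by (rule L2on_cong[OF L2on_zero]) (use y0 in simp)
  from L2on_Un[OF Ly this, of 2] have L1: "L2on {1..} y" by (simp add: un)
  have "L2on {2<..} \<eta>" by (rule L2on_cong[OF L2on_zero]) (use \<eta>0 in simp)
  from L2on_Un[OF L\<eta> this, of 2] have L2: "L2on {1..} \<eta>" by (simp add: un)
  have yD: "y \<in> \<Delta>" by (rule classical_max_dom[OF y(1,3) \<eta>c L2 L1])
  show ?thesis
  proof (rule that[OF yD y(2)])
    fix g assume g: "g \<in> \<Delta>"
    have "\<forall>\<^sub>F X in at_top. B y g X = 0"
      using eventually_ge_at_top[of 2]
    proof eventually_elim
      case (elim X)
      then show ?case by (intro green_form_zero_data ay max_domD(1)[OF g] yX) auto
    qed
    then have "(B y g \<longlongrightarrow> 0) at_top" by (rule tendsto_eventually)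
    with Binf_limit(1)[OF yD g] show "Binf y g = 0"
      by (intro tendsto_unique[OF _ Binf_limit(1)[OF yD g]]) auto
  qed
qed

lemma sum_lessThan_add:
  fixes h :: "nat \<Rightarrow> complex"
  shows "(\<Sum>l<r+m. h l) = (\<Sum>l<r. h l) + (\<Sum>l<m. h (r + l))"
  by (induction m) (simp_all add: add.assoc)

text \<open>Add to the \<open>F i\<close> the \<open>m = 2k-1\<close> functions with unit data at \<open>1\<close> that are invisible at infinity. If these
  \<open>r + m\<close> functions outnumbered the dimensions of the defect spaces, a nontrivial combination would have
  neither defect component, hence zero form at infinity and zero data at \<open>1\<close>. The nonzero minor removes the
  coefficients of the \<open>F i\<close>, and the data remove the others.\<close>

lemma rank_le_defect:
  assumes FG: "\<And>i. i < r \<Longrightarrow> F i \<in> \<Delta>" "\<And>i. i < r \<Longrightarrow> G i \<in> \<Delta>"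
    and det: "green_det k s q r F G \<noteq> 0"
  shows "r + (2*k-1) \<le> cfun.dim (defect \<i>) + cfun.dim (defect (-\<i>))"
proof (rule ccontr)
  define m where "m = 2*k-1"
  define Np where "Np = cfun.dim (defect \<i>)"
  define Nm where "Nm = cfun.dim (defect (-\<i>))"
  assume "\<not> r + (2*k-1) \<le> cfun.dim (defect \<i>) + cfun.dim (defect (-\<i>))"
  then have lt: "Np + Nm < r + m" by (simp add: Np_def Nm_def m_def)
  obtain e where e0: "cfun.dim (defect \<i>) \<le> 2*k-1"
    "\<And>i. i < cfun.dim (defect \<i>) \<Longrightarrow> e i \<in> defect \<i>"
    "\<And>f. f \<in> defect \<i> \<Longrightarrow> \<exists>c. f = (\<lambda>x. \<Sum>i<cfun.dim (defect \<i>). c i * e i x)"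
    "\<And>c i. (\<lambda>x. \<Sum>i<cfun.dim (defect \<i>). c i * e i x) = (\<lambda>_. 0) \<Longrightarrow> i < cfun.dim (defect \<i>) \<Longrightarrow> c i = 0"
    by (rule defect_basis[of \<i>], rule that)
  note e = e0(2,3)[folded Np_def]
  obtain e' where e0': "cfun.dim (defect (-\<i>)) \<le> 2*k-1"
    "\<And>i. i < cfun.dim (defect (-\<i>)) \<Longrightarrow> e' i \<in> defect (-\<i>)"
    "\<And>f. f \<in> defect (-\<i>) \<Longrightarrow> \<exists>c. f = (\<lambda>x. \<Sum>i<cfun.dim (defect (-\<i>)). c i * e' i x)"
    "\<And>c i. (\<lambda>x. \<Sum>i<cfun.dim (defect (-\<i>)). c i * e' i x) = (\<lambda>_. 0) \<Longrightarrow> i < cfun.dim (defect (-\<i>)) \<Longrightarrow> c i = 0"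
    by (rule defect_basis[of "-\<i>"], rule that)
  note e' = e0'(2,3)[folded Nm_def]
  have "\<forall>b. \<exists>y. y \<in> \<Delta> \<and> (\<forall>j\<le>2*k-2. (hderiv ^^ j) y 1 = (if j = b then 1 else 0)) \<and> (\<forall>g\<in>\<Delta>. Binf y g = 0)"
  proof
    fix b
    show "\<exists>y. y \<in> \<Delta> \<and> (\<forall>j\<le>2*k-2. (hderiv ^^ j) y 1 = (if j = b then 1 else 0)) \<and> (\<forall>g\<in>\<Delta>. Binf y g = 0)"
      by (rule compactly_supported_data[of "\<lambda>j. if j = b then 1 else 0"]) (rule exI, intro conjI allI impI ballI)
  qed
  from choice[OF this] obtain y where y: "\<forall>b. y b \<in> \<Delta> \<and>
      (\<forall>j\<le>2*k-2. (hderiv ^^ j) (y b) 1 = (if j = b then 1 else 0)) \<and> (\<forall>g\<in>\<Delta>. Binf (y b) g = 0)" by (elim exE)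
  define T where "T l = (if l < r then F l else y (l - r))" for l
  have TD: "T l \<in> \<Delta>" for l unfolding T_def using FG(1) y by auto
  have ex: "\<forall>l. \<exists>p. fst p \<in> defect \<i> \<and> snd p \<in> defect (-\<i>) \<and>
      (\<forall>g\<in>\<Delta>. Binf (T l) g = Binf (fst p) g + Binf (snd p) g) \<and>
      (\<forall>j\<le>2*k-2. (hderiv ^^ j) (T l) 1 = (hderiv ^^ j) (fst p) 1 + (hderiv ^^ j) (snd p) 1)"
  proof
    fix l
    show "\<exists>p. fst p \<in> defect \<i> \<and> snd p \<in> defect (-\<i>) \<and>
      (\<forall>g\<in>\<Delta>. Binf (T l) g = Binf (fst p) g + Binf (snd p) g) \<and>
      (\<forall>j\<le>2*k-2. (hderiv ^^ j) (T l) 1 = (hderiv ^^ j) (fst p) 1 + (hderiv ^^ j) (snd p) 1)"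
    proof (rule defect_decomposition[OF TD[of l]])
      fix u v assume "u \<in> defect \<i>" "v \<in> defect (-\<i>)" "\<And>g. g \<in> \<Delta> \<Longrightarrow> Binf (T l) g = Binf u g + Binf v g"
        "\<And>j. j \<le> 2*k-2 \<Longrightarrow> (hderiv ^^ j) (T l) 1 = (hderiv ^^ j) u 1 + (hderiv ^^ j) v 1"
      then show ?thesis by (intro exI[of _ "(u, v)"]) simp
    qed
  qed
  from choice[OF ex] obtain p where p: "\<forall>l. fst (p l) \<in> defect \<i> \<and> snd (p l) \<in> defect (-\<i>) \<and>
      (\<forall>g\<in>\<Delta>. Binf (T l) g = Binf (fst (p l)) g + Binf (snd (p l)) g) \<and>
      (\<forall>j\<le>2*k-2. (hderiv ^^ j) (T l) 1 = (hderiv ^^ j) (fst (p l)) 1 + (hderiv ^^ j) (snd (p l)) 1)" by (elim exE)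
  define u v where "u l = fst (p l)" and "v l = snd (p l)" for l
  have uD: "u l \<in> defect \<i>" and vD: "v l \<in> defect (-\<i>)" for l using p by (auto simp: u_def v_def)
  have TB: "Binf (T l) g = Binf (u l) g + Binf (v l) g" if "g \<in> \<Delta>" for l g using p that by (simp add: u_def v_def)
  have Td: "(hderiv ^^ j) (T l) 1 = (hderiv ^^ j) (u l) 1 + (hderiv ^^ j) (v l) 1" if "j \<le> 2*k-2" for l j
    using p that by (simp add: u_def v_def)
  have "\<forall>l. \<exists>c. u l = (\<lambda>x. \<Sum>i<Np. c i * e i x)" using e(2) uD by simp
  from choice[OF this] obtain cu where cu: "\<forall>l. u l = (\<lambda>x. \<Sum>i<Np. cu l i * e i x)" by (elim exE)
  have "\<forall>l. \<exists>c. v l = (\<lambda>x. \<Sum>i<Nm. c i * e' i x)" using e'(2) vD by simp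
  from choice[OF this] obtain cv where cv: "\<forall>l. v l = (\<lambda>x. \<Sum>i<Nm. cv l i * e' i x)" by (elim exE)
  \<comment> \<open>more functions than dimensions: some combination has no component in either defect space\<close>
  obtain a where a: "\<exists>l<r+m. a l \<noteq> 0" "\<And>i. i < Np + Nm \<Longrightarrow>
      (\<Sum>l<r+m. (if i < Np then cu l i else cv l (i - Np)) * a l) = 0"
    using underdetermined_system[OF lt, of "\<lambda>i l. if i < Np then cu l i else cv l (i - Np)"] by blast
  have au: "(\<lambda>x. \<Sum>l<r+m. a l * u l x) = (\<lambda>_. 0)"
  proof
    fix x
    have "(\<Sum>l<r+m. a l * u l x) = (\<Sum>l<r+m. \<Sum>i<Np. e i x * (cu l i * a l))"
      by (intro sum.cong refl) (simp add: cu[rule_format] sum_distrib_left mult_ac)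
    also have "\<dots> = (\<Sum>i<Np. e i x * (\<Sum>l<r+m. cu l i * a l))"
      by (subst sum.swap) (simp add: sum_distrib_left)
    also have "\<dots> = 0"
    proof (intro sum.neutral ballI)
      fix i assume "i \<in> {..<Np}"
      then show "e i x * (\<Sum>l<r+m. cu l i * a l) = 0" using a(2)[of i] by simp
    qed
    finally show "(\<Sum>l<r+m. a l * u l x) = 0" .
  qed
  have av: "(\<lambda>x. \<Sum>l<r+m. a l * v l x) = (\<lambda>_. 0)"
  proof
    fix x
    have "(\<Sum>l<r+m. a l * v l x) = (\<Sum>l<r+m. \<Sum>i<Nm. e' i x * (cv l i * a l))"
      by (intro sum.cong refl) (simp add: cv[rule_format] sum_distrib_left mult_ac)
    also have "\<dots> = (\<Sum>i<Nm. e' i x * (\<Sum>l<r+m. cv l i * a l))"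
      by (subst sum.swap) (simp add: sum_distrib_left)
    also have "\<dots> = 0"
    proof (intro sum.neutral ballI)
      fix i assume "i \<in> {..<Nm}"
      then show "e' i x * (\<Sum>l<r+m. cv l i * a l) = 0" using a(2)[of "Np + i"] by simp
    qed
    finally show "(\<Sum>l<r+m. a l * v l x) = 0" .
  qed
  have uDl: "u l \<in> \<Delta>" and vDl: "v l \<in> \<Delta>" for l using uD vD defectD(1) by blast+
  have T0: "(\<Sum>l<r+m. a l * Binf (T l) g) = 0" if g: "g \<in> \<Delta>" for g
  proof -
    have "(\<Sum>l<r+m. a l * Binf (T l) g) = (\<Sum>l<r+m. a l * Binf (u l) g) + (\<Sum>l<r+m. a l * Binf (v l) g)"
      by (simp add: TB[OF g] distrib_left sum.distrib)
    also have "\<dots> = Binf (\<lambda>x. \<Sum>l<r+m. a l * u l x) g + Binf (\<lambda>x. \<Sum>l<r+m. a l * v l x) g"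
      using Binf_lincomb_left[of "{..<r+m}" u g a] Binf_lincomb_left[of "{..<r+m}" v g a] uDl vDl g by simp
    also have "\<dots> = 0" unfolding au av using Binf_zero_left[OF g] by simp
    finally show ?thesis .
  qed
  have split: "(\<Sum>l<r+m. h l) = (\<Sum>l<r. h l) + (\<Sum>l<m. h (r + l))" for h :: "nat \<Rightarrow> complex"
    by (rule sum_lessThan_add)
  have "a l = 0" if "l < r" for l
  proof (rule only_zero_solution_if_det_nonzero[OF _ _ that])
    have "transpose_mat (Matrix.mat r r (\<lambda>(i,j). Binf (F i) (G j))) = Matrix.mat r r (\<lambda>(i,j). Binf (F j) (G i))"
      by (intro eq_matI) auto
    then show "Determinant.det (Matrix.mat r r (\<lambda>(i,j). Binf (F j) (G i))) \<noteq> 0"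
      using det det_transpose[of "Matrix.mat r r (\<lambda>(i,j). Binf (F i) (G j))" r] by (simp add: green_det_def)
    fix i assume i: "i < r"
    have "(\<Sum>l<r. a l * Binf (F l) (G i)) + (\<Sum>l<m. a (r + l) * Binf (y l) (G i)) = 0"
      using T0[OF FG(2)[OF i]] unfolding split by (simp add: T_def)
    moreover have "Binf (y l) (G i) = 0" for l using y FG(2)[OF i] by blast
    ultimately show "(\<Sum>l<r. Binf (F l) (G i) * a l) = 0" by (simp add: mult.commute)
  qed
  moreover have "a (r + b) = 0" if b: "b < m" for b
  proof -
    have b': "b \<le> 2*k-2" using b k2 by (simp add: m_def)
    have z: "(\<Sum>l<r+m. a l * (hderiv ^^ b) (w l) 1) = 0"
      if "(\<lambda>x. \<Sum>l<r+m. a l * w l x) = (\<lambda>_. 0)" "\<And>l. w l \<in> \<Delta>" for w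
    proof -
      have "(\<Sum>l<r+m. a l * (hderiv ^^ b) (w l) 1) = (hderiv ^^ b) (\<lambda>x. \<Sum>l<r+m. a l * w l x) 1"
        by (rule hderiv_lincomb[symmetric, where n = "2*k-2"])
           (use b' that(2) in \<open>auto simp: max_dom_iff ac_dom_def\<close>)
      also have "\<dots> = 0" unfolding that(1) by (rule hderiv_zero_open[of 0 2]) auto
      finally show ?thesis .
    qed
    have "(\<Sum>l<r+m. a l * (hderiv ^^ b) (T l) 1) = 0"
      using z[OF au uDl] z[OF av vDl] by (simp add: Td[OF b'] distrib_left sum.distrib)
    then have "(\<Sum>l<m. a (r + l) * (hderiv ^^ b) (y l) 1) = 0"
      unfolding split using \<open>\<And>l. l < r \<Longrightarrow> a l = 0\<close> by (simp add: T_def)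
    moreover have "(\<Sum>l<m. a (r + l) * (hderiv ^^ b) (y l) 1) = (\<Sum>l<m. if l = b then a (r + l) else 0)"
      using y b' by (intro sum.cong refl) auto
    ultimately show ?thesis using b by simp
  qed
  ultimately have "a l = 0" if "l < r + m" for l
    using that by (cases "l < r") (auto dest: le_Suc_ex simp: not_less)
  with a(1) show False by blast
qed

text \<open>If the defect spaces had more than \<open>r + 2k-1\<close> dimensions together, a nonzero pair \<open>(u,v)\<close> from them would
  have a sum \<open>w\<close> with zero data at \<open>1\<close> and zero form at infinity. Put \<open>w' = u - v\<close>. As \<open>M w = iw'\<close> and
  \<open>M w' = iw\<close>, Green's formula for \<open>w\<close> and \<open>w'\<close> says that the sum of their squared norms is zero.\<close>

lemma rank_ge_defect:
  assumes FG: "\<And>i. i < r \<Longrightarrow> F i \<in> \<Delta>" "\<And>i. i < r \<Longrightarrow> G i \<in> \<Delta>"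
    and det: "green_det k s q r F G \<noteq> 0"
    and border: "\<And>F G. (\<And>i. i < Suc r \<Longrightarrow> F i \<in> \<Delta> \<and> G i \<in> \<Delta>) \<Longrightarrow> green_det k s q (Suc r) F G = 0"
  shows "cfun.dim (defect \<i>) + cfun.dim (defect (-\<i>)) \<le> r + (2*k-1)"
proof (rule ccontr)
  define m where "m = 2*k-1"
  define Np where "Np = cfun.dim (defect \<i>)"
  define Nm where "Nm = cfun.dim (defect (-\<i>))"
  assume "\<not> cfun.dim (defect \<i>) + cfun.dim (defect (-\<i>)) \<le> r + (2*k-1)"
  then have lt: "r + m < Np + Nm" by (simp add: Np_def Nm_def m_def)
  obtain e where e0: "cfun.dim (defect \<i>) \<le> 2*k-1"
    "\<And>i. i < cfun.dim (defect \<i>) \<Longrightarrow> e i \<in> defect \<i>"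
    "\<And>f. f \<in> defect \<i> \<Longrightarrow> \<exists>c. f = (\<lambda>x. \<Sum>i<cfun.dim (defect \<i>). c i * e i x)"
    "\<And>c i. (\<lambda>x. \<Sum>i<cfun.dim (defect \<i>). c i * e i x) = (\<lambda>_. 0) \<Longrightarrow> i < cfun.dim (defect \<i>) \<Longrightarrow> c i = 0"
    by (rule defect_basis[of \<i>], rule that)
  note e = e0(2,4)[folded Np_def]
  obtain e' where e0': "cfun.dim (defect (-\<i>)) \<le> 2*k-1"
    "\<And>i. i < cfun.dim (defect (-\<i>)) \<Longrightarrow> e' i \<in> defect (-\<i>)"
    "\<And>f. f \<in> defect (-\<i>) \<Longrightarrow> \<exists>c. f = (\<lambda>x. \<Sum>i<cfun.dim (defect (-\<i>)). c i * e' i x)"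
    "\<And>c i. (\<lambda>x. \<Sum>i<cfun.dim (defect (-\<i>)). c i * e' i x) = (\<lambda>_. 0) \<Longrightarrow> i < cfun.dim (defect (-\<i>)) \<Longrightarrow> c i = 0"
    by (rule defect_basis[of "-\<i>"], rule that)
  note e' = e0'(2,4)[folded Nm_def]
  define T where "T l = (if l < Np then e l else e' (l - Np))" for l
  have TD: "T l \<in> \<Delta>" if "l < Np + Nm" for l
  proof (cases "l < Np")
    case True
    then show ?thesis using defectD(1)[OF e(1)] by (simp add: T_def)
  next
    case False
    then have "l - Np < Nm" using that by simp
    from defectD(1)[OF e'(1)[OF this]] show ?thesis using False by (simp add: T_def)
  qed
  have minor: "\<exists>c. \<forall>g\<in>\<Delta>. Binf f g = (\<Sum>i<r. c i * Binf (F i) g)" if "f \<in> \<Delta>" for f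
  proof (rule bordered_minors[of r Binf F G \<Delta>])
    show "Determinant.det (Matrix.mat r r (\<lambda>(i, j). Binf (F i) (G j))) \<noteq> 0" using det by (simp add: green_det_def)
    fix f g assume "f \<in> \<Delta>" "g \<in> \<Delta>"
    then have "green_det k s q (Suc r) (F(r := f)) (G(r := g)) = 0"
      using FG by (intro border) (auto simp: less_Suc_eq)
    then show "Determinant.det (Matrix.mat (Suc r) (Suc r) (\<lambda>(i, j). Binf ((F(r := f)) i) ((G(r := g)) j))) = 0"
      by (simp add: green_det_def)
  qed (rule that)
  have "\<forall>l\<in>{..<Np+Nm}. \<exists>c. \<forall>g\<in>\<Delta>. Binf (T l) g = (\<Sum>i<r. c i * Binf (F i) g)"
    using minor TD by simp
  from bchoice[OF this] obtain c where c: "\<forall>l\<in>{..<Np+Nm}. \<forall>g\<in>\<Delta>. Binf (T l) g = (\<Sum>i<r. c l i * Binf (F i) g)"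
    by (elim exE)
  \<comment> \<open>\<open>r\<close> conditions put the combination into the radical of the form, \<open>m\<close> make its data at \<open>1\<close> zero\<close>
  obtain a where a: "\<exists>l<Np+Nm. a l \<noteq> 0" "\<And>i. i < r + m \<Longrightarrow>
      (\<Sum>l<Np+Nm. (if i < r then c l i else (hderiv ^^ (i - r)) (T l) 1) * a l) = 0"
    using underdetermined_system[OF lt, of "\<lambda>i l. if i < r then c l i else (hderiv ^^ (i - r)) (T l) 1"] by blast
  define u where "u = (\<lambda>x. \<Sum>i<Np. a i * e i x)"
  define v where "v = (\<lambda>x. \<Sum>i<Nm. a (Np + i) * e' i x)"
  have uD: "u \<in> defect \<i>" unfolding u_def by (rule defect_lincomb) (use e(1) in auto)
  have vD: "v \<in> defect (-\<i>)" unfolding v_def by (rule defect_lincomb) (use e'(1) in auto)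
  define w where "w = (\<lambda>x. \<Sum>l<Np+Nm. a l * T l x)"
  have wuv: "w x = u x + v x" for x
    unfolding w_def u_def v_def sum_lessThan_add by (simp add: T_def)
  define w' where "w' = (\<lambda>x. u x - v x)"
  have wD: "w \<in> \<Delta>" unfolding w_def by (rule max_dom_lincomb) (use TD in auto)
  have w'D: "w' \<in> \<Delta>" unfolding w'_def by (rule max_dom_diff[OF defectD(1)[OF uD] defectD(1)[OF vD]])
  have Bw: "Binf w w' = 0"
  proof -
    have "Binf w w' = (\<Sum>l<Np+Nm. a l * Binf (T l) w')"
      unfolding w_def by (rule Binf_lincomb_left) (use TD w'D in auto)
    also have "\<dots> = (\<Sum>l<Np+Nm. \<Sum>i<r. Binf (F i) w' * (c l i * a l))"
      using c w'D by (intro sum.cong refl) (simp add: sum_distrib_left mult_ac)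
    also have "\<dots> = (\<Sum>i<r. Binf (F i) w' * (\<Sum>l<Np+Nm. c l i * a l))"
      by (subst sum.swap) (simp add: sum_distrib_left)
    also have "\<dots> = 0"
    proof (intro sum.neutral ballI)
      fix i assume "i \<in> {..<r}"
      then show "Binf (F i) w' * (\<Sum>l<Np+Nm. c l i * a l) = 0" using a(2)[of i] by simp
    qed
    finally show ?thesis .
  qed
  have w1: "(hderiv ^^ j) w 1 = 0" if j: "j \<le> 2*k-2" for j
  proof -
    have "(hderiv ^^ j) w 1 = (\<Sum>l<Np+Nm. a l * (hderiv ^^ j) (T l) 1)"
      unfolding w_def
      by (rule hderiv_lincomb[where n = "2*k-2"]) (use TD j in \<open>auto simp: max_dom_iff ac_dom_def\<close>)
    then show ?thesis using a(2)[of "r + j"] j k2 by (simp add: m_def mult.commute)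
  qed
  note w_ = max_domD[OF wD] and w'_ = max_domD[OF w'D]
  have "B w w' 1 = 0" by (rule green_form_zero_data[OF w_(1) w'_(1) one_pos w1])
  then have z: "ip {1..} (M w) w' - ip {1..} w (M w') = 0"
    using Binf_limit(2)[OF wD w'D] Bw by simp
  have Mw: "AE x in lebesgue. x \<in> {1..} \<longrightarrow> M w x = \<i> * w' x"
  proof -
    have eq: "w = (\<lambda>x. \<Sum>b\<in>UNIV. (1::complex) * (if b then u else v) x)"
      by (auto simp: wuv UNIV_bool)
    have "AE x in lebesgue. x > 0 \<longrightarrow> M (\<lambda>x. \<Sum>b\<in>UNIV. (1::complex) * (if b then u else v) x) x
        = (\<Sum>b\<in>UNIV. 1 * M (if b then u else v) x)"
      by (rule M_lincomb_ae) (use max_domD(1)[OF defectD(1)[OF uD]] max_domD(1)[OF defectD(1)[OF vD]] in auto)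
    then show ?thesis
      using defectD(2)[OF uD] defectD(2)[OF vD] unfolding eq[symmetric]
      by eventually_elim (auto simp: UNIV_bool w'_def algebra_simps)
  qed
  have Mw': "AE x in lebesgue. x \<in> {1..} \<longrightarrow> M w' x = \<i> * w x"
    using M_diff_ae[OF max_domD(1)[OF defectD(1)[OF uD]] max_domD(1)[OF defectD(1)[OF vD]]]
      defectD(2)[OF uD] defectD(2)[OF vD] unfolding w'_def[symmetric]
    by eventually_elim (auto simp: wuv algebra_simps)
  have "ip {1..} (M w) w' = ip {1..} (\<lambda>x. \<i> * w' x) w'"
    by (rule ip_cong_AE[OF w_(3) Mw w'_(2)]) simp
  also have "\<dots> = \<i> * of_real (nsq {1..} w')" by (simp add: ip_cmult_left w'_ ip_self)
  finally have 1: "ip {1..} (M w) w' = \<i> * of_real (nsq {1..} w')" .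
  have "ip {1..} w (M w') = ip {1..} w (\<lambda>x. \<i> * w x)"
    by (rule ip_cong_AE[OF w_(2) _ w'_(3) Mw']) simp
  also have "\<dots> = - \<i> * of_real (nsq {1..} w)" by (simp add: ip_cmult_right w_ ip_self)
  finally have 2: "ip {1..} w (M w') = - \<i> * of_real (nsq {1..} w)" .
  have "nsq {1..} w' + nsq {1..} w = 0"
    using arg_cong[OF z, of Im] unfolding 1 2 by simp
  then have n0: "nsq {1..} w' = 0" "nsq {1..} w = 0"
    using nsq_nonneg[of "{1..}" w'] nsq_nonneg[of "{1..}" w] by linarith+
  have n12: "nsq {1..2} w' = 0" "nsq {1..2} w = 0"
    using n0 nsq_mono[OF w_(2), of "{1..2}"] nsq_mono[OF w'_(2), of "{1..2}"]
      nsq_nonneg[of "{1..2}" w'] nsq_nonneg[of "{1..2}" w] by auto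
  have half: "nsq {1..2} (\<lambda>x. (1/2) * w x + t * w' x) = 0" for t
  proof -
    have c0: "nsq {1..2} (\<lambda>x. b * g x) = (norm b)\<^sup>2 * nsq {1..2} g" for b g
      unfolding nsq_def by (simp add: norm_mult power_mult_distrib)
    have "nsq {1..2} (\<lambda>x. (1/2) * w x + t * w' x) \<le> 2 * nsq {1..2} (\<lambda>x. (1/2) * w x) + 2 * nsq {1..2} (\<lambda>x. t * w' x)"
      by (intro nsq_add_le L2on_cmult w_ w'_)
    also have "\<dots> = 0" unfolding c0 n12 by simp
    finally show ?thesis using nsq_nonneg[of "{1..2}" "\<lambda>x. (1/2) * w x + t * w' x"] by linarith
  qed
  have "u = (\<lambda>x. (1/2) * w x + (1/2) * w' x)" by (auto simp: wuv w'_def field_simps)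
  then have u0: "u = (\<lambda>_. 0)" using half[of "1/2"] defect_nsq_zero[OF uD] by simp
  have "v = (\<lambda>x. (1/2) * w x + (-1/2) * w' x)" by (auto simp: wuv w'_def field_simps)
  then have v0: "v = (\<lambda>_. 0)" using half[of "-1/2"] defect_nsq_zero[OF vD] by simp
  have "a l = 0" if l: "l < Np + Nm" for l
  proof (cases "l < Np")
    case True
    then show ?thesis using e(2)[of a l] u0 by (simp add: u_def)
  next
    case False
    then show ?thesis using e'(2)[of "\<lambda>i. a (Np + i)" "l - Np"] v0 l by (simp add: v_def)
  qed
  with a(1) show False by blast
qed

lemma defect_dim_le: "cfun.dim (defect z) \<le> 2*k-1"
  by (rule defect_basis[of z])

end

theorem theorem2p2:
  fixes k :: nat and s q :: "nat \<Rightarrow> real \<Rightarrow> real"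
  assumes "k \<ge> 2"
    and "\<And>r. r < k \<Longrightarrow> Ck_halfline r (s r)"
    and "\<And>r. r < k \<Longrightarrow> Ck_halfline (r+1) (q r)"
    and "\<And>x. x \<ge> 0 \<Longrightarrow> q (k-1) x > 0"
  shows
    "(\<forall>a b. a \<le> k \<and> b \<le> k-1 \<and> limit_case k s q (k-1+a) (k+b) \<longrightarrow>
        (\<forall>F G. (\<forall>i<a+b+1. F i \<in> max_dom k s q \<and> G i \<in> max_dom k s q) \<longrightarrow>
          green_det k s q (a+b+1) F G = 0))
     \<and>
     (\<forall>n\<le>2*k-1.
        (\<forall>F G. (\<forall>i<n+1. F i \<in> max_dom k s q \<and> G i \<in> max_dom k s q) \<longrightarrow>
          green_det k s q (n+1) F G = 0) \<longrightarrow>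
        (\<exists>a b. a \<le> k \<and> b \<le> k-1 \<and> a + b \<le> n \<and> limit_case k s q (k-1+a) (k+b) \<and>
          ((\<exists>F G. (\<forall>i<n. F i \<in> max_dom k s q \<and> G i \<in> max_dom k s q) \<and>
             green_det k s q n F G \<noteq> 0) \<longrightarrow> a + b = n)))"
proof -
  interpret odd_expr k s q by unfold_locales (use assms in auto)
  let ?Np = "cfun.dim (defect \<i>)" and ?Nm = "cfun.dim (defect (-\<i>))"
  \<comment> \<open>the largest size of a nonzero minor is the rank of the form\<close>
  define nonzero_minor where "nonzero_minor n \<longleftrightarrow> (\<exists>F G. (\<forall>i<n. F i \<in> \<Delta> \<and> G i \<in> \<Delta>) \<and> green_det k s q n F G \<noteq> 0)" for n
  have upper: "n + (2*k-1) \<le> ?Np + ?Nm" if "nonzero_minor n" for n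
    using that rank_le_defect unfolding nonzero_minor_def by blast
  have M0: "nonzero_minor 0" unfolding nonzero_minor_def green_det_def by simp
  have lower: "?Np + ?Nm \<le> n + (2*k-1)" if n: "\<not> nonzero_minor (Suc n)" for n
  proof -
    \<comment> \<open>the last size before all minors vanish for the first time; it exists as the empty minor is \<open>1\<close>\<close>
    obtain r where r: "r \<le> n" "nonzero_minor r" "\<not> nonzero_minor (Suc r)"
    proof -
      define P where "P j \<longleftrightarrow> \<not> nonzero_minor (Suc j)" for j
      have "P (LEAST j. P j)" and le: "(LEAST j. P j) \<le> n"
        using LeastI[of P n] Least_le[of P n] n by (auto simp: P_def)
      moreover have "nonzero_minor (LEAST j. P j)"
      proof (cases "LEAST j. P j")
        case (Suc j)
        then have "\<not> P j" using not_less_Least[of j P] by simp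
        then show ?thesis using Suc by (simp add: P_def)
      qed (use M0 in simp)
      ultimately show ?thesis using that by (auto simp: P_def)
    qed
    obtain F G where FG: "\<forall>i<r. F i \<in> \<Delta> \<and> G i \<in> \<Delta>" "green_det k s q r F G \<noteq> 0"
      using r(2) unfolding nonzero_minor_def by blast
    have "green_det k s q (Suc r) F G = 0" if "\<And>i. i < Suc r \<Longrightarrow> F i \<in> \<Delta> \<and> G i \<in> \<Delta>" for F G
      using r(3) that unfolding nonzero_minor_def by blast
    with rank_ge_defect[of r F G] FG have "?Np + ?Nm \<le> r + (2*k-1)" by blast
    then show ?thesis using r(1) by linarith
  qed
  note ge = defect_dim_ge
  note le = defect_dim_le[of \<i>] defect_dim_le[of "-\<i>"]
  show ?thesis
  proof (intro conjI allI impI)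
    fix a b F G
    assume ab: "a \<le> k \<and> b \<le> k-1 \<and> limit_case k s q (k-1+a) (k+b)"
      and FG: "\<forall>i<a+b+1. F i \<in> \<Delta> \<and> G i \<in> \<Delta>"
    have N: "?Np = k-1+a" "?Nm = k+b" using ab by (auto simp: limit_case_def)
    show "green_det k s q (a+b+1) F G = 0"
    proof (rule ccontr)
      assume "green_det k s q (a+b+1) F G \<noteq> 0"
      then have "nonzero_minor (a+b+1)" using FG unfolding nonzero_minor_def by blast
      from upper[OF this] N k2 show False by simp
    qed
  next
    fix n
    assume "n \<le> 2*k-1" and van: "\<forall>F G. (\<forall>i<n+1. F i \<in> \<Delta> \<and> G i \<in> \<Delta>) \<longrightarrow> green_det k s q (n+1) F G = 0"
    have "\<not> nonzero_minor (Suc n)" using van unfolding nonzero_minor_def Suc_eq_plus1 by blast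
    from lower[OF this] have low: "?Np + ?Nm \<le> n + (2*k-1)" .
    define a b where "a = ?Np - (k-1)" and "b = ?Nm - k"
    have N: "?Np = k-1+a" "?Nm = k+b" using ge by (simp_all add: a_def b_def)
    have "limit_case k s q (k-1+a) (k+b)" using N by (simp add: limit_case_def)
    moreover have "a \<le> k" "b \<le> k-1" "a + b \<le> n" using N le low k2 by linarith+
    moreover have "a + b = n" if "nonzero_minor n" using upper[OF that] N low k2 by linarith
    ultimately show "\<exists>a b. a \<le> k \<and> b \<le> k-1 \<and> a + b \<le> n \<and> limit_case k s q (k-1+a) (k+b) \<and>
          ((\<exists>F G. (\<forall>i<n. F i \<in> \<Delta> \<and> G i \<in> \<Delta>) \<and> green_det k s q n F G \<noteq> 0) \<longrightarrow> a + b = n)"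
      unfolding nonzero_minor_def by blast
  qed
qed

end
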